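(* Let $\mathbb{K}$ be a field of characteristic zero, let $R=\mathbb{K}[x_1,\ldots,x_n]$, and let $P\subset R$ be a prime ideal of codimension $c$ such that $\{x_{c+1},\ldots,x_n\}$ is a maximal independent set of variables modulo $P$. Let $\mathbb{F}$ be the field of fractions of $R/P$ and let $m\ge 1$ be an integer. Then the following four sets are in natural bijective correspondence: (a) the $P$-primary ideals $Q$ in $R$ of multiplicity $m$ over $P$; (b) the points of the punctual Hilbert scheme $\mathrm{Hilb}^m(\mathbb{F}[[y_1,\ldots,y_c]])$, i.e. the ideals $I$ of colength $m$ in $\mathbb{F}[[y_1,\ldots,y_c]]$; (c) the $m$-dimensional $\mathbb{F}$-subspaces $V$ of $\mathbb{F}[z_1,\ldots,z_c]$ that are closed under differentiation; (d) the $m$-dimensional $\mathbb{F}$-subspaces $\mathcal{E}$ of the Weyl-Noether module $\mathbb{F}\otimes_R D_{n,c}$ that are $R$-bimodules. The bijections are given by the following mutually inverse maps. (a)$\leftrightarrow$(b): $Q\mapsto I=\langle y_1,\ldots,y_c\rangle^m+\gamma(Q)\,\mathbb{F}[y_1,\ldots,y_c]$, with inverse $I\mapsto Q=\gamma^{-1}(I)$. (b)$\leftrightarrow$(c): $I\mapsto V=I^\perp$, with inverse $V\mapsto I=\mathrm{Ann}(V)$. (c)$\leftrightarrow$(d): $V\mapsto\mathcal{E}=\omega(V)$, with inverse $\mathcal{E}\mapsto\omega^{-1}(\mathcal{E})$. Moreover, any $\mathbb{F}$-basis of the subspace $\mathcal{E}$ in (d) lifts to operators $A_1,\ldots,A_m\in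 D_{n,c}$ (Noetherian operators) that represent the corresponding ideal $Q$ in (a), meaning that $$Q=\{\,f\in R : A_l\bullet f\in P\ \text{ for } l=1,\ldots,m\,\}.$$
   Context: Independence: $\{x_{c+1},\ldots,x_n\}$ being a maximal independent set modulo $P$ means that $\mathbb{K}[x_{c+1},\ldots,x_n]\cap P=\{0\}$ and the set is maximal with this property. Consequently $\mathbb{F}=\mathrm{Quot}(R/P)$ is algebraic over $\mathbb{K}(x_{c+1},\ldots,x_n)$. This can always be arranged by permuting the variables. Write $u_i$ for the class of $x_i$ in $\mathbb{F}$. Multiplicity: the multiplicity of a $P$-primary ideal $Q$ over $P$ is the length of the artinian local ring $R_P/QR_P$. The map $\gamma$: $\gamma:R\hookrightarrow\mathbb{F}[y_1,\ldots,y_c]$ is the $\mathbb{K}$-algebra inclusion with $x_i\mapsto y_i+u_i$ for $1\le i\le c$ and $x_j\mapsto u_j$ for $c+1\le j\le n$. Identification: an ideal of colength $m$ in $\mathbb{F}[[y_1,\ldots,y_c]]$ contains $\langle y_1,\ldots,y_c\rangle^m$. Such ideals are identified, by contraction and extension, with the $\langle y_1,\ldots,y_c\rangle$-primary ideals of colength $m$ in $\mathbb{F}[y_1,\ldots,y_c]$. Points of the punctual Hilbert scheme are understood as these ideals. Inverse systems: $\mathbb{F}[[y_1,\ldots,y_c]]$ acts on $\mathbb{F}[z_1,\ldots,z_c]$ with $y_i$ acting as $\partial_{z_i}=\partial/\partial z_i$; write $f\bullet F$ for this action. Then $$I^\perp=\{F\in\mathbb{F}[z_1,\ldots,z_c]: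 f\bullet F=0\text{ for all }f\in I\},\qquad \mathrm{Ann}(V)=\{f\in\mathbb{F}[[y_1,\ldots,y_c]]: f\bullet F=0\text{ for all }F\in V\}.$$ A subspace $V$ is closed under differentiation if $\partial_{z_i}\bullet F\in V$ for all $F\in V$ and $1\le i\le c$. Relative Weyl algebra: $D_{n,c}=\mathbb{K}\langle x_1,\ldots,x_n,\partial_{x_1},\ldots,\partial_{x_c}\rangle=R\langle\partial_{x_1},\ldots,\partial_{x_c}\rangle$, where the generators commute except that $\partial_{x_i}x_i=x_i\partial_{x_i}+1$ for $1\le i\le c$. It acts on $R$ by $x_i\bullet f=x_if$ and $\partial_{x_i}\bullet f=\partial f/\partial x_i$. Weyl-Noether module: $\mathbb{F}\otimes_R D_{n,c}$ is formed using the left $R$-module structure of $D_{n,c}$. It is a left $\mathbb{F}$-vector space with basis $\{1\otimes\partial_{\mathbf{x}}^\beta:\beta\in\mathbb{N}^c\}$, where $\partial_{\mathbf{x}}^\beta=\partial_{x_1}^{\beta_1}\cdots\partial_{x_c}^{\beta_c}$. The left $R$-action is through $R\to\mathbb{F}$, and the right $R$-action is $(a\otimes A)\cdot r=a\otimes(Ar)$ with the product $Ar$ taken in $D_{n,c}$. An $\mathbb{F}$-subspace is an $R$-bimodule if it is closed under both $R$-actions. The map $\omega$: $\omega:\mathbb{F}[z_1,\ldots,z_c]\to\mathbb{F}\otimes_R D_{n,c}$ is the $\mathbb{F}$-linear isomorphism $z_1^{\alpha_1}\cdots z_c^{\alpha_c}\mapsto 1\otimes\partial_{x_1}^{\alpha_1}\cdots\partial_{x_c}^{\alpha_c}$.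 Lifting: given an $\mathbb{F}$-basis of $\mathcal{E}$, multiply each basis element by a nonzero element of $\mathbb{F}$ (clearing denominators) so that it has the form $\sum_\alpha\overline{\lambda_\alpha}\otimes\partial_{\mathbf{x}}^\alpha$, where $\lambda_\alpha\in R$ and $\overline{\lambda_\alpha}$ is the class of $\lambda_\alpha$ in $R/P$. A lift is then the operator $\sum_\alpha\lambda_\alpha\partial_{\mathbf{x}}^\alpha\in D_{n,c}$. *)

theory Defs
  imports
    "HOL-Library.Poly_Mapping"
    "HOL-Library.Extended_Nat"
    "HOL-Computational_Algebra.Fraction_Field"
    "HOL-Algebra.QuotRing"
    "HOL-Algebra.Ideal_Product"
    "HOL-Algebra.Embedded_Algebras"
begin

section \<open>Commutative algebra not in HOL-Algebra\<close>

definition ring_on :: "'a::comm_ring_1 set \<Rightarrow> 'a ring" where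
  "ring_on A = \<lparr>carrier = A, mult = (*), one = 1, zero = 0, add = (+)\<rparr>"

definition ideal_radical :: "('a, 'b) ring_scheme \<Rightarrow> 'a set \<Rightarrow> 'a set" where
  "ideal_radical S I = {a \<in> carrier S. \<exists>k::nat. a [^]\<^bsub>S\<^esub> k \<in> I}"

definition primary_ideal :: "('a, 'b) ring_scheme \<Rightarrow> 'a set \<Rightarrow> bool" where
  "primary_ideal S I \<longleftrightarrow> ideal I S \<and> I \<noteq> carrier S \<and>
     (\<forall>a\<in>carrier S. \<forall>b\<in>carrier S. a \<otimes>\<^bsub>S\<^esub> b \<in> I \<longrightarrow> a \<in> I \<or> b \<in> ideal_radical S I)"

definition primary_to :: "('a, 'b) ring_scheme \<Rightarrow> 'a set \<Rightarrow> 'a set \<Rightarrow> bool" where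
  "primary_to S P I \<longleftrightarrow> primary_ideal S I \<and> ideal_radical S I = P"

definition codimension :: "('a, 'b) ring_scheme \<Rightarrow> 'a set \<Rightarrow> enat" where
  "codimension S P = Sup {enat k | k. \<exists>J :: nat \<Rightarrow> 'a set.
     (\<forall>i\<le>k. primeideal (J i) S) \<and> (\<forall>i<k. J i \<subset> J (Suc i)) \<and> J k = P}"

text \<open>Length of a commutative ring as a module over itself; its submodules are the ideals.\<close>

definition ring_length :: "('a, 'b) ring_scheme \<Rightarrow> enat" where
  "ring_length S = Sup {enat k | k. \<exists>J :: nat \<Rightarrow> 'a set.
     (\<forall>i\<le>k. ideal (J i) S) \<and> (\<forall>i<k. J i \<subset> J (Suc i))}"

text \<open>The localization of a domain at a prime, as a subring of its field of fractions.\<close>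

definition localization :: "'a::idom ring \<Rightarrow> 'a set \<Rightarrow> 'a fract ring" where
  "localization S P = ring_on {Fract a s | a s. a \<in> carrier S \<and> s \<in> carrier S - P}"

definition multiplicity_over :: "'a::idom ring \<Rightarrow> 'a set \<Rightarrow> 'a set \<Rightarrow> enat" where
  "multiplicity_over S P Q =
     ring_length (localization S P Quot (Idl\<^bsub>localization S P\<^esub> ((\<lambda>q. Fract q 1) ` Q)))"

text \<open>
  \<open>has_colength S \<iota> I m\<close>: the quotient of the algebra \<open>S\<close>, with structure map \<open>\<iota>\<close> from a field,
  by the ideal \<open>I\<close> has vector space dimension \<open>m\<close>.
\<close>

definition has_colength ::
    "('a, 'b) ring_scheme \<Rightarrow> ('f::field \<Rightarrow> 'a) \<Rightarrow> 'a set \<Rightarrow> nat \<Rightarrow> bool" where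
  "has_colength S \<iota> I m \<longleftrightarrow>
     ring.dimension (S Quot I) m (range (\<lambda>a. I +>\<^bsub>S\<^esub> \<iota> a)) (carrier (S Quot I))"

definition mutually_inverse :: "('a \<Rightarrow> 'b) \<Rightarrow> ('b \<Rightarrow> 'a) \<Rightarrow> 'a set \<Rightarrow> 'b set \<Rightarrow> bool" where
  "mutually_inverse f g A B \<longleftrightarrow>
     f ` A \<subseteq> B \<and> g ` B \<subseteq> A \<and> (\<forall>a\<in>A. g (f a) = a) \<and> (\<forall>b\<in>B. f (g b) = b)"

section \<open>Polynomials and power series\<close>

text \<open>
  The variables are indexed by all natural numbers; the polynomial ring in the variables
  \<open>1, \<dots>, n\<close> is the subring \<open>poly_ring n\<close>.  The same type serves for \<open>x\<close>, \<open>y\<close> and \<open>z\<close>.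
\<close>

type_synonym monom = "nat \<Rightarrow>\<^sub>0 nat"
type_synonym 'a mpoly = "monom \<Rightarrow>\<^sub>0 'a"
type_synonym 'a mseries = "monom \<Rightarrow> 'a"

definition mconst :: "'a::zero \<Rightarrow> 'a mpoly" where
  "mconst a = Poly_Mapping.single 0 a"

definition mvar :: "nat \<Rightarrow> 'a::zero_neq_one mpoly" where
  "mvar i = Poly_Mapping.single (Poly_Mapping.single i 1) 1"

definition polys_in :: "nat set \<Rightarrow> 'a::zero mpoly set" where
  "polys_in V = {p. \<forall>\<alpha>\<in>Poly_Mapping.keys p. Poly_Mapping.keys \<alpha> \<subseteq> V}"

definition poly_ring :: "nat \<Rightarrow> 'a::comm_ring_1 mpoly ring" where
  "poly_ring n = ring_on (polys_in {1..n})"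

definition meval :: "('a::zero \<Rightarrow> 'b::comm_ring_1) \<Rightarrow> (nat \<Rightarrow> 'b) \<Rightarrow> 'a mpoly \<Rightarrow> 'b" where
  "meval h g p = (\<Sum>\<alpha>\<in>Poly_Mapping.keys p. h (Poly_Mapping.lookup p \<alpha>) *
     (\<Prod>i\<in>Poly_Mapping.keys \<alpha>. g i ^ Poly_Mapping.lookup \<alpha> i))"

definition series_ring :: "nat \<Rightarrow> 'a::comm_ring_1 mseries ring" where
  "series_ring n =
     \<lparr>carrier = {f. \<forall>\<alpha>. f \<alpha> \<noteq> 0 \<longrightarrow> Poly_Mapping.keys \<alpha> \<subseteq> {1..n}},
      mult = (\<lambda>f g \<alpha>. \<Sum>(\<beta>, \<delta>) | \<beta> + \<delta> = \<alpha>. f \<beta> * g \<delta>),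
      one = Poly_Mapping.lookup 1,
      zero = (\<lambda>_. 0),
      add = (\<lambda>f g \<alpha>. f \<alpha> + g \<alpha>)\<rparr>"

lemma keys_plus_monom: "Poly_Mapping.keys (a + b) = Poly_Mapping.keys a \<union> Poly_Mapping.keys (b::monom)"
  by (auto simp: in_keys_iff lookup_add)

lemma finite_splits: "finite {(\<beta>, \<delta>). \<beta> + \<delta> = (\<alpha>::monom)}"
proof -
  let ?G = "{f. \<forall>i. (i \<in> Poly_Mapping.keys \<alpha> \<longrightarrow> f i \<in> {..Max (range (Poly_Mapping.lookup \<alpha>))}) \<and> (i \<notin> Poly_Mapping.keys \<alpha> \<longrightarrow> f i = (0::nat))}"
  have fr: "finite (range (Poly_Mapping.lookup \<alpha>))"
  proof (rule finite_subset)
    show "range (Poly_Mapping.lookup \<alpha>) \<subseteq> insert 0 (Poly_Mapping.lookup \<alpha> ` Poly_Mapping.keys \<alpha>)"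
      by (auto simp: in_keys_iff image_iff) 
  qed simp
  have "finite ?G" by (rule finite_set_of_finite_funs) auto
  then have "finite (?G \<times> ?G)" by blast
  moreover have "(\<lambda>(\<beta>, \<delta>). (Poly_Mapping.lookup \<beta>, Poly_Mapping.lookup \<delta>)) ` {(\<beta>, \<delta>). \<beta> + \<delta> = \<alpha>} \<subseteq> ?G \<times> ?G"
  proof -
    have "Poly_Mapping.lookup \<beta> \<in> ?G \<and> Poly_Mapping.lookup \<delta> \<in> ?G" if "\<beta> + \<delta> = \<alpha>" for \<beta> \<delta>
    proof -
      have *: "Poly_Mapping.lookup \<alpha> i = Poly_Mapping.lookup \<beta> i + Poly_Mapping.lookup \<delta> i" for i
        using that by (auto simp: lookup_add)
      have "Poly_Mapping.lookup \<alpha> i \<le> Max (range (Poly_Mapping.lookup \<alpha>))" for i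
        using fr by (auto intro: Max_ge)
      then show ?thesis using * by (auto simp: in_keys_iff) (metis add_leD1 add_leD2)+
    qed
    then show ?thesis by auto
  qed
  ultimately have "finite ((\<lambda>(\<beta>, \<delta>). (Poly_Mapping.lookup \<beta>, Poly_Mapping.lookup \<delta>)) ` {(\<beta>, \<delta>). \<beta> + \<delta> = \<alpha>})"
    using finite_subset by blast
  then show ?thesis
    by (rule finite_imageD) (auto simp: inj_on_def)
qed

lemma cring_ring_on:
  assumes "0 \<in> A" "1 \<in> A" "\<And>a b. a \<in> A \<Longrightarrow> b \<in> A \<Longrightarrow> a + b \<in> A"
    "\<And>a b. a \<in> A \<Longrightarrow> b \<in> A \<Longrightarrow> a * b \<in> A" "\<And>a. a \<in> A \<Longrightarrow> - a \<in> A"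
  shows "cring (ring_on A)"
proof (rule cringI)
  show "abelian_group (ring_on A)"
    by (rule abelian_groupI) (use assms in \<open>auto simp: ring_on_def algebra_simps intro: bexI[of _ "- _"]\<close>)
  show "comm_monoid (ring_on A)"
    by (rule comm_monoidI) (use assms in \<open>auto simp: ring_on_def algebra_simps\<close>)
qed (auto simp: ring_on_def algebra_simps)

lemma cring_poly_ring: "cring (poly_ring n)"
  unfolding poly_ring_def
proof (rule cring_ring_on)
  fix a b :: "'a mpoly"
  assume ab: "a \<in> polys_in {1..n}" "b \<in> polys_in {1..n}"
  show "a + b \<in> polys_in {1..n}"
    using ab keys_add[of a b] unfolding polys_in_def by blast
  show "- a \<in> polys_in {1..n}" using ab by (auto simp: polys_in_def)
  show "a * b \<in> polys_in {1..n}"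
    using ab keys_mult[of a b] unfolding polys_in_def by (fastforce simp: keys_plus_monom)
qed (auto simp: polys_in_def)

lemma sum_splits_single:
  fixes f :: "'a::comm_ring_1 mseries"
  shows "(\<Sum>(\<beta>, \<delta>) | \<beta> + \<delta> = \<alpha>. Poly_Mapping.lookup 1 \<beta> * f \<delta>) = f \<alpha>"
proof -
  define G where "G = (\<lambda>(\<beta>, \<delta>). Poly_Mapping.lookup (1::'a mpoly) \<beta> * f \<delta>)"
  have "sum G {(\<beta>, \<delta>). \<beta> + \<delta> = \<alpha>} = sum G {(0, \<alpha>)}"
    by (rule sum.mono_neutral_right) (auto simp: finite_splits G_def lookup_one when_def split: if_splits)
  then have "sum G {(\<beta>, \<delta>). \<beta> + \<delta> = \<alpha>} = f \<alpha>" by (simp add: G_def)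
  then show ?thesis by (simp add: G_def)
qed

lemma series_assoc:
  fixes f g h :: "'a::comm_ring_1 mseries"
  shows "(\<Sum>(\<beta>, \<delta>) | \<beta> + \<delta> = \<alpha>. (\<Sum>(\<mu>, \<nu>) | \<mu> + \<nu> = \<beta>. f \<mu> * g \<nu>) * h \<delta>)
       = (\<Sum>(\<beta>, \<delta>) | \<beta> + \<delta> = \<alpha>. f \<beta> * (\<Sum>(\<mu>, \<nu>) | \<mu> + \<nu> = \<delta>. g \<mu> * h \<nu>))"
proof -
  have "(\<Sum>(\<beta>, \<delta>) | \<beta> + \<delta> = \<alpha>. (\<Sum>(\<mu>, \<nu>) | \<mu> + \<nu> = \<beta>. f \<mu> * g \<nu>) * h \<delta>)
    = (\<Sum>((\<beta>, \<delta>), (\<mu>, \<nu>)) \<in> (SIGMA p:{(\<beta>, \<delta>). \<beta> + \<delta> = \<alpha>}. {(\<mu>, \<nu>). \<mu> + \<nu> = fst p}). f \<mu> * g \<nu> * h \<delta>)"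
    by (subst sum.Sigma[symmetric]) (auto simp: finite_splits sum_distrib_right case_prod_beta intro!: sum.cong)
  also have "\<dots> = (\<Sum>((\<beta>, \<delta>), (\<mu>, \<nu>)) \<in> (SIGMA p:{(\<beta>, \<delta>). \<beta> + \<delta> = \<alpha>}. {(\<mu>, \<nu>). \<mu> + \<nu> = snd p}). f \<beta> * (g \<mu> * h \<nu>))"
    by (rule sum.reindex_bij_witness[where i = "\<lambda>((\<beta>, \<delta>), (\<mu>, \<nu>)). ((\<beta> + \<mu>, \<nu>), (\<beta>, \<mu>))"
        and j = "\<lambda>((\<beta>, \<delta>), (\<mu>, \<nu>)). ((\<mu>, \<nu> + \<delta>), (\<nu>, \<delta>))"])
      (auto simp: algebra_simps)
  also have "\<dots> = (\<Sum>(\<beta>, \<delta>) | \<beta> + \<delta> = \<alpha>. f \<beta> * (\<Sum>(\<mu>, \<nu>) | \<mu> + \<nu> = \<delta>. g \<mu> * h \<nu>))"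
    by (subst sum.Sigma[symmetric]) (auto simp: finite_splits sum_distrib_left case_prod_beta intro!: sum.cong)
  finally show ?thesis .
qed

lemma series_comm:
  fixes f g :: "'a::comm_ring_1 mseries"
  shows "(\<Sum>(\<beta>, \<delta>) | \<beta> + \<delta> = \<alpha>. f \<beta> * g \<delta>) = (\<Sum>(\<beta>, \<delta>) | \<beta> + \<delta> = \<alpha>. g \<beta> * f \<delta>)"
  by (rule sum.reindex_bij_witness[where i = prod.swap and j = prod.swap])
    (auto simp: add.commute mult.commute)

lemma series_mult_closed:
  fixes f g :: "'a::comm_ring_1 mseries"
  assumes "f \<in> carrier (series_ring n)" "g \<in> carrier (series_ring n)"
  shows "f \<otimes>\<^bsub>series_ring n\<^esub> g \<in> carrier (series_ring n)"
proof -
  have f: "f \<beta> = 0" if "\<not> Poly_Mapping.keys \<beta> \<subseteq> {1..n}" for \<beta>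
    using assms(1) that unfolding series_ring_def by auto
  have g: "g \<beta> = 0" if "\<not> Poly_Mapping.keys \<beta> \<subseteq> {1..n}" for \<beta>
    using assms(2) that unfolding series_ring_def by auto
  have "(\<Sum>(\<beta>, \<delta>) | \<beta> + \<delta> = \<alpha>. f \<beta> * g \<delta>) = 0"
    if \<alpha>: "\<not> Poly_Mapping.keys \<alpha> \<subseteq> {1..n}" for \<alpha>
  proof (rule sum.neutral, clarify)
    fix \<beta> \<delta> assume "\<alpha> = \<beta> + \<delta>"
    with \<alpha> have "\<not> Poly_Mapping.keys \<beta> \<subseteq> {1..n} \<or> \<not> Poly_Mapping.keys \<delta> \<subseteq> {1..n}"
      by (simp add: keys_plus_monom)
    then show "f \<beta> * g \<delta> = 0" using f g by fastforce
  qed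
  then show ?thesis unfolding series_ring_def by auto
qed

lemma cring_series_ring: "cring (series_ring n :: 'a::comm_ring_1 mseries ring)"
proof (rule cringI)
  show "abelian_group (series_ring n :: 'a mseries ring)"
  proof (rule abelian_groupI)
    fix f g :: "'a mseries"
    assume f: "f \<in> carrier (series_ring n)"
    then show "\<exists>y\<in>carrier (series_ring n). y \<oplus>\<^bsub>series_ring n\<^esub> f = \<zero>\<^bsub>series_ring n\<^esub>"
      by (intro bexI[of _ "\<lambda>\<alpha>. - f \<alpha>"]) (auto simp: series_ring_def)
    assume g: "g \<in> carrier (series_ring n)"
    have "Poly_Mapping.keys \<alpha> \<subseteq> {1..n}" if "f \<alpha> + g \<alpha> \<noteq> 0" for \<alpha>
      using f g that unfolding series_ring_def by (cases "f \<alpha> = 0") auto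
    then show "f \<oplus>\<^bsub>series_ring n\<^esub> g \<in> carrier (series_ring n)"
      by (simp add: series_ring_def)
  qed (simp_all add: series_ring_def fun_eq_iff algebra_simps)
  show "comm_monoid (series_ring n :: 'a mseries ring)"
  proof (rule comm_monoidI)
    show "\<one>\<^bsub>series_ring n\<^esub> \<in> carrier (series_ring n :: 'a mseries ring)"
      by (simp add: series_ring_def lookup_one when_def)
    fix f g h :: "'a mseries"
    show "(f \<otimes>\<^bsub>series_ring n\<^esub> g) \<otimes>\<^bsub>series_ring n\<^esub> h = f \<otimes>\<^bsub>series_ring n\<^esub> (g \<otimes>\<^bsub>series_ring n\<^esub> h)"
      unfolding series_ring_def by (simp only: monoid.simps series_assoc)
    show "f \<otimes>\<^bsub>series_ring n\<^esub> g = g \<otimes>\<^bsub>series_ring n\<^esub> f"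
      unfolding series_ring_def monoid.simps by (rule ext, rule series_comm)
    show "\<one>\<^bsub>series_ring n\<^esub> \<otimes>\<^bsub>series_ring n\<^esub> f = f"
      unfolding series_ring_def monoid.simps by (rule ext, rule sum_splits_single)
  qed (rule series_mult_closed)
  show "(x \<oplus>\<^bsub>series_ring n\<^esub> y) \<otimes>\<^bsub>series_ring n\<^esub> z =
      x \<otimes>\<^bsub>series_ring n\<^esub> z \<oplus>\<^bsub>series_ring n\<^esub> y \<otimes>\<^bsub>series_ring n\<^esub> z"
    for x y z :: "'a mseries"
    by (simp add: series_ring_def case_prod_beta distrib_right sum.distrib)
qed

definition mderiv :: "nat \<Rightarrow> 'a::comm_semiring_1 mpoly \<Rightarrow> 'a mpoly" where
  "mderiv i p = (\<Sum>\<alpha>\<in>Poly_Mapping.keys p.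
     Poly_Mapping.single (\<alpha> - Poly_Mapping.single i 1)
       (of_nat (Poly_Mapping.lookup \<alpha> i) * Poly_Mapping.lookup p \<alpha>))"

text \<open>
  \<open>iterate_ops D \<beta>\<close> is the composite of the powers \<open>D i ^^ \<beta> i\<close> in increasing order of \<open>i\<close>, the
  smallest index outermost.
\<close>

definition iterate_ops :: "(nat \<Rightarrow> 'b \<Rightarrow> 'b) \<Rightarrow> monom \<Rightarrow> 'b \<Rightarrow> 'b" where
  "iterate_ops D \<beta> =
     foldr (\<lambda>i. D i ^^ Poly_Mapping.lookup \<beta> i) (sorted_list_of_set (Poly_Mapping.keys \<beta>))"

abbreviation mderivs :: "monom \<Rightarrow> 'a::comm_semiring_1 mpoly \<Rightarrow> 'a mpoly" where
  "mderivs \<equiv> iterate_ops mderiv"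

definition mscale :: "'a::comm_semiring_1 \<Rightarrow> 'a mpoly \<Rightarrow> 'a mpoly" where
  "mscale a p = mconst a * p"

global_interpretation mspace: vector_space "mscale :: 'f::field \<Rightarrow> 'f mpoly \<Rightarrow> 'f mpoly"
  by unfold_locales
    (simp_all add: mscale_def mconst_def single_add algebra_simps mult_single
      flip: mult.assoc single_one)

definition max_independent_vars :: "nat \<Rightarrow> nat set \<Rightarrow> 'a::comm_ring_1 mpoly set \<Rightarrow> bool" where
  "max_independent_vars n V P \<longleftrightarrow> V \<subseteq> {1..n} \<and> polys_in V \<inter> P = {0} \<and>
     (\<forall>W. V \<subset> W \<and> W \<subseteq> {1..n} \<longrightarrow> polys_in W \<inter> P \<noteq> {0})"

section \<open>Primary ideals and the punctual Hilbert scheme\<close>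

text \<open>
  Throughout, \<open>\<phi>\<close> is the map sending a polynomial in \<open>R\<close> to its class in the field \<open>F\<close>.
\<close>

definition primary_ideals :: "nat \<Rightarrow> 'k::idom mpoly set \<Rightarrow> nat \<Rightarrow> 'k mpoly set set" where
  "primary_ideals n P m =
     {Q. primary_to (poly_ring n) P Q \<and> multiplicity_over (poly_ring n) P Q = enat m}"

definition hilb_series :: "nat \<Rightarrow> nat \<Rightarrow> 'f::field mseries set set" where
  "hilb_series c m =
     {J. ideal J (series_ring c) \<and>
         has_colength (series_ring c) (\<lambda>a. Poly_Mapping.lookup (mconst a)) J m}"

definition origin_ideal :: "nat \<Rightarrow> 'f::field mpoly set" where
  "origin_ideal c = Idl\<^bsub>poly_ring c\<^esub> (mvar ` {1..c})"

definition hilb_poly :: "nat \<Rightarrow> nat \<Rightarrow> 'f::field mpoly set set" where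
  "hilb_poly c m =
     {I. primary_to (poly_ring c) (origin_ideal c) I \<and> has_colength (poly_ring c) mconst I m}"

text \<open>The inclusion of polynomials into power series is \<^const>\<open>Poly_Mapping.lookup\<close>.\<close>

definition contraction :: "nat \<Rightarrow> 'f::field mseries set \<Rightarrow> 'f mpoly set" where
  "contraction c J = {p \<in> carrier (poly_ring c). Poly_Mapping.lookup p \<in> J}"

definition extension :: "nat \<Rightarrow> 'f::field mpoly set \<Rightarrow> 'f mseries set" where
  "extension c I = Idl\<^bsub>series_ring c\<^esub> (Poly_Mapping.lookup ` I)"

definition gamma ::
    "nat \<Rightarrow> ('k::comm_ring_1 mpoly \<Rightarrow> 'f::field) \<Rightarrow> 'k mpoly \<Rightarrow> 'f mpoly" where
  "gamma c \<phi> = meval (\<lambda>a. mconst (\<phi> (mconst a)))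
     (\<lambda>i. if i \<le> c then mvar i + mconst (\<phi> (mvar i)) else mconst (\<phi> (mvar i)))"

text \<open>Powers of ideals are taken in the monoid \<^const>\<open>ideals_set\<close> of ideals.\<close>

definition primary_to_hilb ::
    "nat \<Rightarrow> nat \<Rightarrow> ('k::comm_ring_1 mpoly \<Rightarrow> 'f::field) \<Rightarrow> 'k mpoly set \<Rightarrow> 'f mpoly set" where
  "primary_to_hilb c m \<phi> Q =
     (origin_ideal c [^]\<^bsub>ideals_set (poly_ring c)\<^esub> m)
       <+>\<^bsub>poly_ring c\<^esub> (Idl\<^bsub>poly_ring c\<^esub> (gamma c \<phi> ` Q))"

definition hilb_to_primary ::
    "nat \<Rightarrow> nat \<Rightarrow> ('k::comm_ring_1 mpoly \<Rightarrow> 'f::field) \<Rightarrow> 'f mpoly set \<Rightarrow> 'k mpoly set" where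
  "hilb_to_primary n c \<phi> I = {f \<in> carrier (poly_ring n). gamma c \<phi> f \<in> I}"

section \<open>Inverse systems\<close>

text \<open>
  A polynomial has only finitely many nonzero derivatives, so the sum is finite.
\<close>

definition series_act :: "'f::field mseries \<Rightarrow> 'f mpoly \<Rightarrow> 'f mpoly" where
  "series_act f F = (\<Sum>\<beta> | mderivs \<beta> F \<noteq> 0. mscale (f \<beta>) (mderivs \<beta> F))"

definition perp :: "nat \<Rightarrow> 'f::field mseries set \<Rightarrow> 'f mpoly set" where
  "perp c J = {F \<in> carrier (poly_ring c). \<forall>f\<in>J. series_act f F = 0}"

definition ann :: "nat \<Rightarrow> 'f::field mpoly set \<Rightarrow> 'f mseries set" where
  "ann c V = {f \<in> carrier (series_ring c). \<forall>F\<in>V. series_act f F = 0}"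

definition inverse_systems :: "nat \<Rightarrow> nat \<Rightarrow> 'f::field mpoly set set" where
  "inverse_systems c m =
     {V. V \<subseteq> carrier (poly_ring c) \<and> mspace.subspace V \<and> mspace.dim V = m \<and>
         (\<forall>F\<in>V. \<forall>i\<in>{1..c}. mderiv i F \<in> V)}"

section \<open>The relative Weyl algebra and the Weyl-Noether module\<close>

text \<open>
  An operator is stored in normal form: \<open>A :: 'k weyl\<close> stands for the sum over \<open>\<alpha>\<close> of
  \<open>lookup A \<alpha>\<close> times \<open>\<partial>\<^sub>x\<^sup>\<alpha>\<close>, with coefficients in \<open>R\<close> on the left.  The product of the Weyl
  algebra is \<open>weyl_mult\<close>, not the commutative convolution product that this type carries by
  default.
\<close>

type_synonym 'k weyl = "monom \<Rightarrow>\<^sub>0 'k mpoly"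

definition weyl_algebra :: "nat \<Rightarrow> nat \<Rightarrow> 'k::comm_ring_1 weyl set" where
  "weyl_algebra n c = {A. \<forall>\<alpha>\<in>Poly_Mapping.keys A.
     Poly_Mapping.keys \<alpha> \<subseteq> {1..c} \<and> Poly_Mapping.lookup A \<alpha> \<in> carrier (poly_ring n)}"

definition weyl_partial :: "monom \<Rightarrow> 'k::comm_ring_1 weyl" where
  "weyl_partial \<beta> = Poly_Mapping.single \<beta> 1"

definition weyl_of_poly :: "'k::comm_ring_1 mpoly \<Rightarrow> 'k weyl" where
  "weyl_of_poly r = Poly_Mapping.single 0 r"

definition weyl_lscale :: "'k::comm_ring_1 mpoly \<Rightarrow> 'k weyl \<Rightarrow> 'k weyl" where
  "weyl_lscale r A =
     (\<Sum>\<alpha>\<in>Poly_Mapping.keys A. Poly_Mapping.single \<alpha> (r * Poly_Mapping.lookup A \<alpha>))"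

text \<open>
  Left multiplication by the generator \<open>\<partial>\<^sub>i\<close>: the relations give
  \<open>\<partial>\<^sub>i a = a \<partial>\<^sub>i + \<partial>a/\<partial>x\<^sub>i\<close> for \<open>a\<close> in \<open>R\<close>.
\<close>

definition weyl_lpartial :: "nat \<Rightarrow> 'k::comm_ring_1 weyl \<Rightarrow> 'k weyl" where
  "weyl_lpartial i A = (\<Sum>\<alpha>\<in>Poly_Mapping.keys A.
     Poly_Mapping.single (\<alpha> + Poly_Mapping.single i 1) (Poly_Mapping.lookup A \<alpha>) +
     Poly_Mapping.single \<alpha> (mderiv i (Poly_Mapping.lookup A \<alpha>)))"

definition weyl_mult :: "'k::comm_ring_1 weyl \<Rightarrow> 'k weyl \<Rightarrow> 'k weyl" where
  "weyl_mult A B = (\<Sum>\<beta>\<in>Poly_Mapping.keys A.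
     weyl_lscale (Poly_Mapping.lookup A \<beta>) (iterate_ops weyl_lpartial \<beta> B))"

lemma iterate_ops_single: "iterate_ops D (Poly_Mapping.single i 1) = D i"
  by (simp add: iterate_ops_def)

lemma weyl_relation:
  "weyl_mult (weyl_partial (Poly_Mapping.single i 1)) (weyl_of_poly r) =
     weyl_mult (weyl_of_poly r) (weyl_partial (Poly_Mapping.single i 1)) + weyl_of_poly (mderiv i r)"
proof (cases "r = 0")
  case False
  have 1: "weyl_lscale 1 B = B" for B :: "'b::comm_ring_1 weyl"
    by (rule poly_mapping_eqI) (auto simp: weyl_lscale_def lookup_sum lookup_single when_def in_keys_iff)
  show ?thesis using False 
    by (simp add: weyl_mult_def weyl_partial_def weyl_of_poly_def iterate_ops_single 1)
      (simp add: weyl_lscale_def iterate_ops_def weyl_lpartial_def)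
qed (simp add: weyl_mult_def weyl_partial_def weyl_of_poly_def iterate_ops_single[simplified] weyl_lscale_def weyl_lpartial_def mderiv_def)

definition weyl_act :: "'k::comm_ring_1 weyl \<Rightarrow> 'k mpoly \<Rightarrow> 'k mpoly" where
  "weyl_act A f = (\<Sum>\<alpha>\<in>Poly_Mapping.keys A. Poly_Mapping.lookup A \<alpha> * mderivs \<alpha> f)"

text \<open>
  Since \<open>D\<close> is free over \<open>R\<close> on the \<open>\<partial>\<^sub>x\<^sup>\<beta>\<close>, an element of the tensor product of \<open>F\<close> and \<open>D\<close>
  is stored by its coordinates in the \<open>F\<close>-basis \<open>1 \<otimes> \<partial>\<^sub>x\<^sup>\<beta>\<close>; \<open>wn_tensor \<phi> a A\<close> is \<open>a \<otimes> A\<close>.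
  The \<open>F\<close>-vector space structure is \<^const>\<open>mscale\<close>.
\<close>

type_synonym 'f weyl_noether = "monom \<Rightarrow>\<^sub>0 'f"

definition weyl_noether :: "nat \<Rightarrow> 'f::field weyl_noether set" where
  "weyl_noether c = {w. \<forall>\<beta>\<in>Poly_Mapping.keys w. Poly_Mapping.keys \<beta> \<subseteq> {1..c}}"

definition wn_tensor ::
    "('k::comm_ring_1 mpoly \<Rightarrow> 'f::field) \<Rightarrow> 'f \<Rightarrow> 'k weyl \<Rightarrow> 'f weyl_noether" where
  "wn_tensor \<phi> a A = (\<Sum>\<beta>\<in>Poly_Mapping.keys A.
     Poly_Mapping.single \<beta> (a * \<phi> (Poly_Mapping.lookup A \<beta>)))"

lemma tensor_balanced:
  assumes "\<And>p q. p \<in> X \<Longrightarrow> q \<in> X \<Longrightarrow> \<phi> (p * q) = \<phi> p * \<phi> q" "\<phi> 0 = 0" "r \<in> X"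
   "\<forall>\<alpha>\<in>Poly_Mapping.keys A. Poly_Mapping.lookup A \<alpha> \<in> X"
  shows "wn_tensor \<phi> a (weyl_lscale r A) = wn_tensor \<phi> (a * \<phi> r) A"
proof -
  have L: "Poly_Mapping.lookup (weyl_lscale r A) \<alpha> = r * Poly_Mapping.lookup A \<alpha>" for \<alpha>
    by (auto simp: weyl_lscale_def lookup_sum lookup_single when_def in_keys_iff)
  have "wn_tensor \<phi> a (weyl_lscale r A) = (\<Sum>\<beta>\<in>Poly_Mapping.keys A.
     Poly_Mapping.single \<beta> (a * \<phi> (Poly_Mapping.lookup (weyl_lscale r A) \<beta>)))"
    unfolding wn_tensor_def
    by (rule sum.mono_neutral_left) (auto simp: L in_keys_iff assms)
  also have "\<dots> = wn_tensor \<phi> (a * \<phi> r) A"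
    unfolding wn_tensor_def by (rule sum.cong) (use assms in \<open>auto simp: L mult.assoc\<close>)
  finally show ?thesis .
qed

definition wn_left ::
    "('k::comm_ring_1 mpoly \<Rightarrow> 'f::field) \<Rightarrow> 'k mpoly \<Rightarrow> 'f weyl_noether \<Rightarrow> 'f weyl_noether" where
  "wn_left \<phi> r w = mscale (\<phi> r) w"

definition wn_right ::
    "('k::comm_ring_1 mpoly \<Rightarrow> 'f::field) \<Rightarrow> 'f weyl_noether \<Rightarrow> 'k mpoly \<Rightarrow> 'f weyl_noether" where
  "wn_right \<phi> w r = (\<Sum>\<beta>\<in>Poly_Mapping.keys w.
     wn_tensor \<phi> (Poly_Mapping.lookup w \<beta>) (weyl_mult (weyl_partial \<beta>) (weyl_of_poly r)))"

definition sub_bimodules ::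
    "nat \<Rightarrow> nat \<Rightarrow> ('k::comm_ring_1 mpoly \<Rightarrow> 'f::field) \<Rightarrow> nat \<Rightarrow> 'f weyl_noether set set" where
  "sub_bimodules n c \<phi> m =
     {E. E \<subseteq> weyl_noether c \<and> mspace.subspace E \<and> mspace.dim E = m \<and>
         (\<forall>w\<in>E. \<forall>r\<in>carrier (poly_ring n). wn_left \<phi> r w \<in> E \<and> wn_right \<phi> w r \<in> E)}"

definition omega ::
    "('k::comm_ring_1 mpoly \<Rightarrow> 'f::field) \<Rightarrow> 'f mpoly \<Rightarrow> 'f weyl_noether" where
  "omega \<phi> F = (\<Sum>\<alpha>\<in>Poly_Mapping.keys F.
     mscale (Poly_Mapping.lookup F \<alpha>) (wn_tensor \<phi> 1 (weyl_partial \<alpha>)))"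

definition omega_preimage ::
    "nat \<Rightarrow> ('k::comm_ring_1 mpoly \<Rightarrow> 'f::field) \<Rightarrow> 'f weyl_noether set \<Rightarrow> 'f mpoly set" where
  "omega_preimage c \<phi> E = {F \<in> carrier (poly_ring c). omega \<phi> F \<in> E}"

definition is_lift ::
    "nat \<Rightarrow> nat \<Rightarrow> ('k::comm_ring_1 mpoly \<Rightarrow> 'f::field) \<Rightarrow> 'f weyl_noether \<Rightarrow> 'k weyl \<Rightarrow> bool" where
  "is_lift n c \<phi> w A \<longleftrightarrow> A \<in> weyl_algebra n c \<and> (\<exists>a. a \<noteq> 0 \<and> mscale a w = wn_tensor \<phi> 1 A)"

end

theory Submission
  imports Defs "HOL-Computational_Algebra.Formal_Power_Series"
begin

text \<open>
  Let \<open>u\<close> be the point with coordinates \<open>u\<^sub>i\<close> in the residue field \<open>F\<close>.  The map \<open>\<gamma>\<close> is Taylor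
  expansion at \<open>u\<close> in the directions \<open>1, \<dots>, c\<close>: the coefficient of \<open>y\<^sup>\<alpha>\<close> in \<open>\<gamma> f\<close> is the class of
  \<open>\<partial>\<^sup>\<alpha> f\<close> divided by \<open>\<alpha>!\<close>.  The theorem combines linear algebra over \<open>F\<close> with two properties of
  this map.

  Linear algebra.  In characteristic zero, \<open>\<langle>f, F\<rangle> = (\<Sum>\<alpha>. \<alpha>! f\<^sub>\<alpha> F\<^sub>\<alpha>)\<close> is a perfect pairing of
  polynomials in \<open>y\<close> modulo order \<open>N\<close> with polynomials in \<open>z\<close> of degree below \<open>N\<close>, under which
  multiplication by \<open>y\<^sub>i\<close> is adjoint to \<open>\<partial>\<^sub>i\<close>.  Hence the ideals that contain everything of order
  at least some \<open>N\<close> correspond to the finite-dimensional spaces closed under differentiation, and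
  colength becomes dimension.  The locale \<open>coefficient_space\<close> runs this argument once for
  polynomials and for power series, which gives (b)-(c) and the contraction and extension of
  ideals.  The one further input is that an ideal of finite colength in the power series ring
  contains all series of large order (\<open>finite_colength_tails\<close>).

  The Taylor map.  Algebraicity of the \<open>u\<^sub>i\<close> over the independent variables and characteristic
  zero provide elements of \<open>P\<close> whose Taylor expansions start with nonzero multiples of
  \<open>y\<^sub>1, \<dots>, y\<^sub>c\<close>.  They imply density: every polynomial in \<open>y\<close> is, to any order, a quotient
  \<open>\<gamma> f / \<gamma> h\<close> with \<open>h \<notin> P\<close> (\<open>jet_lift\<close>).  They also imply a Zariski-Nagata theorem: if \<open>\<gamma> f\<close>
  vanishes to order \<open>k\<close>, then \<open>f\<close> lies in the \<open>k\<close>-th symbolic power of \<open>P\<close>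
  (\<open>spow_if_\<gamma>_order\<close>).

  For (a)-(b), density shows that preimages under \<open>\<gamma>\<close> identify the ideals above \<open>I\<close> with the
  \<open>P\<close>-saturated ideals above \<open>\<gamma>\<^sup>-\<^sup>1(I)\<close>, that is, with the ideals of the local ring whose length
  is the multiplicity; so multiplicity equals colength.  Conversely, \<open>P\<close> annihilates every step of
  a maximal chain of saturated ideals above a \<open>P\<close>-primary ideal \<open>Q\<close> of multiplicity \<open>m\<close>, so \<open>Q\<close>
  contains the \<open>m\<close>-th symbolic power, and Zariski-Nagata recovers \<open>Q\<close> from
  \<open>\<langle>y\<rangle>\<^sup>m + \<gamma>(Q) F[y]\<close>.

  For (c)-(d), \<open>\<omega>\<close> is the identity in coordinates, and right multiplication by \<open>x\<^sub>i\<close> is the operator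
  \<open>u\<^sub>i + \<partial>\<^sub>i\<close>; so sub-bimodules are the same as spaces closed under differentiation.  Finally, for a
  lift \<open>A\<close> of \<open>w\<close> the class of \<open>A \<bullet> f\<close> is a nonzero multiple of \<open>\<langle>\<gamma> f, w\<rangle>\<close>, which turns the
  description of \<open>Q\<close> by orthogonality into Noetherian operators.
\<close>

section \<open>Monomials and polynomials\<close>

lemma monom_eq_iff: "\<alpha> = \<beta> \<longleftrightarrow> (\<forall>i. Poly_Mapping.lookup \<alpha> i = Poly_Mapping.lookup (\<beta>::monom) i)"
  by (auto intro: poly_mapping_eqI)

definition evar :: "nat \<Rightarrow> monom" where
  "evar i = Poly_Mapping.single i 1"

lemma lookup_evar: "Poly_Mapping.lookup (evar i) j = (if j = i then 1 else 0)"
  by (simp add: evar_def lookup_single when_def)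

lemma keys_evar [simp]: "Poly_Mapping.keys (evar i) = {i}"
  by (simp add: evar_def)

lemma monom_diff_evar:
  fixes \<alpha> :: monom
  assumes "Poly_Mapping.lookup \<alpha> i \<noteq> 0"
  shows "\<alpha> - evar i + evar i = \<alpha>"
  using assms by (auto simp: monom_eq_iff lookup_add lookup_minus lookup_evar lookup_single when_def)

definition mdeg :: "monom \<Rightarrow> nat" where
  "mdeg \<alpha> = sum (Poly_Mapping.lookup \<alpha>) (Poly_Mapping.keys \<alpha>)"

lemma mdeg_superset:
  assumes "finite A" "Poly_Mapping.keys \<alpha> \<subseteq> A"
  shows "mdeg \<alpha> = sum (Poly_Mapping.lookup \<alpha>) A"
  unfolding mdeg_def by (rule sum.mono_neutral_left) (use assms in \<open>auto simp: in_keys_iff\<close>)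

lemma mdeg_add [simp]: "mdeg (\<alpha> + \<beta>) = mdeg \<alpha> + mdeg \<beta>"
  by (subst (1 2 3) mdeg_superset[of "Poly_Mapping.keys \<alpha> \<union> Poly_Mapping.keys \<beta>"])
    (auto simp: keys_plus_monom lookup_add sum.distrib)

lemma mdeg_single [simp]: "mdeg (Poly_Mapping.single i k) = k"
  by (simp add: mdeg_def)

lemma mdeg_evar [simp]: "mdeg (evar i) = 1"
  by (simp add: evar_def)

lemma mdeg_zero [simp]: "mdeg 0 = 0"
  by (simp add: mdeg_def)

lemma mdeg_eq_0_iff [simp]: "mdeg \<alpha> = 0 \<longleftrightarrow> \<alpha> = 0"
  by (auto simp: mdeg_def in_keys_iff monom_eq_iff)

lemma monom_split_evar:
  assumes "\<alpha> \<noteq> (0::monom)"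
  obtains \<beta> i where "\<alpha> = \<beta> + evar i" "i \<in> Poly_Mapping.keys \<alpha>"
proof -
  obtain i where "i \<in> Poly_Mapping.keys \<alpha>"
    using assms by (metis keys_eq_empty all_not_in_conv)
  then show thesis
    using that[of "\<alpha> - evar i" i] monom_diff_evar[of \<alpha> i] by (simp add: in_keys_iff)
qed

lemma monom_induct [case_names zero add]:
  assumes "P (0::monom)" and "\<And>\<beta> i. P \<beta> \<Longrightarrow> P (\<beta> + evar i)"
  shows "P \<alpha>"
proof (induction "mdeg \<alpha>" arbitrary: \<alpha>)
  case 0
  then show ?case using assms(1) by simp
next
  case (Suc k)
  then have "\<alpha> \<noteq> 0" by auto
  then obtain \<beta> i where "\<alpha> = \<beta> + evar i" by (rule monom_split_evar)
  with Suc assms(2) show ?case by simp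
qed

definition mfact :: "monom \<Rightarrow> nat" where
  "mfact \<alpha> = (\<Prod>i\<in>Poly_Mapping.keys \<alpha>. fact (Poly_Mapping.lookup \<alpha> i))"

lemma mfact_superset:
  assumes "finite A" "Poly_Mapping.keys \<alpha> \<subseteq> A"
  shows "mfact \<alpha> = (\<Prod>i\<in>A. fact (Poly_Mapping.lookup \<alpha> i))"
  unfolding mfact_def by (rule prod.mono_neutral_left) (use assms in \<open>auto simp: in_keys_iff\<close>)

lemma mfact_pos: "mfact \<alpha> > 0"
  by (simp add: mfact_def prod_pos)

lemma mfact_zero [simp]: "mfact 0 = 1"
  by (simp add: mfact_def)

lemma mfact_add_evar: "mfact (\<alpha> + evar i) = (Poly_Mapping.lookup \<alpha> i + 1) * mfact \<alpha>"
proof -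
  let ?A = "insert i (Poly_Mapping.keys \<alpha>)"
  have "mfact (\<alpha> + evar i) = (\<Prod>j\<in>?A. fact (Poly_Mapping.lookup (\<alpha> + evar i) j))"
    by (rule mfact_superset) (auto simp: keys_plus_monom)
  also have "\<dots> = (\<Prod>j\<in>?A. (if j = i then Poly_Mapping.lookup \<alpha> i + 1 else 1) * fact (Poly_Mapping.lookup \<alpha> j))"
    by (rule prod.cong) (auto simp: lookup_add lookup_evar lookup_single when_def)
  also have "\<dots> = (Poly_Mapping.lookup \<alpha> i + 1) * (\<Prod>j\<in>?A. fact (Poly_Mapping.lookup \<alpha> j))"
    by (simp only: prod.distrib) (simp add: prod.delta)
  also have "(\<Prod>j\<in>?A. fact (Poly_Mapping.lookup \<alpha> j)) = mfact \<alpha>"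
    by (rule mfact_superset[symmetric]) auto
  finally show ?thesis .
qed

lemma finite_monoms:
  assumes "finite V"
  shows "finite {\<alpha>. Poly_Mapping.keys \<alpha> \<subseteq> V \<and> mdeg \<alpha> < N}"
proof -
  let ?G = "{f. \<forall>i. (i \<in> V \<longrightarrow> f i \<in> {..N}) \<and> (i \<notin> V \<longrightarrow> f i = (0::nat))}"
  have "finite ?G" by (rule finite_set_of_finite_funs) (use assms in auto)
  moreover have "Poly_Mapping.lookup ` {\<alpha>. Poly_Mapping.keys \<alpha> \<subseteq> V \<and> mdeg \<alpha> < N} \<subseteq> ?G"
  proof (rule image_subsetI, clarify, intro conjI impI)
    fix \<alpha> i assume \<alpha>: "Poly_Mapping.keys \<alpha> \<subseteq> V" "mdeg \<alpha> < N"
    show "Poly_Mapping.lookup \<alpha> i \<in> {..N}" if "i \<in> V"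
      using \<alpha> assms that member_le_sum[of i V "Poly_Mapping.lookup \<alpha>"] mdeg_superset[of V \<alpha>] by auto
    show "Poly_Mapping.lookup \<alpha> i = 0" if "i \<notin> V"
      using \<alpha> that by (auto simp: in_keys_iff)
  qed
  ultimately have "finite (Poly_Mapping.lookup ` {\<alpha>. Poly_Mapping.keys \<alpha> \<subseteq> V \<and> mdeg \<alpha> < N})"
    by (rule rev_finite_subset)
  then show ?thesis
    by (rule finite_imageD) (auto simp: inj_on_def)
qed

lemma poly_mapping_sum_singles:
  "p = (\<Sum>\<alpha>\<in>Poly_Mapping.keys p. Poly_Mapping.single \<alpha> (Poly_Mapping.lookup p \<alpha>))"
  by (rule poly_mapping_eqI) (auto simp: lookup_sum lookup_single when_def in_keys_iff)

lemma poly_mapping_single_induct [case_names single add]: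
  fixes p :: "'a \<Rightarrow>\<^sub>0 'b::comm_monoid_add"
  assumes "\<And>\<alpha> a. \<alpha> \<in> Poly_Mapping.keys p \<or> a = 0 \<Longrightarrow> Q (Poly_Mapping.single \<alpha> a)"
    and "\<And>p q. Q p \<Longrightarrow> Q q \<Longrightarrow> Q (p + q)"
  shows "Q p"
proof -
  have "Q (\<Sum>\<alpha>\<in>A. Poly_Mapping.single \<alpha> (Poly_Mapping.lookup p \<alpha>))"
    if "finite A" "A \<subseteq> Poly_Mapping.keys p" for A
    using that
  proof (induction A rule: finite_induct)
    case empty
    show ?case using assms(1)[of undefined 0] by simp
  qed (use assms in simp)
  then show ?thesis by (subst poly_mapping_sum_singles) simp
qed

lemma mconst_add: "mconst (a + b) = mconst a + mconst b"
  by (simp add: mconst_def single_add)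

lemma mconst_mult: "mconst (a * b) = mconst a * mconst b"
  by (simp add: mconst_def mult_single)

lemma mconst_0 [simp]: "mconst 0 = 0"
  by (simp add: mconst_def)

lemma mconst_1 [simp]: "mconst 1 = 1"
  by (simp add: mconst_def)

lemma mconst_of_nat: "mconst (of_nat k) = of_nat k"
  by (simp add: mconst_def)

lemma mconst_uminus: "mconst (- a) = - mconst a"
  by (simp add: mconst_def single_uminus)

lemma mvar_times_single:
  "mvar i * Poly_Mapping.single \<alpha> (a::'a::comm_semiring_1) = Poly_Mapping.single (\<alpha> + evar i) a"
  by (simp add: mvar_def evar_def mult_single add.commute)

lemma lookup_mconst_mult:
  fixes p :: "'a::comm_semiring_1 mpoly"
  shows "Poly_Mapping.lookup (mconst a * p) \<alpha> = a * Poly_Mapping.lookup p \<alpha>"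
  unfolding mconst_def mult_map_scale_conv_mult[symmetric]
  by (simp add: Poly_Mapping.map.rep_eq when_def)

lemma lookup_mpoly_mult:
  fixes p q :: "'a::comm_semiring_1 mpoly"
  shows "Poly_Mapping.lookup (p * q) \<alpha> =
    (\<Sum>(\<beta>, \<delta>) | \<beta> + \<delta> = \<alpha>. Poly_Mapping.lookup p \<beta> * Poly_Mapping.lookup q \<delta>)"
proof (induction p rule: poly_mapping_single_induct)
  case (single \<mu> a)
  show ?case
  proof (induction q rule: poly_mapping_single_induct)
    case (single \<nu> b)
    have "(\<Sum>(\<beta>, \<delta>) | \<beta> + \<delta> = \<alpha>. Poly_Mapping.lookup (Poly_Mapping.single \<mu> a) \<beta> * Poly_Mapping.lookup (Poly_Mapping.single \<nu> b) \<delta>)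
      = (\<Sum>(\<beta>, \<delta>)\<in>{(\<beta>, \<delta>). \<beta> + \<delta> = \<alpha>} \<inter> {(\<mu>, \<nu>)}. a * b)"
      by (rule sum.mono_neutral_cong_right) (auto simp: finite_splits lookup_single when_def split: if_splits)
    also have "\<dots> = Poly_Mapping.lookup (Poly_Mapping.single \<mu> a * Poly_Mapping.single \<nu> b) \<alpha>"
      by (auto simp: mult_single lookup_evar lookup_single when_def)
    finally show ?case by simp
  next
    case (add p q)
    then show ?case
      by (simp add: distrib_left lookup_add case_prod_beta sum.distrib)
  qed
next
  case (add p q)
  then show ?case
    by (simp add: distrib_right lookup_add case_prod_beta sum.distrib)
qed

lemma lookup_mult_zero:
  fixes p q :: "'a::comm_semiring_1 mpoly"
  shows "Poly_Mapping.lookup (p * q) 0 = Poly_Mapping.lookup p 0 * Poly_Mapping.lookup q 0"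
proof -
  have "{(\<beta>, \<delta>). \<beta> + \<delta> = (0::monom)} = {(0, 0)}"
    by (auto simp: monom_eq_iff lookup_add)
  then show ?thesis by (simp add: lookup_mpoly_mult)
qed

lemma polys_in_const [simp]: "mconst a \<in> polys_in V"
  by (auto simp: polys_in_def mconst_def split: if_splits)

lemma polys_in_0 [simp]: "0 \<in> polys_in V"
  by (auto simp: polys_in_def)

lemma polys_in_1 [simp]: "1 \<in> polys_in V"
  by (auto simp: polys_in_def)

lemma polys_in_single: "Poly_Mapping.keys \<alpha> \<subseteq> V \<Longrightarrow> Poly_Mapping.single \<alpha> a \<in> polys_in V"
  by (auto simp: polys_in_def)

lemma polys_in_var: "i \<in> V \<Longrightarrow> mvar i \<in> polys_in V"
  by (simp add: mvar_def polys_in_single flip: evar_def)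

lemma polys_in_add: "p \<in> polys_in V \<Longrightarrow> q \<in> polys_in V \<Longrightarrow> p + q \<in> polys_in V"
  using keys_add[of p q] unfolding polys_in_def by blast

lemma polys_in_uminus: "p \<in> polys_in V \<Longrightarrow> - p \<in> polys_in V" for p :: "'a::comm_ring_1 mpoly"
  by (auto simp: polys_in_def)

lemma polys_in_diff: "p \<in> polys_in V \<Longrightarrow> q \<in> polys_in V \<Longrightarrow> p - q \<in> polys_in V"
  for p :: "'a::comm_ring_1 mpoly"
  using polys_in_add[of p V "- q"] polys_in_uminus[of q V] by simp

lemma polys_in_mult: "p \<in> polys_in V \<Longrightarrow> q \<in> polys_in V \<Longrightarrow> p * q \<in> polys_in V"
  for p :: "'a::comm_semiring_1 mpoly"
  using keys_mult[of p q] unfolding polys_in_def by (fastforce simp: keys_plus_monom)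

lemma polys_in_power: "p \<in> polys_in V \<Longrightarrow> p ^ k \<in> polys_in V"
  for p :: "'a::comm_semiring_1 mpoly"
  by (induction k) (auto intro: polys_in_mult)

lemma polys_in_sum: "(\<And>i. i \<in> A \<Longrightarrow> f i \<in> polys_in V) \<Longrightarrow> sum f A \<in> polys_in V"
  by (induction A rule: infinite_finite_induct) (auto intro: polys_in_add)

lemma polys_in_prod: "(\<And>i. i \<in> A \<Longrightarrow> f i \<in> polys_in V) \<Longrightarrow> prod f A \<in> polys_in V"
  for f :: "_ \<Rightarrow> 'a::comm_semiring_1 mpoly"
  by (induction A rule: infinite_finite_induct) (auto intro: polys_in_mult)

lemmas polys_in_closed = polys_in_add polys_in_uminus polys_in_diff polys_in_mult polys_in_power
  polys_in_sum polys_in_prod polys_in_var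

lemma polys_in_mono: "V \<subseteq> W \<Longrightarrow> polys_in V \<subseteq> polys_in W"
  by (auto simp: polys_in_def)

lemma polys_in_UNIV [simp]: "polys_in UNIV = UNIV"
  by (auto simp: polys_in_def)

lemma polys_in_lookup: "p \<in> polys_in V \<Longrightarrow> Poly_Mapping.lookup p \<alpha> \<noteq> 0 \<Longrightarrow> Poly_Mapping.keys \<alpha> \<subseteq> V"
  by (auto simp: polys_in_def in_keys_iff)

lemma polys_in_induct [consumes 1, case_names const add var]:
  fixes p :: "'a::comm_semiring_1 mpoly"
  assumes "p \<in> polys_in V" "\<And>a. Q (mconst a)"
    and "\<And>p q. p \<in> polys_in V \<Longrightarrow> q \<in> polys_in V \<Longrightarrow> Q p \<Longrightarrow> Q q \<Longrightarrow> Q (p + q)"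
    and "\<And>i p. i \<in> V \<Longrightarrow> p \<in> polys_in V \<Longrightarrow> Q p \<Longrightarrow> Q (mvar i * p)"
  shows "Q p"
proof -
  have Qs: "Q (Poly_Mapping.single \<alpha> a)" if "Poly_Mapping.keys \<alpha> \<subseteq> V" for \<alpha> a
    using that
  proof (induction \<alpha> rule: monom_induct)
    case zero
    show ?case using assms(2)[of a] by (simp add: mconst_def)
  next
    case (add \<beta> i)
    then have "Q (mvar i * Poly_Mapping.single \<beta> a)"
      by (intro assms(4)) (auto simp: keys_plus_monom polys_in_single)
    then show ?case by (simp add: mvar_times_single)
  qed
  have "p \<in> polys_in V \<and> Q p"
  proof (induction p rule: poly_mapping_single_induct)
    case (single \<alpha> a)
    then have "Poly_Mapping.keys \<alpha> \<subseteq> V \<or> a = 0" using assms(1) by (auto simp: polys_in_def)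
    then show ?case using Qs assms(2)[of 0] by (auto simp: polys_in_single)
  qed (auto intro: assms(3) polys_in_add)
  then show ?thesis ..
qed

lemma mpoly_induct [case_names const add var]:
  fixes p :: "'a::comm_semiring_1 mpoly"
  assumes "\<And>a. Q (mconst a)" "\<And>p q. Q p \<Longrightarrow> Q q \<Longrightarrow> Q (p + q)" "\<And>i p. Q p \<Longrightarrow> Q (mvar i * p)"
  shows "Q p"
  using polys_in_induct[of p UNIV Q] assms by simp

section \<open>Evaluation of polynomials\<close>

lemma meval_superset:
  assumes "finite A" "Poly_Mapping.keys p \<subseteq> A" "h 0 = 0"
  shows "meval h g p = (\<Sum>\<alpha>\<in>A. h (Poly_Mapping.lookup p \<alpha>) *
     (\<Prod>i\<in>Poly_Mapping.keys \<alpha>. g i ^ Poly_Mapping.lookup \<alpha> i))"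
  unfolding meval_def by (rule sum.mono_neutral_left) (use assms in \<open>auto simp: in_keys_iff\<close>)

lemma prod_power_monom_add:
  fixes g :: "nat \<Rightarrow> 'b::comm_semiring_1"
  shows "(\<Prod>i\<in>Poly_Mapping.keys (\<alpha> + \<beta>). g i ^ Poly_Mapping.lookup (\<alpha> + \<beta>) i) =
    (\<Prod>i\<in>Poly_Mapping.keys \<alpha>. g i ^ Poly_Mapping.lookup \<alpha> i) *
    (\<Prod>i\<in>Poly_Mapping.keys \<beta>. g i ^ Poly_Mapping.lookup \<beta> i)"
proof -
  let ?A = "Poly_Mapping.keys \<alpha> \<union> Poly_Mapping.keys \<beta>"
  have "(\<Prod>i\<in>Poly_Mapping.keys \<mu>. g i ^ Poly_Mapping.lookup \<mu> i) = (\<Prod>i\<in>?A. g i ^ Poly_Mapping.lookup \<mu> i)"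
    if "Poly_Mapping.keys \<mu> \<subseteq> ?A" for \<mu>
    by (rule prod.mono_neutral_left) (use that in \<open>auto simp: in_keys_iff\<close>)
  then show ?thesis
    by (simp add: keys_plus_monom lookup_add power_add prod.distrib)
qed

context
  fixes h :: "'a::comm_ring_1 \<Rightarrow> 'b::comm_ring_1" and g :: "nat \<Rightarrow> 'b"
  assumes h_add: "\<And>a b. h (a + b) = h a + h b"
    and h_mult: "\<And>a b. h (a * b) = h a * h b"
    and h_1: "h 1 = 1"
begin

lemma meval_hom_0: "h 0 = 0"
  using h_add[of 0 0] by simp

lemma meval_single:
  "meval h g (Poly_Mapping.single \<alpha> a) = h a * (\<Prod>i\<in>Poly_Mapping.keys \<alpha>. g i ^ Poly_Mapping.lookup \<alpha> i)"
  by (cases "a = 0") (simp_all add: meval_def meval_hom_0)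

lemma meval_add: "meval h g (p + q) = meval h g p + meval h g q"
proof -
  let ?A = "Poly_Mapping.keys p \<union> Poly_Mapping.keys q"
  show ?thesis
    using meval_superset[of ?A p h g] meval_superset[of ?A q h g] meval_superset[of ?A "p + q" h g]
      keys_add[of p q]
    by (simp add: meval_hom_0 lookup_add h_add distrib_right sum.distrib)
qed

lemma meval_mult: "meval h g (p * q) = meval h g p * meval h g q"
proof (induction p rule: poly_mapping_single_induct)
  case (single \<alpha> a)
  show ?case
  proof (induction q rule: poly_mapping_single_induct)
    case (single \<beta> b)
    show ?case
      by (simp add: mult_single meval_single prod_power_monom_add h_mult mult_ac)
  qed (simp add: distrib_left meval_add)
qed (simp add: distrib_right meval_add)

lemma meval_const: "meval h g (mconst a) = h a"
  by (simp add: mconst_def meval_single)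

lemma meval_var: "meval h g (mvar i) = g i"
  by (simp add: mvar_def meval_single h_1)

end

section \<open>Derivatives\<close>

lemma lookup_mderiv:
  "Poly_Mapping.lookup (mderiv i p) \<delta> = of_nat (Poly_Mapping.lookup \<delta> i + 1) * Poly_Mapping.lookup p (\<delta> + evar i)"
proof -
  have "Poly_Mapping.lookup (mderiv i p) \<delta> = (\<Sum>\<alpha>\<in>Poly_Mapping.keys p.
     (of_nat (Poly_Mapping.lookup \<alpha> i) * Poly_Mapping.lookup p \<alpha> when \<alpha> - evar i = \<delta>))"
    by (simp add: mderiv_def lookup_sum lookup_single evar_def)
  also have "\<dots> = (\<Sum>\<alpha>\<in>Poly_Mapping.keys p \<inter> {\<delta> + evar i}.
     of_nat (Poly_Mapping.lookup \<delta> i + 1) * Poly_Mapping.lookup p \<alpha>)"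
  proof (rule sum.mono_neutral_cong_right)
    show "\<forall>\<alpha>\<in>Poly_Mapping.keys p - Poly_Mapping.keys p \<inter> {\<delta> + evar i}.
       (of_nat (Poly_Mapping.lookup \<alpha> i) * Poly_Mapping.lookup p \<alpha> when \<alpha> - evar i = \<delta>) = 0"
    proof
      fix \<alpha> assume "\<alpha> \<in> Poly_Mapping.keys p - Poly_Mapping.keys p \<inter> {\<delta> + evar i}"
      then show "(of_nat (Poly_Mapping.lookup \<alpha> i) * Poly_Mapping.lookup p \<alpha> when \<alpha> - evar i = \<delta>) = 0"
        using monom_diff_evar[of \<alpha> i] by (cases "Poly_Mapping.lookup \<alpha> i = 0") (auto simp: when_def)
    qed
  qed (auto simp: when_def lookup_add lookup_evar)
  also have "\<dots> = of_nat (Poly_Mapping.lookup \<delta> i + 1) * Poly_Mapping.lookup p (\<delta> + evar i)"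
    by (cases "\<delta> + evar i \<in> Poly_Mapping.keys p") (auto simp: in_keys_iff)
  finally show ?thesis .
qed

lemma mderiv_add: "mderiv i (p + q) = mderiv i p + mderiv i q"
  by (rule poly_mapping_eqI) (simp add: lookup_mderiv lookup_add distrib_left)

lemma mderiv_0 [simp]: "mderiv i 0 = 0"
  by (rule poly_mapping_eqI) (simp add: lookup_mderiv)

lemma mderiv_diff: "mderiv i (p - q) = mderiv i p - mderiv i q" for p :: "'a::comm_ring_1 mpoly"
  by (rule poly_mapping_eqI) (simp add: lookup_mderiv lookup_minus right_diff_distrib)

lemma mderiv_sum: "mderiv i (sum f A) = (\<Sum>x\<in>A. mderiv i (f x))"
  by (induction A rule: infinite_finite_induct) (simp_all add: mderiv_add)

lemma mderiv_const [simp]: "mderiv i (mconst a) = 0"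
  by (rule poly_mapping_eqI)
    (auto simp: lookup_mderiv mconst_def lookup_evar lookup_single when_def monom_eq_iff lookup_add)

lemma mderiv_const_mult: "mderiv i (mconst a * p) = mconst a * mderiv i p"
  by (rule poly_mapping_eqI) (simp add: lookup_mderiv lookup_mconst_mult mult.left_commute)

lemma mderiv_1 [simp]: "mderiv i 1 = 0"
  using mderiv_const[of i 1] by simp

lemma mderiv_single:
  "mderiv i (Poly_Mapping.single \<alpha> a) = Poly_Mapping.single (\<alpha> - evar i) (of_nat (Poly_Mapping.lookup \<alpha> i) * a)"
  by (cases "a = 0") (simp_all add: mderiv_def evar_def)

lemma mderiv_mult: "mderiv i (p * q) = mderiv i p * q + p * mderiv i q"
proof (induction p rule: poly_mapping_single_induct)
  case (single \<alpha> a)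
  show ?case
  proof (induction q rule: poly_mapping_single_induct)
    case (single \<beta> b)
    have 1: "Poly_Mapping.single (\<alpha> + \<beta> - evar i) (of_nat (Poly_Mapping.lookup \<alpha> i) * (a * b))
      = Poly_Mapping.single (\<alpha> - evar i + \<beta>) (of_nat (Poly_Mapping.lookup \<alpha> i) * (a * b))"
    proof (cases "Poly_Mapping.lookup \<alpha> i = 0")
      case False
      then have "\<alpha> + \<beta> - evar i = \<alpha> - evar i + \<beta>"
        by (auto simp: monom_eq_iff lookup_add lookup_minus lookup_evar lookup_single when_def)
      then show ?thesis by simp
    qed simp
    have 2: "Poly_Mapping.single (\<alpha> + \<beta> - evar i) (of_nat (Poly_Mapping.lookup \<beta> i) * (a * b))
      = Poly_Mapping.single (\<alpha> + (\<beta> - evar i)) (of_nat (Poly_Mapping.lookup \<beta> i) * (a * b))"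
    proof (cases "Poly_Mapping.lookup \<beta> i = 0")
      case False
      then have "\<alpha> + \<beta> - evar i = \<alpha> + (\<beta> - evar i)"
        by (auto simp: monom_eq_iff lookup_add lookup_minus lookup_evar lookup_single when_def)
      then show ?thesis by simp
    qed simp
    have "mderiv i (Poly_Mapping.single \<alpha> a * Poly_Mapping.single \<beta> b) =
      Poly_Mapping.single (\<alpha> + \<beta> - evar i) (of_nat (Poly_Mapping.lookup \<alpha> i) * (a * b)) +
      Poly_Mapping.single (\<alpha> + \<beta> - evar i) (of_nat (Poly_Mapping.lookup \<beta> i) * (a * b))"
      by (simp add: mult_single mderiv_single lookup_add distrib_right flip: single_add)
    then show ?case
      unfolding 1 2 by (simp add: mult_single mderiv_single) (simp add: mult_ac)
  qed (simp add: distrib_left mderiv_add algebra_simps)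
qed (simp add: distrib_right mderiv_add algebra_simps)

lemma mderiv_var: "mderiv i (mvar j) = (if i = j then 1 else 0)"
  by (auto simp: mvar_def mderiv_single lookup_evar simp flip: evar_def One_nat_def)

lemma mderiv_commute: "mderiv i (mderiv j p) = mderiv j (mderiv i p)"
  by (rule poly_mapping_eqI) (auto simp: lookup_mderiv lookup_add lookup_evar algebra_simps)

lemma polys_in_mderiv: "p \<in> polys_in V \<Longrightarrow> mderiv i p \<in> polys_in V"
proof -
  assume p: "p \<in> polys_in V"
  have "Poly_Mapping.keys \<alpha> \<subseteq> V" if "Poly_Mapping.lookup (mderiv i p) \<alpha> \<noteq> 0" for \<alpha>
  proof -
    from that have "Poly_Mapping.lookup p (\<alpha> + evar i) \<noteq> 0" by (auto simp: lookup_mderiv)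
    from polys_in_lookup[OF p this] show ?thesis by (simp add: keys_plus_monom)
  qed
  then show ?thesis by (auto simp: polys_in_def in_keys_iff)
qed

lemma mderiv_notin: "p \<in> polys_in V \<Longrightarrow> i \<notin> V \<Longrightarrow> mderiv i p = 0"
proof (rule poly_mapping_eqI)
  fix \<alpha> assume "p \<in> polys_in V" "i \<notin> V"
  then have "Poly_Mapping.lookup p (\<alpha> + evar i) = 0"
    using polys_in_lookup[of p V "\<alpha> + evar i"] by (auto simp: keys_plus_monom)
  then show "Poly_Mapping.lookup (mderiv i p) \<alpha> = Poly_Mapping.lookup 0 \<alpha>"
    by (simp add: lookup_mderiv)
qed

lemma iterate_ops_0 [simp]: "iterate_ops D 0 = id"
  by (simp add: iterate_ops_def)

lemma iterate_ops_superset: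
  assumes "finite A" "Poly_Mapping.keys \<beta> \<subseteq> A"
  shows "iterate_ops D \<beta> = foldr (\<lambda>i. D i ^^ Poly_Mapping.lookup \<beta> i) (sorted_list_of_set A)"
proof -
  have "sorted_list_of_set (Poly_Mapping.keys \<beta>) = filter (\<lambda>i. i \<in> Poly_Mapping.keys \<beta>) (sorted_list_of_set A)"
    using assms by (intro sorted_distinct_set_unique) (auto simp: sorted_wrt_filter)
  moreover have "foldr (\<lambda>i. D i ^^ Poly_Mapping.lookup \<beta> i) (filter (\<lambda>i. i \<in> Poly_Mapping.keys \<beta>) xs)
    = foldr (\<lambda>i. D i ^^ Poly_Mapping.lookup \<beta> i) xs" for xs
    by (induction xs) (auto simp: in_keys_iff fun_eq_iff)
  ultimately show ?thesis by (simp add: iterate_ops_def)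
qed

text \<open>
  Since the order of the factors in \<^const>\<open>iterate_ops\<close> is prescribed, its recursion on the
  exponent needs the operators to commute.
\<close>

lemma iterate_ops_add_evar:
  assumes comm: "\<And>i j x. D i (D j x) = D j (D i x)"
  shows "iterate_ops D (\<beta> + evar i) x = D i (iterate_ops D \<beta> x)"
proof -
  let ?A = "insert i (Poly_Mapping.keys \<beta>)"
  have powc: "(D j ^^ k) (D i x) = D i ((D j ^^ k) x)" for j k x
    by (induction k) (simp_all add: comm)
  have foldc: "foldr (\<lambda>j. D j ^^ Poly_Mapping.lookup \<beta> j) xs (D i x)
    = D i (foldr (\<lambda>j. D j ^^ Poly_Mapping.lookup \<beta> j) xs x)" for xs x
    by (induction xs) (simp_all add: powc)
  have "foldr (\<lambda>j. D j ^^ Poly_Mapping.lookup (\<beta> + evar i) j) xs x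
    = (if i \<in> set xs then D i else id) (foldr (\<lambda>j. D j ^^ Poly_Mapping.lookup \<beta> j) xs x)"
    if "distinct xs" for xs
    using that by (induction xs) (auto simp: lookup_add lookup_evar powc)
  note * = this[of "sorted_list_of_set ?A"]
  have "iterate_ops D (\<beta> + evar i) x = foldr (\<lambda>j. D j ^^ Poly_Mapping.lookup (\<beta> + evar i) j) (sorted_list_of_set ?A) x"
    by (subst iterate_ops_superset[of ?A]) (auto simp: keys_plus_monom)
  moreover have "iterate_ops D \<beta> x = foldr (\<lambda>j. D j ^^ Poly_Mapping.lookup \<beta> j) (sorted_list_of_set ?A) x"
    by (subst iterate_ops_superset[of ?A]) auto
  ultimately show ?thesis using * by (simp del: sorted_list_of_set_insert_remove)
qed

lemma mderivs_add_evar: "mderivs (\<beta> + evar i) p = mderiv i (mderivs \<beta> p)"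
  by (rule iterate_ops_add_evar) (rule mderiv_commute)

lemma polys_in_mderivs: "p \<in> polys_in V \<Longrightarrow> mderivs \<beta> p \<in> polys_in V"
  by (induction \<beta> rule: monom_induct) (simp_all add: mderivs_add_evar polys_in_mderiv)

lemma lookup_mderivs:
  "of_nat (mfact \<delta>) * Poly_Mapping.lookup (mderivs \<beta> p) \<delta> = of_nat (mfact (\<delta> + \<beta>)) * Poly_Mapping.lookup p (\<delta> + \<beta>)"
proof (induction \<beta> arbitrary: \<delta> rule: monom_induct)
  case (add \<beta> i)
  have "of_nat (mfact \<delta>) * Poly_Mapping.lookup (mderivs (\<beta> + evar i) p) \<delta>
    = of_nat (mfact (\<delta> + evar i)) * Poly_Mapping.lookup (mderivs \<beta> p) (\<delta> + evar i)"
    by (simp add: mderivs_add_evar lookup_mderiv mfact_add_evar algebra_simps)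
  also have "\<dots> = of_nat (mfact (\<delta> + (\<beta> + evar i))) * Poly_Mapping.lookup p (\<delta> + (\<beta> + evar i))"
    by (simp add: add add_ac)
  finally show ?case .
qed simp

(* Keeps the index sets {1..c} and the order 1 in the form in which they are stated. *)
declare One_nat_def [simp del]

section \<open>Ideals of subrings of a type\<close>

definition is_subring :: "'a::comm_ring_1 set \<Rightarrow> bool" where
  "is_subring A \<longleftrightarrow> 0 \<in> A \<and> 1 \<in> A \<and> (\<forall>a\<in>A. \<forall>b\<in>A. a + b \<in> A \<and> a * b \<in> A) \<and> (\<forall>a\<in>A. - a \<in> A)"

definition ideal_in :: "'a::comm_ring_1 set \<Rightarrow> 'a set \<Rightarrow> bool" where
  "ideal_in A I \<longleftrightarrow> I \<subseteq> A \<and> 0 \<in> I \<and> (\<forall>x\<in>I. \<forall>y\<in>I. x + y \<in> I) \<and> (\<forall>a\<in>A. \<forall>x\<in>I. a * x \<in> I)"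

lemma ideal_inD:
  assumes "ideal_in A I"
  shows "I \<subseteq> A" "0 \<in> I" "x \<in> I \<Longrightarrow> y \<in> I \<Longrightarrow> x + y \<in> I" "a \<in> A \<Longrightarrow> x \<in> I \<Longrightarrow> a * x \<in> I"
  using assms by (auto simp: ideal_in_def)

lemma is_subring_cring: "is_subring A \<Longrightarrow> cring (ring_on A)"
  by (rule cring_ring_on) (auto simp: is_subring_def)

lemma is_subring_polys_in: "is_subring (polys_in V)"
  by (auto simp: is_subring_def intro: polys_in_closed)

lemma ideal_in_uminus:
  assumes "is_subring A" "ideal_in A I" "x \<in> I"
  shows "- x \<in> I"
  using assms ideal_inD(4)[of A I "- 1" x] by (simp add: is_subring_def)

lemma ideal_in_diff:
  assumes "is_subring A" "ideal_in A I" "x \<in> I" "y \<in> I"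
  shows "x - y \<in> I"
  using assms ideal_in_uminus[of A I y] ideal_inD(3)[of A I x "- y"] by simp

lemma ring_on_simps [simp]:
  "carrier (ring_on A) = A" "x \<oplus>\<^bsub>ring_on A\<^esub> y = x + y" "x \<otimes>\<^bsub>ring_on A\<^esub> y = x * y"
  "\<zero>\<^bsub>ring_on A\<^esub> = 0" "\<one>\<^bsub>ring_on A\<^esub> = 1"
  by (simp_all add: ring_on_def)

lemma ideal_ring_on_iff:
  assumes "is_subring A"
  shows "ideal I (ring_on A) \<longleftrightarrow> ideal_in A I"
proof
  assume "ideal I (ring_on A)"
  then interpret ideal I "ring_on A" .
  show "ideal_in A I"
    unfolding ideal_in_def
    using a_subset additive_subgroup.zero_closed[OF is_additive_subgroup]
      additive_subgroup.a_closed[OF is_additive_subgroup] I_l_closed by auto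
next
  assume I: "ideal_in A I"
  interpret cring "ring_on A" using assms by (rule is_subring_cring)
  have inv: "\<ominus>\<^bsub>ring_on A\<^esub> x = - x" if "x \<in> A" for x
    using that assms by (intro sum_zero_eq_neg[symmetric]) (auto simp: is_subring_def)
  show "ideal I (ring_on A)"
  proof (rule idealI)
    show "subgroup I (add_monoid (ring_on A))"
    proof
      fix x assume "x \<in> I"
      then show "inv\<^bsub>add_monoid (ring_on A)\<^esub> x \<in> I"
        using inv[of x] ideal_in_uminus[OF assms I] ideal_inD(1)[OF I] by (auto simp: a_inv_def)
    qed (use I in \<open>auto simp: ideal_in_def\<close>)
  next
    fix a x assume "a \<in> I" "x \<in> carrier (ring_on A)"
    then have "x * a \<in> I" using ideal_inD(4)[OF I] by simp
    then show "x \<otimes>\<^bsub>ring_on A\<^esub> a \<in> I" "a \<otimes>\<^bsub>ring_on A\<^esub> x \<in> I"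
      by (simp_all add: mult.commute)
  qed (rule ring_axioms)
qed

lemma ring_on_pow:
  assumes "is_subring A" "x \<in> A"
  shows "x [^]\<^bsub>ring_on A\<^esub> (k::nat) = x ^ k"
proof -
  interpret cring "ring_on A" using assms(1) by (rule is_subring_cring)
  show ?thesis by (induction k) (simp_all add: mult.commute)
qed

inductive_set ideal_span :: "'a::comm_ring_1 set \<Rightarrow> 'a set \<Rightarrow> 'a set" for A X where
  zero: "0 \<in> ideal_span A X"
| mult: "a \<in> A \<Longrightarrow> x \<in> X \<Longrightarrow> a * x \<in> ideal_span A X"
| add: "x \<in> ideal_span A X \<Longrightarrow> y \<in> ideal_span A X \<Longrightarrow> x + y \<in> ideal_span A X"

lemma ideal_in_ideal_span:
  assumes "is_subring A" "X \<subseteq> A"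
  shows "ideal_in A (ideal_span A X)"
proof -
  have "x \<in> A" if "x \<in> ideal_span A X" for x
    using that by induction (use assms in \<open>auto simp: is_subring_def\<close>)
  moreover have "a * x \<in> ideal_span A X" if "x \<in> ideal_span A X" "a \<in> A" for a x
    using that
  proof induction
    case (mult b x)
    then show ?case
      using ideal_span.mult[of "a * b" A x X] assms by (auto simp: is_subring_def mult_ac)
  qed (auto simp: distrib_left intro: ideal_span.intros)
  ultimately show ?thesis by (auto simp: ideal_in_def intro: ideal_span.intros)
qed

lemma ideal_span_superset: "is_subring A \<Longrightarrow> X \<subseteq> ideal_span A X"
  using ideal_span.mult[of 1 A _ X] by (auto simp: is_subring_def)

lemma ideal_span_minimal:
  assumes "ideal_in A I" "X \<subseteq> I"
  shows "ideal_span A X \<subseteq> I"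
proof
  fix x assume "x \<in> ideal_span A X"
  then show "x \<in> I" by induction (use assms in \<open>auto dest: ideal_inD\<close>)
qed

lemma genideal_ring_on:
  assumes "is_subring A" "X \<subseteq> A"
  shows "Idl\<^bsub>ring_on A\<^esub> X = ideal_span A X"
proof
  interpret cring "ring_on A" using assms(1) by (rule is_subring_cring)
  have "ideal (ideal_span A X) (ring_on A)"
    using assms ideal_in_ideal_span by (simp add: ideal_ring_on_iff)
  then show "Idl\<^bsub>ring_on A\<^esub> X \<subseteq> ideal_span A X"
    by (rule genideal_minimal) (rule ideal_span_superset[OF assms(1)])
  have "ideal (Idl\<^bsub>ring_on A\<^esub> X) (ring_on A)" "X \<subseteq> Idl\<^bsub>ring_on A\<^esub> X"
    using genideal_ideal genideal_self assms(2) by simp_all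
  then show "ideal_span A X \<subseteq> Idl\<^bsub>ring_on A\<^esub> X"
    by (intro ideal_span_minimal) (simp_all add: ideal_ring_on_iff[OF assms(1)])
qed

lemma set_add_ring_on: "I <+>\<^bsub>ring_on A\<^esub> J = {x + y |x y. x \<in> I \<and> y \<in> J}"
  unfolding set_add_def'[of "ring_on A"] by auto

lemma primary_to_ring_on_iff:
  assumes "is_subring A"
  shows "primary_to (ring_on A) P I \<longleftrightarrow> ideal_in A I \<and> I \<noteq> A \<and>
    (\<forall>a\<in>A. \<forall>b\<in>A. a * b \<in> I \<longrightarrow> a \<in> I \<or> b \<in> P) \<and> P = {a \<in> A. \<exists>k. a ^ k \<in> I}"
proof -
  have "ideal_radical (ring_on A) I = {a \<in> A. \<exists>k. a ^ k \<in> I}"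
    by (auto simp: ideal_radical_def ring_on_pow[OF assms])
  then show ?thesis
    by (auto simp: primary_to_def primary_ideal_def ideal_ring_on_iff[OF assms])
qed

lemma carrier_poly_ring [simp]: "carrier (poly_ring n) = polys_in {1..n}"
  by (simp add: poly_ring_def)

section \<open>Polynomials of large order\<close>

definition order_ge :: "nat \<Rightarrow> nat \<Rightarrow> 'f::field mpoly set" where
  "order_ge c N = {p \<in> polys_in {1..c}. \<forall>\<alpha>. Poly_Mapping.lookup p \<alpha> \<noteq> 0 \<longrightarrow> N \<le> mdeg \<alpha>}"

lemma order_ge_subset: "order_ge c N \<subseteq> polys_in {1..c}"
  by (auto simp: order_ge_def)

lemma order_ge_0 [simp]: "order_ge c 0 = polys_in {1..c}"
  by (auto simp: order_ge_def)

lemma order_ge_antimono: "M \<le> N \<Longrightarrow> order_ge c N \<subseteq> order_ge c M"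
  by (fastforce simp: order_ge_def)

lemma order_ge_zero [simp]: "0 \<in> order_ge c N"
  by (simp add: order_ge_def)

lemma order_ge_add: "p \<in> order_ge c N \<Longrightarrow> q \<in> order_ge c N \<Longrightarrow> p + q \<in> order_ge c N"
  by (auto simp: order_ge_def lookup_add intro: polys_in_add) (metis add.right_neutral)

lemma order_ge_mult:
  assumes "p \<in> order_ge c M" "q \<in> order_ge c N"
  shows "p * q \<in> order_ge c (M + N)"
proof -
  have "M + N \<le> mdeg \<alpha>" if nz: "Poly_Mapping.lookup (p * q) \<alpha> \<noteq> 0" for \<alpha>
  proof -
    from nz obtain \<beta> \<delta> where "\<beta> + \<delta> = \<alpha>" "Poly_Mapping.lookup p \<beta> * Poly_Mapping.lookup q \<delta> \<noteq> 0"
      unfolding lookup_mpoly_mult by (auto elim!: sum.not_neutral_contains_not_neutral)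
    with assms show ?thesis by (force simp: order_ge_def)
  qed
  with assms show ?thesis by (auto simp: order_ge_def intro: polys_in_mult)
qed

lemma ideal_in_order_ge: "ideal_in (polys_in {1..c}) (order_ge c N)"
  using order_ge_mult[of _ c 0 _ N] subsetD[OF order_ge_subset] by (auto simp: ideal_in_def intro: order_ge_add)

lemma order_ge_diff: "p \<in> order_ge c N \<Longrightarrow> q \<in> order_ge c N \<Longrightarrow> p - q \<in> order_ge c N"
  by (rule ideal_in_diff[OF is_subring_polys_in ideal_in_order_ge])

lemma order_ge_uminus: "p \<in> order_ge c N \<Longrightarrow> - p \<in> order_ge c N"
  by (rule ideal_in_uminus[OF is_subring_polys_in ideal_in_order_ge])

lemma order_ge_1_iff: "p \<in> order_ge c 1 \<longleftrightarrow> p \<in> polys_in {1..c} \<and> Poly_Mapping.lookup p 0 = 0"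
proof -
  have "1 \<le> mdeg \<alpha> \<longleftrightarrow> \<alpha> \<noteq> 0" for \<alpha>
    using mdeg_eq_0_iff[of \<alpha>] by linarith
  then show ?thesis by (auto simp: order_ge_def)
qed

lemma order_ge_power: "p \<in> order_ge c 1 \<Longrightarrow> p ^ k \<in> order_ge c k"
proof (induction k)
  case (Suc k)
  then show ?case using order_ge_mult[of p c 1 "p ^ k" k] by (simp add: One_nat_def)
qed simp

lemma order_ge_single: "Poly_Mapping.keys \<alpha> \<subseteq> {1..c} \<Longrightarrow> N \<le> mdeg \<alpha> \<Longrightarrow> Poly_Mapping.single \<alpha> a \<in> order_ge c N"
  by (auto simp: order_ge_def lookup_single when_def polys_in_single split: if_splits)

lemma order_ge_var: "i \<in> {1..c} \<Longrightarrow> mvar i \<in> order_ge c 1"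
  unfolding mvar_def by (rule order_ge_single) auto

lemma order_ge_mderiv: "p \<in> order_ge c (Suc N) \<Longrightarrow> mderiv i p \<in> order_ge c N"
  by (fastforce simp: order_ge_def lookup_mderiv intro: polys_in_mderiv)

lemma order_ge_Suc_induct [consumes 1, case_names zero add var]:
  assumes p: "p \<in> order_ge c (Suc N)" and "Q 0"
    and add: "\<And>p q. Q p \<Longrightarrow> Q q \<Longrightarrow> Q (p + q)"
    and var: "\<And>i q. i \<in> {1..c} \<Longrightarrow> q \<in> order_ge c N \<Longrightarrow> Q (mvar i * q)"
  shows "Q p"
proof (induction p rule: poly_mapping_single_induct)
  case (single \<alpha> a)
  show ?case
  proof (cases "a = 0")
    case False
    with single p have \<alpha>: "Suc N \<le> mdeg \<alpha>" "Poly_Mapping.keys \<alpha> \<subseteq> {1..c}"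
      by (auto simp: order_ge_def in_keys_iff dest: polys_in_lookup)
    then have "\<alpha> \<noteq> 0" by auto
    then obtain \<beta> i where \<beta>: "\<alpha> = \<beta> + evar i" "i \<in> Poly_Mapping.keys \<alpha>" by (rule monom_split_evar)
    with \<alpha> have "Q (mvar i * Poly_Mapping.single \<beta> a)"
      by (intro var order_ge_single) (auto simp: keys_plus_monom)
    then show ?thesis by (simp add: \<beta>(1) mvar_times_single)
  qed (simp add: \<open>Q 0\<close>)
qed (rule add)

lemma origin_ideal_eq: "origin_ideal c = order_ge c 1"
proof -
  have vars: "mvar ` {1..c} \<subseteq> (polys_in {1..c} :: 'a mpoly set)" by (auto intro: polys_in_var)
  have "origin_ideal c = ideal_span (polys_in {1..c}) (mvar ` {1..c} :: 'a mpoly set)"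
    unfolding origin_ideal_def poly_ring_def by (rule genideal_ring_on[OF is_subring_polys_in vars])
  also have "\<dots> = order_ge c 1"
  proof
    show "ideal_span (polys_in {1..c}) (mvar ` {1..c}) \<subseteq> order_ge c 1"
      by (rule ideal_span_minimal[OF ideal_in_order_ge]) (auto intro: order_ge_var)
    have "p \<in> ideal_span (polys_in {1..c}) (mvar ` {1..c})" if "p \<in> order_ge c (Suc 0)" for p :: "'a mpoly"
      using that
    proof (induction p rule: order_ge_Suc_induct)
      case (var i q)
      then show ?case using ideal_span.mult[of q "polys_in {1..c}" "mvar i" "mvar ` {1..c}"]
        by (auto simp: mult.commute)
    qed (auto intro: ideal_span.intros)
    then show "order_ge c 1 \<subseteq> ideal_span (polys_in {1..c}) (mvar ` {1..c} :: 'a mpoly set)"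
      by (auto simp: One_nat_def)
  qed
  finally show ?thesis .
qed

lemma origin_ideal_power: "origin_ideal c [^]\<^bsub>ideals_set (poly_ring c)\<^esub> (m::nat) = order_ge c m"
proof (induction m)
  case 0
  show ?case by (simp add: ideals_set_def)
next
  case (Suc m)
  have "origin_ideal c [^]\<^bsub>ideals_set (poly_ring c)\<^esub> Suc m
    = ideal_prod (poly_ring c) (order_ge c m) (order_ge c 1 :: 'a mpoly set)"
    using Suc by (simp add: ideals_set_def origin_ideal_eq nat_pow_def)
  also have "\<dots> = order_ge c (Suc m)"
  proof
    show "ideal_prod (poly_ring c) (order_ge c m) (order_ge c 1) \<subseteq> (order_ge c (Suc m) :: 'a mpoly set)"
    proof
      fix x :: "'a mpoly" assume "x \<in> ideal_prod (poly_ring c) (order_ge c m) (order_ge c 1)"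
      then show "x \<in> order_ge c (Suc m)"
      proof induction
        case (prod i j)
        then show ?case using order_ge_mult[of i c m j 1] by (simp add: poly_ring_def One_nat_def)
      qed (simp add: poly_ring_def order_ge_add)
    qed
    have "p \<in> ideal_prod (poly_ring c) (order_ge c m) (order_ge c 1)"
      if "p \<in> order_ge c (Suc m)" for p :: "'a mpoly"
      using that
    proof (induction p rule: order_ge_Suc_induct)
      case zero
      show ?case using ideal_prod.prod[of 0 "order_ge c m" 0 "order_ge c 1" "poly_ring c"]
        by (simp add: poly_ring_def)
    next
      case (add p q)
      then show ?case using ideal_prod.sum[of p "poly_ring c"] by (simp add: poly_ring_def)
    next
      case (var i q)
      then show ?case using ideal_prod.prod[of q "order_ge c m" "mvar i" "order_ge c 1" "poly_ring c"]
        by (simp add: poly_ring_def order_ge_var mult.commute)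
    qed
    then show "order_ge c (Suc m) \<subseteq> ideal_prod (poly_ring c) (order_ge c m) (order_ge c 1 :: 'a mpoly set)"
      by auto
  qed
  finally show ?case .
qed

text \<open>
  Modulo an ideal containing all polynomials of order at least \<open>N\<close>, the powers of
  \<open>t = a - u\<close> vanish eventually, so \<open>u = a - t\<close> with \<open>a \<noteq> 0\<close> constant is inverted by a finite
  geometric sum.
\<close>

lemma unit_mod_order_ge:
  fixes s u :: "'f::field mpoly"
  assumes I: "ideal_in (polys_in {1..c}) I" "order_ge c N \<subseteq> I"
    and u: "u \<in> polys_in {1..c}" "Poly_Mapping.lookup u 0 \<noteq> 0"
    and s: "s \<in> polys_in {1..c}" "u * s \<in> I"
  shows "s \<in> I"
proof -
  define a where "a = Poly_Mapping.lookup u 0"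
  define t where "t = mconst a - u"
  have t: "t \<in> order_ge c 1"
    unfolding order_ge_1_iff t_def a_def
    using u(1) by (auto intro!: polys_in_diff polys_in_const) (simp add: lookup_minus mconst_def)
  define w where "w = (\<Sum>i<N. t ^ (N - Suc i) * mconst a ^ i)"
  have w: "w \<in> polys_in {1..c}"
    using t order_ge_subset unfolding w_def by (blast intro: polys_in_closed polys_in_const)
  have "mconst a ^ N - t ^ N = (mconst a - t) * w"
    unfolding w_def by (rule power_diff_sumr2)
  then have "mconst a ^ N * s = w * (u * s) + s * t ^ N"
    by (simp add: t_def algebra_simps)
  also have "\<dots> \<in> I"
    using ideal_inD(4)[OF I(1) w s(2)] ideal_inD(4)[OF I(1) s(1), of "t ^ N"] order_ge_power[OF t, of N] I(2)
    by (auto intro: ideal_inD(3)[OF I(1)])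
  finally have "mconst (inverse a ^ N) * (mconst a ^ N * s) \<in> I"
    by (intro ideal_inD(4)[OF I(1) polys_in_const])
  moreover have "mconst (inverse a ^ N) * mconst a ^ N = 1"
  proof -
    have "mconst a ^ k = mconst (a ^ k)" for k by (induction k) (simp_all add: mconst_mult)
    then show ?thesis using u(2) by (simp add: a_def power_inverse flip: mconst_mult)
  qed
  ultimately show ?thesis by (simp flip: mult.assoc)
qed

text \<open>A pigeonhole principle: it turns powers of the single variables into all monomials of large degree.\<close>

lemma large_monom_exponent:
  assumes "Poly_Mapping.keys \<alpha> \<subseteq> {1..c}" "c * K < mdeg \<alpha>"
  shows "\<exists>i\<in>{1..c}. K \<le> Poly_Mapping.lookup \<alpha> i"
proof (rule ccontr)
  assume *: "\<not> ?thesis"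
  have "mdeg \<alpha> = sum (Poly_Mapping.lookup \<alpha>) {1..c}"
    by (rule mdeg_superset) (simp_all add: assms(1))
  also have "\<dots> \<le> (\<Sum>i\<in>{1..c}. K)"
  proof (rule sum_mono)
    fix i assume "i \<in> {1..c}"
    with * show "Poly_Mapping.lookup \<alpha> i \<le> K" by (meson linear)
  qed
  finally show False using assms(2) by simp
qed

lemma primary_to_origin_iff:
  "primary_to (poly_ring c) (origin_ideal c) I \<longleftrightarrow>
    ideal_in (polys_in {1..c}) I \<and> I \<subseteq> order_ge c 1 \<and> (\<exists>N. order_ge c N \<subseteq> (I :: 'f::field mpoly set))"
    (is "?L \<longleftrightarrow> ?R")
proof
  let ?S = "polys_in {1..c} :: 'f mpoly set"
  assume ?L
  then have I: "ideal_in ?S I" "I \<noteq> ?S"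
    "\<And>a b. a \<in> ?S \<Longrightarrow> b \<in> ?S \<Longrightarrow> a * b \<in> I \<Longrightarrow> a \<in> I \<or> b \<in> order_ge c 1"
    "order_ge c 1 = {a \<in> ?S. \<exists>k. a ^ k \<in> I}"
    unfolding poly_ring_def primary_to_ring_on_iff[OF is_subring_polys_in] origin_ideal_eq by blast+
  have "I \<subseteq> order_ge c 1"
  proof
    fix x assume "x \<in> I"
    then have "x \<in> ?S" "x ^ 1 \<in> I" using ideal_inD(1)[OF I(1)] by auto
    then show "x \<in> order_ge c 1" unfolding I(4) by blast
  qed
  moreover have "\<exists>k. mvar i ^ k \<in> I" if "i \<in> {1..c}" for i
  proof -
    have "mvar i \<in> (order_ge c 1 :: 'f mpoly set)" using that by (rule order_ge_var)
    then show ?thesis unfolding I(4) by blast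
  qed
  then obtain k where k: "\<And>i. i \<in> {1..c} \<Longrightarrow> mvar i ^ k i \<in> I" by metis
  \<comment> \<open>with \<open>0\<close> inserted, the maximum exists also for \<open>c = 0\<close>\<close>
  define K where "K = Max (insert 0 (k ` {1..c}))"
  have "order_ge c (Suc (c * K)) \<subseteq> I"
  proof
    fix p :: "'f mpoly" assume p: "p \<in> order_ge c (Suc (c * K))"
    show "p \<in> I"
    proof (induction p rule: poly_mapping_single_induct)
      case (single \<alpha> a)
      show ?case
      proof (cases "a = 0")
        case True
        then show ?thesis using ideal_inD(2)[OF I(1)] by simp
      next
        case False
        with single p have \<alpha>: "c * K < mdeg \<alpha>" "Poly_Mapping.keys \<alpha> \<subseteq> {1..c}"
          by (auto simp: order_ge_def in_keys_iff Suc_le_eq dest: polys_in_lookup)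
        then obtain i where i: "i \<in> {1..c}" "K \<le> Poly_Mapping.lookup \<alpha> i"
          using large_monom_exponent by blast
        then have ki: "k i \<le> Poly_Mapping.lookup \<alpha> i"
          using Max_ge[of "insert 0 (k ` {1..c})" "k i"] by (auto simp: K_def)
        have split: "Poly_Mapping.single i (k i) + (\<alpha> - Poly_Mapping.single i (k i)) = \<alpha>"
          using ki by (auto simp: monom_eq_iff lookup_add lookup_minus lookup_single when_def)
        have "mvar i ^ j = Poly_Mapping.single (Poly_Mapping.single i j) (1::'f)" for j
          by (induction j) (simp_all add: mvar_def mult_single One_nat_def flip: single_add)
        then have "Poly_Mapping.single \<alpha> a = Poly_Mapping.single (\<alpha> - Poly_Mapping.single i (k i)) a * mvar i ^ k i"
          using split by (simp add: mult_single add.commute)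
        also have "\<dots> \<in> I"
        proof (rule ideal_inD(4)[OF I(1) _ k[OF i(1)]])
          have "Poly_Mapping.keys (\<alpha> - Poly_Mapping.single i (k i)) \<subseteq> Poly_Mapping.keys \<alpha>"
            by (subst (2) split[symmetric]) (auto simp: keys_plus_monom)
          with \<alpha> show "Poly_Mapping.single (\<alpha> - Poly_Mapping.single i (k i)) a \<in> ?S"
            by (intro polys_in_single) auto
        qed
        finally show ?thesis .
      qed
    qed (rule ideal_inD(3)[OF I(1)])
  qed
  ultimately show ?R using I(1) by blast
next
  let ?S = "polys_in {1..c} :: 'f mpoly set"
  assume ?R
  then obtain N where I: "ideal_in ?S I" "I \<subseteq> order_ge c 1" and N: "order_ge c N \<subseteq> I" by blast
  have power_in: "b ^ N \<in> I" if "b \<in> order_ge c 1" for b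
    using order_ge_power[OF that, of N] N by auto
  show ?L
    unfolding poly_ring_def primary_to_ring_on_iff[OF is_subring_polys_in] origin_ideal_eq
  proof (intro conjI ballI impI)
    have "1 \<notin> order_ge c 1" by (auto simp: order_ge_1_iff)
    then show "I \<noteq> ?S" using I(2) polys_in_1 by blast
    fix a b assume ab: "a \<in> ?S" "b \<in> ?S" "a * b \<in> I"
    show "a \<in> I \<or> b \<in> order_ge c 1"
    proof (cases "Poly_Mapping.lookup b 0 = 0")
      case False
      then show ?thesis using unit_mod_order_ge[OF I(1) N, of b a] ab by (simp add: mult.commute)
    qed (use ab in \<open>simp add: order_ge_1_iff\<close>)
  next
    show "order_ge c 1 = {a \<in> ?S. \<exists>k. a ^ k \<in> I}"
    proof (intro equalityI subsetI)
    fix x :: "'f mpoly" assume "x \<in> order_ge c 1"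
    then show "x \<in> {a \<in> ?S. \<exists>k. a ^ k \<in> I}" using power_in order_ge_subset by blast
  next
    fix x :: "'f mpoly" assume "x \<in> {a \<in> ?S. \<exists>k. a ^ k \<in> I}"
    then obtain k where "x \<in> ?S" "x ^ k \<in> I" by blast
    moreover have "Poly_Mapping.lookup (x ^ j) 0 = Poly_Mapping.lookup x 0 ^ j" for j
      by (induction j) (simp_all add: lookup_mult_zero)
    ultimately show "x \<in> order_ge c 1" using I(2) by (auto simp: order_ge_1_iff subset_iff)
    qed
  qed (use I in auto)
qed

section \<open>Chains of sets\<close>

text \<open>
  Length is defined by strict chains of ideals.  Keeping the family of sets arbitrary lets chains
  be moved between the ideals of a quotient of a localization, the saturated ideals of a polynomial
  ring and the ideals of another one.
\<close>

definition has_chain :: "'a set set \<Rightarrow> nat \<Rightarrow> bool" where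
  "has_chain \<J> k \<longleftrightarrow> (\<exists>J. (\<forall>i\<le>k. J i \<in> \<J>) \<and> (\<forall>i<k. J i \<subset> J (Suc i)))"

lemma has_chain_mono_map:
  assumes "has_chain \<J> k" "\<And>J. J \<in> \<J> \<Longrightarrow> f J \<in> \<J>'"
    and "\<And>J J'. J \<in> \<J> \<Longrightarrow> J' \<in> \<J> \<Longrightarrow> J \<subset> J' \<Longrightarrow> f J \<subset> f J'"
  shows "has_chain \<J>' k"
proof -
  from assms(1) obtain J where J: "\<forall>i\<le>k. J i \<in> \<J>" "\<forall>i<k. J i \<subset> J (Suc i)"
    by (auto simp: has_chain_def)
  then show ?thesis
    unfolding has_chain_def
    by (intro exI[of _ "\<lambda>i. f (J i)"]) (use assms(2,3) in \<open>simp add: Suc_le_eq\<close>)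
qed

definition chain_length :: "'a set set \<Rightarrow> enat" where
  "chain_length \<J> = Sup {enat k |k. has_chain \<J> k}"

lemma chain_length_cong:
  "(\<And>k. has_chain \<J> k \<longleftrightarrow> has_chain \<J>' k) \<Longrightarrow> chain_length \<J> = chain_length \<J>'"
  by (simp add: chain_length_def)

lemma chain_length_eqI:
  assumes "has_chain \<J> m" "\<And>k. has_chain \<J> k \<Longrightarrow> k \<le> m"
  shows "chain_length \<J> = enat m"
  unfolding chain_length_def
  by (rule antisym) (auto intro!: Sup_least Sup_upper assms)

lemma chain_length_eqD:
  assumes "chain_length \<J> = enat m" "\<J> \<noteq> {}"
  shows "has_chain \<J> m" "has_chain \<J> k \<Longrightarrow> k \<le> m"
proof -
  let ?X = "{enat k |k. has_chain \<J> k}"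
  show le: "k \<le> m" if "has_chain \<J> k" for k
    using Sup_upper[of "enat k" ?X] that assms(1) by (auto simp: chain_length_def)
  have "has_chain \<J> 0" using assms(2) by (auto simp: has_chain_def)
  then have ne: "?X \<noteq> {}" by blast
  have "finite ?X"
    by (rule finite_subset[of _ "enat ` {..m}"]) (use le in auto)
  then have "Max ?X \<in> ?X"
    using ne by (rule Max_in)
  then have "Sup ?X \<in> ?X"
    using ne \<open>finite ?X\<close> unfolding Sup_enat_def by (simp only: if_True if_False)
  then show "has_chain \<J> m" using assms(1) by (auto simp: chain_length_def)
qed

lemma ring_length_eq: "ring_length S = chain_length {J. ideal J S}"
  by (simp add: ring_length_def chain_length_def has_chain_def)

section \<open>Colength as the length of a flag of coefficient vectors\<close>

definition sspace :: "'f::field mseries set \<Rightarrow> bool" where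
  "sspace I \<longleftrightarrow> (\<lambda>_. 0) \<in> I \<and> (\<forall>f\<in>I. \<forall>g\<in>I. (\<lambda>\<alpha>. f \<alpha> + g \<alpha>) \<in> I) \<and> (\<forall>a. \<forall>f\<in>I. (\<lambda>\<alpha>. a * f \<alpha>) \<in> I)"

lemma sspaceD:
  assumes "sspace I"
  shows "(\<lambda>_. 0) \<in> I" "f \<in> I \<Longrightarrow> g \<in> I \<Longrightarrow> (\<lambda>\<alpha>. f \<alpha> + g \<alpha>) \<in> I" "f \<in> I \<Longrightarrow> (\<lambda>\<alpha>. a * f \<alpha>) \<in> I"
  using assms by (auto simp: sspace_def)

lemma sspace_diff: "sspace I \<Longrightarrow> f \<in> I \<Longrightarrow> g \<in> I \<Longrightarrow> (\<lambda>\<alpha>. f \<alpha> - g \<alpha>) \<in> I"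
  using sspaceD(2)[of I f "\<lambda>\<alpha>. - 1 * g \<alpha>"] sspaceD(3)[of I g "- 1"] by simp

definition add_line :: "'f::field mseries \<Rightarrow> 'f mseries set \<Rightarrow> 'f mseries set" where
  "add_line v E = {\<lambda>\<alpha>. e \<alpha> + a * v \<alpha> |e a. e \<in> E}"

lemma add_lineI: "e \<in> E \<Longrightarrow> f = (\<lambda>\<alpha>. e \<alpha> + a * v \<alpha>) \<Longrightarrow> f \<in> add_line v E"
  by (auto simp: add_line_def)

lemma add_line_superset: "E \<subseteq> add_line v E"
  by (auto intro!: add_lineI[where a = 0])

lemma add_line_self: "sspace E \<Longrightarrow> v \<in> add_line v E"
  by (rule add_lineI[where a = 1 and e = "\<lambda>_. 0"]) (auto dest: sspaceD)

lemma sspace_add_line: 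
  assumes "sspace E"
  shows "sspace (add_line v E)"
  unfolding sspace_def
proof (intro conjI ballI allI)
  show "(\<lambda>_. 0) \<in> add_line v E"
    using add_line_superset sspaceD(1)[OF assms] by blast
  fix f a assume "f \<in> add_line v E"
  then obtain e b where e: "e \<in> E" "f = (\<lambda>\<alpha>. e \<alpha> + b * v \<alpha>)" by (auto simp: add_line_def)
  show "(\<lambda>\<alpha>. a * f \<alpha>) \<in> add_line v E"
    by (rule add_lineI[OF sspaceD(3)[OF assms e(1), of a], of _ "a * b"]) (simp add: e algebra_simps)
  fix g assume "g \<in> add_line v E"
  then obtain e' b' where e': "e' \<in> E" "g = (\<lambda>\<alpha>. e' \<alpha> + b' * v \<alpha>)" by (auto simp: add_line_def)
  show "(\<lambda>\<alpha>. f \<alpha> + g \<alpha>) \<in> add_line v E"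
    by (rule add_lineI[OF sspaceD(2)[OF assms e(1) e'(1)], of _ "b + b'"]) (simp add: e e' algebra_simps)
qed

text \<open>
  The definition of colength in a quotient ring builds up the quotient one dimension at a time.
  Read upstairs and in coefficients, it is a flag from the ideal to the whole ring that adds one
  vector per step.  Both rings are mapped into the same type of coefficient functions.
\<close>

inductive flag :: "'f::field mseries set \<Rightarrow> nat \<Rightarrow> 'f mseries set \<Rightarrow> bool" for I where
  zero: "flag I 0 I"
| Suc: "flag I k E \<Longrightarrow> v \<notin> E \<Longrightarrow> flag I (Suc k) (add_line v E)"

lemma flag_sspace:
  assumes "flag I k E" "sspace I"
  shows "sspace E" "I \<subseteq> E"
proof -
  have "sspace E \<and> I \<subseteq> E"
    using assms
  proof (induction)
    case (Suc k E v)
    then show ?case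
      using add_line_superset[of E v] sspace_add_line[of E v] by blast
  qed auto
  then show "sspace E" "I \<subseteq> E" by simp_all
qed

text \<open>
  Subspaces of the quotient correspond to subspaces above \<open>I\<close> by taking preimages, and adding a line
  commutes with this correspondence.
\<close>

lemma has_colength_iff_flag:
  fixes \<iota> :: "'f::field \<Rightarrow> 'a" and \<tau> :: "'a \<Rightarrow> 'f mseries"
  assumes S: "cring S" and I: "ideal I S"
    and inj: "inj_on \<tau> (carrier S)"
    and add: "\<And>x y. x \<in> carrier S \<Longrightarrow> y \<in> carrier S \<Longrightarrow> \<tau> (x \<oplus>\<^bsub>S\<^esub> y) = (\<lambda>\<alpha>. \<tau> x \<alpha> + \<tau> y \<alpha>)"
    and const: "\<And>a. \<iota> a \<in> carrier S"
    and scale: "\<And>a x. x \<in> carrier S \<Longrightarrow> \<tau> (\<iota> a \<otimes>\<^bsub>S\<^esub> x) = (\<lambda>\<alpha>. a * \<tau> x \<alpha>)"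
  shows "has_colength S \<iota> I m \<longleftrightarrow> flag (\<tau> ` I) m (\<tau> ` carrier S)"
proof -
  interpret S: cring S by fact
  interpret I: ideal I S by fact
  let ?Q = "S Quot I"
  interpret Q: ring ?Q by (rule I.quotient_is_ring)
  let ?c = "(+>\<^bsub>S\<^esub>) I"
  let ?K = "range (\<lambda>a. I +>\<^bsub>S\<^esub> \<iota> a)"
  let ?pre = "\<lambda>E. {x \<in> carrier S. ?c x \<in> E}"
  have carrier_Q: "carrier ?Q = ?c ` carrier S"
    by (auto simp: FactRing_def A_RCOSETS_def')
  note hom = I.rcos_ring_hom
  have c_eq: "?c x = ?c y \<longleftrightarrow> x \<ominus>\<^bsub>S\<^esub> y \<in> I" if "x \<in> carrier S" "y \<in> carrier S" for x y
    using S.quotient_eq_iff_same_a_r_cos[OF I that] by simp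
  have combine: "\<iota> a \<otimes>\<^bsub>S\<^esub> v \<oplus>\<^bsub>S\<^esub> z \<in> carrier S" if "v \<in> carrier S" "z \<in> carrier S" for a v z
    using that const by simp
  have c_combine: "?c (\<iota> a \<otimes>\<^bsub>S\<^esub> v \<oplus>\<^bsub>S\<^esub> z) = ?c (\<iota> a) \<otimes>\<^bsub>?Q\<^esub> ?c v \<oplus>\<^bsub>?Q\<^esub> ?c z"
    if "v \<in> carrier S" "z \<in> carrier S" for a v z
    using that const by (simp add: ring_hom_add[OF hom] ring_hom_mult[OF hom])
  have \<tau>_combine: "\<tau> (\<iota> a \<otimes>\<^bsub>S\<^esub> v \<oplus>\<^bsub>S\<^esub> z) = (\<lambda>\<alpha>. \<tau> z \<alpha> + a * \<tau> v \<alpha>)"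
    if "v \<in> carrier S" "z \<in> carrier S" for a v z
    using that const by (simp add: add scale algebra_simps)
  have I_sub: "I \<subseteq> carrier S" by (rule I.a_subset)
  have \<tau>_mem: "\<tau> x \<in> \<tau> ` A \<longleftrightarrow> x \<in> A" if "x \<in> carrier S" "A \<subseteq> carrier S" for x A
    using that inj by (meson inj_on_image_mem_iff)
  have line: "\<tau> ` ?pre (Q.line_extension ?K (?c v) E) = add_line (\<tau> v) (\<tau> ` ?pre E)"
    if v: "v \<in> carrier S" and E: "E \<subseteq> carrier ?Q" for v E
  proof (intro equalityI subsetI)
    fix f assume "f \<in> \<tau> ` ?pre (Q.line_extension ?K (?c v) E)"
    then obtain x a e where x: "x \<in> carrier S" "f = \<tau> x" "e \<in> E"
      "?c x = ?c (\<iota> a) \<otimes>\<^bsub>?Q\<^esub> ?c v \<oplus>\<^bsub>?Q\<^esub> e"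
      by (auto simp: Q.line_extension_mem_iff)
    obtain y where y: "y \<in> carrier S" "e = ?c y" using x(3) E carrier_Q by blast
    define z where "z = x \<ominus>\<^bsub>S\<^esub> \<iota> a \<otimes>\<^bsub>S\<^esub> v"
    have z: "z \<in> carrier S" unfolding z_def using x v const by simp
    have "x \<ominus>\<^bsub>S\<^esub> (\<iota> a \<otimes>\<^bsub>S\<^esub> v \<oplus>\<^bsub>S\<^esub> y) \<in> I"
      using x(4) c_combine[OF v y(1), of a] c_eq[OF x(1) combine[OF v y(1), of a]] y(2) by simp
    also have "x \<ominus>\<^bsub>S\<^esub> (\<iota> a \<otimes>\<^bsub>S\<^esub> v \<oplus>\<^bsub>S\<^esub> y) = z \<ominus>\<^bsub>S\<^esub> y"
    proof -
      have "\<iota> a \<otimes>\<^bsub>S\<^esub> v \<in> carrier S" using v const by simp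
      then show ?thesis unfolding z_def using x(1) y(1) by algebra
    qed
    finally have "?c z = e" using c_eq[OF z y(1)] y(2) by simp
    moreover have "x = \<iota> a \<otimes>\<^bsub>S\<^esub> v \<oplus>\<^bsub>S\<^esub> z"
    proof -
      have "\<iota> a \<otimes>\<^bsub>S\<^esub> v \<in> carrier S" using v const by simp
      then show ?thesis unfolding z_def using x(1) by algebra
    qed
    ultimately show "f \<in> add_line (\<tau> v) (\<tau> ` ?pre E)"
      using x(2,3) z \<tau>_combine[OF v z] by (intro add_lineI[of "\<tau> z" _ _ a]) auto
  next
    fix f assume "f \<in> add_line (\<tau> v) (\<tau> ` ?pre E)"
    then obtain z a where z: "z \<in> carrier S" "?c z \<in> E" "f = (\<lambda>\<alpha>. \<tau> z \<alpha> + a * \<tau> v \<alpha>)"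
      by (auto simp: add_line_def)
    have "?c (\<iota> a \<otimes>\<^bsub>S\<^esub> v \<oplus>\<^bsub>S\<^esub> z) \<in> Q.line_extension ?K (?c v) E"
      unfolding c_combine[OF v z(1)] Q.line_extension_mem_iff using z(2) by blast
    then show "f \<in> \<tau> ` ?pre (Q.line_extension ?K (?c v) E)"
      using z(3) \<tau>_combine[OF v z(1), of a] combine[OF v z(1), of a] by (auto intro!: image_eqI)
  qed
  have zero: "?pre {\<zero>\<^bsub>?Q\<^esub>} = I"
  proof -
    have "?c x = I \<longleftrightarrow> x \<in> I" if "x \<in> carrier S" for x
    proof -
      have "?c \<zero>\<^bsub>S\<^esub> = I" using I_sub by (simp add: S.a_coset_add_zero)
      then show ?thesis using c_eq[OF that S.zero_closed] that by (simp add: S.minus_eq)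
    qed
    then show ?thesis using I_sub by (auto simp: FactRing_def)
  qed
  note zero_pre = zero
  have line_sub: "Q.line_extension ?K (?c v) E \<subseteq> carrier ?Q"
    if v: "v \<in> carrier S" and E: "E \<subseteq> carrier ?Q" for v E
  proof
    fix u assume "u \<in> Q.line_extension ?K (?c v) E"
    then obtain a e where u: "e \<in> E" "u = ?c (\<iota> a) \<otimes>\<^bsub>?Q\<^esub> ?c v \<oplus>\<^bsub>?Q\<^esub> e"
      by (auto simp: Q.line_extension_mem_iff)
    moreover have "?c (\<iota> a) \<in> carrier ?Q" "?c v \<in> carrier ?Q" "e \<in> carrier ?Q"
      using v const E u(1) carrier_Q by auto
    ultimately show "u \<in> carrier ?Q" by simp
  qed
  have to_flag: "E \<subseteq> carrier ?Q \<and> flag (\<tau> ` I) k (\<tau> ` ?pre E)" if "Q.dimension k K E" "K = ?K" for k K E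
    using that
  proof (induction)
    case (zero_dim K)
    show ?case
      unfolding zero using flag.zero[of "\<tau> ` I"] Q.zero_closed by simp
  next
    case (Suc_dim w E k K)
    then obtain v where v: "v \<in> carrier S" "w = ?c v" using carrier_Q by blast
    have "\<tau> v \<notin> \<tau> ` ?pre E"
      using Suc_dim(2) v \<tau>_mem[OF v(1), of "?pre E"] by simp
    moreover have "Q.line_extension K w E \<subseteq> carrier ?Q"
      using line_sub[OF v(1), of E] Suc_dim v(2) by simp
    ultimately show ?case
      using Suc_dim line[OF v(1), of E] v by (auto intro: flag.intros)
  qed
  have sI: "sspace (\<tau> ` I)"
    unfolding sspace_def
  proof (intro conjI ballI allI)
    have "\<tau> \<zero>\<^bsub>S\<^esub> = (\<lambda>\<alpha>. \<tau> \<zero>\<^bsub>S\<^esub> \<alpha> + \<tau> \<zero>\<^bsub>S\<^esub> \<alpha>)"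
      using add[of "\<zero>\<^bsub>S\<^esub>" "\<zero>\<^bsub>S\<^esub>"] by simp
    then have "\<tau> \<zero>\<^bsub>S\<^esub> \<alpha> = \<tau> \<zero>\<^bsub>S\<^esub> \<alpha> + \<tau> \<zero>\<^bsub>S\<^esub> \<alpha>" for \<alpha>
      by (rule fun_cong)
    then have "\<tau> \<zero>\<^bsub>S\<^esub> \<alpha> = 0" for \<alpha>
      by (rule add_cancel_right_right[THEN iffD1])
    then have "\<tau> \<zero>\<^bsub>S\<^esub> = (\<lambda>_. 0)" by (rule ext)
    then show "(\<lambda>_. 0) \<in> \<tau> ` I"
      using additive_subgroup.zero_closed[OF I.is_additive_subgroup] by (intro image_eqI[of _ _ "\<zero>\<^bsub>S\<^esub>"]) simp_all
    fix f a assume "f \<in> \<tau> ` I"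
    then obtain x where x: "x \<in> I" "f = \<tau> x" by blast
    have xS: "x \<in> carrier S" using x(1) I_sub by blast
    show "(\<lambda>\<alpha>. a * f \<alpha>) \<in> \<tau> ` I"
      unfolding x(2) scale[OF xS, symmetric] by (rule imageI) (rule I.I_l_closed[OF x(1) const])
    fix g assume "g \<in> \<tau> ` I"
    then obtain y where y: "y \<in> I" "g = \<tau> y" by blast
    have yS: "y \<in> carrier S" using y(1) I_sub by blast
    show "(\<lambda>\<alpha>. f \<alpha> + g \<alpha>) \<in> \<tau> ` I"
      unfolding x(2) y(2) add[OF xS yS, symmetric]
      by (rule imageI) (rule additive_subgroup.a_closed[OF I.is_additive_subgroup x(1) y(1)])
  qed
  have from_flag: "Q.dimension k ?K (?c ` {x \<in> carrier S. \<tau> x \<in> F})"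
    if "flag (\<tau> ` I) k F" "F \<subseteq> \<tau> ` carrier S" for k F
  proof -
    have "F \<subseteq> \<tau> ` carrier S \<Longrightarrow> Q.dimension k ?K (?c ` {x \<in> carrier S. \<tau> x \<in> F})"
      using that(1)
    proof (induction)
      case zero
      have "{x \<in> carrier S. \<tau> x \<in> \<tau> ` I} = I" using \<tau>_mem I_sub by blast
      moreover have "?c ` I = {\<zero>\<^bsub>?Q\<^esub>}" using zero_pre I_sub additive_subgroup.zero_closed[OF I.is_additive_subgroup] by blast
      ultimately show ?case by (simp only: Q.zero_dim)
    next
      case (Suc k E f)
      have sE: "sspace E" "\<tau> ` I \<subseteq> E" using flag_sspace[OF Suc(1) sI] by blast+
      have "E \<subseteq> \<tau> ` carrier S" "f \<in> \<tau> ` carrier S"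
        using Suc(4) add_line_superset[of E f] add_line_self[OF sE(1), of f] by blast+
      then obtain v where v: "v \<in> carrier S" "f = \<tau> v" by blast
      let ?E = "?c ` {x \<in> carrier S. \<tau> x \<in> E}"
      have pre: "?pre ?E = {x \<in> carrier S. \<tau> x \<in> E}"
      proof (intro equalityI subsetI)
        fix x assume "x \<in> ?pre ?E"
        then obtain y where y: "x \<in> carrier S" "y \<in> carrier S" "\<tau> y \<in> E" "?c x = ?c y" by auto
        then have d: "x \<ominus>\<^bsub>S\<^esub> y \<in> I" using c_eq by blast
        then have "x = (x \<ominus>\<^bsub>S\<^esub> y) \<oplus>\<^bsub>S\<^esub> y" using y(1,2) by algebra
        then have "\<tau> x = (\<lambda>\<alpha>. \<tau> (x \<ominus>\<^bsub>S\<^esub> y) \<alpha> + \<tau> y \<alpha>)"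
          using add[of "x \<ominus>\<^bsub>S\<^esub> y" y] y by simp
        then show "x \<in> {x \<in> carrier S. \<tau> x \<in> E}"
          using sspaceD(2)[OF sE(1), of "\<tau> (x \<ominus>\<^bsub>S\<^esub> y)" "\<tau> y"] y d sE(2) by auto
      qed auto
      have "?c v \<notin> ?E"
        using Suc(2) v pre by blast
      then have "Q.dimension (Suc k) ?K (Q.line_extension ?K (?c v) ?E)"
        using Suc(3) \<open>E \<subseteq> \<tau> ` carrier S\<close> v carrier_Q by (intro Q.Suc_dim) auto
      moreover have "Q.line_extension ?K (?c v) ?E = ?c ` {x \<in> carrier S. \<tau> x \<in> add_line f E}"
      proof -
        have sub: "Q.line_extension ?K (?c v) ?E \<subseteq> carrier ?Q"
          using carrier_Q by (intro line_sub[OF v(1)]) auto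
        have "\<tau> ` ?pre ?E = E"
          unfolding pre using \<open>E \<subseteq> \<tau> ` carrier S\<close> by auto
        then have "\<tau> ` ?pre (Q.line_extension ?K (?c v) ?E) = add_line f E"
          using line[OF v(1), of ?E] carrier_Q v(2) by auto
        then have "{x \<in> carrier S. \<tau> x \<in> add_line f E} = ?pre (Q.line_extension ?K (?c v) ?E)"
          using \<tau>_mem[of _ "?pre (Q.line_extension ?K (?c v) ?E)"] by auto
        then show ?thesis using sub carrier_Q by auto
      qed
      ultimately show ?case by simp
    qed
    then show ?thesis using that(2) by blast
  qed
  show ?thesis
  proof
    assume "has_colength S \<iota> I m"
    then have "flag (\<tau> ` I) m (\<tau> ` ?pre (carrier ?Q))"
      using to_flag[of m ?K "carrier ?Q"] by (simp add: has_colength_def)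
    moreover have "?pre (carrier ?Q) = carrier S" using carrier_Q by blast
    ultimately show "flag (\<tau> ` I) m (\<tau> ` carrier S)" by simp
  next
    assume "flag (\<tau> ` I) m (\<tau> ` carrier S)"
    then have "Q.dimension m ?K (?c ` {x \<in> carrier S. \<tau> x \<in> \<tau> ` carrier S})"
      by (rule from_flag) simp
    moreover have "{x \<in> carrier S. \<tau> x \<in> \<tau> ` carrier S} = carrier S" by auto
    ultimately show "has_colength S \<iota> I m" by (simp add: has_colength_def carrier_Q)
  qed
qed

section \<open>The pairing of polynomials with power series\<close>

lemma lookup_mscale [simp]: "Poly_Mapping.lookup (mscale a p) \<alpha> = a * Poly_Mapping.lookup p \<alpha>"
  by (simp add: mscale_def lookup_mconst_mult)

lemma mscale_single: "mscale a (Poly_Mapping.single \<alpha> b) = Poly_Mapping.single \<alpha> (a * b)"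
  by (simp add: mscale_def mconst_def mult_single)

lemma polys_in_mscale: "p \<in> polys_in V \<Longrightarrow> mscale a p \<in> polys_in V"
  by (simp add: mscale_def polys_in_mult)

definition linear_functional :: "('f::field mpoly \<Rightarrow> 'f) \<Rightarrow> bool" where
  "linear_functional l \<longleftrightarrow> (\<forall>p q. l (p + q) = l p + l q) \<and> (\<forall>a p. l (mscale a p) = a * l p)"

lemma linear_functional_zero: "linear_functional l \<Longrightarrow> l 0 = 0"
proof -
  assume "linear_functional l"
  then have "l (0 + 0) = l 0 + l 0" unfolding linear_functional_def by blast
  then show ?thesis by (metis add.right_neutral add_left_cancel)
qed

lemma linear_functional_sum: "linear_functional l \<Longrightarrow> l (sum f A) = (\<Sum>x\<in>A. l (f x))"
  by (induction A rule: infinite_finite_induct)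
    (auto simp: linear_functional_zero, simp add: linear_functional_def)

text \<open>The source of all duality below: a basis of \<open>V\<close> together with \<open>x\<close> extends to a basis of the space.\<close>

lemma separating_functional:
  fixes V :: "'a::field mpoly set"
  assumes "mspace.subspace V" "x \<notin> V"
  obtains l where "linear_functional l" "\<And>v. v \<in> V \<Longrightarrow> l v = 0" "l x = 1"
proof -
  interpret mfun: vector_space_pair "mscale :: 'a \<Rightarrow> 'a mpoly \<Rightarrow> 'a mpoly" "(*) :: 'a \<Rightarrow> 'a \<Rightarrow> 'a"
    by unfold_locales (auto simp: algebra_simps)
  obtain B where B: "B \<subseteq> V" "mspace.independent B" "V \<subseteq> mspace.span B"
    by (rule mspace.maximal_independent_subset)
  have span: "mspace.span B = V"
    using B(1,3) assms(1) mspace.span_minimal by blast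
  then have ind: "mspace.independent (insert x B)"
    using assms(2) B(2) by (intro mspace.independent_insertI) auto
  define l where "l = mfun.construct (insert x B) (\<lambda>b. if b = x then 1 else 0)"
  have lin: "Vector_Spaces.linear mscale (*) l"
    unfolding l_def by (rule mfun.linear_construct[OF ind])
  interpret l: Vector_Spaces.linear mscale "(*)" l by (rule lin)
  have "l b = 0" if "b \<in> B" for b
    using that assms(2) B(1) mfun.construct_basis[OF ind, of b] by (auto simp: l_def)
  then have "l v = 0" if "v \<in> V" for v
    using l.eq_0_on_span[of B v] that span by auto
  moreover have "l x = 1"
    using mfun.construct_basis[OF ind, of x] by (simp add: l_def)
  moreover have "linear_functional l"
    by (simp add: linear_functional_def l.add l.scale)
  ultimately show thesis by (rule that[rotated 1])
qed

text \<open>The constant coefficient of \<open>f \<bullet> F\<close>, where \<open>y\<^sub>i\<close> acts as \<open>\<partial>\<^sub>i\<close>.\<close>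

definition pair :: "'f::field mseries \<Rightarrow> 'f mpoly \<Rightarrow> 'f" where
  "pair f F = (\<Sum>\<alpha>\<in>Poly_Mapping.keys F. f \<alpha> * of_nat (mfact \<alpha>) * Poly_Mapping.lookup F \<alpha>)"

lemma pair_superset:
  assumes "finite A" "Poly_Mapping.keys F \<subseteq> A"
  shows "pair f F = (\<Sum>\<alpha>\<in>A. f \<alpha> * of_nat (mfact \<alpha>) * Poly_Mapping.lookup F \<alpha>)"
  unfolding pair_def by (rule sum.mono_neutral_left) (use assms in \<open>auto simp: in_keys_iff\<close>)

lemma pair_add_left: "pair (\<lambda>\<alpha>. f \<alpha> + g \<alpha>) F = pair f F + pair g F"
  unfolding pair_def by (simp only: distrib_right sum.distrib)

lemma pair_scale_left: "pair (\<lambda>\<alpha>. a * f \<alpha>) F = a * pair f F"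
  unfolding pair_def by (simp only: mult.assoc sum_distrib_left)

lemma pair_zero_left [simp]: "pair (\<lambda>_. 0) F = 0"
  by (simp add: pair_def)

lemma linear_functional_pair: "linear_functional (pair f)"
  unfolding linear_functional_def
proof (intro conjI allI)
  fix F G :: "'a mpoly"
  let ?A = "Poly_Mapping.keys F \<union> Poly_Mapping.keys G"
  show "pair f (F + G) = pair f F + pair f G"
    using pair_superset[of ?A F f] pair_superset[of ?A G f] pair_superset[of ?A "F + G" f] keys_add[of F G]
    by (simp add: lookup_add distrib_left sum.distrib)
  fix a
  show "pair f (mscale a F) = a * pair f F"
  proof -
    have "pair f (mscale a F) = (\<Sum>\<alpha>\<in>Poly_Mapping.keys F. f \<alpha> * of_nat (mfact \<alpha>) * Poly_Mapping.lookup (mscale a F) \<alpha>)"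
      by (rule pair_superset) (auto simp: in_keys_iff)
    then show ?thesis unfolding pair_def sum_distrib_left lookup_mscale by (simp only: mult.left_commute[of a])
  qed
qed

lemmas pair_add_right = linear_functional_pair[unfolded linear_functional_def, THEN conjunct1, rule_format]
lemmas pair_scale_right = linear_functional_pair[unfolded linear_functional_def, THEN conjunct2, rule_format]

abbreviation monoms :: "nat \<Rightarrow> nat \<Rightarrow> monom set" where
  "monoms c N \<equiv> {\<alpha>. Poly_Mapping.keys \<alpha> \<subseteq> {1..c} \<and> mdeg \<alpha> < N}"

lemma finite_monoms_atLeastAtMost [simp]: "finite (monoms c N)"
  by (rule finite_monoms) simp

definition trunc :: "nat \<Rightarrow> nat \<Rightarrow> 'f::field mseries \<Rightarrow> 'f mpoly" where
  "trunc c N f = (\<Sum>\<alpha>\<in>monoms c N. Poly_Mapping.single \<alpha> (f \<alpha>))"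

lemma lookup_trunc: "Poly_Mapping.lookup (trunc c N f) \<alpha> = (if \<alpha> \<in> monoms c N then f \<alpha> else 0)"
  by (auto simp: trunc_def lookup_sum lookup_single when_def)

lemma keys_trunc: "Poly_Mapping.keys (trunc c N f) \<subseteq> monoms c N"
proof
  fix \<alpha> assume "\<alpha> \<in> Poly_Mapping.keys (trunc c N f)"
  then have "Poly_Mapping.lookup (trunc c N f) \<alpha> \<noteq> 0" unfolding in_keys_iff .
  then show "\<alpha> \<in> monoms c N" unfolding lookup_trunc by presburger
qed

lemma polys_in_trunc: "trunc c N f \<in> polys_in {1..c}"
  unfolding trunc_def by (intro polys_in_sum polys_in_single) auto

text \<open>
  The polynomial that represents the functional \<open>l\<close> on polynomials of degree below \<open>N\<close> under the
  pairing; the division by \<open>\<alpha>!\<close> is where characteristic zero enters.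
\<close>

definition dual_element :: "nat \<Rightarrow> nat \<Rightarrow> ('f::field mpoly \<Rightarrow> 'f) \<Rightarrow> 'f mpoly" where
  "dual_element c N l = trunc c N (\<lambda>\<alpha>. l (Poly_Mapping.single \<alpha> 1) / of_nat (mfact \<alpha>))"

lemma of_nat_mfact_nz: "CHAR('f::field) = 0 \<Longrightarrow> of_nat (mfact \<alpha>) \<noteq> (0::'f)"
  using mfact_pos[of \<alpha>] by (simp add: of_nat_eq_0_iff_char_dvd)

lemma linear_functional_trunc:
  assumes "linear_functional l"
  shows "l (trunc c N f) = (\<Sum>\<alpha>\<in>monoms c N. f \<alpha> * l (Poly_Mapping.single \<alpha> 1))"
proof -
  have "l (Poly_Mapping.single \<alpha> (f \<alpha>)) = f \<alpha> * l (Poly_Mapping.single \<alpha> 1)" for \<alpha>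
  proof -
    have "l (mscale (f \<alpha>) (Poly_Mapping.single \<alpha> 1)) = f \<alpha> * l (Poly_Mapping.single \<alpha> 1)"
      using assms unfolding linear_functional_def by blast
    then show ?thesis by (simp add: mscale_single)
  qed
  then show ?thesis by (simp add: trunc_def linear_functional_sum[OF assms])
qed

lemma pair_dual_element:
  fixes l :: "'f::field mpoly \<Rightarrow> 'f"
  assumes "CHAR('f) = 0" "linear_functional l"
  shows "pair f (dual_element c N l) = l (trunc c N f)"
proof -
  have "pair f (dual_element c N l) = (\<Sum>\<alpha>\<in>monoms c N. f \<alpha> * of_nat (mfact \<alpha>) * Poly_Mapping.lookup (dual_element c N l) \<alpha>)"
    by (rule pair_superset) (simp_all add: dual_element_def keys_trunc)
  also have "\<dots> = (\<Sum>\<alpha>\<in>monoms c N. f \<alpha> * l (Poly_Mapping.single \<alpha> 1))"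
    by (rule sum.cong) (auto simp: dual_element_def lookup_trunc of_nat_mfact_nz[OF assms(1)])
  finally show ?thesis by (simp add: linear_functional_trunc[OF assms(2)])
qed

lemma pair_lookup_dual_element:
  fixes l :: "'f::field mpoly \<Rightarrow> 'f"
  assumes "CHAR('f) = 0" "linear_functional l" "Poly_Mapping.keys F \<subseteq> monoms c N"
  shows "pair (Poly_Mapping.lookup (dual_element c N l)) F = l F"
proof -
  have "pair (Poly_Mapping.lookup (dual_element c N l)) F = (\<Sum>\<alpha>\<in>monoms c N.
      Poly_Mapping.lookup (dual_element c N l) \<alpha> * of_nat (mfact \<alpha>) * Poly_Mapping.lookup F \<alpha>)"
    by (rule pair_superset) (use assms(3) in auto)
  also have "\<dots> = (\<Sum>\<alpha>\<in>monoms c N. Poly_Mapping.lookup F \<alpha> * l (Poly_Mapping.single \<alpha> 1))"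
    by (rule sum.cong) (auto simp: dual_element_def lookup_trunc of_nat_mfact_nz[OF assms(1)])
  also have "\<dots> = l (trunc c N (Poly_Mapping.lookup F))"
    by (simp add: linear_functional_trunc[OF assms(2)])
  also have "trunc c N (Poly_Mapping.lookup F) = F"
    using assms(3) by (intro poly_mapping_eqI) (auto simp: lookup_trunc in_keys_iff subset_iff)
  finally show ?thesis .
qed


lemma pair_single: "pair f (Poly_Mapping.single \<alpha> a) = f \<alpha> * of_nat (mfact \<alpha>) * a"
  by (cases "a = 0") (simp_all add: pair_def)

section \<open>Duality between cofinite subspaces and finite-dimensional spaces of polynomials\<close>

definition orth :: "nat \<Rightarrow> 'f::field mseries set \<Rightarrow> 'f mpoly set" where
  "orth c J = {F \<in> polys_in {1..c}. \<forall>f\<in>J. pair f F = 0}"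

lemma subspace_orth: "mspace.subspace (orth c J)"
  by (auto simp: mspace.subspace_def orth_def polys_in_add polys_in_mscale pair_add_right
      pair_scale_right linear_functional_zero[OF linear_functional_pair])

text \<open>A functional that does not vanish on \<open>W\<close> cuts its dimension by one.\<close>

lemma dim_codim1:
  fixes W :: "'f::field mpoly set"
  assumes W: "mspace.subspace W" "W \<subseteq> mspace.span B" "finite B"
    and l: "linear_functional l" and F0: "F0 \<in> W" "l F0 \<noteq> 0"
  shows "mspace.dim W = Suc (mspace.dim {F \<in> W. l F = 0})"
proof -
  let ?W' = "{F \<in> W. l F = 0}"
  have sub: "mspace.subspace ?W'"
    using W(1) l linear_functional_zero[OF l]
    by (auto simp: mspace.subspace_def linear_functional_def)
  obtain B' where B': "B' \<subseteq> ?W'" "mspace.independent B'" "?W' \<subseteq> mspace.span B'" "card B' = mspace.dim ?W'"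
    by (rule mspace.basis_exists)
  have fin: "finite B'"
    using mspace.independent_span_bound[OF W(3) B'(2)] B'(1) W(2) by blast
  have span: "mspace.span B' \<subseteq> ?W'"
    using B'(1) sub by (rule mspace.span_minimal)
  then have F0n: "F0 \<notin> mspace.span B'" using F0(2) by blast
  have "W \<subseteq> mspace.span (insert F0 B')"
  proof
    fix F assume F: "F \<in> W"
    define a where "a = l F / l F0"
    have "F + mscale (- a) F0 \<in> W"
      using W(1) F F0(1) unfolding mspace.subspace_def by blast
    moreover have "l (F + mscale (- a) F0) = l F + - a * l F0"
      using l unfolding linear_functional_def by metis
    ultimately have "F + mscale (- a) F0 \<in> mspace.span B'"
      using B'(3) F0(2) by (auto simp: a_def)
    then have "F + mscale (- a) F0 \<in> mspace.span (insert F0 B')"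
      using mspace.span_mono[of B' "insert F0 B'"] by blast
    moreover have "mscale a F0 \<in> mspace.span (insert F0 B')"
      by (intro mspace.span_scale mspace.span_base) simp
    ultimately have "(F + mscale (- a) F0) + mscale a F0 \<in> mspace.span (insert F0 B')"
      by (rule mspace.span_add)
    moreover have "(F + mscale (- a) F0) + mscale a F0 = F"
      by (rule poly_mapping_eqI) (simp add: lookup_add)
    ultimately show "F \<in> mspace.span (insert F0 B')" by simp
  qed
  moreover have "mspace.independent (insert F0 B')"
    using F0n B'(2) by (rule mspace.independent_insertI)
  moreover have "insert F0 B' \<subseteq> W" using F0(1) B'(1) by auto
  moreover have "card (insert F0 B') = Suc (card B')"
    using fin F0n mspace.span_base[of F0 B'] by (auto simp: card_insert_if)
  ultimately show ?thesis
    using mspace.dim_unique[of "insert F0 B'" W] B'(4) by metis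
qed

lemma keys_bounded: "\<exists>N. Poly_Mapping.keys F \<subseteq> monoms c N" if "F \<in> polys_in {1..c}" for F :: "'f::zero mpoly"
proof
  show "Poly_Mapping.keys F \<subseteq> monoms c (Suc (Max (insert 0 (mdeg ` Poly_Mapping.keys F))))"
  proof
    fix \<alpha> assume \<alpha>: "\<alpha> \<in> Poly_Mapping.keys F"
    then have "mdeg \<alpha> \<le> Max (insert 0 (mdeg ` Poly_Mapping.keys F))" by (intro Max_ge) auto
    moreover have "Poly_Mapping.keys \<alpha> \<subseteq> {1..c}" using \<alpha> that by (auto simp: polys_in_def)
    ultimately show "\<alpha> \<in> monoms c (Suc (Max (insert 0 (mdeg ` Poly_Mapping.keys F))))"
      by (simp add: less_Suc_eq_le)
  qed
qed

lemma monoms_mono: "M \<le> N \<Longrightarrow> monoms c M \<subseteq> monoms c N"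
  by auto

lemma in_span_monoms:
  fixes F :: "'f::field mpoly"
  assumes "Poly_Mapping.keys F \<subseteq> monoms c N"
  shows "F \<in> mspace.span ((\<lambda>\<alpha>. Poly_Mapping.single \<alpha> (1::'f)) ` monoms c N)"
proof -
  have "(\<Sum>\<alpha>\<in>Poly_Mapping.keys F. mscale (Poly_Mapping.lookup F \<alpha>) (Poly_Mapping.single \<alpha> 1))
    \<in> mspace.span ((\<lambda>\<alpha>. Poly_Mapping.single \<alpha> (1::'f)) ` monoms c N)"
    using assms by (intro mspace.span_sum mspace.span_scale mspace.span_base) auto
  then show ?thesis by (simp add: mscale_single flip: poly_mapping_sum_singles)
qed

text \<open>
  The coefficient functions of polynomials, or of power series, in the variables \<open>1, \<dots>, c\<close>.
  Modulo the functions of order at least \<open>N\<close> the two spaces agree, so one duality serves both; \<open>U\<close> is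
  therefore any space that contains the polynomials.
\<close>

locale coefficient_space =
  fixes c :: nat and U :: "'f::field mseries set"
  assumes char0: "CHAR('f) = 0"
    and sspace_U: "sspace U"
    and polys_U: "Poly_Mapping.lookup ` polys_in {1..c} \<subseteq> U"
    and vars_U: "f \<in> U \<Longrightarrow> f \<alpha> \<noteq> 0 \<Longrightarrow> Poly_Mapping.keys \<alpha> \<subseteq> {1..c}"
begin

definition tails :: "nat \<Rightarrow> 'f mseries set" where
  "tails N = {f \<in> U. \<forall>\<alpha>. mdeg \<alpha> < N \<longrightarrow> f \<alpha> = 0}"

definition annihilator :: "'f mpoly set \<Rightarrow> 'f mseries set" where
  "annihilator V = {f \<in> U. \<forall>F\<in>V. pair f F = 0}"

lemma trunc_U: "Poly_Mapping.lookup (trunc c N f) \<in> U"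
  using polys_U polys_in_trunc by blast

lemma diff_trunc: "f \<in> U \<Longrightarrow> (\<lambda>\<alpha>. f \<alpha> - Poly_Mapping.lookup (trunc c N f) \<alpha>) \<in> tails N"
  using sspace_diff[OF sspace_U _ trunc_U, of f N f] vars_U[of f]
  by (auto simp: tails_def lookup_trunc)

lemma trunc_mem_iff:
  assumes "sspace E" "tails N \<subseteq> E" "f \<in> U"
  shows "Poly_Mapping.lookup (trunc c N f) \<in> E \<longleftrightarrow> f \<in> E"
proof
  assume "Poly_Mapping.lookup (trunc c N f) \<in> E"
  then show "f \<in> E"
    using sspaceD(2)[OF assms(1), of "Poly_Mapping.lookup (trunc c N f)"] diff_trunc[OF assms(3), of N] assms(2)
    by fastforce
next
  assume "f \<in> E"
  then show "Poly_Mapping.lookup (trunc c N f) \<in> E"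
    using sspace_diff[OF assms(1), of f "\<lambda>\<alpha>. f \<alpha> - Poly_Mapping.lookup (trunc c N f) \<alpha>"]
      diff_trunc[OF assms(3), of N] assms(2) by auto
qed

text \<open>
  A function outside \<open>E\<close> has its truncation outside \<open>E\<close>, since \<open>E\<close> contains the tails.  A functional
  that separates the truncation from \<open>E\<close> is represented by a polynomial orthogonal to \<open>E\<close>.
\<close>

lemma annihilator_orth:
  assumes "sspace E" "tails N \<subseteq> E" "E \<subseteq> U"
  shows "annihilator (orth c E) = E"
proof (intro equalityI subsetI)
  fix f assume "f \<in> E"
  then show "f \<in> annihilator (orth c E)" using assms(3) by (auto simp: annihilator_def orth_def)
next
  fix f assume f: "f \<in> annihilator (orth c E)"
  then have fU: "f \<in> U" by (simp add: annihilator_def)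
  show "f \<in> E"
  proof (rule ccontr)
    assume "f \<notin> E"
    define V where "V = {p. Poly_Mapping.lookup p \<in> E}"
    have "mspace.subspace V"
    proof -
      have "Poly_Mapping.lookup 0 = (\<lambda>_::monom. 0::'f)" by (simp add: fun_eq_iff)
      moreover have "Poly_Mapping.lookup (p + q) = (\<lambda>\<alpha>. Poly_Mapping.lookup p \<alpha> + Poly_Mapping.lookup q \<alpha>)"
        for p q :: "'f mpoly" by (simp add: fun_eq_iff lookup_add)
      moreover have "Poly_Mapping.lookup (mscale a p) = (\<lambda>\<alpha>. a * Poly_Mapping.lookup p \<alpha>)"
        for a and p :: "'f mpoly" by (simp add: fun_eq_iff)
      ultimately show ?thesis
        unfolding mspace.subspace_def V_def
        by (simp add: sspaceD[OF assms(1)])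
    qed
    moreover have "trunc c N f \<notin> V"
      using trunc_mem_iff[OF assms(1,2) fU] \<open>f \<notin> E\<close> by (simp add: V_def)
    ultimately obtain l where l: "linear_functional l" "\<And>v. v \<in> V \<Longrightarrow> l v = 0" "l (trunc c N f) = 1"
      by (rule separating_functional) blast
    have "dual_element c N l \<in> orth c E"
      using trunc_mem_iff[OF assms(1,2)] assms(3) l(2)
      by (auto simp: orth_def pair_dual_element[OF char0 l(1)] V_def subset_iff)
        (simp add: dual_element_def polys_in_trunc)
    then have "pair f (dual_element c N l) = 0"
      using f by (simp add: annihilator_def)
    then show False using l(3) by (simp add: pair_dual_element[OF char0 l(1)])
  qed
qed

lemma tails_antimono: "M \<le> N \<Longrightarrow> tails N \<subseteq> tails M"
  by (auto simp: tails_def)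

lemma tails_annihilator:
  assumes "\<And>F. F \<in> V \<Longrightarrow> Poly_Mapping.keys F \<subseteq> monoms c N"
  shows "tails N \<subseteq> annihilator V"
proof
  fix f assume f: "f \<in> tails N"
  have "pair f F = 0" if "F \<in> V" for F
    unfolding pair_def using f assms[OF that] by (intro sum.neutral) (auto simp: tails_def)
  with f show "f \<in> annihilator V" by (auto simp: tails_def annihilator_def)
qed

lemma sspace_annihilator: "sspace (annihilator V)"
  using sspaceD[OF sspace_U]
  by (auto simp: sspace_def annihilator_def pair_add_left pair_scale_left)

text \<open>The same separation argument, with the representing element now on the side of \<open>U\<close>.\<close>

lemma orth_annihilator:
  assumes V: "mspace.subspace V" "V \<subseteq> polys_in {1..c}"
    and bound: "\<And>F. F \<in> V \<Longrightarrow> Poly_Mapping.keys F \<subseteq> monoms c N"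
  shows "orth c (annihilator V) = V"
proof (intro equalityI subsetI)
  fix F assume "F \<in> V"
  then show "F \<in> orth c (annihilator V)" using V(2) by (auto simp: annihilator_def orth_def)
next
  fix F assume F: "F \<in> orth c (annihilator V)"
  show "F \<in> V"
  proof (rule ccontr)
    assume "F \<notin> V"
    with V(1) obtain l where l: "linear_functional l" "\<And>v. v \<in> V \<Longrightarrow> l v = 0" "l F = 1"
      by (rule separating_functional) blast
    obtain M where M: "Poly_Mapping.keys F \<subseteq> monoms c M"
    proof -
      have "F \<in> polys_in {1..c}" using F by (simp add: orth_def)
      then show thesis using keys_bounded[of F c] that by blast
    qed
    define K where "K = max M N"
    have K: "Poly_Mapping.keys F \<subseteq> monoms c K" "\<And>G. G \<in> V \<Longrightarrow> Poly_Mapping.keys G \<subseteq> monoms c K"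
      using M bound monoms_mono[of M K] monoms_mono[of N K] unfolding K_def by (meson max.cobounded1 max.cobounded2 order_trans)+
    let ?f = "Poly_Mapping.lookup (dual_element c K l)"
    have "?f \<in> annihilator V"
      using l(2) K(2) trunc_U unfolding annihilator_def
      by (simp add: pair_lookup_dual_element[OF char0 l(1)]) (simp add: dual_element_def)
    then have "pair ?f F = 0" using F by (simp add: orth_def)
    then show False using l(3) by (simp add: pair_lookup_dual_element[OF char0 l(1) K(1)])
  qed
qed

lemma keys_orth:
  assumes "tails N \<subseteq> E" "F \<in> orth c E"
  shows "Poly_Mapping.keys F \<subseteq> monoms c N"
proof
  fix \<alpha> assume \<alpha>: "\<alpha> \<in> Poly_Mapping.keys F"
  have keys: "Poly_Mapping.keys \<alpha> \<subseteq> {1..c}" using \<alpha> assms(2) by (auto simp: orth_def polys_in_def)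
  have "mdeg \<alpha> < N"
  proof (rule ccontr)
    assume *: "\<not> mdeg \<alpha> < N"
    let ?f = "Poly_Mapping.lookup (Poly_Mapping.single \<alpha> (1::'f))"
    have "?f \<in> tails N"
      using * polys_U polys_in_single[OF keys, of "1::'f"]
      by (auto simp: tails_def lookup_single when_def)
    then have "pair ?f F = 0" using assms by (auto simp: orth_def)
    moreover have "pair ?f F = (\<Sum>\<beta>\<in>{\<alpha>}. ?f \<beta> * of_nat (mfact \<beta>) * Poly_Mapping.lookup F \<beta>)"
      unfolding pair_def using \<alpha> by (intro sum.mono_neutral_right) (auto simp: lookup_single when_def)
    ultimately show False using \<alpha> of_nat_mfact_nz[OF char0] by (auto simp: in_keys_iff)
  qed
  with keys show "\<alpha> \<in> monoms c N" by simp
qed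

text \<open>
  Each step of a flag imposes one more linear condition on the orthogonal space, and the condition
  is new because \<open>annihilator_orth\<close> separates the added vector from the smaller space.
\<close>

lemma dim_orth_flag:
  assumes "flag I k E" "sspace I" "tails N \<subseteq> I" "E \<subseteq> U"
  shows "mspace.dim (orth c I) = k + mspace.dim (orth c E)"
  using assms
proof (induction)
  case (Suc k E v)
  have E: "sspace E" "I \<subseteq> E" using flag_sspace[OF Suc(1) Suc(4)] by blast+
  have EU: "E \<subseteq> U" "v \<in> U"
    using Suc(6) add_line_superset[of E v] add_line_self[OF E(1), of v] by blast+
  have tE: "tails N \<subseteq> E" using Suc(5) E(2) by blast
  obtain F0 where F0: "F0 \<in> orth c E" "pair v F0 \<noteq> 0"
    using annihilator_orth[OF E(1) tE EU(1)] Suc(2) EU(2) by (auto simp: annihilator_def)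
  have "orth c (add_line v E) = {F \<in> orth c E. pair v F = 0}"
  proof (intro equalityI subsetI)
    fix F assume "F \<in> orth c (add_line v E)"
    then show "F \<in> {F \<in> orth c E. pair v F = 0}"
      using add_line_superset[of E v] add_line_self[OF E(1), of v] by (auto simp: orth_def)
  next
    fix F assume "F \<in> {F \<in> orth c E. pair v F = 0}"
    then show "F \<in> orth c (add_line v E)"
      by (auto simp: orth_def add_line_def pair_add_left pair_scale_left)
  qed
  moreover have "orth c E \<subseteq> mspace.span ((\<lambda>\<alpha>. Poly_Mapping.single \<alpha> (1::'f)) ` monoms c N)"
    by (intro subsetI in_span_monoms keys_orth[OF tE])
  ultimately have "mspace.dim (orth c E) = Suc (mspace.dim (orth c (add_line v E)))"
    using dim_codim1[OF subspace_orth _ _ linear_functional_pair F0] by auto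
  then show ?case using Suc(3)[OF Suc(4,5) EU(1)] by simp
qed simp

lemma orth_U: "orth c U = {0}"
proof -
  have "sspace U" "tails 0 \<subseteq> U" using sspace_U by (auto simp: tails_def)
  then have "Poly_Mapping.keys F \<subseteq> monoms c 0" if "F \<in> orth c U" for F
    using keys_orth that by blast
  then have "F = 0" if "F \<in> orth c U" for F
    using that by simp
  moreover have "0 \<in> orth c U" using subspace_orth[of c U] by (simp add: mspace.subspace_def)
  ultimately show ?thesis by blast
qed

text \<open>
  Add the finitely many monomials of degree below \<open>N\<close> one after the other, skipping those already
  reached.
\<close>

lemma flag_exists:
  assumes "sspace I" "tails N \<subseteq> I" "I \<subseteq> U"
  shows "\<exists>k. flag I k U"
proof -
  define E where "E A = {\<lambda>\<alpha>. f \<alpha> + Poly_Mapping.lookup p \<alpha> |f p. f \<in> I \<and> Poly_Mapping.keys p \<subseteq> A}" for A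
  have "\<exists>k. flag I k (E A)" if "finite A" for A
    using that
  proof (induction A rule: finite_induct)
    case empty
    have "E {} = I" by (auto simp: E_def)
    then show ?case using flag.zero by metis
  next
    case (insert \<alpha> A)
    then obtain k where k: "flag I k (E A)" by blast
    note sE = flag_sspace[OF k assms(1)]
    let ?v = "Poly_Mapping.lookup (Poly_Mapping.single \<alpha> (1::'f))"
    have line: "E (insert \<alpha> A) = add_line ?v (E A)"
    proof (intro equalityI subsetI)
      fix g assume "g \<in> E (insert \<alpha> A)"
      then obtain f p where fp: "f \<in> I" "Poly_Mapping.keys p \<subseteq> insert \<alpha> A"
        "g = (\<lambda>\<alpha>. f \<alpha> + Poly_Mapping.lookup p \<alpha>)" by (auto simp: E_def)
      let ?q = "p - Poly_Mapping.single \<alpha> (Poly_Mapping.lookup p \<alpha>)"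
      have "Poly_Mapping.keys ?q \<subseteq> A"
        using fp(2) by (auto simp: in_keys_iff lookup_minus lookup_single when_def split: if_splits)
      then have "(\<lambda>\<beta>. f \<beta> + Poly_Mapping.lookup ?q \<beta>) \<in> E A" using fp(1) by (auto simp: E_def)
      then show "g \<in> add_line ?v (E A)"
        by (rule add_lineI[where a = "Poly_Mapping.lookup p \<alpha>"])
          (auto simp: fp(3) fun_eq_iff lookup_minus lookup_single when_def)
    next
      fix g assume "g \<in> add_line ?v (E A)"
      then obtain f p a where fp: "f \<in> I" "Poly_Mapping.keys p \<subseteq> A"
        "g = (\<lambda>\<alpha>. f \<alpha> + Poly_Mapping.lookup p \<alpha> + a * ?v \<alpha>)" by (auto simp: E_def add_line_def)
      have "g = (\<lambda>\<beta>. f \<beta> + Poly_Mapping.lookup (p + Poly_Mapping.single \<alpha> a) \<beta>)"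
        by (auto simp: fp(3) fun_eq_iff lookup_add lookup_single when_def)
      moreover have "Poly_Mapping.keys (p + Poly_Mapping.single \<alpha> a) \<subseteq> insert \<alpha> A"
        using keys_add[of p "Poly_Mapping.single \<alpha> a"] fp(2) by (auto split: if_splits)
      ultimately show "g \<in> E (insert \<alpha> A)" using fp(1) unfolding E_def by blast
    qed
    show ?case
    proof (cases "?v \<in> E A")
      case True
      have "add_line ?v (E A) \<subseteq> E A"
        using sspaceD(2)[OF sE(1) _ sspaceD(3)[OF sE(1) True]] by (auto simp: add_line_def)
      then have "add_line ?v (E A) = E A" using add_line_superset by blast
      then show ?thesis using k line by auto
    next
      case False
      then show ?thesis using flag.Suc[OF k False] line by metis
    qed
  qed
  from this[OF finite_monoms_atLeastAtMost] obtain k where "flag I k (E (monoms c N))" by blast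
  moreover have "E (monoms c N) = U"
  proof (intro equalityI subsetI)
    fix g assume "g \<in> E (monoms c N)"
    then obtain f p where fp: "f \<in> I" "Poly_Mapping.keys p \<subseteq> monoms c N"
      "g = (\<lambda>\<alpha>. f \<alpha> + Poly_Mapping.lookup p \<alpha>)" by (auto simp: E_def)
    have "p \<in> polys_in {1..c}" using fp(2) by (auto simp: polys_in_def)
    then have "Poly_Mapping.lookup p \<in> U" using polys_U by blast
    then show "g \<in> U" using sspaceD(2)[OF sspace_U] fp assms(3) by blast
  next
    fix g assume g: "g \<in> U"
    have "(\<lambda>\<alpha>. g \<alpha> - Poly_Mapping.lookup (trunc c N g) \<alpha>) \<in> I"
      using diff_trunc[OF g] assms(2) by blast
    then show "g \<in> E (monoms c N)"
      using keys_trunc[of c N g] unfolding E_def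
      by (intro CollectI exI[of _ "\<lambda>\<alpha>. g \<alpha> - Poly_Mapping.lookup (trunc c N g) \<alpha>"] exI[of _ "trunc c N g"]) auto
  qed
  ultimately show ?thesis by blast
qed

lemma flag_iff_dim_orth:
  assumes "sspace I" "tails N \<subseteq> I" "I \<subseteq> U"
  shows "flag I k U \<longleftrightarrow> mspace.dim (orth c I) = k"
proof -
  have "mspace.dim (orth c U) = 0"
    unfolding orth_U by (rule mspace.dim_unique[of "{}"]) (simp_all add: mspace.independent_empty)
  then have "mspace.dim (orth c I) = l" if "flag I l U" for l
    using dim_orth_flag[OF that assms(1,2)] by simp
  then show ?thesis using flag_exists[OF assms] by metis
qed

end

section \<open>Multiplication by a variable is adjoint to differentiation\<close>

text \<open>Multiplication of a power series by the variable \<open>i\<close>.\<close>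

definition shift :: "nat \<Rightarrow> 'f::zero mseries \<Rightarrow> 'f mseries" where
  "shift i f = (\<lambda>\<alpha>. if Poly_Mapping.lookup \<alpha> i = 0 then 0 else f (\<alpha> - evar i))"

lemma shift_add_evar: "shift i f (\<alpha> + evar i) = f \<alpha>"
  by (simp add: shift_def lookup_add lookup_evar)

lemma pair_shift: "pair (shift i f) F = pair f (mderiv i F)"
proof (induction F rule: poly_mapping_single_induct)
  case (single \<alpha> a)
  show ?case
  proof (cases "Poly_Mapping.lookup \<alpha> i = 0")
    case True
    then show ?thesis
      by (simp add: pair_single mderiv_single shift_def linear_functional_zero[OF linear_functional_pair])
  next
    case False
    then obtain \<beta> where \<beta>: "\<alpha> = \<beta> + evar i" using monom_diff_evar[of \<alpha> i] by metis
    then have "\<alpha> - evar i = \<beta>" by simp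
    then show ?thesis
      unfolding mderiv_single pair_single \<beta>
      by (simp add: shift_add_evar mfact_add_evar lookup_add lookup_evar)
  qed
qed (simp add: pair_add_right mderiv_add)

lemma lookup_mvar_mult:
  "Poly_Mapping.lookup (mvar i * p) = shift i (Poly_Mapping.lookup (p :: 'a::comm_semiring_1 mpoly))"
proof
  fix \<alpha>
  show "Poly_Mapping.lookup (mvar i * p) \<alpha> = shift i (Poly_Mapping.lookup p) \<alpha>"
  proof (induction p rule: poly_mapping_single_induct)
    case (single \<beta> b)
    then show ?case
    proof (cases "Poly_Mapping.lookup \<alpha> i = 0")
      case True
      then have "\<alpha> \<noteq> \<beta> + evar i" by (auto simp: lookup_add lookup_evar)
      then show ?thesis using True by (simp add: mvar_times_single lookup_single when_def shift_def)
    next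
      case False
      then obtain \<mu> where "\<alpha> = \<mu> + evar i" using monom_diff_evar[of \<alpha> i] by metis
      then show ?thesis by (simp add: mvar_times_single lookup_single when_def shift_add_evar)
    qed
  qed (simp add: distrib_left lookup_add shift_def)
qed

lemma finite_nonzero_mderivs:
  fixes F :: "'f::field mpoly"
  assumes "CHAR('f) = 0"
  shows "finite {\<beta>. mderivs \<beta> F \<noteq> 0}"
proof -
  let ?A = "\<Union>\<alpha>\<in>Poly_Mapping.keys F. fst ` {(\<beta>, \<delta>). \<beta> + \<delta> = \<alpha>}"
  have "{\<beta>. mderivs \<beta> F \<noteq> 0} \<subseteq> ?A"
  proof
    fix \<beta> assume "\<beta> \<in> {\<beta>. mderivs \<beta> F \<noteq> 0}"
    then obtain \<delta> where "Poly_Mapping.lookup (mderivs \<beta> F) \<delta> \<noteq> 0"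
      by (auto simp: poly_mapping_eq_iff fun_eq_iff)
    then have "of_nat (mfact (\<delta> + \<beta>)) * Poly_Mapping.lookup F (\<delta> + \<beta>) \<noteq> 0"
      using of_nat_mfact_nz[OF assms, of \<delta>] by (simp flip: lookup_mderivs)
    then have "\<delta> + \<beta> \<in> Poly_Mapping.keys F" by (auto simp: in_keys_iff)
    then show "\<beta> \<in> ?A" by (force simp: add.commute)
  qed
  moreover have "finite ?A" by (intro finite_UN_I finite_imageI finite_splits finite_keys)
  ultimately show ?thesis by (rule finite_subset)
qed

text \<open>
  All coefficients of \<open>f \<bullet> F\<close> are pairings with derivatives of \<open>F\<close>.  Hence, for families that are
  stable under the variables or under differentiation, \<open>f \<bullet> F = 0\<close> and \<open>\<langle>f, F\<rangle> = 0\<close> define the same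
  orthogonal.
\<close>

lemma lookup_series_act:
  fixes F :: "'f::field mpoly"
  assumes "CHAR('f) = 0"
  shows "of_nat (mfact \<delta>) * Poly_Mapping.lookup (series_act f F) \<delta> = pair f (mderivs \<delta> F)"
proof -
  let ?B = "{\<beta>. mderivs \<beta> F \<noteq> 0}"
  have "of_nat (mfact \<delta>) * Poly_Mapping.lookup (series_act f F) \<delta>
    = (\<Sum>\<beta>\<in>?B. f \<beta> * (of_nat (mfact (\<delta> + \<beta>)) * Poly_Mapping.lookup F (\<delta> + \<beta>)))"
    unfolding series_act_def lookup_sum sum_distrib_left lookup_mscale lookup_mderivs[symmetric]
    by (intro sum.cong refl mult.left_commute)
  also have "\<dots> = (\<Sum>\<beta>\<in>?B. f \<beta> * (of_nat (mfact \<beta>) * Poly_Mapping.lookup (mderivs \<delta> F) \<beta>))"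
    by (simp add: lookup_mderivs add.commute)
  also have "\<dots> = pair f (mderivs \<delta> F)"
  proof (subst pair_superset)
    show "finite ?B" by (rule finite_nonzero_mderivs[OF assms])
    show "Poly_Mapping.keys (mderivs \<delta> F) \<subseteq> ?B"
    proof
      fix \<beta> assume "\<beta> \<in> Poly_Mapping.keys (mderivs \<delta> F)"
      then have "of_nat (mfact \<beta>) * Poly_Mapping.lookup (mderivs \<delta> F) \<beta> \<noteq> 0"
        using of_nat_mfact_nz[OF assms] by (simp add: in_keys_iff)
      then have "of_nat (mfact \<delta>) * Poly_Mapping.lookup (mderivs \<beta> F) \<delta> \<noteq> 0"
        by (simp add: lookup_mderivs add.commute)
      then show "\<beta> \<in> ?B" by auto
    qed
  qed (simp only: mult.assoc)
  finally show ?thesis .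
qed

lemma series_act_eq_0_iff:
  fixes F :: "'f::field mpoly"
  assumes "CHAR('f) = 0"
  shows "series_act f F = 0 \<longleftrightarrow> (\<forall>\<delta>. pair f (mderivs \<delta> F) = 0)"
proof -
  have "series_act f F = 0 \<longleftrightarrow> (\<forall>\<delta>. of_nat (mfact \<delta>) * Poly_Mapping.lookup (series_act f F) \<delta> = 0)"
    using of_nat_mfact_nz[OF assms] by (auto intro: poly_mapping_eqI)
  then show ?thesis by (simp add: lookup_series_act[OF assms])
qed

definition deriv_closed :: "nat \<Rightarrow> 'f::field mpoly set \<Rightarrow> bool" where
  "deriv_closed c V \<longleftrightarrow> (\<forall>F\<in>V. \<forall>i\<in>{1..c}. mderiv i F \<in> V)"

lemma deriv_closed_mderivs:
  assumes "deriv_closed c V" "V \<subseteq> polys_in {1..c}" "0 \<in> V" "F \<in> V"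
  shows "mderivs \<delta> F \<in> V"
proof (induction \<delta> rule: monom_induct)
  case (add \<beta> i)
  show ?case
  proof (cases "i \<in> {1..c}")
    case True
    then show ?thesis using assms(1) add by (simp add: mderivs_add_evar deriv_closed_def)
  next
    case False
    then have "mderiv i (mderivs \<beta> F) = 0" using add assms(2) mderiv_notin by blast
    then show ?thesis using assms(3) by (simp add: mderivs_add_evar)
  qed
qed (use assms in simp)

lemma perp_eq_orth:
  fixes J :: "'f::field mseries set"
  assumes "CHAR('f) = 0" "deriv_closed c (orth c J)"
  shows "perp c J = orth c J"
proof (intro equalityI subsetI)
  fix F assume "F \<in> perp c J"
  then show "F \<in> orth c J"
    unfolding perp_def orth_def series_act_eq_0_iff[OF assms(1)]
    by (auto dest!: bspec spec[of _ "0 :: monom"])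
next
  fix F assume F: "F \<in> orth c J"
  have "mderivs \<delta> F \<in> orth c J" for \<delta>
    using subspace_orth[of c J] by (intro deriv_closed_mderivs[OF assms(2) _ _ F])
      (auto simp: orth_def mspace.subspace_def)
  with F show "F \<in> perp c J"
    unfolding perp_def orth_def series_act_eq_0_iff[OF assms(1)] by auto
qed

definition shift_closed :: "nat \<Rightarrow> 'f::field mseries set \<Rightarrow> bool" where
  "shift_closed c I \<longleftrightarrow> (\<forall>f\<in>I. \<forall>i\<in>{1..c}. shift i f \<in> I)"

lemma deriv_closed_orth: "shift_closed c I \<Longrightarrow> deriv_closed c (orth c I)"
  by (auto simp: shift_closed_def deriv_closed_def orth_def polys_in_mderiv simp flip: pair_shift)

context coefficient_space
begin

lemma shift_closed_annihilator:
  "shift_closed c U \<Longrightarrow> deriv_closed c V \<Longrightarrow> shift_closed c (annihilator V)"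
  by (auto simp: shift_closed_def deriv_closed_def annihilator_def pair_shift)

end

section \<open>Ideals of the power series ring\<close>

abbreviation series :: "nat \<Rightarrow> 'f::field mseries set" where
  "series c \<equiv> carrier (series_ring c)"

lemma series_iff: "f \<in> series c \<longleftrightarrow> (\<forall>\<alpha>. f \<alpha> \<noteq> 0 \<longrightarrow> Poly_Mapping.keys \<alpha> \<subseteq> {1..c})"
  by (simp add: series_ring_def)

lemma series_add: "f \<oplus>\<^bsub>series_ring c\<^esub> g = (\<lambda>\<alpha>. f \<alpha> + g \<alpha>)"
  by (simp add: series_ring_def)

lemma series_mult: "f \<otimes>\<^bsub>series_ring c\<^esub> g = (\<lambda>\<alpha>. \<Sum>(\<beta>, \<delta>) | \<beta> + \<delta> = \<alpha>. f \<beta> * g \<delta>)"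
  by (simp add: series_ring_def)

lemma lookup_in_series: "p \<in> polys_in {1..c} \<Longrightarrow> Poly_Mapping.lookup p \<in> series c"
  by (auto simp: series_iff dest: polys_in_lookup)

lemma series_single_mult:
  "(Poly_Mapping.lookup (Poly_Mapping.single \<beta> a) \<otimes>\<^bsub>series_ring c\<^esub> f) \<alpha> =
    (if \<exists>\<delta>. \<alpha> = \<beta> + \<delta> then a * f (\<alpha> - \<beta>) else 0)"
proof -
  have "(Poly_Mapping.lookup (Poly_Mapping.single \<beta> a) \<otimes>\<^bsub>series_ring c\<^esub> f) \<alpha>
    = (\<Sum>(\<mu>, \<delta>)\<in>{(\<mu>, \<delta>). \<mu> + \<delta> = \<alpha>} \<inter> {(\<beta>, \<alpha> - \<beta>)}. a * f (\<alpha> - \<beta>))"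
    unfolding series_mult
    by (rule sum.mono_neutral_cong_right) (auto simp: finite_splits lookup_single when_def split: if_splits)
  also have "{(\<mu>, \<delta>). \<mu> + \<delta> = \<alpha>} \<inter> {(\<beta>, \<alpha> - \<beta>)} = (if \<exists>\<delta>. \<alpha> = \<beta> + \<delta> then {(\<beta>, \<alpha> - \<beta>)} else {})"
    by auto (metis)
  finally show ?thesis by auto
qed

lemma series_const_mult:
  "Poly_Mapping.lookup (mconst a) \<otimes>\<^bsub>series_ring c\<^esub> f = (\<lambda>\<alpha>. a * f \<alpha>)"
proof
  fix \<alpha> :: monom
  have ex: "\<exists>\<delta>. \<alpha> = 0 + \<delta>" by (metis add_0)
  show "(Poly_Mapping.lookup (mconst a) \<otimes>\<^bsub>series_ring c\<^esub> f) \<alpha> = a * f \<alpha>"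
    unfolding mconst_def series_single_mult if_P[OF ex] diff_zero ..
qed

lemma series_var_mult: "Poly_Mapping.lookup (mvar i) \<otimes>\<^bsub>series_ring c\<^esub> f = shift i f"
proof
  fix \<alpha> :: monom
  have "(\<exists>\<delta>. \<alpha> = evar i + \<delta>) \<longleftrightarrow> Poly_Mapping.lookup \<alpha> i \<noteq> 0"
  proof
    show "Poly_Mapping.lookup \<alpha> i \<noteq> 0" if "\<exists>\<delta>. \<alpha> = evar i + \<delta>"
      using that by (auto simp: lookup_add lookup_evar)
    assume "Poly_Mapping.lookup \<alpha> i \<noteq> 0"
    then have "\<alpha> = evar i + (\<alpha> - evar i)" using monom_diff_evar[of \<alpha> i] by (simp add: add.commute)
    then show "\<exists>\<delta>. \<alpha> = evar i + \<delta>" ..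
  qed
  then show "(Poly_Mapping.lookup (mvar i) \<otimes>\<^bsub>series_ring c\<^esub> f) \<alpha> = shift i f \<alpha>"
    unfolding mvar_def evar_def[symmetric] series_single_mult shift_def by auto
qed

lemma sspace_series: "sspace (series c)"
  unfolding sspace_def
proof (intro conjI ballI allI)
  fix f g :: "'a mseries"
  assume f: "f \<in> series c"
  then show "(\<lambda>\<alpha>. a * f \<alpha>) \<in> series c" for a by (simp add: series_iff)
  assume "g \<in> series c"
  then have "Poly_Mapping.keys \<alpha> \<subseteq> {1..c}" if "f \<alpha> + g \<alpha> \<noteq> 0" for \<alpha>
    using f that unfolding series_iff by (metis add_0)
  then show "(\<lambda>\<alpha>. f \<alpha> + g \<alpha>) \<in> series c" by (simp add: series_iff)
qed (simp add: series_iff)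

lemma coefficient_space_series: "CHAR('f::field) = 0 \<Longrightarrow> coefficient_space c (series c :: 'f mseries set)"
proof
  show "Poly_Mapping.lookup ` polys_in {1..c} \<subseteq> (series c :: 'f mseries set)"
    using lookup_in_series by blast
  show "Poly_Mapping.keys \<alpha> \<subseteq> {1..c}" if "f \<in> series c" "f \<alpha> \<noteq> 0" for f :: "'f mseries" and \<alpha>
    using that by (simp add: series_iff)
qed (auto simp: sspace_series)

lemma coefficient_space_polys:
  assumes "CHAR('f::field) = 0"
  shows "coefficient_space c (Poly_Mapping.lookup ` polys_in {1..c} :: 'f mseries set)"
proof
  show "sspace (Poly_Mapping.lookup ` polys_in {1..c} :: 'f mseries set)"
    unfolding sspace_def
  proof (intro conjI ballI allI)
    show "(\<lambda>_. 0) \<in> Poly_Mapping.lookup ` (polys_in {1..c} :: 'f mpoly set)"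
      by (rule image_eqI[of _ _ 0]) auto
    fix f a assume "f \<in> Poly_Mapping.lookup ` (polys_in {1..c} :: 'f mpoly set)"
    then obtain p where p: "p \<in> polys_in {1..c}" "f = Poly_Mapping.lookup p" by blast
    show "(\<lambda>\<alpha>. a * f \<alpha>) \<in> Poly_Mapping.lookup ` (polys_in {1..c} :: 'f mpoly set)"
      by (rule image_eqI[of _ _ "mscale a p"]) (auto simp: p polys_in_mscale)
    fix g assume "g \<in> Poly_Mapping.lookup ` (polys_in {1..c} :: 'f mpoly set)"
    then obtain q where q: "q \<in> polys_in {1..c}" "g = Poly_Mapping.lookup q" by blast
    show "(\<lambda>\<alpha>. f \<alpha> + g \<alpha>) \<in> Poly_Mapping.lookup ` (polys_in {1..c} :: 'f mpoly set)"
      by (rule image_eqI[of _ _ "p + q"]) (auto simp: p q polys_in_add lookup_add)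
  qed
  show "Poly_Mapping.keys \<alpha> \<subseteq> {1..c}"
    if "f \<in> Poly_Mapping.lookup ` (polys_in {1..c} :: 'f mpoly set)" "f \<alpha> \<noteq> 0" for f \<alpha>
    using that polys_in_lookup by blast
qed (use assms in auto)

lemma series_idealD:
  assumes "ideal J (series_ring c)"
  shows "J \<subseteq> series c" "sspace J" "shift_closed c J"
    "g \<in> series c \<Longrightarrow> f \<in> J \<Longrightarrow> g \<otimes>\<^bsub>series_ring c\<^esub> f \<in> J"
proof -
  interpret ideal J "series_ring c" by fact
  show "J \<subseteq> series c" by (rule a_subset)
  show mult: "g \<otimes>\<^bsub>series_ring c\<^esub> f \<in> J" if "g \<in> series c" "f \<in> J" for f g
    using I_l_closed that by blast
  show "sspace J"
    unfolding sspace_def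
  proof (intro conjI ballI allI)
    show "(\<lambda>_. 0) \<in> J"
      using additive_subgroup.zero_closed[OF is_additive_subgroup] by (simp add: series_ring_def)
    show "(\<lambda>\<alpha>. f \<alpha> + g \<alpha>) \<in> J" if "f \<in> J" "g \<in> J" for f g
      using additive_subgroup.a_closed[OF is_additive_subgroup that] by (simp add: series_ring_def)
    show "(\<lambda>\<alpha>. a * f \<alpha>) \<in> J" if "f \<in> J" for f a
      using mult[of "Poly_Mapping.lookup (mconst a)" f] that
      by (simp add: series_const_mult lookup_in_series)
  qed
  show "shift_closed c J"
    unfolding shift_closed_def
  proof (intro ballI)
    fix f i assume "f \<in> J" "i \<in> {1..c}"
    then show "shift i f \<in> J"
      using mult[of "Poly_Mapping.lookup (mvar i)" f]
      by (simp add: series_var_mult lookup_in_series polys_in_var)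
  qed
qed

lemma series_idealI:
  fixes J :: "'f::field mseries set"
  assumes J: "J \<subseteq> series c" "sspace J"
    and mult: "\<And>f g. f \<in> J \<Longrightarrow> g \<in> series c \<Longrightarrow> g \<otimes>\<^bsub>series_ring c\<^esub> f \<in> J"
  shows "ideal J (series_ring c)"
proof -
  interpret cring "series_ring c :: 'f mseries ring" by (rule cring_series_ring)
  show ?thesis
  proof (rule idealI)
    show "subgroup J (add_monoid (series_ring c))"
    proof
      fix f assume f: "f \<in> J"
      have "(\<lambda>\<alpha>. - f \<alpha>) \<in> J" using sspaceD(3)[OF J(2) f, of "- 1"] by simp
      moreover have "\<ominus>\<^bsub>series_ring c\<^esub> f = (\<lambda>\<alpha>. - f \<alpha>)"
        using f J(1) calculation
        by (intro sum_zero_eq_neg[symmetric]) (auto simp: series_ring_def)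
      ultimately show "inv\<^bsub>add_monoid (series_ring c)\<^esub> f \<in> J" by (simp add: a_inv_def)
    qed (use J sspaceD[OF J(2)] in \<open>auto simp: series_ring_def\<close>)
    fix f g :: "'f mseries" assume "f \<in> J" "g \<in> series c"
    then show "g \<otimes>\<^bsub>series_ring c\<^esub> f \<in> J" "f \<otimes>\<^bsub>series_ring c\<^esub> g \<in> J"
      using mult[of f g] J(1) m_comm[of f g] by auto
  qed (rule ring_axioms)
qed

lemma shift_closed_series: "shift_closed c (series c :: 'f::field mseries set)"
proof -
  have "shift i f \<in> series c" if "f \<in> series c" "i \<in> {1..c}" for f :: "'f mseries" and i
    using series_mult_closed[of "Poly_Mapping.lookup (mvar i)" c f] that
    by (simp add: series_var_mult lookup_in_series polys_in_var)
  then show ?thesis by (simp add: shift_closed_def)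
qed

text \<open>
  Stability under the variables gives stability under multiplication by polynomials.  A power series
  is a polynomial plus a tail of order at least \<open>N\<close>, and products with such a tail are annihilated
  anyway.
\<close>

lemma series_ideal_annihilator:
  fixes V :: "'f::field mpoly set"
  assumes "CHAR('f) = 0" "deriv_closed c V"
    and bound: "\<And>F. F \<in> V \<Longrightarrow> Poly_Mapping.keys F \<subseteq> monoms c N"
  shows "ideal (coefficient_space.annihilator (series c) V) (series_ring c)"
proof -
  interpret coefficient_space c "series c :: 'f mseries set"
    by (rule coefficient_space_series[OF assms(1)])
  let ?J = "annihilator V"
  have shift: "shift_closed c ?J"
    by (rule shift_closed_annihilator[OF shift_closed_series assms(2)])
  show ?thesis
  proof (rule series_idealI)
    show "?J \<subseteq> series c" by (auto simp: annihilator_def)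
    show "sspace ?J" by (rule sspace_annihilator)
    fix f g :: "'f mseries" assume f: "f \<in> ?J" and g: "g \<in> series c"
    have fU: "f \<in> series c" using f by (simp add: annihilator_def)
    let ?m = "\<lambda>g. g \<otimes>\<^bsub>series_ring c\<^esub> f"
    have poly: "?m (Poly_Mapping.lookup p) \<in> ?J" if "p \<in> polys_in {1..c}" for p
      using that
    proof (induction p rule: polys_in_induct)
      case (const a)
      show ?case using sspaceD(3)[OF sspace_annihilator f] by (simp add: series_const_mult)
    next
      case (add p q)
      have "?m (Poly_Mapping.lookup (p + q)) = (\<lambda>\<alpha>. ?m (Poly_Mapping.lookup p) \<alpha> + ?m (Poly_Mapping.lookup q) \<alpha>)"
        unfolding series_mult lookup_add distrib_right case_prod_beta sum.distrib ..
      then show ?case using sspaceD(2)[OF sspace_annihilator add(3,4)] by simp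
    next
      case (var i p)
      interpret S: cring "series_ring c :: 'f mseries ring" by (rule cring_series_ring)
      have "?m (Poly_Mapping.lookup (mvar i * p)) = ?m (Poly_Mapping.lookup (mvar i) \<otimes>\<^bsub>series_ring c\<^esub> Poly_Mapping.lookup p)"
        by (simp add: lookup_mvar_mult series_var_mult)
      also have "\<dots> = shift i (?m (Poly_Mapping.lookup p))"
        using var fU by (subst S.m_assoc) (auto simp: lookup_in_series polys_in_var series_var_mult)
      finally show ?case using shift var by (simp add: shift_closed_def)
    qed
    let ?t = "\<lambda>\<alpha>. g \<alpha> - Poly_Mapping.lookup (trunc c N g) \<alpha>"
    have t: "?t \<in> tails N" by (rule diff_trunc[OF g])
    have "?m ?t \<in> tails N"
    proof -
      have "(\<Sum>(\<beta>, \<delta>) | \<beta> + \<delta> = \<alpha>. ?t \<beta> * f \<delta>) = 0" if "mdeg \<alpha> < N" for \<alpha>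
      proof (intro sum.neutral ballI, clarify)
        fix \<beta> \<delta> assume "\<alpha> = \<beta> + \<delta>"
        then have "mdeg \<beta> < N" using that by simp
        then show "?t \<beta> * f \<delta> = 0" using t by (simp add: tails_def)
      qed
      moreover have "?m ?t \<in> series c"
        using t fU by (intro series_mult_closed) (auto simp: tails_def)
      ultimately show ?thesis by (simp add: tails_def series_mult)
    qed
    then have "?m ?t \<in> ?J" using tails_annihilator[of V N] bound by blast
    moreover have "?m g = (\<lambda>\<alpha>. ?m (Poly_Mapping.lookup (trunc c N g)) \<alpha> + ?m ?t \<alpha>)"
      by (simp add: series_mult case_prod_beta left_diff_distrib flip: sum.distrib)
    ultimately show "?m g \<in> ?J"
      using sspaceD(2)[OF sspace_annihilator poly[OF polys_in_trunc]] by simp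
  qed
qed

section \<open>Ideals of finite colength in the power series ring\<close>

text \<open>The exchange argument for a flag: use the last vector of the flag as a pivot and eliminate it.\<close>

lemma flag_dependent:
  fixes v :: "nat \<Rightarrow> 'f::field mseries"
  assumes "flag I k E" "sspace I" "finite A" "k < card A" "\<And>j. j \<in> A \<Longrightarrow> v j \<in> E"
  shows "\<exists>a. (\<exists>j\<in>A. a j \<noteq> 0) \<and> (\<lambda>\<alpha>. \<Sum>j\<in>A. a j * v j \<alpha>) \<in> I"
  using assms
proof (induction arbitrary: A v)
  case zero
  then obtain p where p: "p \<in> A" by (metis card.empty all_not_in_conv less_irrefl)
  have "(\<lambda>\<alpha>. \<Sum>j\<in>A. (if j = p then 1 else 0) * v j \<alpha>) = v p"
    using p zero(2) by (simp add: if_distrib[where f = "\<lambda>x. x * _"] cong: if_cong)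
  then show ?case using p zero(4) by (intro exI[of _ "\<lambda>j. if j = p then 1 else 0"]) auto
next
  case (Suc k E w)
  have "\<forall>j\<in>A. \<exists>e b. e \<in> E \<and> v j = (\<lambda>\<alpha>. e \<alpha> + b * w \<alpha>)"
    using Suc(7) unfolding add_line_def by blast
  then obtain e b where eb: "\<And>j. j \<in> A \<Longrightarrow> e j \<in> E" "\<And>j. j \<in> A \<Longrightarrow> v j = (\<lambda>\<alpha>. e j \<alpha> + b j * w \<alpha>)"
    by metis
  note sE = flag_sspace[OF Suc(1) Suc(4)]
  show ?case
  proof (cases "\<forall>j\<in>A. b j = 0")
    case True
    then have "v j \<in> E" if "j \<in> A" for j using eb[OF that] that by simp
    then show ?thesis using Suc(3)[of A v] Suc(4,5,6) by simp
  next
    case False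
    then obtain p where p: "p \<in> A" "b p \<noteq> 0" by blast
    let ?A = "A - {p}"
    \<comment> \<open>subtract multiples of the pivot vector so that the \<open>w\<close>-components disappear\<close>
    let ?u = "\<lambda>j \<alpha>. v j \<alpha> + - (b j / b p) * v p \<alpha>"
    have u: "?u j = (\<lambda>\<alpha>. e j \<alpha> + - (b j / b p) * e p \<alpha>)" if "j \<in> A" for j
    proof
      fix \<alpha>
      show "v j \<alpha> + - (b j / b p) * v p \<alpha> = e j \<alpha> + - (b j / b p) * e p \<alpha>"
        unfolding eb(2)[OF that] eb(2)[OF p(1)] by (simp add: distrib_left p(2))
    qed
    have "?u j \<in> E" if "j \<in> ?A" for j
    proof -
      have j: "j \<in> A" using that by blast
      show ?thesis
        unfolding u[OF j] by (rule sspaceD(2)[OF sE(1) eb(1)[OF j] sspaceD(3)[OF sE(1) eb(1)[OF p(1)]]])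
    qed
    moreover have "finite ?A" "k < card ?A" using Suc(5,6) p(1) by auto
    ultimately obtain a where a: "\<exists>j\<in>?A. a j \<noteq> 0" "(\<lambda>\<alpha>. \<Sum>j\<in>?A. a j * ?u j \<alpha>) \<in> I"
      using Suc(3)[of ?A ?u] Suc(4) by blast
    define a' where "a' j = (if j = p then - (\<Sum>j\<in>?A. a j * (b j / b p)) else a j)" for j
    have "(\<Sum>j\<in>A. a' j * v j \<alpha>) = (\<Sum>j\<in>?A. a j * ?u j \<alpha>)" for \<alpha>
    proof -
      have "(\<Sum>j\<in>A. a' j * v j \<alpha>) = a' p * v p \<alpha> + (\<Sum>j\<in>?A. a' j * v j \<alpha>)"
        using Suc(5) p(1) by (rule sum.remove)
      also have "(\<Sum>j\<in>?A. a' j * v j \<alpha>) = (\<Sum>j\<in>?A. a j * v j \<alpha>)"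
        by (rule sum.cong) (auto simp: a'_def)
      also have "a' p * v p \<alpha> = (\<Sum>j\<in>?A. a j * (- (b j / b p) * v p \<alpha>))"
        unfolding a'_def if_P[OF refl] sum_negf[symmetric] sum_distrib_right
        by (intro sum.cong) simp_all
      finally show ?thesis
        by (simp only: sum.distrib distrib_left add.commute)
    qed
    moreover have "\<exists>j\<in>A. a' j \<noteq> 0" using a(1) by (auto simp: a'_def)
    ultimately show ?thesis using a(2) by (intro exI[of _ a']) simp
  qed
qed

text \<open>
  Univariate power series in the variable \<open>i\<close>: through this embedding a series in one variable with
  nonzero constant term has an inverse.
\<close>

definition fps_embed :: "nat \<Rightarrow> 'f::field fps \<Rightarrow> 'f mseries" where
  "fps_embed i F = (\<lambda>\<alpha>. if Poly_Mapping.keys \<alpha> \<subseteq> {i} then fps_nth F (Poly_Mapping.lookup \<alpha> i) else 0)"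

lemma fps_embed_series: "i \<in> {1..c} \<Longrightarrow> fps_embed i F \<in> series c"
  by (auto simp: fps_embed_def series_iff split: if_splits)

lemma keys_subset_single_iff:
  "Poly_Mapping.keys (\<alpha>::monom) \<subseteq> {i} \<longleftrightarrow> \<alpha> = Poly_Mapping.single i (Poly_Mapping.lookup \<alpha> i)"
proof
  assume *: "Poly_Mapping.keys \<alpha> \<subseteq> {i}"
  show "\<alpha> = Poly_Mapping.single i (Poly_Mapping.lookup \<alpha> i)"
  proof (rule poly_mapping_eqI)
    fix j
    show "Poly_Mapping.lookup \<alpha> j = Poly_Mapping.lookup (Poly_Mapping.single i (Poly_Mapping.lookup \<alpha> i)) j"
      using * by (cases "j = i") (auto simp: lookup_single when_def in_keys_iff)
  qed
next
  assume *: "\<alpha> = Poly_Mapping.single i (Poly_Mapping.lookup \<alpha> i)"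
  have "Poly_Mapping.keys (Poly_Mapping.single i (Poly_Mapping.lookup \<alpha> i)) \<subseteq> {i}" by simp
  then show "Poly_Mapping.keys \<alpha> \<subseteq> {i}" using * by simp
qed

lemma fps_embed_mult: "fps_embed i (F * G) = fps_embed i F \<otimes>\<^bsub>series_ring c\<^esub> fps_embed i G"
proof
  fix \<alpha> :: monom
  let ?S = "{(\<beta>, \<delta>). \<beta> + \<delta> = \<alpha>}"
  show "fps_embed i (F * G) \<alpha> = (fps_embed i F \<otimes>\<^bsub>series_ring c\<^esub> fps_embed i G) \<alpha>"
  proof (cases "Poly_Mapping.keys \<alpha> \<subseteq> {i}")
    case True
    define k where "k = Poly_Mapping.lookup \<alpha> i"
    have \<alpha>: "\<alpha> = Poly_Mapping.single i k" using True by (simp add: keys_subset_single_iff k_def)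
    have sub: "Poly_Mapping.keys \<beta> \<subseteq> {i} \<and> Poly_Mapping.keys \<delta> \<subseteq> {i}" if "\<beta> + \<delta> = \<alpha>" for \<beta> \<delta>
      using that True by (auto simp: keys_plus_monom)
    have "(\<Sum>(\<beta>, \<delta>)\<in>?S. fps_embed i F \<beta> * fps_embed i G \<delta>) = (\<Sum>j\<in>{0..k}. fps_nth F j * fps_nth G (k - j))"
    proof (rule sum.reindex_bij_witness[where i = "\<lambda>j. (Poly_Mapping.single i j, Poly_Mapping.single i (k - j))"
          and j = "\<lambda>(\<beta>, \<delta>). Poly_Mapping.lookup \<beta> i"])
      fix x assume "x \<in> ?S"
      then obtain \<beta> \<delta> where x: "x = (\<beta>, \<delta>)" "\<beta> + \<delta> = \<alpha>" by auto
      have \<beta>\<delta>: "\<beta> = Poly_Mapping.single i (Poly_Mapping.lookup \<beta> i)" "\<delta> = Poly_Mapping.single i (Poly_Mapping.lookup \<delta> i)"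
        using sub[OF x(2)] keys_subset_single_iff by blast+
      have k: "k = Poly_Mapping.lookup \<beta> i + Poly_Mapping.lookup \<delta> i"
        using x(2) by (auto simp: k_def lookup_add)
      show "(case case x of (\<beta>, \<delta>) \<Rightarrow> Poly_Mapping.lookup \<beta> i of
          j \<Rightarrow> (Poly_Mapping.single i j, Poly_Mapping.single i (k - j))) = x"
        using \<beta>\<delta> by (simp add: x k)
      show "(case x of (\<beta>, \<delta>) \<Rightarrow> Poly_Mapping.lookup \<beta> i) \<in> {0..k}" by (simp add: x k)
      show "fps_nth F (case x of (\<beta>, \<delta>) \<Rightarrow> Poly_Mapping.lookup \<beta> i) *
          fps_nth G (k - (case x of (\<beta>, \<delta>) \<Rightarrow> Poly_Mapping.lookup \<beta> i)) =
        (case x of (\<beta>, \<delta>) \<Rightarrow> fps_embed i F \<beta> * fps_embed i G \<delta>)"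
        using sub[OF x(2)] by (simp add: x k fps_embed_def)
    next
      fix j assume "j \<in> {0..k}"
      then show "(Poly_Mapping.single i j, Poly_Mapping.single i (k - j)) \<in> ?S"
        by (simp add: \<alpha> flip: single_add)
    qed simp
    then show ?thesis using True by (simp add: series_mult fps_mult_nth fps_embed_def[of _ "F * G"] k_def)
  next
    case False
    have "fps_embed i F \<beta> * fps_embed i G \<delta> = 0" if "\<beta> + \<delta> = \<alpha>" for \<beta> \<delta>
      using False that by (auto simp: fps_embed_def keys_plus_monom)
    then have "(\<Sum>(\<beta>, \<delta>)\<in>?S. fps_embed i F \<beta> * fps_embed i G \<delta>) = 0"
      by (intro sum.neutral) auto
    then show ?thesis using False by (simp add: series_mult fps_embed_def[of _ "F * G"])
  qed
qed

lemma fps_embed_X_power: "fps_embed i (fps_X ^ k) = Poly_Mapping.lookup (Poly_Mapping.single (Poly_Mapping.single i k) 1)"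
proof
  fix \<alpha> :: monom
  show "fps_embed i (fps_X ^ k) \<alpha> = Poly_Mapping.lookup (Poly_Mapping.single (Poly_Mapping.single i k) 1) \<alpha>"
    using keys_subset_single_iff[of \<alpha> i]
    by (auto simp: fps_embed_def fps_X_power_nth lookup_single when_def)
qed

text \<open>
  Split off the part of \<open>f\<close> that is divisible by one of the monomials; this is possible for infinite
  sums since a power series may be divided by a monomial term by term.
\<close>

lemma series_ideal_monomials:
  fixes J :: "'f::field mseries set"
  assumes J: "ideal J (series_ring c)" and "finite B"
    and "\<And>\<beta>. \<beta> \<in> B \<Longrightarrow> Poly_Mapping.lookup (Poly_Mapping.single \<beta> 1) \<in> J"
    and "f \<in> series c" "\<And>\<alpha>. f \<alpha> \<noteq> 0 \<Longrightarrow> \<exists>\<beta>\<in>B. \<exists>\<delta>. \<alpha> = \<beta> + \<delta>"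
  shows "f \<in> J"
  using assms(2-)
proof (induction B arbitrary: f rule: finite_induct)
  case empty
  then have "f = (\<lambda>_. 0)" by auto
  then show ?case using sspaceD(1)[OF series_idealD(2)[OF J]] by simp
next
  case (insert \<beta> B)
  interpret S: cring "series_ring c :: 'f mseries ring" by (rule cring_series_ring)
  define g where "g \<delta> = f (\<beta> + \<delta>)" for \<delta>
  have g: "g \<in> series c"
  proof -
    have "Poly_Mapping.keys (\<beta> + \<delta>) \<subseteq> {1..c}" if "f (\<beta> + \<delta>) \<noteq> 0" for \<delta>
      using insert(5) that unfolding series_iff by blast
    then show ?thesis unfolding series_iff g_def keys_plus_monom by blast
  qed
  define f1 where "f1 = Poly_Mapping.lookup (Poly_Mapping.single \<beta> 1) \<otimes>\<^bsub>series_ring c\<^esub> g"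
  have f1J: "f1 \<in> J"
  proof -
    have "Poly_Mapping.lookup (Poly_Mapping.single \<beta> 1) \<in> J" using insert(4) by simp
    then have "g \<otimes>\<^bsub>series_ring c\<^esub> Poly_Mapping.lookup (Poly_Mapping.single \<beta> 1) \<in> J"
      using series_idealD(4)[OF J g] by blast
    moreover have "Poly_Mapping.lookup (Poly_Mapping.single \<beta> (1::'f)) \<in> series c"
      by (rule subsetD[OF series_idealD(1)[OF J] insert(4)[OF insertI1]])
    ultimately show ?thesis
      unfolding f1_def using S.m_comm[OF g] by simp
  qed
  have f1: "f1 \<alpha> = (if \<exists>\<delta>. \<alpha> = \<beta> + \<delta> then f \<alpha> else 0)" for \<alpha>
    by (auto simp: f1_def series_single_mult g_def)
  have "(\<lambda>\<alpha>. f \<alpha> - f1 \<alpha>) \<in> J"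
  proof (rule insert(3))
    show "(\<lambda>\<alpha>. f \<alpha> - f1 \<alpha>) \<in> series c"
      using f1J series_idealD(1)[OF J] insert(5) by (intro sspace_diff[OF sspace_series]) auto
    show "\<exists>\<beta>\<in>B. \<exists>\<delta>. \<alpha> = \<beta> + \<delta>" if "f \<alpha> - f1 \<alpha> \<noteq> 0" for \<alpha>
      using insert(6)[of \<alpha>] that f1[of \<alpha>] by (auto split: if_splits)
  qed (use insert(4) in auto)
  then show ?case
    using sspaceD(2)[OF series_idealD(2)[OF J] _ f1J, of "\<lambda>\<alpha>. f \<alpha> - f1 \<alpha>"] by simp
qed

abbreviation series_tails :: "nat \<Rightarrow> nat \<Rightarrow> 'f::field mseries set" where
  "series_tails c \<equiv> coefficient_space.tails (series c)"

lemma series_ideal_tails: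
  fixes J :: "'f::field mseries set"
  assumes char: "CHAR('f) = 0" and J: "ideal J (series_ring c)"
    and vars: "\<And>i. i \<in> {1..c} \<Longrightarrow> Poly_Mapping.lookup (Poly_Mapping.single (Poly_Mapping.single i k) 1) \<in> J"
  shows "series_tails c (Suc (c * k)) \<subseteq> J"
proof
  interpret coefficient_space c "series c :: 'f mseries set"
    by (rule coefficient_space_series[OF char])
  fix f :: "'f mseries" assume f: "f \<in> tails (Suc (c * k))"
  show "f \<in> J"
  proof (rule series_ideal_monomials[OF J, of "(\<lambda>i. Poly_Mapping.single i k) ` {1..c}"])
    fix \<alpha> assume \<alpha>: "f \<alpha> \<noteq> 0"
    have "Poly_Mapping.keys \<alpha> \<subseteq> {1..c}" "c * k < mdeg \<alpha>"
      using f \<alpha> by (auto simp: tails_def series_iff not_less_eq)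
    then obtain i where i: "i \<in> {1..c}" "k \<le> Poly_Mapping.lookup \<alpha> i"
      using large_monom_exponent by blast
    have "\<alpha> = Poly_Mapping.single i k + (\<alpha> - Poly_Mapping.single i k)"
      using i(2) by (auto simp: monom_eq_iff lookup_add lookup_minus lookup_single when_def)
    then show "\<exists>\<beta>\<in>(\<lambda>i. Poly_Mapping.single i k) ` {1..c}. \<exists>\<delta>. \<alpha> = \<beta> + \<delta>" using i(1) by blast
  qed (use f vars in \<open>auto simp: tails_def\<close>)
qed

text \<open>
  Among \<open>1, y\<^sub>i, \<dots>, y\<^sub>i\<^sup>m\<close> there is a linear relation modulo \<open>J\<close>.  It is a power of \<open>y\<^sub>i\<close> times a unit
  of the power series ring, so \<open>J\<close> contains \<open>y\<^sub>i\<^sup>m\<close>.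
\<close>

lemma finite_colength_tails:
  fixes J :: "'f::field mseries set"
  assumes char: "CHAR('f) = 0" and J: "ideal J (series_ring c)" and flag: "flag J m (series c)"
  shows "series_tails c (Suc (c * m)) \<subseteq> J"
proof (rule series_ideal_tails[OF char J])
  fix i assume i: "i \<in> {1..c}"
  let ?v = "\<lambda>j. fps_embed i (fps_X ^ j) :: 'f mseries"
  obtain a where a: "\<exists>j\<in>{..m}. a j \<noteq> 0" "(\<lambda>\<alpha>. \<Sum>j\<in>{..m}. a j * ?v j \<alpha>) \<in> J"
    using flag_dependent[OF flag series_idealD(2)[OF J], of "{..m}" ?v] fps_embed_series[OF i] by auto
  define F where "F = Abs_fps (\<lambda>j. if j \<le> m then a j else 0)"
  have "fps_embed i F = (\<lambda>\<alpha>. \<Sum>j\<in>{..m}. a j * ?v j \<alpha>)"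
  proof
    fix \<alpha> :: monom
    show "fps_embed i F \<alpha> = (\<Sum>j\<in>{..m}. a j * ?v j \<alpha>)"
    proof (cases "Poly_Mapping.keys \<alpha> \<subseteq> {i}")
      case True
      then have "(\<Sum>j\<in>{..m}. a j * ?v j \<alpha>) = (\<Sum>j\<in>{..m}. if j = Poly_Mapping.lookup \<alpha> i then a j else 0)"
        by (intro sum.cong) (auto simp: fps_embed_def fps_X_power_nth)
      then show ?thesis using True by (simp add: fps_embed_def F_def)
    qed (simp add: fps_embed_def)
  qed
  with a(2) have FJ: "fps_embed i F \<in> J" by simp
  obtain j0 where j0: "j0 \<le> m" "a j0 \<noteq> 0" using a(1) by auto
  then have F0: "F \<noteq> 0" by (auto simp: F_def fps_eq_iff)
  have sub: "subdegree F \<le> m"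
    using j0 by (intro subdegree_leI[THEN order_trans, of F j0]) (auto simp: F_def)
  define G where "G = inverse (fps_shift (subdegree F) F)"
  have "fps_nth (fps_shift (subdegree F) F) 0 \<noteq> 0" using F0 by simp
  then have "G * fps_shift (subdegree F) F = 1" unfolding G_def by (rule inverse_mult_eq_1)
  then have "G * F = fps_X ^ subdegree F"
    by (subst subdegree_decompose) (simp flip: mult.assoc)
  then have "fps_X ^ (m - subdegree F) * G * F = fps_X ^ m"
    using sub by (simp add: mult.assoc flip: power_add)
  moreover have "fps_embed i (fps_X ^ (m - subdegree F) * G) \<otimes>\<^bsub>series_ring c\<^esub> fps_embed i F \<in> J"
    using series_idealD(4)[OF J fps_embed_series[OF i] FJ] .
  ultimately have "fps_embed i (fps_X ^ m) \<in> J" by (simp flip: fps_embed_mult)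
  then show "Poly_Mapping.lookup (Poly_Mapping.single (Poly_Mapping.single i m) 1) \<in> J"
    by (simp add: fps_embed_X_power)
qed

section \<open>Inverse systems\<close>

lemma inverse_systems_iff:
  "V \<in> inverse_systems c m \<longleftrightarrow>
    V \<subseteq> polys_in {1..c} \<and> mspace.subspace V \<and> mspace.dim V = m \<and> deriv_closed c V"
  by (auto simp: inverse_systems_def deriv_closed_def)

lemma finite_dim_bounded:
  fixes V :: "'f::field mpoly set"
  assumes "V \<subseteq> polys_in {1..c}" "mspace.dim V \<noteq> 0"
  obtains N where "\<And>F. F \<in> V \<Longrightarrow> Poly_Mapping.keys F \<subseteq> monoms c N"
proof -
  obtain B where B: "B \<subseteq> V" "V \<subseteq> mspace.span B" "card B = mspace.dim V"
    by (rule mspace.basis_exists)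
  have fin: "finite B" using assms(2) B(3) by (metis card.infinite)
  have "\<exists>N. Poly_Mapping.keys F \<subseteq> monoms c N" if "F \<in> B" for F
    by (rule keys_bounded) (use that B(1) assms(1) in blast)
  then obtain N where N: "\<And>F. F \<in> B \<Longrightarrow> Poly_Mapping.keys F \<subseteq> monoms c (N F)" by metis
  define M where "M = Max (insert 0 (N ` B))"
  have NM: "N F \<le> M" if "F \<in> B" for F using that fin by (simp add: M_def)
  have BM: "B \<subseteq> {F. Poly_Mapping.keys F \<subseteq> monoms c M}"
  proof
    fix F assume F: "F \<in> B"
    show "F \<in> {F. Poly_Mapping.keys F \<subseteq> monoms c M}"
      using N[OF F] monoms_mono[of "N F" M c] NM[OF F] by blast
  qed
  have "mspace.subspace {F :: 'f mpoly. Poly_Mapping.keys F \<subseteq> monoms c M}"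
    unfolding mspace.subspace_def
  proof (intro conjI ballI allI CollectI)
    fix F G :: "'f mpoly" and a
    assume F: "F \<in> {F. Poly_Mapping.keys F \<subseteq> monoms c M}"
    have "Poly_Mapping.keys (mscale a F) \<subseteq> Poly_Mapping.keys F"
      by (auto simp: in_keys_iff[of _ "mscale a F"] in_keys_iff[of _ F])
    with F show "Poly_Mapping.keys (mscale a F) \<subseteq> monoms c M" by blast
    assume "G \<in> {F. Poly_Mapping.keys F \<subseteq> monoms c M}"
    then show "Poly_Mapping.keys (F + G) \<subseteq> monoms c M"
      using F keys_add[of F G] by blast
  qed simp
  then have "mspace.span B \<subseteq> {F. Poly_Mapping.keys F \<subseteq> monoms c M}"
    using BM by (intro mspace.span_minimal)
  then show thesis using that[of M] B(2) by blast
qed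

lemma has_colength_series_iff:
  fixes J :: "'f::field mseries set"
  assumes "ideal J (series_ring c)"
  shows "has_colength (series_ring c) (\<lambda>a. Poly_Mapping.lookup (mconst a)) J m \<longleftrightarrow> flag J m (series c)"
  using has_colength_iff_flag[OF cring_series_ring assms, of "\<lambda>f. f" "\<lambda>a. Poly_Mapping.lookup (mconst a)" m]
  by (simp add: series_add series_const_mult lookup_in_series)

lemma has_colength_poly_iff:
  fixes I :: "'f::field mpoly set"
  assumes "ideal_in (polys_in {1..c}) I"
  shows "has_colength (poly_ring c) mconst I m \<longleftrightarrow>
    flag (Poly_Mapping.lookup ` I) m (Poly_Mapping.lookup ` polys_in {1..c})"
proof -
  have "ideal I (poly_ring c)"
    using assms by (simp add: poly_ring_def ideal_ring_on_iff[OF is_subring_polys_in])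
  then show ?thesis
    using has_colength_iff_flag[OF cring_poly_ring, of I c Poly_Mapping.lookup mconst m]
    by (simp add: poly_ring_def lookup_mconst_mult lookup_add fun_eq_iff inj_on_def poly_mapping_eq_iff)
qed

text \<open>
  From here on, colength is the dimension of the orthogonal space, for power series and, in
  \<open>hilb_poly_iff\<close>, for polynomials.
\<close>

lemma hilb_series_iff:
  fixes J :: "'f::field mseries set"
  assumes char: "CHAR('f) = 0"
  shows "J \<in> hilb_series c m \<longleftrightarrow> ideal J (series_ring c) \<and> (\<exists>N. series_tails c N \<subseteq> J) \<and> mspace.dim (orth c J) = m"
proof -
  interpret coefficient_space c "series c :: 'f mseries set"
    by (rule coefficient_space_series[OF char])
  have "has_colength (series_ring c) (\<lambda>a. Poly_Mapping.lookup (mconst a)) J m \<longleftrightarrow>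
      (\<exists>N. tails N \<subseteq> J) \<and> mspace.dim (orth c J) = m" if J: "ideal J (series_ring c)"
    using finite_colength_tails[OF char J] flag_iff_dim_orth[OF series_idealD(2)[OF J] _ series_idealD(1)[OF J]]
    unfolding has_colength_series_iff[OF J] by blast
  then show ?thesis unfolding hilb_series_def by blast
qed

lemma sspace_lookup_ideal:
  fixes I :: "'f::field mpoly set"
  assumes I: "ideal_in (polys_in {1..c}) I"
  shows "sspace (Poly_Mapping.lookup ` I)" "shift_closed c (Poly_Mapping.lookup ` I)"
    "Poly_Mapping.lookup ` I \<subseteq> Poly_Mapping.lookup ` polys_in {1..c}"
proof -
  show "sspace (Poly_Mapping.lookup ` I)"
    unfolding sspace_def
  proof (intro conjI ballI allI)
    show "(\<lambda>_. 0) \<in> Poly_Mapping.lookup ` I"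
      by (rule image_eqI[OF _ ideal_inD(2)[OF I]]) auto
    fix f a assume "f \<in> Poly_Mapping.lookup ` I"
    then obtain p where p: "p \<in> I" "f = Poly_Mapping.lookup p" by blast
    show "(\<lambda>\<alpha>. a * f \<alpha>) \<in> Poly_Mapping.lookup ` I"
      by (rule image_eqI[OF _ ideal_inD(4)[OF I polys_in_const p(1), of a]]) (simp add: p fun_eq_iff lookup_mconst_mult)
    fix g assume "g \<in> Poly_Mapping.lookup ` I"
    then obtain q where q: "q \<in> I" "g = Poly_Mapping.lookup q" by blast
    show "(\<lambda>\<alpha>. f \<alpha> + g \<alpha>) \<in> Poly_Mapping.lookup ` I"
      by (rule image_eqI[OF _ ideal_inD(3)[OF I p(1) q(1)]]) (simp add: p q fun_eq_iff lookup_add)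
  qed
  show "shift_closed c (Poly_Mapping.lookup ` I)"
    unfolding shift_closed_def
    using ideal_inD(4)[OF I polys_in_var] by (auto simp flip: lookup_mvar_mult)
  show "Poly_Mapping.lookup ` I \<subseteq> Poly_Mapping.lookup ` polys_in {1..c}"
    using ideal_inD(1)[OF I] by (rule image_mono)
qed

abbreviation poly_tails :: "nat \<Rightarrow> nat \<Rightarrow> 'f::field mseries set" where
  "poly_tails c \<equiv> coefficient_space.tails (Poly_Mapping.lookup ` polys_in {1..c})"

lemma poly_tails_eq:
  assumes "CHAR('f::field) = 0"
  shows "poly_tails c N = Poly_Mapping.lookup ` (order_ge c N :: 'f mpoly set)"
proof -
  interpret coefficient_space c "Poly_Mapping.lookup ` polys_in {1..c} :: 'f mseries set"
    by (rule coefficient_space_polys[OF assms])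
  show ?thesis
    unfolding tails_def order_ge_def by (auto simp: not_le image_iff) (metis not_le)
qed

lemma lookup_image_mono_iff: "Poly_Mapping.lookup ` A \<subseteq> Poly_Mapping.lookup ` B \<longleftrightarrow> A \<subseteq> B"
  by (auto simp: poly_mapping_eq_iff[symmetric])

lemma flag_poly_iff:
  fixes I :: "'f::field mpoly set"
  assumes char: "CHAR('f) = 0" and I: "ideal_in (polys_in {1..c}) I" "order_ge c N \<subseteq> I"
  shows "flag (Poly_Mapping.lookup ` I) m (Poly_Mapping.lookup ` polys_in {1..c}) \<longleftrightarrow>
    mspace.dim (orth c (Poly_Mapping.lookup ` I)) = m"
proof -
  interpret coefficient_space c "Poly_Mapping.lookup ` polys_in {1..c} :: 'f mseries set"
    by (rule coefficient_space_polys[OF char])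
  show ?thesis
    by (rule flag_iff_dim_orth[of _ N])
      (use sspace_lookup_ideal[OF I(1)] I(2) in \<open>simp_all add: poly_tails_eq[OF char] lookup_image_mono_iff\<close>)
qed

lemma hilb_poly_iff:
  fixes I :: "'f::field mpoly set"
  assumes char: "CHAR('f) = 0"
  shows "I \<in> hilb_poly c m \<longleftrightarrow> ideal_in (polys_in {1..c}) I \<and> I \<subseteq> order_ge c 1 \<and>
    (\<exists>N. order_ge c N \<subseteq> I) \<and> mspace.dim (orth c (Poly_Mapping.lookup ` I)) = m"
  using flag_poly_iff[OF char, of c I _ m] has_colength_poly_iff[of c I m]
  unfolding hilb_poly_def primary_to_origin_iff by blast

lemma annihilator_lookup_ideal:
  fixes I :: "'f::field mpoly set"
  assumes char: "CHAR('f) = 0" and I: "ideal_in (polys_in {1..c}) I" "order_ge c N \<subseteq> I"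
    and p: "p \<in> polys_in {1..c}"
  shows "p \<in> I \<longleftrightarrow> (\<forall>F\<in>orth c (Poly_Mapping.lookup ` I). pair (Poly_Mapping.lookup p) F = 0)"
proof -
  interpret coefficient_space c "Poly_Mapping.lookup ` polys_in {1..c} :: 'f mseries set"
    by (rule coefficient_space_polys[OF char])
  have "annihilator (orth c (Poly_Mapping.lookup ` I)) = Poly_Mapping.lookup ` I"
    by (rule annihilator_orth[of _ N])
      (use sspace_lookup_ideal[OF I(1)] I(2) in \<open>simp_all add: poly_tails_eq[OF char] lookup_image_mono_iff\<close>)
  moreover have "Poly_Mapping.lookup p \<in> Poly_Mapping.lookup ` I \<longleftrightarrow> p \<in> I"
    by (auto simp: poly_mapping_eq_iff[symmetric])
  ultimately show ?thesis using p unfolding annihilator_def by blast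
qed

lemma ann_eq_annihilator:
  fixes V :: "'f::field mpoly set"
  assumes char: "CHAR('f) = 0" and V: "V \<subseteq> polys_in {1..c}" "0 \<in> V" "deriv_closed c V"
  shows "ann c V = coefficient_space.annihilator (series c) V"
proof -
  interpret coefficient_space c "series c :: 'f mseries set"
    by (rule coefficient_space_series[OF char])
  have "(\<forall>F\<in>V. series_act f F = 0) \<longleftrightarrow> (\<forall>F\<in>V. pair f F = 0)" for f
  proof
    assume *: "\<forall>F\<in>V. series_act f F = 0"
    show "\<forall>F\<in>V. pair f F = 0"
    proof
      fix F assume "F \<in> V"
      then have "pair f (mderivs 0 F) = 0" using * series_act_eq_0_iff[OF char] by blast
      then show "pair f F = 0" by simp
    qed
  next
    assume "\<forall>F\<in>V. pair f F = 0"
    then show "\<forall>F\<in>V. series_act f F = 0"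
      using deriv_closed_mderivs[OF V(3,1,2)] series_act_eq_0_iff[OF char] by blast
  qed
  then show ?thesis by (simp add: ann_def annihilator_def)
qed

text \<open>An ideal is stable under the variables, so its orthogonal space is stable under their adjoints.\<close>

lemma perp_hilb_series:
  fixes J :: "'f::field mseries set"
  assumes char: "CHAR('f) = 0" and J: "J \<in> hilb_series c m"
  shows "perp c J = orth c J" "orth c J \<in> inverse_systems c m"
    "ann c (orth c J) = J" 
proof -
  interpret coefficient_space c "series c :: 'f mseries set"
    by (rule coefficient_space_series[OF char])
  obtain N where N: "ideal J (series_ring c)" "tails N \<subseteq> J" "mspace.dim (orth c J) = m"
    using J unfolding hilb_series_iff[OF char] by blast
  have closed: "deriv_closed c (orth c J)"
    by (rule deriv_closed_orth[OF series_idealD(3)[OF N(1)]])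
  show "perp c J = orth c J" by (rule perp_eq_orth[OF char closed])
  have sub: "orth c J \<subseteq> polys_in {1..c}" "0 \<in> orth c J"
    using subspace_orth[of c J] by (auto simp: orth_def mspace.subspace_def)
  show "orth c J \<in> inverse_systems c m"
    unfolding inverse_systems_iff using subspace_orth closed N(3) sub by blast
  show "ann c (orth c J) = J"
    unfolding ann_eq_annihilator[OF char sub closed]
    by (rule annihilator_orth[OF series_idealD(2)[OF N(1)] N(2) series_idealD(1)[OF N(1)]])
qed

lemma ann_inverse_system:
  fixes V :: "'f::field mpoly set"
  assumes char: "CHAR('f) = 0" and m: "m \<ge> 1" and V: "V \<in> inverse_systems c m"
  shows "ann c V \<in> hilb_series c m" "orth c (ann c V) = V"
proof -
  interpret coefficient_space c "series c :: 'f mseries set"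
    by (rule coefficient_space_series[OF char])
  have V: "V \<subseteq> polys_in {1..c}" "mspace.subspace V" "mspace.dim V = m" "deriv_closed c V"
    using V unfolding inverse_systems_iff by blast+
  obtain N where N: "\<And>F. F \<in> V \<Longrightarrow> Poly_Mapping.keys F \<subseteq> monoms c N"
  proof (rule finite_dim_bounded[OF V(1)])
    show "mspace.dim V \<noteq> 0" using V(3) m by simp
  qed (rule that)
  have ann: "ann c V = annihilator V"
    using V(2) by (intro ann_eq_annihilator[OF char V(1) _ V(4)]) (simp add: mspace.subspace_def)
  show orth: "orth c (ann c V) = V"
    unfolding ann by (rule orth_annihilator[OF V(2,1) N])
  show "ann c V \<in> hilb_series c m"
    unfolding hilb_series_iff[OF char] orth
  proof (intro conjI exI)
    show "ideal (ann c V) (series_ring c)"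
      unfolding ann by (rule series_ideal_annihilator[OF char V(4) N])
    show "tails N \<subseteq> ann c V" unfolding ann by (rule tails_annihilator[OF N])
  qed (rule V(3))
qed

theorem perp_ann_mutually_inverse:
  assumes "CHAR('f::field) = 0" "m \<ge> 1"
  shows "mutually_inverse (perp c) (ann c) (hilb_series c m :: 'f mseries set set) (inverse_systems c m)"
  unfolding mutually_inverse_def image_subset_iff
  by (simp add: perp_hilb_series[OF assms(1)] perp_hilb_series(1)[OF assms(1) ann_inverse_system(1)[OF assms]]
      ann_inverse_system[OF assms])

section \<open>Contraction and extension\<close>

lemma genideal_series:
  assumes "X \<subseteq> series c"
  shows "ideal (Idl\<^bsub>series_ring c\<^esub> X) (series_ring c)" "X \<subseteq> Idl\<^bsub>series_ring c\<^esub> X"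
    "ideal J (series_ring c) \<Longrightarrow> X \<subseteq> J \<Longrightarrow> Idl\<^bsub>series_ring c\<^esub> X \<subseteq> J"
proof -
  interpret cring "series_ring c" by (rule cring_series_ring)
  show "ideal (Idl\<^bsub>series_ring c\<^esub> X) (series_ring c)" using genideal_ideal assms .
  show "X \<subseteq> Idl\<^bsub>series_ring c\<^esub> X" using genideal_self assms .
  show "ideal J (series_ring c) \<Longrightarrow> X \<subseteq> J \<Longrightarrow> Idl\<^bsub>series_ring c\<^esub> X \<subseteq> J"
    by (rule genideal_minimal)
qed

lemma ideal_in_contraction:
  assumes J: "ideal J (series_ring c)"
  shows "ideal_in (polys_in {1..c}) (contraction c J)"
proof -
  have lookup_mult: "Poly_Mapping.lookup (p * q) = Poly_Mapping.lookup p \<otimes>\<^bsub>series_ring c\<^esub> Poly_Mapping.lookup q"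
    for p q :: "'a mpoly"
    by (simp add: series_mult lookup_mpoly_mult fun_eq_iff)
  have lookup_plus: "Poly_Mapping.lookup (p + q) = (\<lambda>\<alpha>. Poly_Mapping.lookup p \<alpha> + Poly_Mapping.lookup q \<alpha>)"
    for p q :: "'a mpoly" by (simp add: lookup_add fun_eq_iff)
  have lookup_0: "Poly_Mapping.lookup 0 = (\<lambda>_ :: monom. 0 :: 'a)" by (simp add: fun_eq_iff)
  show ?thesis
    using series_idealD(4)[OF J lookup_in_series] sspaceD[OF series_idealD(2)[OF J]]
    unfolding ideal_in_def contraction_def
    by (auto simp: polys_in_add polys_in_mult lookup_0 lookup_plus lookup_mult)
qed

text \<open>
  Contraction does not change the orthogonal space, because polynomials and power series agree modulo
  tails; so it preserves colength.  An element of \<open>J\<close> is a truncation, which lies in the contraction,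
  plus a tail, which lies in every ideal that contains powers of the variables.
\<close>

lemma contraction_hilb_series:
  fixes J :: "'f::field mseries set"
  assumes char: "CHAR('f) = 0" and m: "m \<ge> 1" and J: "J \<in> hilb_series c m"
  shows "contraction c J \<in> hilb_poly c m" "extension c (contraction c J) = J"
proof -
  interpret coefficient_space c "series c :: 'f mseries set"
    by (rule coefficient_space_series[OF char])
  interpret pol: coefficient_space c "Poly_Mapping.lookup ` polys_in {1..c} :: 'f mseries set"
    by (rule coefficient_space_polys[OF char])
  obtain N where N: "ideal J (series_ring c)" "tails N \<subseteq> J" "mspace.dim (orth c J) = m"
    using J unfolding hilb_series_iff[OF char] by blast
  let ?I = "contraction c J"
  have I: "ideal_in (polys_in {1..c}) ?I" by (rule ideal_in_contraction[OF N(1)])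
  have lookup_I: "Poly_Mapping.lookup ` ?I = pol.annihilator (orth c J)"
    using annihilator_orth[OF series_idealD(2)[OF N(1)] N(2) series_idealD(1)[OF N(1)]] lookup_in_series
    unfolding pol.annihilator_def annihilator_def contraction_def by fastforce
  have orth: "orth c (Poly_Mapping.lookup ` ?I) = orth c J"
    unfolding lookup_I
    by (rule pol.orth_annihilator[OF subspace_orth _ keys_orth[OF N(2)]]) (auto simp: orth_def)
  have order: "order_ge c N \<subseteq> ?I"
  proof
    fix p :: "'f mpoly" assume p: "p \<in> order_ge c N"
    then have "Poly_Mapping.lookup p \<in> tails N"
      using lookup_in_series[of p c] by (auto simp: tails_def order_ge_def not_le)
    then show "p \<in> ?I" using N(2) p order_ge_subset by (auto simp: contraction_def)
  qed
  have "?I \<subseteq> order_ge c 1"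
  proof
    fix p assume p: "p \<in> ?I"
    show "p \<in> order_ge c 1"
    proof (rule ccontr)
      assume "p \<notin> order_ge c 1"
      then have "Poly_Mapping.lookup p 0 \<noteq> 0" "p \<in> polys_in {1..c}"
        using p ideal_inD(1)[OF I] by (auto simp: order_ge_1_iff)
      then have "s \<in> ?I" if "s \<in> polys_in {1..c}" for s
        using unit_mod_order_ge[OF I order, of p s] ideal_inD(4)[OF I that p] that by (simp add: mult.commute)
      then have "?I = polys_in {1..c}" using ideal_inD(1)[OF I] by blast
      then have "orth c J = {0}" using orth pol.orth_U by simp
      then have "mspace.dim (orth c J) = 0" using mspace.dim_unique[of "{}" "{0}" 0] mspace.independent_empty by simp
      then show False using N(3) m by simp
    qed
  qed
  then show "?I \<in> hilb_poly c m"
    unfolding hilb_poly_iff[OF char] orth using I order N(3) by blast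
  have lookup_sub: "Poly_Mapping.lookup ` ?I \<subseteq> J" by (auto simp: contraction_def)
  then have gen: "Poly_Mapping.lookup ` ?I \<subseteq> series c" using series_idealD(1)[OF N(1)] by blast
  note ext = genideal_series[OF gen, folded extension_def]
  show "extension c ?I = J"
  proof (intro equalityI subsetI)
    fix f assume "f \<in> extension c ?I"
    then show "f \<in> J" using ext(3)[OF N(1) lookup_sub] by blast
  next
    fix f assume f: "f \<in> J"
    define K where "K = max N (Suc (c * N))"
    have "tails (Suc (c * N)) \<subseteq> extension c ?I"
    proof (rule series_ideal_tails[OF char ext(1)])
      fix i assume "i \<in> {1..c}"
      then have "Poly_Mapping.single (Poly_Mapping.single i N) 1 \<in> ?I"
        by (intro subsetD[OF order] order_ge_single) auto
      then show "Poly_Mapping.lookup (Poly_Mapping.single (Poly_Mapping.single i N) 1) \<in> extension c ?I"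
        using ext(2) by blast
    qed
    then have tE: "tails K \<subseteq> extension c ?I" and tJ: "tails K \<subseteq> J"
      using N(2) tails_antimono[of _ K] unfolding K_def by (meson max.cobounded1 max.cobounded2 order_trans)+
    have fU: "f \<in> series c" using f series_idealD(1)[OF N(1)] by blast
    have "Poly_Mapping.lookup (trunc c K f) \<in> J"
      using trunc_mem_iff[OF series_idealD(2)[OF N(1)] tJ fU] f by blast
    then have "trunc c K f \<in> ?I" by (simp add: contraction_def polys_in_trunc)
    then have "Poly_Mapping.lookup (trunc c K f) \<in> extension c ?I" using ext(2) by blast
    then show "f \<in> extension c ?I"
      using trunc_mem_iff[OF series_idealD(2)[OF ext(1)] tE fU] by blast
  qed
qed

text \<open>
  The annihilator of the inverse system of \<open>I\<close> is an ideal of power series that contains \<open>I\<close>, hence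
  its extension; on polynomials it is \<open>I\<close> again by duality.
\<close>

lemma extension_hilb_poly:
  fixes I :: "'f::field mpoly set"
  assumes char: "CHAR('f) = 0" and I: "I \<in> hilb_poly c m"
  shows "extension c I \<in> hilb_series c m" "contraction c (extension c I) = I"
proof -
  interpret coefficient_space c "series c :: 'f mseries set"
    by (rule coefficient_space_series[OF char])
  obtain N where N: "ideal_in (polys_in {1..c}) I" "order_ge c N \<subseteq> I"
      "mspace.dim (orth c (Poly_Mapping.lookup ` I)) = m"
    using I unfolding hilb_poly_iff[OF char] by blast
  let ?V = "orth c (Poly_Mapping.lookup ` I)"
  have gen: "Poly_Mapping.lookup ` I \<subseteq> series c"
    using ideal_inD(1)[OF N(1)] lookup_in_series by blast
  note ext = genideal_series[OF gen, folded extension_def]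
  have tails: "tails (Suc (c * N)) \<subseteq> extension c I"
  proof (rule series_ideal_tails[OF char ext(1)])
    fix i assume "i \<in> {1..c}"
    then have "Poly_Mapping.single (Poly_Mapping.single i N) 1 \<in> I"
      by (intro subsetD[OF N(2)] order_ge_single) auto
    then show "Poly_Mapping.lookup (Poly_Mapping.single (Poly_Mapping.single i N) 1) \<in> extension c I"
      using ext(2) by blast
  qed
  have orth_sub: "orth c (extension c I) \<subseteq> ?V"
    using ext(2) by (auto simp: orth_def)
  have closed: "deriv_closed c ?V"
    by (rule deriv_closed_orth[OF sspace_lookup_ideal(2)[OF N(1)]])
  have "poly_tails c N \<subseteq> Poly_Mapping.lookup ` I"
    using N(2) by (simp add: poly_tails_eq[OF char] lookup_image_mono_iff)
  then have bound: "Poly_Mapping.keys F \<subseteq> monoms c N" if "F \<in> ?V" for F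
    using coefficient_space.keys_orth[OF coefficient_space_polys[OF char]] that by blast
  have "ideal (annihilator ?V) (series_ring c)"
    using char closed bound by (rule series_ideal_annihilator)
  moreover have "Poly_Mapping.lookup ` I \<subseteq> annihilator ?V"
    using gen by (auto simp: annihilator_def orth_def)
  ultimately have sub_ann: "extension c I \<subseteq> annihilator ?V" by (rule ext(3))
  have "?V \<subseteq> orth c (extension c I)"
    using sub_ann by (auto simp: orth_def annihilator_def)
  with orth_sub have orth: "orth c (extension c I) = ?V" by (rule equalityI)
  show "extension c I \<in> hilb_series c m"
    unfolding hilb_series_iff[OF char] orth using ext(1) tails N(3) by blast
  show "contraction c (extension c I) = I"
  proof (intro equalityI subsetI)
    fix p assume "p \<in> contraction c (extension c I)"
    then have p: "p \<in> polys_in {1..c}" "Poly_Mapping.lookup p \<in> annihilator ?V"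
      using sub_ann by (auto simp: contraction_def)
    then show "p \<in> I"
      unfolding annihilator_lookup_ideal[OF char N(1,2) p(1)] by (simp add: annihilator_def)
  next
    fix p assume "p \<in> I"
    then show "p \<in> contraction c (extension c I)"
      using ext(2) ideal_inD(1)[OF N(1)] by (auto simp: contraction_def)
  qed
qed

theorem contraction_extension_mutually_inverse:
  assumes "CHAR('f::field) = 0" "m \<ge> 1"
  shows "mutually_inverse (contraction c) (extension c) (hilb_series c m :: 'f mseries set set) (hilb_poly c m)"
  unfolding mutually_inverse_def image_subset_iff
  by (simp add: contraction_hilb_series[OF assms] extension_hilb_poly[OF assms(1)])

section \<open>A polynomial ring with a point in a field\<close>

lemma mderiv_power: "mderiv i (p ^ k) = of_nat k * p ^ (k - 1) * mderiv i p"
proof (induction k)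
  case (Suc k)
  have "mderiv i (p ^ Suc k) = (of_nat k * (p * p ^ (k - 1)) + p ^ k) * mderiv i p"
    using Suc by (simp add: mderiv_mult algebra_simps)
  also have "of_nat k * (p * p ^ (k - 1)) = of_nat k * p ^ k"
    by (cases k) simp_all
  also have "(of_nat k * p ^ k + p ^ k) * mderiv i p = of_nat (Suc k) * p ^ (Suc k - 1) * mderiv i p"
    by (simp add: algebra_simps)
  finally show ?case .
qed simp

text \<open>
  The residue class map of a prime ideal for which the variables \<open>c + 1, \<dots>, n\<close> form a maximal
  independent set.  The map \<open>\<Phi>\<close> is a ring homomorphism on polynomials in all variables, so that its
  laws hold without restriction; it extends the residue class map of \<open>R\<close>.
\<close>

locale generic_point =
  fixes n c :: nat and \<Phi> :: "'k::field_char_0 mpoly \<Rightarrow> 'f::field"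
  assumes c_le_n: "c \<le> n"
    and \<Phi>_add: "\<Phi> (p + q) = \<Phi> p + \<Phi> q"
    and \<Phi>_mult: "\<Phi> (p * q) = \<Phi> p * \<Phi> q"
    and \<Phi>_1 [simp]: "\<Phi> 1 = 1"
    and fractions: "\<exists>p\<in>polys_in {1..n}. \<exists>q\<in>polys_in {1..n}. \<Phi> q \<noteq> 0 \<and> a * \<Phi> q = \<Phi> p"
    and independent: "p \<in> polys_in {c+1..n} \<Longrightarrow> \<Phi> p = 0 \<Longrightarrow> p = 0"
    and algebraic: "i \<in> {1..c} \<Longrightarrow> \<exists>p\<in>polys_in (insert i {c+1..n}). p \<noteq> 0 \<and> \<Phi> p = 0"
begin

abbreviation R :: "'k mpoly set" where "R \<equiv> polys_in {1..n}"
abbreviation S :: "'f mpoly set" where "S \<equiv> polys_in {1..c}"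

definition P :: "'k mpoly set" where "P = {f \<in> R. \<Phi> f = 0}"

lemma \<Phi>_0 [simp]: "\<Phi> 0 = 0"
  using \<Phi>_add[of 0 0] unfolding add_0_left by (rule add_cancel_right_right[THEN iffD1])

lemma \<Phi>_uminus: "\<Phi> (- p) = - \<Phi> p"
  using \<Phi>_add[of p "- p"] by (simp add: add_eq_0_iff)

lemma \<Phi>_diff: "\<Phi> (p - q) = \<Phi> p - \<Phi> q"
  using \<Phi>_add[of p "- q"] by (simp add: \<Phi>_uminus)

lemma \<Phi>_sum: "\<Phi> (sum f A) = (\<Sum>x\<in>A. \<Phi> (f x))"
  by (induction A rule: infinite_finite_induct) (simp_all add: \<Phi>_add)

lemma \<Phi>_prod: "\<Phi> (prod f A) = (\<Prod>x\<in>A. \<Phi> (f x))"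
  by (induction A rule: infinite_finite_induct) (simp_all add: \<Phi>_mult)

lemma \<Phi>_of_nat: "\<Phi> (of_nat k) = of_nat k"
  by (induction k) (simp_all add: \<Phi>_add)

lemma char_0: "CHAR('f) = 0"
proof -
  have "of_nat k \<noteq> (0::'f)" if "k > 0" for k
  proof
    assume "of_nat k = (0::'f)"
    then have "\<Phi> (mconst (of_nat k :: 'k) * mconst (1 / of_nat k)) = 0"
      by (simp add: \<Phi>_mult mconst_of_nat \<Phi>_of_nat)
    then show False using that by (simp flip: mconst_mult)
  qed
  then show ?thesis using of_nat_CHAR by (metis gr0I)
qed

lemma of_nat_nz: "k \<noteq> 0 \<Longrightarrow> of_nat k \<noteq> (0::'f)"
  using char_0 by (simp add: of_nat_eq_0_iff_char_dvd)

lemma P_R: "p \<in> P \<Longrightarrow> p \<in> R"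
  by (simp add: P_def)

section \<open>The Taylor map\<close>

abbreviation \<gamma> :: "'k mpoly \<Rightarrow> 'f mpoly" where "\<gamma> \<equiv> gamma c \<Phi>"

lemma \<gamma>_add: "\<gamma> (p + q) = \<gamma> p + \<gamma> q"
  unfolding gamma_def by (rule meval_add) (simp_all add: mconst_add mconst_mult \<Phi>_add \<Phi>_mult)

lemma \<gamma>_mult: "\<gamma> (p * q) = \<gamma> p * \<gamma> q"
  unfolding gamma_def by (rule meval_mult) (simp_all add: mconst_add mconst_mult \<Phi>_add \<Phi>_mult)

lemma \<gamma>_const: "\<gamma> (mconst a) = mconst (\<Phi> (mconst a))"
  unfolding gamma_def by (rule meval_const) (simp_all add: mconst_add mconst_mult \<Phi>_add \<Phi>_mult)

lemma \<gamma>_var: "\<gamma> (mvar i) = (if i \<le> c then mvar i + mconst (\<Phi> (mvar i)) else mconst (\<Phi> (mvar i)))"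
  unfolding gamma_def by (rule meval_var) (simp_all add: mconst_add mconst_mult \<Phi>_add \<Phi>_mult)

lemma \<gamma>_0 [simp]: "\<gamma> 0 = 0"
  using \<gamma>_const[of 0] by simp

lemma \<gamma>_1 [simp]: "\<gamma> 1 = 1"
  using \<gamma>_const[of 1] by simp

lemma \<gamma>_diff: "\<gamma> (p - q) = \<gamma> p - \<gamma> q"
  using \<gamma>_add[of "p - q" q] by simp

lemma \<gamma>_S: "f \<in> R \<Longrightarrow> \<gamma> f \<in> S"
  by (induction f rule: polys_in_induct)
    (auto simp: \<gamma>_add \<gamma>_mult \<gamma>_const \<gamma>_var intro!: polys_in_add polys_in_mult polys_in_var)

lemma lookup_\<gamma>_0: "Poly_Mapping.lookup (\<gamma> f) 0 = \<Phi> f"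
proof (induction f rule: mpoly_induct)
  case (const a)
  show ?case by (simp add: \<gamma>_const) (simp add: mconst_def)
next
  case (var i p)
  have "Poly_Mapping.lookup (mvar i :: 'f mpoly) 0 = 0"
    by (auto simp: mvar_def lookup_single when_def) (metis evar_def mdeg_evar mdeg_zero zero_neq_one)
  then have "Poly_Mapping.lookup (\<gamma> (mvar i)) 0 = \<Phi> (mvar i)"
    by (simp add: \<gamma>_var lookup_add mconst_def)
  with var show ?case by (simp add: \<gamma>_mult \<Phi>_mult lookup_mult_zero)
qed (simp add: \<gamma>_add \<Phi>_add lookup_add)

lemma mderiv_\<gamma>: "i \<in> {1..c} \<Longrightarrow> mderiv i (\<gamma> f) = \<gamma> (mderiv i f)"
proof (induction f rule: mpoly_induct)
  case (var j p)
  have "mderiv i (\<gamma> (mvar j)) = \<gamma> (mderiv i (mvar j))"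
    using var(2) by (auto simp: \<gamma>_var mderiv_var mderiv_add)
  with var show ?case by (simp add: mderiv_mult \<gamma>_mult \<gamma>_add)
qed (simp_all add: \<gamma>_add mderiv_add \<gamma>_const)

text \<open>\<open>P\<close> is the preimage of the maximal ideal at the origin.\<close>

lemma \<gamma>_order_ge_1_iff: "f \<in> R \<Longrightarrow> \<gamma> f \<in> order_ge c 1 \<longleftrightarrow> f \<in> P"
  by (simp add: order_ge_1_iff \<gamma>_S lookup_\<gamma>_0 P_def)

section \<open>Division by an algebraic relation\<close>

text \<open>
  The polynomials of degree less than \<open>d\<close> in the variable \<open>j\<close> with coefficients in the variables
  \<open>W\<close>: the stage on which division with remainder takes place.
\<close>

definition xpolys :: "nat set \<Rightarrow> nat \<Rightarrow> nat \<Rightarrow> 'k mpoly set" where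
  "xpolys W j d = {\<Sum>l<d. r l * mvar j ^ l |r. \<forall>l. r l \<in> polys_in W}"

lemma xpolysI: "(\<And>l. r l \<in> polys_in W) \<Longrightarrow> (\<Sum>l<d. r l * mvar j ^ l) \<in> xpolys W j d"
  unfolding xpolys_def by blast

lemma xpolys_subset: "xpolys W j d \<subseteq> polys_in (insert j W)"
proof -
  have "polys_in W \<subseteq> polys_in (insert j W)" by (rule polys_in_mono) auto
  then show ?thesis unfolding xpolys_def by (auto intro!: polys_in_closed)
qed

lemma xpolys_add:
  assumes "f \<in> xpolys W j d" "g \<in> xpolys W j d"
  shows "f + g \<in> xpolys W j d"
proof -
  from assms obtain r s where rs: "\<And>l. r l \<in> polys_in W" "\<And>l. s l \<in> polys_in W"
    "f = (\<Sum>l<d. r l * mvar j ^ l)" "g = (\<Sum>l<d. s l * mvar j ^ l)"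
    unfolding xpolys_def by blast
  have "f + g = (\<Sum>l<d. (r l + s l) * mvar j ^ l)" unfolding rs(3,4) by (simp only: distrib_right sum.distrib)
  also have "\<dots> \<in> xpolys W j d" by (rule xpolysI) (rule polys_in_add[OF rs(1,2)])
  finally show ?thesis .
qed

lemma xpolys_mult:
  assumes "f \<in> xpolys W j d" "a \<in> polys_in W"
  shows "a * f \<in> xpolys W j d"
proof -
  from assms obtain r where r: "\<And>l. r l \<in> polys_in W" "f = (\<Sum>l<d. r l * mvar j ^ l)"
    unfolding xpolys_def by blast
  have "a * f = (\<Sum>l<d. (a * r l) * mvar j ^ l)" unfolding r(2) by (simp only: sum_distrib_left mult.assoc)
  also have "\<dots> \<in> xpolys W j d" by (rule xpolysI) (rule polys_in_mult[OF assms(2) r(1)])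
  finally show ?thesis .
qed

lemma xpolys_diff: "f \<in> xpolys W j d \<Longrightarrow> g \<in> xpolys W j d \<Longrightarrow> f - g \<in> xpolys W j d"
proof -
  assume fg: "f \<in> xpolys W j d" "g \<in> xpolys W j d"
  have "f + mconst (- 1) * g \<in> xpolys W j d"
    by (intro xpolys_add xpolys_mult fg polys_in_const)
  then show ?thesis by (simp add: mconst_uminus)
qed

lemma xpolys_shift:
  assumes "f \<in> xpolys W j d"
  shows "mvar j ^ k * f \<in> xpolys W j (d + k)"
proof -
  from assms obtain r where r: "\<And>l. r l \<in> polys_in W" "f = (\<Sum>l<d. r l * mvar j ^ l)"
    unfolding xpolys_def by blast
  have "mvar j ^ k * f = (\<Sum>l<d. r l * mvar j ^ (l + k))"
    by (simp add: r(2) sum_distrib_left power_add mult_ac)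
  also have "\<dots> = (\<Sum>l\<in>{k..<d + k}. r (l - k) * mvar j ^ l)"
    by (rule sum.reindex_bij_witness[where i = "\<lambda>l. l - k" and j = "\<lambda>l. l + k"]) auto
  also have "\<dots> = (\<Sum>l<d + k. (if k \<le> l then r (l - k) else 0) * mvar j ^ l)"
    by (rule sum.mono_neutral_cong_left) auto
  finally show ?thesis using xpolysI[of "\<lambda>l. if k \<le> l then r (l - k) else 0" W j "d + k"] r(1) by auto
qed

lemma xpolys_mono:
  assumes "f \<in> xpolys W j d" "d \<le> e"
  shows "f \<in> xpolys W j e"
proof -
  from assms obtain r where r: "\<And>l. r l \<in> polys_in W" "f = (\<Sum>l<d. r l * mvar j ^ l)"
    unfolding xpolys_def by blast
  have "f = (\<Sum>l<e. (if l < d then r l else 0) * mvar j ^ l)"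
    unfolding r(2) by (rule sum.mono_neutral_cong_left) (use assms(2) in auto)
  then show ?thesis using xpolysI[of "\<lambda>l. if l < d then r l else 0" W j e] r(1) by auto
qed

lemma xpolys_const: "a \<in> polys_in W \<Longrightarrow> a \<in> xpolys W j 1"
  using xpolysI[of "\<lambda>_. a" W j 1] by (simp add: One_nat_def)

lemma polys_in_xpolys: "f \<in> polys_in (insert j W) \<Longrightarrow> \<exists>d. f \<in> xpolys W j d"
proof (induction f rule: polys_in_induct)
  case (const a)
  show ?case using xpolys_const[of "mconst a" W j] by auto
next
  case (add p q)
  then obtain d e where "p \<in> xpolys W j d" "q \<in> xpolys W j e" by blast
  then have "p + q \<in> xpolys W j (max d e)" by (intro xpolys_add) (auto elim: xpolys_mono)
  then show ?case ..
next
  case (var i p)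
  then obtain d where d: "p \<in> xpolys W j d" by blast
  show ?case
  proof (cases "i = j")
    case True
    then show ?thesis using xpolys_shift[OF d, of 1] by auto
  next
    case False
    then have "mvar i \<in> polys_in W" using var(1) by (auto intro: polys_in_var)
    then show ?thesis using xpolys_mult[OF d] by blast
  qed
qed

text \<open>
  No polynomial of degree less than \<open>d\<close> in the variable \<open>j\<close> is a nontrivial algebraic relation for
  \<open>u\<^sub>j\<close> over the field generated by the variables \<open>W\<close>.
\<close>

definition detects :: "nat set \<Rightarrow> nat \<Rightarrow> nat \<Rightarrow> bool" where
  "detects W j d \<longleftrightarrow> (\<forall>r. (\<forall>l. r l \<in> polys_in W) \<longrightarrow> \<Phi> (\<Sum>l<d. r l * mvar j ^ l) = 0 \<longrightarrow> (\<forall>l<d. \<Phi> (r l) = 0))"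

text \<open>
  A relation of least degree plays the role of the minimal polynomial of \<open>u\<^sub>j\<close>.  Its derivative has
  smaller degree and, in characteristic zero, a nonzero leading coefficient, so it does not vanish
  at \<open>u\<close>: minimal polynomials are separable.
\<close>

lemma minimal_relation:
  assumes j: "j \<in> {1..c}" and W: "{c+1..n} \<subseteq> W" "j \<notin> W"
  obtains d r where "detects W j d" "\<And>l. r l \<in> polys_in W" "\<Phi> (r d) \<noteq> 0"
    "\<Phi> (\<Sum>l<Suc d. r l * mvar j ^ l) = 0" "\<Phi> (mderiv j (\<Sum>l<Suc d. r l * mvar j ^ l)) \<noteq> 0"
proof -
  obtain p where p: "p \<in> polys_in (insert j {c+1..n})" "p \<noteq> 0" "\<Phi> p = 0"
    using algebraic[OF j] by blast
  obtain e where "p \<in> xpolys {c+1..n} j e" using polys_in_xpolys[OF p(1)] by blast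
  then obtain s where s: "\<And>l. s l \<in> polys_in {c+1..n}" "p = (\<Sum>l<e. s l * mvar j ^ l)"
    unfolding xpolys_def by blast
  obtain l0 where l0: "l0 < e" "s l0 \<noteq> 0"
  proof (rule ccontr)
    assume "\<not> thesis"
    then have "s l = 0" if "l < e" for l using that \<open>\<And>l0. l0 < e \<Longrightarrow> s l0 \<noteq> 0 \<Longrightarrow> thesis\<close> by blast
    then show False using p(2) s(2) by simp
  qed
  have "\<Phi> (s l0) \<noteq> 0" using independent[OF s(1)] l0(2) by blast
  moreover have "s l \<in> polys_in W" for l using s(1) polys_in_mono[OF W(1)] by blast
  ultimately have "\<not> detects W j e"
    using p(3) s(2) l0(1) unfolding detects_def by blast
  define D where "D = (LEAST e. \<not> detects W j e)"
  have D: "\<not> detects W j D" unfolding D_def using \<open>\<not> detects W j e\<close> by (rule LeastI)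
  moreover have "detects W j 0" by (simp add: detects_def)
  ultimately obtain d where d: "D = Suc d" by (cases D) auto
  then have det: "detects W j d" using not_less_Least[of d "\<lambda>e. \<not> detects W j e"] by (auto simp: D_def)
  obtain r l1 where r: "\<And>l. r l \<in> polys_in W" "\<Phi> (\<Sum>l<Suc d. r l * mvar j ^ l) = 0" "l1 < Suc d" "\<Phi> (r l1) \<noteq> 0"
    using D unfolding d detects_def by blast
  have rd: "\<Phi> (r d) \<noteq> 0"
  proof
    assume 0: "\<Phi> (r d) = 0"
    then have "\<Phi> (\<Sum>l<d. r l * mvar j ^ l) = 0" using r(2) by (simp add: \<Phi>_add \<Phi>_mult)
    then have "\<forall>l<d. \<Phi> (r l) = 0" using det r(1) unfolding detects_def by blast
    then show False using r(3,4) 0 less_Suc_eq by auto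
  qed
  have d0: "d \<noteq> 0"
  proof
    assume "d = 0"
    then show False using r(2) rd by simp
  qed
  then obtain d' where d': "d = Suc d'" by (cases d) auto
  have "mderiv j (\<Sum>l<Suc d. r l * mvar j ^ l) = (\<Sum>l<Suc d. r l * (of_nat l * mvar j ^ (l - 1)))"
    using mderiv_notin[OF r(1) W(2)] by (simp add: mderiv_sum mderiv_mult mderiv_power mderiv_var del: sum.lessThan_Suc)
  also have "\<dots> = (\<Sum>l<d. of_nat (Suc l) * r (Suc l) * mvar j ^ l)"
    by (subst sum.lessThan_Suc_shift) (simp add: mult_ac)
  finally have deriv: "mderiv j (\<Sum>l<Suc d. r l * mvar j ^ l) = (\<Sum>l<d. of_nat (Suc l) * r (Suc l) * mvar j ^ l)" .
  have "\<Phi> (mderiv j (\<Sum>l<Suc d. r l * mvar j ^ l)) \<noteq> 0"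
  proof
    assume "\<Phi> (mderiv j (\<Sum>l<Suc d. r l * mvar j ^ l)) = 0"
    then have "\<Phi> (\<Sum>l<d. (of_nat (Suc l) * r (Suc l)) * mvar j ^ l) = 0" unfolding deriv .
    moreover have "of_nat (Suc l) * r (Suc l) \<in> polys_in W" for l
      using r(1) polys_in_const[of "of_nat (Suc l)" W] by (intro polys_in_mult) (simp_all only: mconst_of_nat)
    ultimately have "\<Phi> (of_nat (Suc d') * r (Suc d')) = 0"
      using det[unfolded detects_def, rule_format, of "\<lambda>l. of_nat (Suc l) * r (Suc l)" d'] d' by blast
    then show False using rd d' of_nat_nz[of "Suc d'"] by (simp add: \<Phi>_mult \<Phi>_of_nat del: of_nat_Suc)
  qed
  then show thesis using that det r(1,2) rd by blast
qed

text \<open>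
  Division by a polynomial whose leading coefficient \<open>r d\<close> need not be invertible, at the cost of
  multiplying the dividend by an \<open>h\<close> that does not vanish at the point.
\<close>

lemma pseudo_division:
  assumes r: "\<And>l. r l \<in> polys_in W" "\<Phi> (r d) \<noteq> 0"
    and f: "f \<in> polys_in (insert j W)"
  obtains h q t where "h \<in> polys_in W" "\<Phi> h \<noteq> 0" "q \<in> polys_in (insert j W)" "\<And>l. t l \<in> polys_in W"
    "h * f = q * (\<Sum>l<Suc d. r l * mvar j ^ l) + (\<Sum>l<d. t l * mvar j ^ l)"
proof -
  let ?g = "\<Sum>l<Suc d. r l * mvar j ^ l"
  have sub: "polys_in W \<subseteq> (polys_in (insert j W) :: 'k mpoly set)" by (rule polys_in_mono) auto
  have "\<exists>h q. h \<in> polys_in W \<and> \<Phi> h \<noteq> 0 \<and> q \<in> polys_in (insert j W) \<and> h * f - q * ?g \<in> xpolys W j d"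
    if "f \<in> xpolys W j N" for f N
    using that
  proof (induction N arbitrary: f)
    case 0
    then show ?case using xpolys_mono[of f W j 0 d] by (intro exI[of _ 1] exI[of _ 0]) simp
  next
    case (Suc N)
    show ?case
    proof (cases "Suc N \<le> d")
      case True
      then show ?thesis using xpolys_mono[OF Suc(2)] by (intro exI[of _ 1] exI[of _ 0]) simp
    next
      case False
      then have N: "N - d + d = N" by simp
      obtain s where s: "\<And>l. s l \<in> polys_in W" "f = (\<Sum>l<Suc N. s l * mvar j ^ l)"
        using Suc(2) unfolding xpolys_def by blast
      let ?q = "s N * mvar j ^ (N - d)"
      have "r d * f - ?q * ?g = r d * (\<Sum>l<N. s l * mvar j ^ l) - s N * (mvar j ^ (N - d) * (\<Sum>l<d. r l * mvar j ^ l))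
        + r d * s N * (mvar j ^ N - mvar j ^ (N - d) * mvar j ^ d)"
        by (simp add: s(2) algebra_simps)
      also have "mvar j ^ N - mvar j ^ (N - d) * mvar j ^ d = (0 :: 'k mpoly)"
        using N by (simp flip: power_add)
      finally have *: "r d * f - ?q * ?g = r d * (\<Sum>l<N. s l * mvar j ^ l) - s N * (mvar j ^ (N - d) * (\<Sum>l<d. r l * mvar j ^ l))"
        by simp
      have "mvar j ^ (N - d) * (\<Sum>l<d. r l * mvar j ^ l) \<in> xpolys W j (d + (N - d))"
        by (rule xpolys_shift[OF xpolysI[OF r(1)]])
      then have "mvar j ^ (N - d) * (\<Sum>l<d. r l * mvar j ^ l) \<in> xpolys W j N"
        using N by (simp add: add.commute)
      then have "r d * f - ?q * ?g \<in> xpolys W j N"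
        unfolding * by (intro xpolys_diff[OF xpolys_mult[OF xpolysI[OF s(1)] r(1)] xpolys_mult[OF _ s(1)]])
      then obtain h q where hq: "h \<in> polys_in W" "\<Phi> h \<noteq> 0" "q \<in> polys_in (insert j W)"
        "h * (r d * f - ?q * ?g) - q * ?g \<in> xpolys W j d"
        using Suc(1) by blast
      have "(h * r d) * f - (h * ?q + q) * ?g = h * (r d * f - ?q * ?g) - q * ?g"
        by (simp only: right_diff_distrib distrib_right mult.assoc) simp
      moreover have "h * ?q + q \<in> polys_in (insert j W)"
        using hq s(1) sub by (intro polys_in_add polys_in_mult polys_in_power polys_in_var) auto
      ultimately show ?thesis
        using hq r by (intro exI[of _ "h * r d"] exI[of _ "h * ?q + q"]) (auto simp: \<Phi>_mult intro: polys_in_mult)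
    qed
  qed
  then obtain h q where hq: "h \<in> polys_in W" "\<Phi> h \<noteq> 0" "q \<in> polys_in (insert j W)" "h * f - q * ?g \<in> xpolys W j d"
    using polys_in_xpolys[OF f] by blast
  then obtain t where t: "\<And>l. t l \<in> polys_in W" "h * f - q * ?g = (\<Sum>l<d. t l * mvar j ^ l)"
    unfolding xpolys_def by blast
  then have "h * f = q * ?g + (\<Sum>l<d. t l * mvar j ^ l)" by (simp add: algebra_simps)
  then show thesis using that hq t(1) by blast
qed


section \<open>Symbolic powers\<close>

text \<open>
  The symbolic powers of \<open>P\<close>: products of \<open>k\<close> elements of \<open>P\<close>, their sums, and saturation with respect
  to the complement of \<open>P\<close>.  As an inductive predicate they allow statements about derivations to be
  proved on products and carried through sums and saturation.
\<close>

inductive spow :: "nat \<Rightarrow> 'k mpoly \<Rightarrow> bool" where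
  base: "f \<in> R \<Longrightarrow> spow 0 f"
| mult: "p \<in> P \<Longrightarrow> spow k q \<Longrightarrow> spow (Suc k) (p * q)"
| add: "spow k f \<Longrightarrow> spow k g \<Longrightarrow> spow k (f + g)"
| sat: "h \<in> R \<Longrightarrow> \<Phi> h \<noteq> 0 \<Longrightarrow> f \<in> R \<Longrightarrow> spow k (h * f) \<Longrightarrow> spow k f"

lemma spow_R: "spow k f \<Longrightarrow> f \<in> R"
  by (induction rule: spow.induct) (auto intro: polys_in_closed P_R)

lemma P_mult: "r \<in> R \<Longrightarrow> p \<in> P \<Longrightarrow> r * p \<in> P"
  by (auto simp: P_def \<Phi>_mult intro: polys_in_mult)

lemma spow_smult: "spow k f \<Longrightarrow> r \<in> R \<Longrightarrow> spow k (r * f)"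
proof (induction rule: spow.induct)
  case (mult p k q)
  then show ?case using spow.mult[OF P_mult[of r p]] by (simp add: mult.assoc)
next
  case (sat h f k)
  then show ?case
    using spow.sat[of h "r * f" k] by (simp add: polys_in_mult mult.left_commute)
qed (auto simp: distrib_left intro: spow.intros polys_in_mult)

lemma spow_mult: "spow j f \<Longrightarrow> spow k g \<Longrightarrow> spow (j + k) (f * g)"
proof (induction rule: spow.induct)
  case (base f)
  then show ?case by (simp add: spow_smult)
next
  case (mult p j q)
  then show ?case using spow.mult[of p "j + k" "q * g"] by (simp add: mult.assoc)
next
  case (sat h f j)
  then show ?case
    using spow.sat[of h "f * g" "j + k"] spow_R[of k g] by (simp add: polys_in_mult mult.assoc)
qed (auto simp: distrib_right intro: spow.intros)

lemma spow_1: "p \<in> P \<Longrightarrow> spow 1 p"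
  using spow.mult[of p 0 1] spow.base[of 1] by (simp add: One_nat_def)

lemma spow_0: "spow k 0"
proof (induction k)
  case (Suc k)
  then show ?case using spow.mult[of 0 k 0] by (simp add: P_def)
qed (simp add: spow.base)

lemma spow_sum: "(\<And>x. x \<in> A \<Longrightarrow> spow k (f x)) \<Longrightarrow> spow k (sum f A)"
  by (induction A rule: infinite_finite_induct) (auto intro: spow_0 spow.add)

lemma spow_diff: "spow k f \<Longrightarrow> spow k g \<Longrightarrow> spow k (f - g)"
proof -
  assume fg: "spow k f" "spow k g"
  have "spow k (f + mconst (- 1) * g)"
    by (intro spow.add spow_smult fg polys_in_const)
  then show ?thesis by (simp add: mconst_uminus)
qed

text \<open>
  The conormal map from \<open>P/P\<^sup>2\<close> to differentials is injective after localization.  Treat one variable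
  at a time: write \<open>h f = q g + t\<close> with \<open>g\<close> the minimal relation for the last variable and \<open>t\<close> of
  smaller degree.  By minimality the coefficients of \<open>t\<close> lie in \<open>P\<close>.  Differentiating with respect to the
  last variable gives \<open>q \<partial>g \<in> P\<close>, hence \<open>q \<in> P\<close> and \<open>q g \<in> P\<^sup>2\<close>.  Differentiating with respect to the
  others shows that the coefficients of \<open>t\<close> satisfy the induction hypothesis.
\<close>

lemma cotangent_injective_aux:
  assumes "j \<le> c" "f \<in> polys_in ({1..j} \<union> {c+1..n})" "\<Phi> f = 0" "\<And>i. i \<in> {1..j} \<Longrightarrow> \<Phi> (mderiv i f) = 0"
  shows "spow 2 f"
  using assms
proof (induction j arbitrary: f)
  case 0
  then have "f = 0" using independent[of f] by simp
  then show ?case by (simp add: spow_0)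
next
  case (Suc j)
  let ?W = "{1..j} \<union> {c+1..n}" and ?j = "Suc j"
  have insW: "{1..Suc j} \<union> {c+1..n} = insert ?j ?W" by auto
  have jc: "?j \<in> {1..c}" using Suc(2) by auto
  have WR: "polys_in ?W \<subseteq> R" and jWR: "polys_in (insert ?j ?W) \<subseteq> R"
    using Suc(2) c_le_n by (auto intro!: polys_in_mono)
  obtain d r where r: "detects ?W ?j d" "\<And>l. r l \<in> polys_in ?W" "\<Phi> (r d) \<noteq> 0"
    "\<Phi> (\<Sum>l<Suc d. r l * mvar ?j ^ l) = 0" "\<Phi> (mderiv ?j (\<Sum>l<Suc d. r l * mvar ?j ^ l)) \<noteq> 0"
    by (rule minimal_relation[OF jc, of ?W]) (use Suc(2) in auto)
  let ?g = "\<Sum>l<Suc d. r l * mvar ?j ^ l"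
  have f: "f \<in> polys_in (insert ?j ?W)" using Suc(3) unfolding insW .
  obtain h q t where hqt: "h \<in> polys_in ?W" "\<Phi> h \<noteq> 0" "q \<in> polys_in (insert ?j ?W)" "\<And>l. t l \<in> polys_in ?W"
    "h * f = q * ?g + (\<Sum>l<d. t l * mvar ?j ^ l)"
    by (rule pseudo_division[where r = r and W = ?W and d = d and f = f and j = ?j, OF r(2,3) f]) blast
  let ?t = "\<Sum>l<d. t l * mvar ?j ^ l"
  have detect: "\<Phi> (s l) = 0" if "\<And>l. s l \<in> polys_in ?W" "\<Phi> (\<Sum>l<d. s l * mvar ?j ^ l) = 0" "l < d" for s l
    using r(1) that unfolding detects_def by blast
  have t_eq: "?t = h * f - q * ?g" using hqt(5) by simp
  have "\<Phi> ?t = 0" unfolding t_eq by (simp only: \<Phi>_diff \<Phi>_mult r(4) Suc(4)) simp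
  then have t0: "\<Phi> (t l) = 0" if "l < d" for l using detect[where s = t and l = l, OF hqt(4)] that by blast
  have deriv_t: "\<Phi> (mderiv i ?t) = \<Phi> (\<Sum>l<d. mderiv i (t l) * mvar ?j ^ l)" for i
    by (simp add: mderiv_sum mderiv_mult \<Phi>_sum \<Phi>_add \<Phi>_mult t0)
  have deriv_t': "\<Phi> (mderiv i ?t) = \<Phi> h * \<Phi> (mderiv i f) - \<Phi> q * \<Phi> (mderiv i ?g)" for i
    unfolding t_eq by (simp only: mderiv_diff mderiv_mult \<Phi>_diff \<Phi>_add \<Phi>_mult r(4) Suc(4)) simp
  have "mderiv ?j (t l) = 0" for l using hqt(4) by (rule mderiv_notin) (use Suc(2) in auto)
  then have "\<Phi> (mderiv ?j ?t) = 0" unfolding deriv_t by simp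
  then have "\<Phi> q = 0" using deriv_t'[of ?j] Suc(5)[of ?j] r(5) by simp
  moreover have qR: "q \<in> R" using hqt(3) jWR by blast
  ultimately have qP: "q \<in> P" by (simp add: P_def)
  have gR: "?g \<in> R"
    using r(2) WR jc c_le_n by (intro polys_in_sum polys_in_mult polys_in_power polys_in_var) auto
  have "?g \<in> P" using gR r(4) unfolding P_def by blast
  then have qg: "spow 2 (q * ?g)"
    using spow_mult[OF spow_1[OF qP] spow_1[of ?g]] by simp
  have "spow 2 (t l)" if "l < d" for l
  proof (rule Suc(1))
    show "t l \<in> polys_in ?W" "\<Phi> (t l) = 0" by (rule hqt(4), rule t0[OF that])
    fix i assume i: "i \<in> {1..j}"
    have "\<Phi> (mderiv i ?t) = 0" unfolding deriv_t' using Suc(5)[of i] i \<open>\<Phi> q = 0\<close> by simp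
    then show "\<Phi> (mderiv i (t l)) = 0"
      unfolding deriv_t by (rule detect[of "\<lambda>l. mderiv i (t l)", OF polys_in_mderiv[OF hqt(4)] _ that])
  qed (use Suc(2) in simp)
  moreover have "mvar ?j ^ l \<in> R" for l
    using jc c_le_n by (intro polys_in_power polys_in_var) auto
  ultimately have "spow 2 (mvar ?j ^ l * t l)" if "l < d" for l
    using spow_smult that by blast
  then have "spow 2 ?t"
    by (intro spow_sum) (simp add: mult.commute)
  then have "spow 2 (h * f)" unfolding hqt(5) using qg by (intro spow.add)
  then show ?case using spow.sat[of h f 2] hqt(1,2) f WR jWR by blast
qed

lemma cotangent_injective:
  assumes "f \<in> P" "\<And>i. i \<in> {1..c} \<Longrightarrow> \<Phi> (mderiv i f) = 0"
  shows "spow 2 f"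
proof (rule cotangent_injective_aux[OF order_refl])
  have "{1..c} \<union> {c+1..n} = {1..n}" using c_le_n by auto
  then show "f \<in> polys_in ({1..c} \<union> {c+1..n})" using assms(1) by (simp add: P_def)
qed (use assms in \<open>auto simp: P_def\<close>)

section \<open>Local coordinates and the Euler operator\<close>

lemma coordinates_exist:
  "\<exists>g. \<forall>i\<in>{1..c}. g i \<in> P \<and> \<Phi> (mderiv i (g i)) \<noteq> 0 \<and> (\<forall>j\<in>{1..c}. j \<noteq> i \<longrightarrow> mderiv j (g i) = 0)"
proof -
  have "\<exists>g. g \<in> P \<and> \<Phi> (mderiv i g) \<noteq> 0 \<and> (\<forall>j\<in>{1..c}. j \<noteq> i \<longrightarrow> mderiv j g = 0)" if i: "i \<in> {1..c}" for i
  proof -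
    obtain d r where r: "\<And>l. r l \<in> polys_in {c+1..n}"
      "\<Phi> (\<Sum>l<Suc d. r l * mvar i ^ l) = 0" "\<Phi> (mderiv i (\<Sum>l<Suc d. r l * mvar i ^ l)) \<noteq> 0"
      by (rule minimal_relation[OF i, of "{c+1..n}"]) (use i in auto)
    let ?g = "\<Sum>l<Suc d. r l * mvar i ^ l"
    have g: "?g \<in> polys_in (insert i {c+1..n})" by (rule subsetD[OF xpolys_subset xpolysI[where r = r and d = "Suc d" and j = i, OF r(1)]])
    moreover have "polys_in (insert i {c+1..n}) \<subseteq> R" using i c_le_n by (intro polys_in_mono) auto
    ultimately have "?g \<in> P" using r(2) unfolding P_def by blast
    moreover have "mderiv j ?g = 0" if "j \<in> {1..c}" "j \<noteq> i" for j
      using g by (rule mderiv_notin) (use that in auto)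
    ultimately show ?thesis using r(3) by blast
  qed
  then show ?thesis by metis
qed

text \<open>Elements of \<open>P\<close> that serve as local coordinates transversal to the point.\<close>

definition coord :: "nat \<Rightarrow> 'k mpoly" where
  "coord = (SOME g. \<forall>i\<in>{1..c}. g i \<in> P \<and> \<Phi> (mderiv i (g i)) \<noteq> 0 \<and> (\<forall>j\<in>{1..c}. j \<noteq> i \<longrightarrow> mderiv j (g i) = 0))"

lemma coord:
  assumes "i \<in> {1..c}"
  shows "coord i \<in> P" "\<Phi> (mderiv i (coord i)) \<noteq> 0" "j \<in> {1..c} \<Longrightarrow> j \<noteq> i \<Longrightarrow> mderiv j (coord i) = 0"
  using someI_ex[OF coordinates_exist, folded coord_def] assms by blast+

definition slope :: "nat \<Rightarrow> 'k mpoly" where "slope i = mderiv i (coord i)"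
definition slopes :: "'k mpoly" where "slopes = (\<Prod>i\<in>{1..c}. slope i)"
definition coslope :: "nat \<Rightarrow> 'k mpoly" where "coslope i = (\<Prod>j\<in>{1..c} - {i}. slope j)"

text \<open>
  The Euler vector field of the local coordinates, \<open>\<Sum>i. (g\<^sub>i / e\<^sub>i) \<partial>\<^sub>i\<close> with \<open>e\<^sub>i\<close> the slope of \<open>g\<^sub>i\<close>,
  multiplied by the product \<open>slopes\<close> of the denominators.
\<close>

definition euler :: "'k mpoly \<Rightarrow> 'k mpoly" where
  "euler f = (\<Sum>i\<in>{1..c}. coslope i * coord i * mderiv i f)"

lemma slope_R: "i \<in> {1..c} \<Longrightarrow> slope i \<in> R"
  unfolding slope_def by (intro polys_in_mderiv P_R coord(1))

lemma slopes_R: "slopes \<in> R"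
  unfolding slopes_def by (intro polys_in_prod slope_R)

lemma coslope_R: "coslope i \<in> R"
  unfolding coslope_def by (intro polys_in_prod slope_R) auto

lemma slopes_eq: "i \<in> {1..c} \<Longrightarrow> slopes = slope i * coslope i"
  unfolding slopes_def coslope_def by (simp add: prod.remove)

lemma slopes_nz: "\<Phi> slopes \<noteq> 0"
  unfolding slopes_def \<Phi>_prod using coord(2) by (simp add: slope_def)

lemma euler_add: "euler (f + g) = euler f + euler g"
  by (simp add: euler_def mderiv_add distrib_left sum.distrib)

lemma euler_mult: "euler (f * g) = euler f * g + f * euler g"
proof -
  have "euler (f * g) = (\<Sum>i\<in>{1..c}. coslope i * coord i * mderiv i f * g + f * (coslope i * coord i * mderiv i g))"
    unfolding euler_def by (rule sum.cong) (simp_all add: mderiv_mult algebra_simps)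
  then show ?thesis by (simp add: euler_def sum.distrib sum_distrib_left sum_distrib_right)
qed

lemma euler_P: "f \<in> R \<Longrightarrow> euler f \<in> P"
proof -
  assume f: "f \<in> R"
  have "\<Phi> (coord i) = 0" if "i \<in> {1..c}" for i using coord(1)[OF that] by (simp add: P_def)
  then have "\<Phi> (euler f) = 0" by (simp add: euler_def \<Phi>_sum \<Phi>_mult)
  moreover have "euler f \<in> R"
    unfolding euler_def using coord(1) f by (intro polys_in_sum polys_in_mult coslope_R polys_in_mderiv) (auto simp: P_def)
  ultimately show ?thesis by (simp add: P_def)
qed

text \<open>
  Modulo \<open>P\<close> both sides of \<open>euler p = slopes * p\<close> have the same derivatives, so the difference lies in
  the second symbolic power.
\<close>

lemma euler_cotangent: "p \<in> P \<Longrightarrow> spow 2 (euler p - slopes * p)"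
proof (rule cotangent_injective)
  assume p: "p \<in> P"
  then have p0: "\<Phi> p = 0" "p \<in> R" by (auto simp: P_def)
  have "euler p \<in> P" by (rule euler_P[OF p0(2)])
  then show "euler p - slopes * p \<in> P"
    using p0 slopes_R by (auto simp: P_def \<Phi>_diff \<Phi>_mult intro: polys_in_diff polys_in_mult)
  fix j assume j: "j \<in> {1..c}"
  have "\<Phi> (mderiv j (euler p)) = (\<Sum>i\<in>{1..c}. \<Phi> (coslope i) * \<Phi> (mderiv j (coord i)) * \<Phi> (mderiv i p))"
    unfolding euler_def mderiv_sum \<Phi>_sum
  proof (rule sum.cong)
    fix i assume "i \<in> {1..c}"
    then have "\<Phi> (coord i) = 0" using coord(1) by (simp add: P_def)
    then show "\<Phi> (mderiv j (coslope i * coord i * mderiv i p)) = \<Phi> (coslope i) * \<Phi> (mderiv j (coord i)) * \<Phi> (mderiv i p)"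
      by (simp add: mderiv_mult \<Phi>_add \<Phi>_mult)
  qed simp
  also have "\<dots> = (\<Sum>i\<in>{1..c}. if i = j then \<Phi> (coslope j) * \<Phi> (slope j) * \<Phi> (mderiv j p) else 0)"
    using coord(3) j by (intro sum.cong) (auto simp: slope_def)
  also have "\<dots> = \<Phi> slopes * \<Phi> (mderiv j p)"
  proof -
    have "\<Phi> slopes = \<Phi> (coslope j) * \<Phi> (slope j)"
      unfolding slopes_eq[OF j] \<Phi>_mult by (rule mult.commute)
    then show ?thesis using j by (simp only: sum.delta finite_atLeastAtMost if_True)
  qed
  finally show "\<Phi> (mderiv j (euler p - slopes * p)) = 0"
    by (simp add: mderiv_diff mderiv_mult \<Phi>_diff \<Phi>_add \<Phi>_mult p0)
qed

text \<open>
  Euler's identity: up to the factor \<open>slopes\<close>, the derivation \<open>euler\<close> acts on the \<open>k\<close>-th graded piece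
  as multiplication by \<open>k\<close>.  By the product rule this follows from the case of elements of \<open>P\<close>.
\<close>

lemma euler_spow: "spow k f \<Longrightarrow> spow (Suc k) (euler f - of_nat k * slopes * f)"
proof (induction rule: spow.induct)
  case (base f)
  then show ?case using spow_1[OF euler_P] by (simp add: One_nat_def)
next
  case (mult p k q)
  have "spow (2 + k) ((euler p - slopes * p) * q)"
    by (rule spow_mult[OF euler_cotangent[OF mult(1)] mult(2)])
  moreover have "spow (Suc (Suc k)) (p * (euler q - of_nat k * slopes * q))"
    by (rule spow.mult[OF mult(1,3)])
  ultimately have "spow (Suc (Suc k)) ((euler p - slopes * p) * q + p * (euler q - of_nat k * slopes * q))"
    by (intro spow.add) simp_all
  then show ?case by (simp add: euler_mult algebra_simps)
next
  case (add k f g)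
  then show ?case
    using spow.add[OF add(3,4)] by (simp add: euler_add algebra_simps)
next
  case (sat h f k)
  have f: "spow k f" by (rule spow.sat[OF sat(1-4)])
  have "spow (Suc k) (euler h * f)"
    using spow_mult[OF spow_1[OF euler_P[OF sat(1)]] f] unfolding plus_1_eq_Suc .
  then have "spow (Suc k) (euler (h * f) - of_nat k * slopes * (h * f) - euler h * f)"
    by (rule spow_diff[OF sat(5)])
  moreover have "euler (h * f) - of_nat k * slopes * (h * f) - euler h * f = h * (euler f - of_nat k * slopes * f)"
    by (simp add: euler_mult algebra_simps)
  ultimately have "spow (Suc k) (h * (euler f - of_nat k * slopes * f))" by simp
  moreover have "euler f - of_nat k * slopes * f \<in> R"
    using P_R[OF euler_P[OF sat(3)]] sat(3) slopes_R polys_in_const[of "of_nat k" "{1..n}", unfolded mconst_of_nat]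
    by (intro polys_in_diff polys_in_mult)
  ultimately show ?case using spow.sat[OF sat(1,2)] by blast
qed

text \<open>
  If \<open>\<gamma> f\<close> has order \<open>k + 1\<close>, then \<open>f\<close> and its derivatives lie in the \<open>k\<close>-th symbolic power by
  induction.  The coefficients of \<open>euler\<close> lie in \<open>P\<close>, so \<open>euler f\<close> lies in the next power; by Euler's
  identity so does \<open>k f\<close>, up to a factor outside \<open>P\<close>, and \<open>k\<close> is invertible.
\<close>

theorem spow_if_\<gamma>_order: "f \<in> R \<Longrightarrow> \<gamma> f \<in> order_ge c k \<Longrightarrow> spow k f"
proof (induction k arbitrary: f)
  case 0
  then show ?case by (intro spow.base)
next
  case (Suc k)
  have f: "spow k f"
    using Suc(1)[OF Suc(2)] Suc(3) order_ge_antimono[of k "Suc k" c] by auto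
  show ?case
  proof (cases "k = 0")
    case True
    then show ?thesis
      using Suc(2,3) \<gamma>_order_ge_1_iff spow_1 by (simp add: One_nat_def)
  next
    case False
    have d: "spow k (mderiv i f)" if i: "i \<in> {1..c}" for i
      using order_ge_mderiv[OF Suc(3), of i] Suc(1)[OF polys_in_mderiv[OF Suc(2)]] mderiv_\<gamma>[OF i] by simp
    have "spow (Suc k) (coord i * (coslope i * mderiv i f))" if i: "i \<in> {1..c}" for i
      by (rule spow.mult[OF coord(1)[OF i] spow_smult[OF d[OF i] coslope_R]])
    then have "spow (Suc k) (euler f)"
      unfolding euler_def by (intro spow_sum) (simp add: mult_ac)
    then have "spow (Suc k) (euler f - (euler f - of_nat k * slopes * f))"
      by (rule spow_diff[OF _ euler_spow[OF f]])
    then have "spow (Suc k) ((of_nat k * slopes) * f)" by simp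
    moreover have "of_nat k * slopes \<in> R"
      using slopes_R polys_in_const[of "of_nat k" "{1..n}", unfolded mconst_of_nat] by (intro polys_in_mult)
    moreover have "\<Phi> (of_nat k * slopes) \<noteq> 0"
      using False slopes_nz of_nat_nz by (simp add: \<Phi>_mult \<Phi>_of_nat)
    ultimately show ?thesis using spow.sat Suc(2) by blast
  qed
qed

section \<open>Approximation\<close>

lemma order_ge_SucI:
  fixes p :: "'f mpoly"
  assumes "p \<in> S" "Poly_Mapping.lookup p 0 = 0" "\<And>j. j \<in> {1..c} \<Longrightarrow> mderiv j p \<in> order_ge c k"
  shows "p \<in> order_ge c (Suc k)"
proof -
  have "Suc k \<le> mdeg \<alpha>" if nz: "Poly_Mapping.lookup p \<alpha> \<noteq> 0" for \<alpha>
  proof -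
    have "\<alpha> \<noteq> 0" using nz assms(2) by auto
    then obtain \<beta> j where \<beta>: "\<alpha> = \<beta> + evar j" "j \<in> Poly_Mapping.keys \<alpha>" by (rule monom_split_evar)
    have j: "j \<in> {1..c}" using polys_in_lookup[OF assms(1) nz] \<beta>(2) by blast
    have "Poly_Mapping.lookup (mderiv j p) \<beta> \<noteq> 0"
      using nz of_nat_nz[of "Poly_Mapping.lookup \<beta> j + 1"] unfolding lookup_mderiv \<beta>(1) by simp
    then have "k \<le> mdeg \<beta>" using assms(3)[OF j] by (simp add: order_ge_def)
    then show ?thesis by (simp add: \<beta>(1))
  qed
  with assms(1) show ?thesis by (simp add: order_ge_def)
qed

lemma \<gamma>_coord:
  assumes i: "i \<in> {1..c}"
  shows "\<gamma> (coord i) - mconst (\<Phi> (slope i)) * mvar i \<in> order_ge c 2"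
proof -
  have P: "coord i \<in> R" "\<Phi> (coord i) = 0" using coord(1)[OF i] by (auto simp: P_def)
  let ?p = "\<gamma> (coord i) - mconst (\<Phi> (slope i)) * mvar i"
  have S: "?p \<in> S" using \<gamma>_S[OF P(1)] i by (intro polys_in_diff polys_in_mult polys_in_const polys_in_var)
  have "?p \<in> order_ge c (Suc 1)"
  proof (rule order_ge_SucI[OF S])
    have "Poly_Mapping.lookup (mvar i :: 'f mpoly) 0 = 0"
    proof -
      have "(mvar i :: 'f mpoly) \<in> order_ge c 1" by (rule order_ge_var[OF i])
      then show ?thesis by (simp add: order_ge_1_iff)
    qed
    then show "Poly_Mapping.lookup ?p 0 = 0"
      by (simp add: lookup_minus lookup_\<gamma>_0 P(2) lookup_mconst_mult)
    fix j assume j: "j \<in> {1..c}"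
    have "\<Phi> (mderiv j (coord i)) = (if j = i then \<Phi> (slope i) else 0)"
      using coord(3)[OF i j] by (auto simp: slope_def)
    then have "Poly_Mapping.lookup (mderiv j ?p) 0 = 0"
      by (simp add: mderiv_diff mderiv_\<gamma>[OF j] mderiv_const_mult mderiv_var lookup_minus lookup_\<gamma>_0 lookup_mconst_mult)
    then show "mderiv j ?p \<in> order_ge c 1"
      using polys_in_mderiv[OF S] by (simp add: order_ge_1_iff)
  qed
  then show ?thesis by (simp add: numeral_2_eq_2 One_nat_def)
qed

text \<open>Products of the local coordinates realize every monomial as a leading term.\<close>

lemma leading_monomial:
  assumes "Poly_Mapping.keys \<alpha> \<subseteq> {1..c}"
  shows "\<exists>f\<in>R. \<exists>e. e \<noteq> 0 \<and> \<gamma> f - Poly_Mapping.single \<alpha> e \<in> order_ge c (Suc (mdeg \<alpha>))"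
  using assms
proof (induction \<alpha> rule: monom_induct)
  case zero
  show ?case by (intro bexI[of _ 1] exI[of _ 1]) auto
next
  case (add \<beta> i)
  then have i: "i \<in> {1..c}" and \<beta>: "Poly_Mapping.keys \<beta> \<subseteq> {1..c}" by (auto simp: keys_plus_monom)
  obtain f e where f: "f \<in> R" "e \<noteq> 0" "\<gamma> f - Poly_Mapping.single \<beta> e \<in> order_ge c (Suc (mdeg \<beta>))"
    using add.IH[OF \<beta>] by blast
  define u where "u = \<gamma> (coord i) - mconst (\<Phi> (slope i)) * mvar i"
  define v where "v = \<gamma> f - Poly_Mapping.single \<beta> e"
  have uv: "u \<in> order_ge c 2" "v \<in> order_ge c (Suc (mdeg \<beta>))"
    using \<gamma>_coord[OF i] f(3) by (simp_all add: u_def v_def)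
  have \<beta>_ord: "Poly_Mapping.single \<beta> e \<in> order_ge c (mdeg \<beta>)" by (rule order_ge_single[OF \<beta>]) simp
  \<comment> \<open>each term on the right gains an order over the leading term\<close>
  have "\<gamma> (coord i * f) - Poly_Mapping.single (\<beta> + evar i) (\<Phi> (slope i) * e)
    = u * (Poly_Mapping.single \<beta> e) + u * v + mconst (\<Phi> (slope i)) * (mvar i * v)"
  proof -
    have "Poly_Mapping.single (\<beta> + evar i) (\<Phi> (slope i) * e) = mconst (\<Phi> (slope i)) * mvar i * Poly_Mapping.single \<beta> e"
      by (simp add: mvar_times_single mult.assoc) (simp add: mconst_def mult_single)
    then show ?thesis by (simp add: \<gamma>_mult u_def v_def algebra_simps)
  qed
  also have "\<dots> \<in> order_ge c (Suc (Suc (mdeg \<beta>)))"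
  proof (intro order_ge_add)
    show "u * Poly_Mapping.single \<beta> e \<in> order_ge c (Suc (Suc (mdeg \<beta>)))"
      using order_ge_mult[OF uv(1) \<beta>_ord] by simp
    show "u * v \<in> order_ge c (Suc (Suc (mdeg \<beta>)))"
      using order_ge_mult[OF uv] order_ge_antimono[of "Suc (Suc (mdeg \<beta>))" "2 + Suc (mdeg \<beta>)" c] by auto
    have "mvar i * v \<in> order_ge c (Suc (Suc (mdeg \<beta>)))"
      using order_ge_mult[OF order_ge_var[OF i] uv(2)] by (simp add: plus_1_eq_Suc)
    then show "mconst (\<Phi> (slope i)) * (mvar i * v) \<in> order_ge c (Suc (Suc (mdeg \<beta>)))"
      by (rule ideal_inD(4)[OF ideal_in_order_ge polys_in_const])
  qed
  finally have "\<gamma> (coord i * f) - Poly_Mapping.single (\<beta> + evar i) (\<Phi> (slope i) * e) \<in> order_ge c (Suc (mdeg (\<beta> + evar i)))"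
    by (simp flip: Suc_eq_plus1)
  moreover have "\<Phi> (slope i) * e \<noteq> 0" using f(2) coord(2)[OF i] by (simp add: slope_def)
  moreover have "coord i * f \<in> R" using f(1) P_R[OF coord(1)[OF i]] by (intro polys_in_mult)
  ultimately show ?case by blast
qed

text \<open>
  A monomial with arbitrary coefficient: correct the leading term from \<open>leading_monomial\<close> by a
  fraction \<open>\<Phi> p / \<Phi> q\<close>, which is the value of \<open>\<gamma> p / \<gamma> q\<close> at the origin.
\<close>

lemma jet_lift_step:
  assumes "s \<in> order_ge c k"
  shows "\<exists>f\<in>R. \<exists>h\<in>R. \<Phi> h \<noteq> 0 \<and> \<gamma> f - \<gamma> h * s \<in> order_ge c (Suc k)"
proof (induction s rule: poly_mapping_single_induct)
  case (single \<alpha> a)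
  show ?case
  proof (cases "a = 0")
    case True
    then show ?thesis by (intro bexI[of _ 0] bexI[of _ 1]) auto
  next
    case False
    with single assms have \<alpha>: "k \<le> mdeg \<alpha>" "Poly_Mapping.keys \<alpha> \<subseteq> {1..c}"
      by (auto simp: order_ge_def in_keys_iff[of _ s] dest: polys_in_lookup)
    obtain f e where f: "f \<in> R" "e \<noteq> 0" "\<gamma> f - Poly_Mapping.single \<alpha> e \<in> order_ge c (Suc (mdeg \<alpha>))"
      using leading_monomial[OF \<alpha>(2)] by blast
    obtain p q where pq: "p \<in> R" "q \<in> R" "\<Phi> q \<noteq> 0" "a / e * \<Phi> q = \<Phi> p"
      using fractions by blast
    have remainder: "\<gamma> r - mconst (\<Phi> r) \<in> order_ge c 1" if "r \<in> R" for r
      using \<gamma>_S[OF that] by (auto simp: order_ge_1_iff lookup_minus lookup_\<gamma>_0 intro: polys_in_diff)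
        (simp add: mconst_def)
    have "Poly_Mapping.single \<alpha> (\<Phi> p * e) = Poly_Mapping.single \<alpha> (\<Phi> q * a)"
      using pq(4) f(2) by (simp add: field_simps)
    then have "mconst (\<Phi> p) * Poly_Mapping.single \<alpha> e = mconst (\<Phi> q) * Poly_Mapping.single \<alpha> a"
      by (simp add: mconst_def mult_single)
    then have "\<gamma> (p * f) - \<gamma> q * Poly_Mapping.single \<alpha> a = \<gamma> p * (\<gamma> f - Poly_Mapping.single \<alpha> e)
      + (\<gamma> p - mconst (\<Phi> p)) * Poly_Mapping.single \<alpha> e - (\<gamma> q - mconst (\<Phi> q)) * Poly_Mapping.single \<alpha> a"
      by (simp add: \<gamma>_mult algebra_simps)
    also have "\<dots> \<in> order_ge c (Suc (mdeg \<alpha>))"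
    proof (intro order_ge_add order_ge_diff)
      show "\<gamma> p * (\<gamma> f - Poly_Mapping.single \<alpha> e) \<in> order_ge c (Suc (mdeg \<alpha>))"
        by (rule ideal_inD(4)[OF ideal_in_order_ge \<gamma>_S[OF pq(1)] f(3)])
      show "(\<gamma> p - mconst (\<Phi> p)) * Poly_Mapping.single \<alpha> e \<in> order_ge c (Suc (mdeg \<alpha>))"
        using order_ge_mult[OF remainder[OF pq(1)] order_ge_single[OF \<alpha>(2) order_refl]]
        unfolding plus_1_eq_Suc .
      show "(\<gamma> q - mconst (\<Phi> q)) * Poly_Mapping.single \<alpha> a \<in> order_ge c (Suc (mdeg \<alpha>))"
        using order_ge_mult[OF remainder[OF pq(2)] order_ge_single[OF \<alpha>(2) order_refl]]
        unfolding plus_1_eq_Suc .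
    qed
    also have "order_ge c (Suc (mdeg \<alpha>)) \<subseteq> order_ge c (Suc k)"
      using \<alpha>(1) by (intro order_ge_antimono) simp
    finally have "\<gamma> (p * f) - \<gamma> q * Poly_Mapping.single \<alpha> a \<in> order_ge c (Suc k)" .
    then show ?thesis using polys_in_mult[OF pq(1) f(1)] pq(2,3) by blast
  qed
next
  case (add s t)
  then obtain f h f' h' where fh: "f \<in> R" "h \<in> R" "\<Phi> h \<noteq> 0" "\<gamma> f - \<gamma> h * s \<in> order_ge c (Suc k)"
    "f' \<in> R" "h' \<in> R" "\<Phi> h' \<noteq> 0" "\<gamma> f' - \<gamma> h' * t \<in> order_ge c (Suc k)" by blast
  have "\<gamma> (h' * f + h * f') - \<gamma> (h * h') * (s + t) = \<gamma> h' * (\<gamma> f - \<gamma> h * s) + \<gamma> h * (\<gamma> f' - \<gamma> h' * t)"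
    by (simp add: \<gamma>_mult \<gamma>_add algebra_simps)
  also have "\<dots> \<in> order_ge c (Suc k)"
    using fh by (intro order_ge_add ideal_inD(4)[OF ideal_in_order_ge \<gamma>_S])
  finally have "\<gamma> (h' * f + h * f') - \<gamma> (h * h') * (s + t) \<in> order_ge c (Suc k)" .
  moreover have "\<Phi> (h * h') \<noteq> 0" using fh by (simp add: \<Phi>_mult)
  moreover have "h' * f + h * f' \<in> R" "h * h' \<in> R" using fh by (auto intro: polys_in_add polys_in_mult)
  ultimately show ?case by blast
qed

text \<open>
  Successive approximation: the error of order \<open>N\<close> is itself approximated to the next order.
\<close>

theorem jet_lift:
  assumes "s \<in> S"
  obtains f h where "f \<in> R" "h \<in> R" "\<Phi> h \<noteq> 0" "\<gamma> f - \<gamma> h * s \<in> order_ge c N"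
proof -
  have "\<exists>f\<in>R. \<exists>h\<in>R. \<Phi> h \<noteq> 0 \<and> \<gamma> f - \<gamma> h * s \<in> order_ge c N"
  proof (induction N)
    case 0
    show ?case using assms by (intro bexI[of _ 0] bexI[of _ 1]) (auto intro: polys_in_uminus)
  next
    case (Suc N)
    then obtain f h where fh: "f \<in> R" "h \<in> R" "\<Phi> h \<noteq> 0" "\<gamma> f - \<gamma> h * s \<in> order_ge c N" by blast
    obtain f' h' where fh': "f' \<in> R" "h' \<in> R" "\<Phi> h' \<noteq> 0"
      "\<gamma> f' - \<gamma> h' * (\<gamma> f - \<gamma> h * s) \<in> order_ge c (Suc N)"
      using jet_lift_step[OF fh(4)] by blast
    have "\<gamma> (h' * f - f') - \<gamma> (h' * h) * s = - (\<gamma> f' - \<gamma> h' * (\<gamma> f - \<gamma> h * s))"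
      by (simp add: \<gamma>_diff \<gamma>_mult algebra_simps)
    also have "\<dots> \<in> order_ge c (Suc N)" by (rule order_ge_uminus[OF fh'(4)])
    finally have "\<gamma> (h' * f - f') - \<gamma> (h' * h) * s \<in> order_ge c (Suc N)" .
    moreover have "\<Phi> (h' * h) \<noteq> 0" using fh(3) fh'(3) by (simp add: \<Phi>_mult)
    moreover have "h' * f - f' \<in> R" "h' * h \<in> R" using fh fh' by (auto intro: polys_in_diff polys_in_mult)
    ultimately show ?case by blast
  qed
  then show thesis using that by blast
qed

end

section \<open>Colength as the length of a chain of ideals\<close>

definition ideals_above :: "'a::comm_ring_1 set \<Rightarrow> 'a set \<Rightarrow> 'a set set" where
  "ideals_above A I = {J. ideal_in A J \<and> I \<subseteq> J}"

abbreviation orth_ideal :: "nat \<Rightarrow> 'f::field mpoly set \<Rightarrow> 'f mpoly set" where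
  "orth_ideal c I \<equiv> orth c (Poly_Mapping.lookup ` I)"

lemma dim_mono_span:
  fixes A B :: "'f::field mpoly set"
  assumes "A \<subseteq> B" "B \<subseteq> mspace.span X" "finite X"
  shows "mspace.dim A \<le> mspace.dim B"
proof -
  obtain Y where Y: "Y \<subseteq> B" "mspace.independent Y" "B \<subseteq> mspace.span Y" "card Y = mspace.dim B"
    by (rule mspace.basis_exists)
  have "finite Y" using mspace.independent_span_bound[OF assms(3) Y(2)] Y(1) assms(2) by blast
  then show ?thesis using mspace.dim_le_card[of A Y] assms(1) Y(3,4) by (metis order_trans)
qed

lemma keys_orth_ideal:
  fixes I :: "'f::field mpoly set"
  assumes "CHAR('f) = 0" "order_ge c N \<subseteq> I"
  shows "orth_ideal c I \<subseteq> mspace.span ((\<lambda>\<alpha>. Poly_Mapping.single \<alpha> 1) ` monoms c N)"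
proof -
  interpret coefficient_space c "Poly_Mapping.lookup ` polys_in {1..c} :: 'f mseries set"
    by (rule coefficient_space_polys[OF assms(1)])
  have "tails N \<subseteq> Poly_Mapping.lookup ` I"
    using assms(2) by (simp add: poly_tails_eq[OF assms(1)] lookup_image_mono_iff)
  then show ?thesis using in_span_monoms[OF keys_orth] by blast
qed

lemma dim_orth_split:
  fixes I :: "'f::field mpoly set"
  assumes "CHAR('f) = 0" "ideal_in (polys_in {1..c}) I" "order_ge c N \<subseteq> I"
    and f: "f \<in> polys_in {1..c}" "f \<notin> I"
  shows "mspace.dim (orth_ideal c I) =
    Suc (mspace.dim {F \<in> orth_ideal c I. pair (Poly_Mapping.lookup f) F = 0})"
proof -
  obtain F0 where "F0 \<in> orth_ideal c I" "pair (Poly_Mapping.lookup f) F0 \<noteq> 0"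
    using annihilator_lookup_ideal[OF assms(1-3) f(1)] f(2) by blast
  then show ?thesis
    by (intro dim_codim1[OF subspace_orth keys_orth_ideal[OF assms(1,3)] _ linear_functional_pair]) auto
qed

text \<open>Along a strict chain of ideals the dimension of the orthogonal space drops at each step.\<close>

lemma chain_length_le_colength:
  fixes I :: "'f::field mpoly set"
  assumes char: "CHAR('f) = 0" and I: "order_ge c N \<subseteq> I"
    and chain: "has_chain (ideals_above (polys_in {1..c}) I) l"
  shows "l \<le> mspace.dim (orth_ideal c I)"
proof -
  obtain J where J: "\<And>i. i \<le> l \<Longrightarrow> ideal_in (polys_in {1..c}) (J i)" "\<And>i. i \<le> l \<Longrightarrow> I \<subseteq> J i"
    "\<And>i. i < l \<Longrightarrow> J i \<subset> J (Suc i)"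
    using chain unfolding has_chain_def ideals_above_def by blast
  have "mspace.dim (orth_ideal c (J i)) + i \<le> mspace.dim (orth_ideal c (J 0))" if "i \<le> l" for i
    using that
  proof (induction i)
    case (Suc i)
    then obtain f where f: "f \<in> J (Suc i)" "f \<notin> J i" using J(3)[of i] by auto
    have ord: "order_ge c N \<subseteq> J i" using I J(2)[of i] Suc(2) by auto
    have "mspace.dim (orth_ideal c (J i)) = Suc (mspace.dim {F \<in> orth_ideal c (J i). pair (Poly_Mapping.lookup f) F = 0})"
      using dim_orth_split[OF char J(1)[of i] ord _ f(2)] f(1) ideal_inD(1)[OF J(1)[OF Suc(2)]] Suc(2) by auto
    moreover have "mspace.dim (orth_ideal c (J (Suc i))) \<le> mspace.dim {F \<in> orth_ideal c (J i). pair (Poly_Mapping.lookup f) F = 0}"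
    proof (rule dim_mono_span)
      show "orth_ideal c (J (Suc i)) \<subseteq> {F \<in> orth_ideal c (J i). pair (Poly_Mapping.lookup f) F = 0}"
        using f(1) J(3)[of i] Suc(2) by (auto simp: orth_def)
      show "{F \<in> orth_ideal c (J i). pair (Poly_Mapping.lookup f) F = 0} \<subseteq> mspace.span ((\<lambda>\<alpha>. Poly_Mapping.single \<alpha> 1) ` monoms c N)"
        using keys_orth_ideal[OF char ord] by blast
    qed simp
    ultimately show ?case using Suc by simp
  qed simp
  moreover have "mspace.dim (orth_ideal c (J 0)) \<le> mspace.dim (orth_ideal c I)"
    using J(2)[of 0] by (intro dim_mono_span[OF _ keys_orth_ideal[OF char I]]) (auto simp: orth_def)
  ultimately show ?thesis by (metis add_leD2 order_refl order_trans)
qed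

text \<open>
  If the maximal ideal at the origin multiplies \<open>f\<close> into \<open>I\<close>, then a polynomial acts on \<open>f\<close> modulo \<open>I\<close>
  through its constant term, and so adding the line spanned by \<open>f\<close> gives an ideal.
\<close>

lemma socle_extension:
  fixes I :: "'f::field mpoly set"
  assumes I: "ideal_in (polys_in {1..c}) I" and f: "f \<in> polys_in {1..c}"
    and socle: "\<And>u. u \<in> order_ge c 1 \<Longrightarrow> u * f \<in> I"
  shows "ideal_in (polys_in {1..c}) {x + mconst a * f |x a. x \<in> I}"
  unfolding ideal_in_def
proof (intro conjI ballI subsetI)
  let ?J = "{x + mconst a * f |x a. x \<in> I}"
  have J: "y \<in> ?J" if "x \<in> I" "y = x + mconst a * f" for x y a using that by blast
  show "0 \<in> ?J" using J[OF ideal_inD(2)[OF I], of _ 0] by simp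
  show "y \<in> polys_in {1..c}" if "y \<in> ?J" for y
    using that f ideal_inD(1)[OF I] by (auto intro!: polys_in_add polys_in_mult)
  fix y assume "y \<in> ?J"
  then obtain x a where x: "x \<in> I" "y = x + mconst a * f" by blast
  show "y + z \<in> ?J" if z: "z \<in> ?J" for z
  proof -
    obtain x' a' where x': "x' \<in> I" "z = x' + mconst a' * f" using z by blast
    show ?thesis
      by (rule J[OF ideal_inD(3)[OF I x(1) x'(1)], of _ "a + a'"]) (simp add: x x' mconst_add algebra_simps)
  qed
  fix s :: "'f mpoly" assume s: "s \<in> polys_in {1..c}"
  let ?s0 = "Poly_Mapping.lookup s 0"
  have "s - mconst ?s0 \<in> order_ge c 1"
    using s by (auto simp: order_ge_1_iff lookup_minus intro: polys_in_diff) (simp add: mconst_def)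
  then have "(s - mconst ?s0) * f \<in> I" by (rule socle)
  then have "mconst a * ((s - mconst ?s0) * f) \<in> I" by (intro ideal_inD(4)[OF I polys_in_const])
  then have "s * x + mconst a * ((s - mconst ?s0) * f) \<in> I"
    by (intro ideal_inD(3)[OF I ideal_inD(4)[OF I s x(1)]])
  then show "s * y \<in> ?J"
    by (rule J[of _ _ "a * ?s0"]) (simp add: x mconst_mult algebra_simps)
qed

text \<open>
  A polynomial \<open>f \<notin> I\<close> of the largest order for which such polynomials exist is a socle element, and
  adding it lowers the colength by one.  The same induction shows that \<open>I\<close> contains all polynomials of
  order at least its colength, since one more factor \<open>y\<^sub>i\<close> returns to \<open>I\<close>.
\<close>

lemma chain_of_colength:
  fixes I :: "'f::field mpoly set"
  assumes char: "CHAR('f) = 0" and "ideal_in (polys_in {1..c}) I" "order_ge c N \<subseteq> I"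
    and "mspace.dim (orth_ideal c I) = k"
  shows "has_chain (ideals_above (polys_in {1..c}) I) k \<and> order_ge c k \<subseteq> I"
  using assms(2-)
proof (induction k arbitrary: I)
  case 0
  have "s \<in> I" if s: "s \<in> polys_in {1..c}" for s
    using dim_orth_split[OF char 0(1,2) s] 0(3) by auto
  moreover have "has_chain (ideals_above (polys_in {1..c}) I) 0"
    using 0(1) unfolding has_chain_def ideals_above_def by auto
  ultimately show ?case by auto
next
  case (Suc k)
  have nI: "\<exists>s\<in>polys_in {1..c}. s \<notin> I"
  proof (rule ccontr)
    assume "\<not> ?thesis"
    then have "orth_ideal c I \<subseteq> orth_ideal c (polys_in {1..c})" by (auto simp: orth_def)
    also have "\<dots> = {0}"
      by (rule coefficient_space.orth_U[OF coefficient_space_polys[OF char]])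
    also have "{0} \<subseteq> mspace.span {}" by simp
    finally have "mspace.dim (orth_ideal c I) \<le> 0" using mspace.dim_le_card[of "orth_ideal c I" "{}"] by simp
    then show False using Suc(4) by simp
  qed
  \<comment> \<open>the least such order is one more than that of the socle element\<close>
  define M where "M = (LEAST M. order_ge c M \<subseteq> I)"
  have M: "order_ge c M \<subseteq> I" unfolding M_def using Suc(3) by (rule LeastI)
  have "M \<noteq> 0" using M nI by (cases M) auto
  then obtain M' where M': "M = Suc M'" by (cases M) auto
  then have "\<not> order_ge c M' \<subseteq> I"
    using not_less_Least[of M' "\<lambda>M. order_ge c M \<subseteq> I"] by (simp add: M_def)
  then obtain f where f: "f \<in> order_ge c M'" "f \<notin> I" by blast
  have fS: "f \<in> polys_in {1..c}" using f(1) order_ge_subset by blast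
  have socle: "u * f \<in> I" if "u \<in> order_ge c 1" for u
    using order_ge_mult[OF that f(1)] M unfolding M' plus_1_eq_Suc by blast
  define I' where "I' = {x + mconst a * f |x a. x \<in> I}"
  have I': "ideal_in (polys_in {1..c}) I'"
    unfolding I'_def by (rule socle_extension[OF Suc(2) fS socle])
  have sub: "I \<subseteq> I'"
  proof
    fix x assume "x \<in> I"
    moreover have "x = x + mconst 0 * f" by simp
    ultimately show "x \<in> I'" unfolding I'_def by blast
  qed
  have fI': "f \<in> I'"
  proof -
    have "f = 0 + mconst 1 * f" by simp
    then show ?thesis unfolding I'_def using ideal_inD(2)[OF Suc(2)] by blast
  qed
  have "orth_ideal c I' = {F \<in> orth_ideal c I. pair (Poly_Mapping.lookup f) F = 0}"
  proof (intro equalityI subsetI)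
    fix F assume "F \<in> orth_ideal c I'"
    then show "F \<in> {F \<in> orth_ideal c I. pair (Poly_Mapping.lookup f) F = 0}"
      using sub fI' by (auto simp: orth_def)
  next
    fix F assume F: "F \<in> {F \<in> orth_ideal c I. pair (Poly_Mapping.lookup f) F = 0}"
    have "pair (Poly_Mapping.lookup (x + mconst a * f)) F = 0" if "x \<in> I" for x a
    proof -
      have "Poly_Mapping.lookup (x + mconst a * f) = (\<lambda>\<alpha>. Poly_Mapping.lookup x \<alpha> + a * Poly_Mapping.lookup f \<alpha>)"
        by (simp add: fun_eq_iff lookup_add lookup_mconst_mult)
      then show ?thesis using F that by (simp add: pair_add_left pair_scale_left orth_def)
    qed
    then show "F \<in> orth_ideal c I'" using F by (auto simp: orth_def I'_def)
  qed
  then have "mspace.dim (orth_ideal c I') = k"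
    using dim_orth_split[OF char Suc(2,3) fS f(2)] Suc(4) by simp
  then have IH: "has_chain (ideals_above (polys_in {1..c}) I') k" "order_ge c k \<subseteq> I'"
    using Suc(1)[OF I'] Suc(3) sub by blast+
  obtain J where J: "\<And>i. i \<le> k \<Longrightarrow> J i \<in> ideals_above (polys_in {1..c}) I'" "\<And>i. i < k \<Longrightarrow> J i \<subset> J (Suc i)"
    using IH(1) unfolding has_chain_def by blast
  have "I \<subset> J 0" using J(1)[of 0] sub fI' f(2) by (auto simp: ideals_above_def)
  have "has_chain (ideals_above (polys_in {1..c}) I) (Suc k)"
    unfolding has_chain_def
  proof (intro exI[of _ "\<lambda>i. case i of 0 \<Rightarrow> I | Suc i \<Rightarrow> J i"] conjI allI impI)
    fix i assume "i \<le> Suc k"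
    then show "(case i of 0 \<Rightarrow> I | Suc i \<Rightarrow> J i) \<in> ideals_above (polys_in {1..c}) I"
      using Suc(2) J(1) sub by (cases i) (auto simp: ideals_above_def)
  next
    fix i assume "i < Suc k"
    then show "(case i of 0 \<Rightarrow> I | Suc i \<Rightarrow> J i) \<subset> (case Suc i of 0 \<Rightarrow> I | Suc i \<Rightarrow> J i)"
      using \<open>I \<subset> J 0\<close> J(2) by (cases i) auto
  qed
  moreover have "p \<in> I" if "p \<in> order_ge c (Suc k)" for p
    using that
  proof (induction p rule: order_ge_Suc_induct)
    case (var i q)
    then obtain x a where q: "x \<in> I" "q = x + mconst a * f" using IH(2) unfolding I'_def by blast
    have i: "mvar i \<in> polys_in {1..c}" using var(1) by (rule polys_in_var)
    have "mvar i * x + mconst a * (mvar i * f) \<in> I"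
      by (intro ideal_inD(3)[OF Suc(2) ideal_inD(4)[OF Suc(2) i q(1)] ideal_inD(4)[OF Suc(2) polys_in_const socle[OF order_ge_var[OF var(1)]]]])
    then show ?case by (simp add: q(2) algebra_simps)
  qed (use ideal_inD(2,3)[OF Suc(2)] in auto)
  ultimately show ?case by blast
qed

lemma chain_length_eq_colength:
  fixes I :: "'f::field mpoly set"
  assumes char: "CHAR('f) = 0" and I: "ideal_in (polys_in {1..c}) I" "order_ge c N \<subseteq> I"
  shows "chain_length (ideals_above (polys_in {1..c}) I) = enat (mspace.dim (orth_ideal c I))"
  using chain_of_colength[OF char I refl] chain_length_le_colength[OF char I(2)]
  by (intro chain_length_eqI) auto

lemma chain_insert_below:
  assumes "\<forall>i\<le>m. J i \<in> \<J>" "\<forall>i<m. J i \<subset> J (Suc i)" "T \<in> \<J>" "T \<subset> J 0"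
  shows "has_chain \<J> (Suc m)"
  unfolding has_chain_def
proof (intro exI[of _ "\<lambda>i. case i of 0 \<Rightarrow> T | Suc i \<Rightarrow> J i"] conjI allI impI)
  show "(case i of 0 \<Rightarrow> T | Suc i \<Rightarrow> J i) \<in> \<J>" if "i \<le> Suc m" for i
    using assms that by (cases i) auto
  show "(case i of 0 \<Rightarrow> T | Suc i \<Rightarrow> J i) \<subset> (case Suc i of 0 \<Rightarrow> T | Suc i \<Rightarrow> J i)" if "i < Suc m" for i
    using assms that by (cases i) auto
qed

lemma chain_insert_above:
  assumes "\<forall>i\<le>m. J i \<in> \<J>" "\<forall>i<m. J i \<subset> J (Suc i)" "T \<in> \<J>" "J m \<subset> T"
  shows "has_chain \<J> (Suc m)"
  unfolding has_chain_def
  by (rule exI[of _ "\<lambda>i. if i \<le> m then J i else T"]) (use assms in \<open>auto simp: not_le less_Suc_eq_le le_Suc_eq\<close>)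

lemma chain_insert_between:
  assumes "\<forall>i\<le>m. J i \<in> \<J>" "\<forall>i<m. J i \<subset> J (Suc i)" "T \<in> \<J>" "i < m" "J i \<subset> T" "T \<subset> J (Suc i)"
  shows "has_chain \<J> (Suc m)"
  unfolding has_chain_def
proof (intro exI[of _ "\<lambda>j. if j \<le> i then J j else if j = Suc i then T else J (j - 1)"] conjI allI impI)
  show "(if j \<le> i then J j else if j = Suc i then T else J (j - 1)) \<in> \<J>" if "j \<le> Suc m" for j
    using assms that by auto
  show "(if j \<le> i then J j else if j = Suc i then T else J (j - 1)) \<subset>
     (if Suc j \<le> i then J (Suc j) else if Suc j = Suc i then T else J (Suc j - 1))" if "j < Suc m" for j
  proof -
    consider "j < i" | "j = i" | "j = Suc i" | j' where "j = Suc j'" "i < j'"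
      by (metis less_antisym linorder_neqE_nat not0_implies_Suc not_less_eq not_less_zero)
    then show ?thesis using assms that by cases auto
  qed
qed

section \<open>Chains of ideals in a quotient and in a localization\<close>

lemma has_chain_bij:
  assumes "bij_betw f \<J> \<J>'" "\<And>J J'. J \<in> \<J> \<Longrightarrow> J' \<in> \<J> \<Longrightarrow> J \<subseteq> J' \<longleftrightarrow> f J \<subseteq> f J'"
  shows "has_chain \<J> k \<longleftrightarrow> has_chain \<J>' k"
proof
  have mono: "J \<subset> J' \<longleftrightarrow> f J \<subset> f J'" if "J \<in> \<J>" "J' \<in> \<J>" for J J'
    using assms(2)[OF that] assms(2)[OF that(2,1)] by blast
  have im: "f ` \<J> = \<J>'" and inj: "inj_on f \<J>" using assms(1) by (auto simp: bij_betw_def)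
  assume "has_chain \<J> k"
  then show "has_chain \<J>' k"
    by (rule has_chain_mono_map[where f = f]) (use im mono in auto)
next
  have mono: "J \<subset> J' \<longleftrightarrow> f J \<subset> f J'" if "J \<in> \<J>" "J' \<in> \<J>" for J J'
    using assms(2)[OF that] assms(2)[OF that(2,1)] by blast
  have im: "f ` \<J> = \<J>'" and inj: "inj_on f \<J>" using assms(1) by (auto simp: bij_betw_def)
  assume "has_chain \<J>' k"
  then show "has_chain \<J> k"
  proof (rule has_chain_mono_map[where f = "inv_into \<J> f"])
    show "inv_into \<J> f J \<in> \<J>" if "J \<in> \<J>'" for J
      using that im by (auto intro: inv_into_into)
    show "inv_into \<J> f J \<subset> inv_into \<J> f J'" if "J \<in> \<J>'" "J' \<in> \<J>'" "J \<subset> J'" for J J'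
      using that im mono[of "inv_into \<J> f J" "inv_into \<J> f J'"]
      by (simp add: inv_into_into f_inv_into_f)
  qed
qed

lemma ring_length_quotient:
  assumes A: "is_subring A" and I: "ideal_in A I"
  shows "ring_length (ring_on A Quot I) = chain_length (ideals_above A I)"
proof -
  interpret cring "ring_on A" by (rule is_subring_cring[OF A])
  have I': "ideal I (ring_on A)" using I by (simp add: ideal_ring_on_iff[OF A])
  have above: "{J. ideal J (ring_on A) \<and> I \<subseteq> J} = ideals_above A I"
    by (auto simp: ideals_above_def ideal_ring_on_iff[OF A])
  let ?f = "\<lambda>J. (+>\<^bsub>ring_on A\<^esub>) I ` J"
  have bij: "bij_betw ?f (ideals_above A I) {J. ideal J (ring_on A Quot I)}"
    using quot_ideal_correspondence[OF I'] unfolding above .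
  have union: "\<Union> (?f J) = J" if "J \<in> ideals_above A I" for J
    using that ideal_incl_iff[OF I', of J] by (auto simp: ideals_above_def ideal_ring_on_iff[OF A])
  have "J \<subseteq> J' \<longleftrightarrow> ?f J \<subseteq> ?f J'" if "J \<in> ideals_above A I" "J' \<in> ideals_above A I" for J J'
    using union[OF that(1)] union[OF that(2)] by (metis Union_mono image_mono)
  then have "has_chain (ideals_above A I) k \<longleftrightarrow> has_chain {J. ideal J (ring_on A Quot I)} k" for k
    by (rule has_chain_bij[OF bij])
  then show ?thesis unfolding ring_length_eq by (intro chain_length_cong) simp
qed

text \<open>
  The ideals of a ring that are contracted from its localization at \<open>P\<close>.  Through them the length
  of the local ring can be computed without leaving the polynomial ring.
\<close>

definition saturated :: "'a::idom set \<Rightarrow> 'a set \<Rightarrow> 'a set \<Rightarrow> bool" where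
  "saturated A P J \<longleftrightarrow> (\<forall>h\<in>A - P. \<forall>f\<in>A. h * f \<in> J \<longrightarrow> f \<in> J)"

definition saturated_above :: "'a::idom set \<Rightarrow> 'a set \<Rightarrow> 'a set \<Rightarrow> 'a set set" where
  "saturated_above A P Q = {J. ideal_in A J \<and> saturated A P J \<and> Q \<subseteq> J}"

text \<open>
  Contraction and extension along the localization are inverse to each other on saturated ideals,
  so both preserve strict inclusions and carry chains to chains of the same length.
\<close>

lemma multiplicity_over_eq:
  fixes A :: "'a::idom set"
  assumes A: "is_subring A" and P: "primeideal P (ring_on A)" and Q: "Q \<subseteq> A"
  shows "multiplicity_over (ring_on A) P Q = chain_length (saturated_above A P Q)"
proof -
  interpret P: primeideal P "ring_on A" by (rule P)
  have P_ideal: "ideal_in A P" using P.is_ideal by (simp add: ideal_ring_on_iff[OF A])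
  have P1: "1 \<notin> P"
  proof
    assume "1 \<in> P"
    then have "P = A" using ideal_inD(4)[OF P_ideal, of _ 1] ideal_inD(1)[OF P_ideal] by auto
    then show False using P.I_notcarr by simp
  qed
  have Aops: "0 \<in> A" "1 \<in> A" "\<And>a b. a \<in> A \<Longrightarrow> b \<in> A \<Longrightarrow> a + b \<in> A" "\<And>a b. a \<in> A \<Longrightarrow> b \<in> A \<Longrightarrow> a * b \<in> A"
    "\<And>a. a \<in> A \<Longrightarrow> - a \<in> A"
    using A by (auto simp: is_subring_def)
  define T where "T = A - P"
  have T: "1 \<in> T" "\<And>s t. s \<in> T \<Longrightarrow> t \<in> T \<Longrightarrow> s * t \<in> T" "\<And>s. s \<in> T \<Longrightarrow> s \<noteq> 0" "\<And>s. s \<in> T \<Longrightarrow> s \<in> A"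
    using P1 P.I_prime ideal_inD(2)[OF P_ideal] Aops by (auto simp: T_def)
  define L where "L = {Fract a s |a s. a \<in> A \<and> s \<in> T}"
  have L_mem: "Fract a s \<in> L" if "a \<in> A" "s \<in> T" for a s using that unfolding L_def by blast
  have L: "is_subring L"
    unfolding is_subring_def
  proof (intro conjI ballI)
    show "0 \<in> L" "1 \<in> L" using L_mem[of 0 1] L_mem[of 1 1] Aops T(1) by (simp_all add: fract_collapse)
    fix x assume "x \<in> L"
    then obtain a s where x: "a \<in> A" "s \<in> T" "x = Fract a s" unfolding L_def by blast
    show "- x \<in> L" using L_mem[of "- a" s] x Aops by simp
    fix y assume "y \<in> L"
    then obtain b t where y: "b \<in> A" "t \<in> T" "y = Fract b t" unfolding L_def by blast
    have "x + y = Fract (a * t + b * s) (s * t)" using x y T(3) by simp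
    then show "x + y \<in> L" using x y T Aops by (auto intro!: L_mem)
    have "x * y = Fract (a * b) (s * t)" using x y by simp
    then show "x * y \<in> L" using x y T Aops by (auto intro!: L_mem)
  qed
  let ?Q = "(\<lambda>q. Fract q 1) ` Q"
  define I0 where "I0 = ideal_span L ?Q"
  have QL: "?Q \<subseteq> L" using Q T(1) L_mem by blast
  have I0: "ideal_in L I0" unfolding I0_def by (rule ideal_in_ideal_span[OF L QL])
  have loc: "localization (ring_on A) P = ring_on L"
    by (simp add: localization_def L_def T_def)
  have mult: "multiplicity_over (ring_on A) P Q = chain_length (ideals_above L I0)"
    unfolding multiplicity_over_def loc genideal_ring_on[OF L QL] I0_def[symmetric]
    by (rule ring_length_quotient[OF L I0])
  define down where "down K = {f \<in> A. Fract f 1 \<in> K}" for K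
  define up where "up J = {Fract a s |a s. a \<in> J \<and> s \<in> T}" for J
  have split: "Fract a s = Fract 1 s * Fract a 1" "Fract a 1 = Fract s 1 * Fract a s" if "s \<in> T" for a s
    using T(3)[OF that] by (simp_all add: eq_fract mult.commute)
  have "has_chain (ideals_above L I0) k \<longleftrightarrow> has_chain (saturated_above A P Q) k" for k
  proof
    assume "has_chain (ideals_above L I0) k"
    then show "has_chain (saturated_above A P Q) k"
    proof (rule has_chain_mono_map[where f = down])
      fix K assume "K \<in> ideals_above L I0"
      then have K: "ideal_in L K" "I0 \<subseteq> K" by (auto simp: ideals_above_def)
      have "ideal_in A (down K)"
        unfolding ideal_in_def down_def
      proof (intro conjI ballI)
        show "0 \<in> {f \<in> A. Fract f 1 \<in> K}" using ideal_inD(2)[OF K(1)] Aops by (simp add: fract_collapse)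
        fix x assume x: "x \<in> {f \<in> A. Fract f 1 \<in> K}"
        show "x + y \<in> {f \<in> A. Fract f 1 \<in> K}" if "y \<in> {f \<in> A. Fract f 1 \<in> K}" for y
          using ideal_inD(3)[OF K(1), of "Fract x 1" "Fract y 1"] x that Aops by simp
        show "a * x \<in> {f \<in> A. Fract f 1 \<in> K}" if "a \<in> A" for a
          using ideal_inD(4)[OF K(1) L_mem[OF that T(1)], of "Fract x 1"] x that Aops by simp
      qed auto
      moreover have "saturated A P (down K)"
        unfolding saturated_def
      proof (intro ballI impI)
        fix h f assume h: "h \<in> A - P" and f: "f \<in> A" and hf: "h * f \<in> down K"
        then have hT: "h \<in> T" by (simp add: T_def)
        have "Fract 1 h * Fract (h * f) 1 \<in> K"
          by (rule ideal_inD(4)[OF K(1) L_mem[OF Aops(2) hT]]) (use hf in \<open>simp add: down_def\<close>)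
        moreover have "Fract 1 h * Fract (h * f) 1 = Fract f 1"
          using T(3)[OF hT] by (simp add: eq_fract)
        ultimately show "f \<in> down K" using f by (simp add: down_def)
      qed
      moreover have "Q \<subseteq> down K"
        using Q K(2) ideal_span_superset[OF L, of ?Q] by (auto simp: down_def I0_def)
      ultimately show "down K \<in> saturated_above A P Q" by (simp add: saturated_above_def)
    next
      fix K K' assume "K \<in> ideals_above L I0" "K' \<in> ideals_above L I0" and sub: "K \<subset> K'"
      then have K: "ideal_in L K" "ideal_in L K'" by (auto simp: ideals_above_def)
      obtain x where x: "x \<in> K'" "x \<notin> K" using sub by blast
      then obtain a s where as: "a \<in> A" "s \<in> T" "x = Fract a s"
        using ideal_inD(1)[OF K(2)] unfolding L_def by blast
      have "Fract a 1 \<in> K'"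
        unfolding split(2)[OF as(2), of a] by (rule ideal_inD(4)[OF K(2) L_mem[OF T(4)[OF as(2)] T(1)] x(1)[unfolded as(3)]])
      moreover have "Fract a 1 \<notin> K"
      proof
        assume "Fract a 1 \<in> K"
        then have "Fract 1 s * Fract a 1 \<in> K" by (rule ideal_inD(4)[OF K(1) L_mem[OF Aops(2) as(2)]])
        then have "x \<in> K" unfolding as(3) split(1)[OF as(2), of a, symmetric] .
        then show False using x(2) by blast
      qed
      ultimately show "down K \<subset> down K'" using sub as(1) unfolding down_def by blast
    qed
  next
    assume "has_chain (saturated_above A P Q) k"
    then show "has_chain (ideals_above L I0) k"
    proof (rule has_chain_mono_map[where f = up])
      have up_mem: "Fract a s \<in> up J" if "a \<in> J" "s \<in> T" for a s J using that unfolding up_def by blast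
      fix J assume "J \<in> saturated_above A P Q"
      then have J: "ideal_in A J" "Q \<subseteq> J" by (auto simp: saturated_above_def)
      have up: "ideal_in L (up J)"
        unfolding ideal_in_def
      proof (intro conjI ballI)
        show "up J \<subseteq> L" using ideal_inD(1)[OF J(1)] unfolding up_def L_def by blast
        show "0 \<in> up J" using up_mem[OF ideal_inD(2)[OF J(1)] T(1)] by (simp add: fract_collapse)
        fix x assume "x \<in> up J"
        then obtain a s where x: "a \<in> J" "s \<in> T" "x = Fract a s" unfolding up_def by blast
        show "x + y \<in> up J" if "y \<in> up J" for y
        proof -
          obtain b t where y: "b \<in> J" "t \<in> T" "y = Fract b t" using \<open>y \<in> up J\<close> unfolding up_def by blast
          have "x + y = Fract (t * a + s * b) (s * t)" using x y T(3) by (simp add: mult.commute)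
          moreover have "t * a + s * b \<in> J"
            using x y T(4) by (intro ideal_inD(3)[OF J(1)] ideal_inD(4)[OF J(1)])
          ultimately show ?thesis using up_mem T(2)[OF x(2) y(2)] by simp
        qed
        show "y * x \<in> up J" if "y \<in> L" for y
        proof -
          obtain b t where y: "b \<in> A" "t \<in> T" "y = Fract b t" using \<open>y \<in> L\<close> unfolding L_def by blast
          have "y * x = Fract (b * a) (t * s)" using x y by simp
          then show ?thesis using up_mem ideal_inD(4)[OF J(1) y(1) x(1)] T(2)[OF y(2) x(2)] by simp
        qed
      qed
      moreover have "I0 \<subseteq> up J"
        unfolding I0_def by (rule ideal_span_minimal[OF up]) (use J(2) T(1) up_mem in blast)
      ultimately show "up J \<in> ideals_above L I0" by (simp add: ideals_above_def)
    next
      fix J J' assume J: "J \<in> saturated_above A P Q" "J' \<in> saturated_above A P Q" "J \<subset> J'"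
      then have J': "ideal_in A J'" "ideal_in A J" "saturated A P J" by (auto simp: saturated_above_def)
      obtain a where a: "a \<in> J'" "a \<notin> J" using J(3) by blast
      have "Fract a 1 \<notin> up J"
      proof
        assume "Fract a 1 \<in> up J"
        then obtain b t where bt: "b \<in> J" "t \<in> T" "Fract a 1 = Fract b t" unfolding up_def by blast
        then have "t * a = b" using T(3)[OF bt(2)] by (simp add: eq_fract mult.commute)
        then have "t * a \<in> J" using bt(1) by simp
        then show False
          using J'(3) bt(2) a ideal_inD(1)[OF J'(1)] unfolding saturated_def T_def by blast
      qed
      moreover have "Fract a 1 \<in> up J'" unfolding up_def using a(1) T(1) by blast
      moreover have "up J \<subseteq> up J'" using J(3) unfolding up_def by blast
      ultimately show "up J \<subset> up J'" by blast
    qed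
  qed
  then show ?thesis unfolding mult by (rule chain_length_cong)
qed

context generic_point
begin

section \<open>Primary ideals and the Hilbert scheme\<close>

lemma R_subring: "is_subring R"
  by (rule is_subring_polys_in)

lemma P_iff: "f \<in> R \<Longrightarrow> f \<in> P \<longleftrightarrow> \<Phi> f = 0"
  by (simp add: P_def)

lemma saturated_iff: "saturated R P J \<longleftrightarrow> (\<forall>h\<in>R. \<forall>f\<in>R. \<Phi> h \<noteq> 0 \<longrightarrow> h * f \<in> J \<longrightarrow> f \<in> J)"
  by (auto simp: saturated_def P_def)

lemma saturated_aboveD:
  assumes "J \<in> saturated_above R P Q"
  shows "ideal_in R J" "Q \<subseteq> J" "h \<in> R \<Longrightarrow> f \<in> R \<Longrightarrow> \<Phi> h \<noteq> 0 \<Longrightarrow> h * f \<in> J \<Longrightarrow> f \<in> J"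
  using assms unfolding saturated_above_def saturated_iff by blast+

lemma saturated_aboveI:
  assumes "ideal_in R J" "Q \<subseteq> J" "\<And>h f. h \<in> R \<Longrightarrow> f \<in> R \<Longrightarrow> \<Phi> h \<noteq> 0 \<Longrightarrow> h * f \<in> J \<Longrightarrow> f \<in> J"
  shows "J \<in> saturated_above R P Q"
  using assms unfolding saturated_above_def saturated_iff by blast

lemma primary_to_P_iff:
  "primary_to (poly_ring n) P Q \<longleftrightarrow> Q \<in> saturated_above R P Q \<and> Q \<noteq> R \<and> P = {a \<in> R. \<exists>k. a ^ k \<in> Q}"
proof
  assume "primary_to (poly_ring n) P Q"
  then have Q: "ideal_in R Q" "Q \<noteq> R" "\<And>a b. a \<in> R \<Longrightarrow> b \<in> R \<Longrightarrow> a * b \<in> Q \<Longrightarrow> a \<in> Q \<or> b \<in> P"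
    "P = {a \<in> R. \<exists>k. a ^ k \<in> Q}"
    unfolding poly_ring_def primary_to_ring_on_iff[OF R_subring] by blast+
  have "f \<in> Q" if "h \<in> R" "f \<in> R" "\<Phi> h \<noteq> 0" "h * f \<in> Q" for h f
    using Q(3)[of f h] that by (simp add: mult.commute P_iff)
  then have "Q \<in> saturated_above R P Q" by (rule saturated_aboveI[OF Q(1) subset_refl])
  then show "Q \<in> saturated_above R P Q \<and> Q \<noteq> R \<and> P = {a \<in> R. \<exists>k. a ^ k \<in> Q}"
    using Q(2,4) by blast
next
  assume *: "Q \<in> saturated_above R P Q \<and> Q \<noteq> R \<and> P = {a \<in> R. \<exists>k. a ^ k \<in> Q}"
  have "a \<in> Q \<or> b \<in> P" if "a \<in> R" "b \<in> R" "a * b \<in> Q" for a b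
    using saturated_aboveD(3)[of Q Q b a] * that P_iff[OF that(2)] by (auto simp: mult.commute)
  then show "primary_to (poly_ring n) P Q"
    unfolding poly_ring_def primary_to_ring_on_iff[OF R_subring]
    using * saturated_aboveD(1) by blast
qed

lemma \<gamma>_unit:
  assumes J: "ideal_in S J" "order_ge c N \<subseteq> J" and h: "h \<in> R" "\<Phi> h \<noteq> 0" and s: "s \<in> S" "\<gamma> h * s \<in> J"
  shows "s \<in> J"
  by (rule unit_mod_order_ge[OF J \<gamma>_S[OF h(1)] _ s]) (simp add: lookup_\<gamma>_0 h(2))

lemma \<gamma>_preimage_eq: "hilb_to_primary n c \<Phi> J = {f \<in> R. \<gamma> f \<in> J}"
  by (simp add: hilb_to_primary_def)

lemma \<gamma>_preimage_saturated:
  assumes J: "ideal_in S J" "order_ge c N \<subseteq> J" "I \<subseteq> J"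
  shows "hilb_to_primary n c \<Phi> J \<in> saturated_above R P (hilb_to_primary n c \<Phi> I)"
proof (rule saturated_aboveI)
  show "ideal_in R (hilb_to_primary n c \<Phi> J)"
    unfolding \<gamma>_preimage_eq ideal_in_def
    using ideal_inD(2-4)[OF J(1)] \<gamma>_S by (auto simp: \<gamma>_add \<gamma>_mult intro: polys_in_add polys_in_mult)
  show "hilb_to_primary n c \<Phi> I \<subseteq> hilb_to_primary n c \<Phi> J"
    using J(3) by (auto simp: \<gamma>_preimage_eq)
  show "f \<in> hilb_to_primary n c \<Phi> J"
    if "h \<in> R" "f \<in> R" "\<Phi> h \<noteq> 0" "h * f \<in> hilb_to_primary n c \<Phi> J" for h f
    using \<gamma>_unit[OF J(1,2) that(1,3) \<gamma>_S[OF that(2)]] that by (simp add: \<gamma>_preimage_eq \<gamma>_mult)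
qed

text \<open>
  Preimages under \<open>\<gamma>\<close> and the ideals \<open>ext J\<close> of polynomials that are, modulo \<open>I\<close>, quotients
  \<open>\<gamma> f / \<gamma> h\<close> with \<open>f \<in> J\<close> carry strict chains to strict chains.  Density enters in both directions: it
  makes \<open>ext J\<close> an ideal, and it produces elements of the preimages that distinguish two ideals.
\<close>

lemma chain_length_preimage:
  assumes I: "ideal_in S I" "order_ge c N \<subseteq> I"
  shows "chain_length (saturated_above R P (hilb_to_primary n c \<Phi> I)) = chain_length (ideals_above S I)"
proof (rule chain_length_cong, rule iffI)
  let ?Q = "hilb_to_primary n c \<Phi> I"
  define ext where "ext J = {s \<in> S. \<exists>f\<in>J. \<exists>h\<in>R. \<Phi> h \<noteq> 0 \<and> \<gamma> f - \<gamma> h * s \<in> I}" for J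
  fix k
  assume "has_chain (saturated_above R P ?Q) k"
  then show "has_chain (ideals_above S I) k"
  proof (rule has_chain_mono_map[where f = ext])
    fix J assume J: "J \<in> saturated_above R P ?Q"
    note JD = saturated_aboveD[OF J]
    have JR: "f \<in> R" if "f \<in> J" for f using ideal_inD(1)[OF JD(1)] that by blast
    have "ideal_in S (ext J)"
      unfolding ideal_in_def
    proof (intro conjI ballI)
      show "ext J \<subseteq> S" by (auto simp: ext_def)
      show "0 \<in> ext J"
        unfolding ext_def
        by (intro CollectI conjI, simp, rule bexI[of _ 0], rule bexI[of _ 1])
          (simp_all add: ideal_inD(2)[OF JD(1)] ideal_inD(2)[OF I(1)])
      fix s assume "s \<in> ext J"
      then obtain f h where fh: "s \<in> S" "f \<in> J" "h \<in> R" "\<Phi> h \<noteq> 0" "\<gamma> f - \<gamma> h * s \<in> I"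
        unfolding ext_def by blast
      show "s + t \<in> ext J" if "t \<in> ext J" for t
      proof -
        obtain f' h' where fh': "t \<in> S" "f' \<in> J" "h' \<in> R" "\<Phi> h' \<noteq> 0" "\<gamma> f' - \<gamma> h' * t \<in> I"
          using \<open>t \<in> ext J\<close> unfolding ext_def by blast
        have "\<gamma> (h' * f + h * f') - \<gamma> (h * h') * (s + t) = \<gamma> h' * (\<gamma> f - \<gamma> h * s) + \<gamma> h * (\<gamma> f' - \<gamma> h' * t)"
          by (simp add: \<gamma>_mult \<gamma>_add algebra_simps)
        also have "\<dots> \<in> I"
          using fh fh' by (intro ideal_inD(3)[OF I(1)] ideal_inD(4)[OF I(1)] \<gamma>_S)
        finally have "\<gamma> (h' * f + h * f') - \<gamma> (h * h') * (s + t) \<in> I" .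
        moreover have "h' * f + h * f' \<in> J"
          using fh fh' by (intro ideal_inD(3)[OF JD(1)] ideal_inD(4)[OF JD(1)])
        moreover have "h * h' \<in> R" "\<Phi> (h * h') \<noteq> 0" using fh fh' by (auto simp: \<Phi>_mult intro: polys_in_mult)
        ultimately show ?thesis unfolding ext_def using polys_in_add[OF fh(1) fh'(1)] by blast
      qed
      show "t * s \<in> ext J" if "t \<in> S" for t
      proof -
        obtain g k where gk: "g \<in> R" "k \<in> R" "\<Phi> k \<noteq> 0" "\<gamma> g - \<gamma> k * t \<in> order_ge c N"
          using jet_lift[OF \<open>t \<in> S\<close>] .
        have "\<gamma> (g * f) - \<gamma> (h * k) * (t * s) = \<gamma> f * (\<gamma> g - \<gamma> k * t) + \<gamma> k * t * (\<gamma> f - \<gamma> h * s)"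
          by (simp add: \<gamma>_mult algebra_simps)
        also have "\<dots> \<in> I"
          using gk fh I(2) JR that by (intro ideal_inD(3)[OF I(1)] ideal_inD(4)[OF I(1)] \<gamma>_S polys_in_mult) auto
        finally have "\<gamma> (g * f) - \<gamma> (h * k) * (t * s) \<in> I" .
        moreover have "g * f \<in> J" using gk(1) fh(2) by (rule ideal_inD(4)[OF JD(1)])
        moreover have "h * k \<in> R" "\<Phi> (h * k) \<noteq> 0" using fh gk by (auto simp: \<Phi>_mult intro: polys_in_mult)
        ultimately show ?thesis unfolding ext_def using polys_in_mult[OF that fh(1)] by blast
      qed
    qed
    moreover have "I \<subseteq> ext J"
    proof
      fix s assume s: "s \<in> I"
      have \<Phi>_nz1: "\<Phi> 1 \<noteq> 0" by simp
      have "\<gamma> 0 - \<gamma> 1 * s \<in> I" using ideal_in_uminus[OF is_subring_polys_in I(1) s] by simp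
      then show "s \<in> ext J"
        unfolding ext_def
        using s ideal_inD(1)[OF I(1)] ideal_inD(2)[OF JD(1)] polys_in_1[of "{1..n}"] \<Phi>_nz1 by blast
    qed
    ultimately show "ext J \<in> ideals_above S I" by (simp add: ideals_above_def)
  next
    fix J J' assume J: "J \<in> saturated_above R P ?Q" "J' \<in> saturated_above R P ?Q" "J \<subset> J'"
    note JD = saturated_aboveD[OF J(1)] and JD' = saturated_aboveD[OF J(2)]
    obtain f where f: "f \<in> J'" "f \<notin> J" using J(3) by blast
    have fR: "f \<in> R" using f(1) ideal_inD(1)[OF JD'(1)] by blast
    have "\<gamma> f \<in> ext J'"
    proof -
      have "\<gamma> f - \<gamma> 1 * \<gamma> f \<in> I" "\<Phi> 1 \<noteq> 0" using ideal_inD(2)[OF I(1)] by simp_all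
      then show ?thesis
        unfolding ext_def using \<gamma>_S[OF fR] f(1) polys_in_1[of "{1..n}"] by blast
    qed
    moreover have "\<gamma> f \<notin> ext J"
    proof
      assume "\<gamma> f \<in> ext J"
      then obtain g h where gh: "g \<in> J" "h \<in> R" "\<Phi> h \<noteq> 0" "\<gamma> g - \<gamma> h * \<gamma> f \<in> I"
        unfolding ext_def by blast
      have gR: "g \<in> R" using gh(1) ideal_inD(1)[OF JD(1)] by blast
      have "g - h * f \<in> ?Q"
        unfolding \<gamma>_preimage_eq mem_Collect_eq \<gamma>_diff \<gamma>_mult
        by (intro conjI polys_in_diff polys_in_mult gh(2,4) fR gR)
      then have "g - h * f \<in> J" using JD(2) by blast
      then have "g - (g - h * f) \<in> J" by (rule ideal_in_diff[OF R_subring JD(1) gh(1)])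
      then have "h * f \<in> J" by simp
      then show False using JD(3)[OF gh(2) fR gh(3)] f(2) by blast
    qed
    moreover have "ext J \<subseteq> ext J'" using J(3) unfolding ext_def by blast
    ultimately show "ext J \<subset> ext J'" by blast
  qed
next
  let ?Q = "hilb_to_primary n c \<Phi> I"
  fix k
  assume "has_chain (ideals_above S I) k"
  then show "has_chain (saturated_above R P ?Q) k"
  proof (rule has_chain_mono_map[where f = "hilb_to_primary n c \<Phi>"])
    fix J assume "J \<in> ideals_above S I"
    then show "hilb_to_primary n c \<Phi> J \<in> saturated_above R P ?Q"
      using I(2) by (intro \<gamma>_preimage_saturated) (auto simp: ideals_above_def)
  next
    fix J J' assume "J \<in> ideals_above S I" "J' \<in> ideals_above S I" and sub: "J \<subset> J'"
    then have J: "ideal_in S J" "order_ge c N \<subseteq> J" "ideal_in S J'" "order_ge c N \<subseteq> J'"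
      using I(2) by (auto simp: ideals_above_def)
    obtain s where s: "s \<in> J'" "s \<notin> J" using sub by blast
    have sS: "s \<in> S" using s(1) ideal_inD(1)[OF J(3)] by blast
    obtain f h where fh: "f \<in> R" "h \<in> R" "\<Phi> h \<noteq> 0" "\<gamma> f - \<gamma> h * s \<in> order_ge c N"
      using jet_lift[OF sS] .
    have "(\<gamma> f - \<gamma> h * s) + \<gamma> h * s \<in> J'"
      using fh J(4) s(1) by (intro ideal_inD(3)[OF J(3)] ideal_inD(4)[OF J(3) \<gamma>_S]) auto
    then have "f \<in> hilb_to_primary n c \<Phi> J'" using fh(1) by (simp add: \<gamma>_preimage_eq)
    moreover have "f \<notin> hilb_to_primary n c \<Phi> J"
    proof
      assume "f \<in> hilb_to_primary n c \<Phi> J"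
      then have \<gamma>f: "\<gamma> f \<in> J" by (simp add: \<gamma>_preimage_eq)
      have "\<gamma> f - (\<gamma> f - \<gamma> h * s) \<in> J"
        by (rule ideal_in_diff[OF is_subring_polys_in J(1) \<gamma>f]) (use fh(4) J(2) in blast)
      then have "\<gamma> h * s \<in> J" by simp
      then show False using \<gamma>_unit[OF J(1,2) fh(2,3) sS] s(2) by blast
    qed
    ultimately show "hilb_to_primary n c \<Phi> J \<subset> hilb_to_primary n c \<Phi> J'"
      using sub by (auto simp: \<gamma>_preimage_eq)
  qed
qed

lemma primary_to_hilb_eq:
  "primary_to_hilb c m \<Phi> Q = {x + y |x y. x \<in> order_ge c m \<and> y \<in> ideal_span S (\<gamma> ` Q)}" if "Q \<subseteq> R"
proof -
  have "\<gamma> ` Q \<subseteq> S" using that \<gamma>_S by blast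
  then have "Idl\<^bsub>poly_ring c\<^esub> (\<gamma> ` Q) = ideal_span S (\<gamma> ` Q)"
    unfolding poly_ring_def by (rule genideal_ring_on[OF is_subring_polys_in])
  then show ?thesis
    unfolding primary_to_hilb_def origin_ideal_power by (simp add: poly_ring_def set_add_ring_on)
qed

lemma ideal_in_sum_set:
  assumes "ideal_in A I" "ideal_in A J" "is_subring A"
  shows "ideal_in A {x + y |x y. x \<in> I \<and> y \<in> J}"
  unfolding ideal_in_def
proof (intro conjI ballI subsetI)
  let ?K = "{x + y |x y. x \<in> I \<and> y \<in> J}"
  have K: "z \<in> ?K" if "x \<in> I" "y \<in> J" "z = x + y" for x y z using that by blast
  show "0 \<in> ?K" by (rule K[OF ideal_inD(2)[OF assms(1)] ideal_inD(2)[OF assms(2)]]) simp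
  fix z assume "z \<in> ?K"
  then obtain x y where z: "x \<in> I" "y \<in> J" "z = x + y" by blast
  show "z \<in> A"
    using z ideal_inD(1)[OF assms(1)] ideal_inD(1)[OF assms(2)] assms(3) by (auto simp: is_subring_def)
  show "z + z' \<in> ?K" if "z' \<in> ?K" for z'
  proof -
    obtain x' y' where z': "x' \<in> I" "y' \<in> J" "z' = x' + y'" using \<open>z' \<in> ?K\<close> by blast
    show ?thesis
      by (rule K[OF ideal_inD(3)[OF assms(1) z(1) z'(1)] ideal_inD(3)[OF assms(2) z(2) z'(2)]]) (simp add: z z' algebra_simps)
  qed
  show "a * z \<in> ?K" if "a \<in> A" for a
    by (rule K[OF ideal_inD(4)[OF assms(1) that z(1)] ideal_inD(4)[OF assms(2) that z(2)]]) (simp add: z distrib_left)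
qed

lemma spow_le_chain:
  assumes J: "\<And>i. i \<le> m \<Longrightarrow> J i \<in> saturated_above R P Q" and top: "J m = R"
    and step: "\<And>i p y. i < m \<Longrightarrow> p \<in> P \<Longrightarrow> y \<in> J (Suc i) \<Longrightarrow> p * y \<in> J i"
  shows "spow k f \<Longrightarrow> k \<le> m \<Longrightarrow> f \<in> J (m - k)"
proof (induction rule: spow.induct)
  case (base f)
  then show ?case by (simp add: top)
next
  case (mult p k q)
  then have "q \<in> J (Suc (m - Suc k))" by (simp add: Suc_diff_Suc)
  then show ?case using mult by (intro step) auto
next
  case (add k f g)
  then show ?case using ideal_inD(3)[OF saturated_aboveD(1)[OF J[of "m - k"]]] by simp
next
  case (sat h f k)
  then show ?case using saturated_aboveD(3)[OF J[of "m - k"], of h f] by simp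
qed

text \<open>
  In a maximal chain of saturated ideals, each step is annihilated by \<open>P\<close>, because an element of
  \<open>P\<close> is nilpotent modulo \<open>Q\<close> and hence cannot act surjectively on a simple quotient.
\<close>

lemma spow_le_primary:
  assumes prim: "primary_to (poly_ring n) P Q" and mult: "multiplicity_over (poly_ring n) P Q = enat m"
    and prime: "primeideal P (poly_ring n)" and f: "spow m f"
  shows "f \<in> Q"
proof -
  let ?X = "saturated_above R P Q"
  have Q: "Q \<in> ?X" and rad: "P = {a \<in> R. \<exists>k. a ^ k \<in> Q}" using prim primary_to_P_iff by auto
  have QR: "Q \<subseteq> R" using ideal_inD(1)[OF saturated_aboveD(1)[OF Q]] .
  have len: "chain_length ?X = enat m"
    using multiplicity_over_eq[OF R_subring _ QR, of P] prime mult by (simp add: poly_ring_def)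
  have ne: "?X \<noteq> {}" using Q by blast
  have bound: "\<not> has_chain ?X (Suc m)"
    using chain_length_eqD(2)[OF len ne] by force
  obtain J where J: "\<forall>i\<le>m. J i \<in> ?X" "\<forall>i<m. J i \<subset> J (Suc i)"
    using chain_length_eqD(1)[OF len ne] unfolding has_chain_def by blast
  have R: "R \<in> ?X"
    by (rule saturated_aboveI) (use QR in \<open>auto simp: ideal_in_def intro: polys_in_add polys_in_mult\<close>)
  have "J 0 = Q"
  proof (rule ccontr)
    assume "J 0 \<noteq> Q"
    then have "Q \<subset> J 0" using saturated_aboveD(2)[of "J 0" Q] J(1) by auto
    then show False using chain_insert_below[OF J Q] bound by blast
  qed
  moreover have top: "J m = R"
  proof (rule ccontr)
    assume "J m \<noteq> R"
    then have "J m \<subset> R" using ideal_inD(1)[OF saturated_aboveD(1)[of "J m" Q]] J(1) by auto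
    then show False using chain_insert_above[OF J R] bound by blast
  qed
  moreover have "p * y \<in> J i" if i: "i < m" and p: "p \<in> P" and y: "y \<in> J (Suc i)" for i p y
  proof (rule ccontr)
    assume py: "p * y \<notin> J i"
    have Ji: "J i \<in> ?X" "J (Suc i) \<in> ?X" "J i \<subset> J (Suc i)" using J i by auto
    note D = saturated_aboveD[OF Ji(1)] and D' = saturated_aboveD[OF Ji(2)]
    have R': "z \<in> R" if "z \<in> J (Suc i)" for z using that ideal_inD(1)[OF D'(1)] by blast
    have pR: "p \<in> R" using p by (rule P_R)
    \<comment> \<open>the saturation of \<open>J i + p J (i + 1)\<close>, which by maximality equals \<open>J (i + 1)\<close>\<close>
    define T where "T = {f \<in> R. \<exists>h\<in>R. \<Phi> h \<noteq> 0 \<and> (\<exists>x\<in>J i. \<exists>z\<in>J (Suc i). h * f = x + p * z)}"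
    have TI: "f \<in> T" if "f \<in> R" "h \<in> R" "\<Phi> h \<noteq> 0" "x \<in> J i" "z \<in> J (Suc i)" "h * f = x + p * z" for f h x z
      using that unfolding T_def by blast
    have zeros: "0 \<in> J i" "0 \<in> J (Suc i)" using ideal_inD(2) D(1) D'(1) by blast+
    have sub1: "J i \<subseteq> T"
    proof
      fix x assume x: "x \<in> J i"
      then have "x \<in> R" using Ji(3) R' by blast
      then show "x \<in> T" by (rule TI[of x 1 x 0]) (use x zeros in auto)
    qed
    have "T \<in> ?X"
    proof (rule saturated_aboveI)
      show "ideal_in R T"
        unfolding ideal_in_def
      proof (intro conjI ballI)
        show "T \<subseteq> R" by (auto simp: T_def)
        show "0 \<in> T" using sub1 zeros by blast
        fix f assume "f \<in> T"
        then obtain h x z where f: "f \<in> R" "h \<in> R" "\<Phi> h \<noteq> 0" "x \<in> J i" "z \<in> J (Suc i)" "h * f = x + p * z"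
          unfolding T_def by blast
        show "f + g \<in> T" if "g \<in> T" for g
        proof -
          obtain h' x' z' where g: "g \<in> R" "h' \<in> R" "\<Phi> h' \<noteq> 0" "x' \<in> J i" "z' \<in> J (Suc i)" "h' * g = x' + p * z'"
            using \<open>g \<in> T\<close> unfolding T_def by blast
          show ?thesis
          proof (rule TI[of _ "h * h'" "h' * x + h * x'" "h' * z + h * z'"])
            have "(h * h') * (f + g) = h' * (h * f) + h * (h' * g)" by (simp add: algebra_simps)
            also have "\<dots> = (h' * x + h * x') + p * (h' * z + h * z')"
              unfolding f(6) g(6) by (simp add: algebra_simps)
            finally show "(h * h') * (f + g) = (h' * x + h * x') + p * (h' * z + h * z')" .
          qed (use f g in \<open>auto simp: \<Phi>_mult intro!: polys_in_add polys_in_mult ideal_inD(3)[OF D(1)] ideal_inD(4)[OF D(1)] ideal_inD(3)[OF D'(1)] ideal_inD(4)[OF D'(1)]\<close>)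
        qed
        show "a * f \<in> T" if "a \<in> R" for a
        proof (rule TI[of _ h "a * x" "a * z"])
          show "h * (a * f) = a * x + p * (a * z)"
            using f(6) by (metis (no_types, opaque_lifting) distrib_left mult.left_commute)
        qed (use f that in \<open>auto intro: polys_in_mult ideal_inD(4)[OF D(1)] ideal_inD(4)[OF D'(1)]\<close>)
      qed
      show "Q \<subseteq> T" using sub1 D(2) by blast
      fix h f assume h: "h \<in> R" "f \<in> R" "\<Phi> h \<noteq> 0" "h * f \<in> T"
      then obtain h' x z where hf: "h' \<in> R" "\<Phi> h' \<noteq> 0" "x \<in> J i" "z \<in> J (Suc i)" "h' * (h * f) = x + p * z"
        unfolding T_def by blast
      show "f \<in> T"
        by (rule TI[of f "h' * h" x z]) (use h hf in \<open>auto simp: \<Phi>_mult mult.assoc intro: polys_in_mult\<close>)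
    qed
    moreover have "T \<subseteq> J (Suc i)"
    proof
      fix f assume "f \<in> T"
      then obtain h x z where f: "f \<in> R" "h \<in> R" "\<Phi> h \<noteq> 0" "x \<in> J i" "z \<in> J (Suc i)" "h * f = x + p * z"
        unfolding T_def by blast
      have "x + p * z \<in> J (Suc i)"
        using f(4,5) Ji(3) pR by (intro ideal_inD(3)[OF D'(1)] ideal_inD(4)[OF D'(1)]) auto
      then show "f \<in> J (Suc i)" using D'(3)[OF f(2,1,3)] f(6) by simp
    qed
    moreover have "p * y \<in> T"
      by (rule TI[of _ 1 0 y]) (use y zeros pR R' in \<open>auto intro: polys_in_mult\<close>)
    ultimately have T_eq: "T = J (Suc i)"
      using chain_insert_between[OF J, of T i] bound i sub1 py by blast
    \<comment> \<open>so \<open>p\<close> may be split off repeatedly, until its power lies in \<open>Q\<close>\<close>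
    have iterate: "\<exists>h\<in>R. \<Phi> h \<noteq> 0 \<and> (\<exists>x\<in>J i. \<exists>z\<in>J (Suc i). h * g = x + p ^ k * z)" if g: "g \<in> J (Suc i)" for g k
    proof (induction k)
      case 0
      have "1 * g = 0 + p ^ 0 * g" "\<Phi> 1 \<noteq> 0" by simp_all
        then show ?case using g zeros polys_in_1 by blast
    next
      case (Suc k)
      then obtain h x z where h: "h \<in> R" "\<Phi> h \<noteq> 0" "x \<in> J i" "z \<in> J (Suc i)" "h * g = x + p ^ k * z" by blast
      have "z \<in> T" using h(4) T_eq by simp
      then obtain h' x' z' where z: "h' \<in> R" "\<Phi> h' \<noteq> 0" "x' \<in> J i" "z' \<in> J (Suc i)" "h' * z = x' + p * z'"
        using \<open>z \<in> T\<close> unfolding T_def by blast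
      have "(h' * h) * g = h' * (h * g)" by (simp add: mult.assoc)
      also have "\<dots> = h' * x + p ^ k * (h' * z)" unfolding h(5) by (simp add: algebra_simps)
      also have "\<dots> = (h' * x + p ^ k * x') + p ^ Suc k * z'" unfolding z(5) by (simp add: algebra_simps)
      finally have eq: "(h' * h) * g = (h' * x + p ^ k * x') + p ^ Suc k * z'" .
      have "h' * x + p ^ k * x' \<in> J i"
        using h z pR by (intro ideal_inD(3)[OF D(1)] ideal_inD(4)[OF D(1)] polys_in_power)
      moreover have "h' * h \<in> R" "\<Phi> (h' * h) \<noteq> 0" using h z by (auto simp: \<Phi>_mult intro: polys_in_mult)
      ultimately show ?case using eq z(4) by blast
    qed
    obtain k where k: "p ^ k \<in> Q" using p rad by blast
    have "J (Suc i) \<subseteq> J i"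
    proof
      fix g assume g: "g \<in> J (Suc i)"
      obtain h x z where h: "h \<in> R" "\<Phi> h \<noteq> 0" "x \<in> J i" "z \<in> J (Suc i)" "h * g = x + p ^ k * z"
        using iterate[OF g, of k] by blast
      have "z * p ^ k \<in> J i" using k D(2) R'[OF h(4)] by (intro ideal_inD(4)[OF D(1)]) auto
      then have "x + z * p ^ k \<in> J i" by (rule ideal_inD(3)[OF D(1) h(3)])
      then have "h * g \<in> J i" using h(5) by (simp add: mult.commute)
      then show "g \<in> J i" using D(3)[OF h(1) R'[OF g] h(2)] by blast
    qed
    then show False using Ji(3) by blast
  qed
  ultimately show ?thesis using spow_le_chain[of m J Q m f] J(1) f by simp
qed

lemma ideal_in_primary_to_hilb:
  assumes "Q \<subseteq> R"
  shows "ideal_in S (primary_to_hilb c m \<Phi> Q)" "order_ge c m \<subseteq> primary_to_hilb c m \<Phi> Q"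
    "\<gamma> ` Q \<subseteq> primary_to_hilb c m \<Phi> Q"
proof -
  have \<gamma>Q: "\<gamma> ` Q \<subseteq> S" using assms \<gamma>_S by blast
  note span = ideal_in_ideal_span[OF is_subring_polys_in \<gamma>Q]
  show "ideal_in S (primary_to_hilb c m \<Phi> Q)"
    unfolding primary_to_hilb_eq[OF assms] by (rule ideal_in_sum_set[OF ideal_in_order_ge span is_subring_polys_in])
  show "order_ge c m \<subseteq> primary_to_hilb c m \<Phi> Q"
  proof
    fix x :: "'f mpoly" assume "x \<in> order_ge c m"
    moreover have "x = x + 0" by simp
    ultimately show "x \<in> primary_to_hilb c m \<Phi> Q"
      unfolding primary_to_hilb_eq[OF assms] using ideal_inD(2)[OF span] by blast
  qed
  show "\<gamma> ` Q \<subseteq> primary_to_hilb c m \<Phi> Q"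
  proof
    fix y assume "y \<in> \<gamma> ` Q"
    then have "y \<in> ideal_span S (\<gamma> ` Q)" using ideal_span_superset[OF is_subring_polys_in, of "\<gamma> ` Q"] by blast
    moreover have "y = 0 + y" by simp
    ultimately show "y \<in> primary_to_hilb c m \<Phi> Q"
      unfolding primary_to_hilb_eq[OF assms] using order_ge_zero by blast
  qed
qed

text \<open>
  By density, an element of \<open>\<gamma>(Q) F[y]\<close> is up to order \<open>m\<close> a quotient \<open>\<gamma> q / \<gamma> h\<close> with \<open>q \<in> Q\<close>.  So
  if \<open>\<gamma> f\<close> lies in the ideal, then \<open>h f - q\<close> vanishes to order \<open>m\<close> at the point, and Zariski-Nagata
  applies.
\<close>

lemma preimage_primary_to_hilb:
  assumes Q: "Q \<in> saturated_above R P Q" and spow: "\<And>f. spow m f \<Longrightarrow> f \<in> Q"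
  shows "hilb_to_primary n c \<Phi> (primary_to_hilb c m \<Phi> Q) = Q"
proof (intro equalityI subsetI)
  note QD = saturated_aboveD[OF Q]
  have QR: "Q \<subseteq> R" by (rule ideal_inD(1)[OF QD(1)])
  fix f assume "f \<in> Q"
  then show "f \<in> hilb_to_primary n c \<Phi> (primary_to_hilb c m \<Phi> Q)"
    using ideal_in_primary_to_hilb(3)[OF QR] QR by (auto simp: \<gamma>_preimage_eq)
next
  note QD = saturated_aboveD[OF Q]
  have QR: "Q \<subseteq> R" by (rule ideal_inD(1)[OF QD(1)])
  fix f assume "f \<in> hilb_to_primary n c \<Phi> (primary_to_hilb c m \<Phi> Q)"
  then obtain x y where f: "f \<in> R" "\<gamma> f = x + y" "x \<in> order_ge c m" "y \<in> ideal_span S (\<gamma> ` Q)"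
    unfolding \<gamma>_preimage_eq primary_to_hilb_eq[OF QR] by blast
  have "\<exists>q\<in>Q. \<exists>h\<in>R. \<Phi> h \<noteq> 0 \<and> \<gamma> q - \<gamma> h * y \<in> order_ge c m"
    using f(4)
  proof (induction y rule: ideal_span.induct)
    case zero
    show ?case by (rule bexI[of _ 0], rule bexI[of _ 1]) (simp_all add: ideal_inD(2)[OF QD(1)])
  next
    case (mult s x)
    then obtain q where q: "q \<in> Q" "x = \<gamma> q" by blast
    obtain g k where gk: "g \<in> R" "k \<in> R" "\<Phi> k \<noteq> 0" "\<gamma> g - \<gamma> k * s \<in> order_ge c m"
      using jet_lift[OF mult(1)] .
    have "\<gamma> (g * q) - \<gamma> k * (s * x) = \<gamma> q * (\<gamma> g - \<gamma> k * s)"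
      by (simp add: q(2) \<gamma>_mult algebra_simps)
    also have "\<dots> \<in> order_ge c m"
      using q(1) QR gk(4) by (intro ideal_inD(4)[OF ideal_in_order_ge] \<gamma>_S) auto
    finally show ?case using ideal_inD(4)[OF QD(1) gk(1) q(1)] gk by blast
  next
    case (add y z)
    then obtain q h q' h' where *: "q \<in> Q" "h \<in> R" "\<Phi> h \<noteq> 0" "\<gamma> q - \<gamma> h * y \<in> order_ge c m"
      "q' \<in> Q" "h' \<in> R" "\<Phi> h' \<noteq> 0" "\<gamma> q' - \<gamma> h' * z \<in> order_ge c m" by blast
    have "\<gamma> (h' * q + h * q') - \<gamma> (h * h') * (y + z) = \<gamma> h' * (\<gamma> q - \<gamma> h * y) + \<gamma> h * (\<gamma> q' - \<gamma> h' * z)"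
      by (simp add: \<gamma>_mult \<gamma>_add algebra_simps)
    also have "\<dots> \<in> order_ge c m"
      using * by (intro order_ge_add ideal_inD(4)[OF ideal_in_order_ge] \<gamma>_S)
    finally have "\<gamma> (h' * q + h * q') - \<gamma> (h * h') * (y + z) \<in> order_ge c m" .
    moreover have "h' * q + h * q' \<in> Q"
      using * by (intro ideal_inD(3)[OF QD(1)] ideal_inD(4)[OF QD(1)])
    moreover have "h * h' \<in> R" "\<Phi> (h * h') \<noteq> 0" using * by (auto simp: \<Phi>_mult intro: polys_in_mult)
    ultimately show ?case by blast
  qed
  then obtain q h where q: "q \<in> Q" "h \<in> R" "\<Phi> h \<noteq> 0" "\<gamma> q - \<gamma> h * y \<in> order_ge c m" by blast
  have "\<gamma> (h * f - q) = \<gamma> h * x - (\<gamma> q - \<gamma> h * y)"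
    by (simp add: \<gamma>_diff \<gamma>_mult f(2) algebra_simps)
  also have "\<dots> \<in> order_ge c m"
    by (intro order_ge_diff ideal_inD(4)[OF ideal_in_order_ge \<gamma>_S[OF q(2)] f(3)] q(4))
  finally have "h * f - q \<in> Q"
    using q QR f(1) by (intro spow spow_if_\<gamma>_order polys_in_diff polys_in_mult) auto
  then have "(h * f - q) + q \<in> Q" using q(1) by (rule ideal_inD(3)[OF QD(1)])
  then show "f \<in> Q" using QD(3)[OF q(2) f(1) q(3)] by simp
qed

lemma multiplicity_preimage:
  assumes I: "ideal_in S I" "order_ge c N \<subseteq> I" and prime: "primeideal P (poly_ring n)"
  shows "multiplicity_over (poly_ring n) P (hilb_to_primary n c \<Phi> I) = enat (mspace.dim (orth_ideal c I))"
proof -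
  have "hilb_to_primary n c \<Phi> I \<subseteq> R" by (auto simp: \<gamma>_preimage_eq)
  then show ?thesis
    using multiplicity_over_eq[OF R_subring, of P "hilb_to_primary n c \<Phi> I"] prime
      chain_length_preimage[OF I] chain_length_eq_colength[OF char_0 I]
    by (simp add: poly_ring_def)
qed

text \<open>
  Since \<open>I\<close> contains the polynomials of order at least \<open>m\<close>, density up to order \<open>m\<close> writes each element
  of \<open>I\<close> as \<open>\<gamma> f / \<gamma> h\<close> with \<open>f\<close> in the preimage.
\<close>

lemma hilb_to_primary_primary:
  assumes I: "I \<in> hilb_poly c m" and prime: "primeideal P (poly_ring n)"
  shows "hilb_to_primary n c \<Phi> I \<in> primary_ideals n P m" "primary_to_hilb c m \<Phi> (hilb_to_primary n c \<Phi> I) = I"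
proof -
  obtain N where N: "ideal_in S I" "I \<subseteq> order_ge c 1" "order_ge c N \<subseteq> I" "mspace.dim (orth_ideal c I) = m"
    using I unfolding hilb_poly_iff[OF char_0] by blast
  let ?Q = "hilb_to_primary n c \<Phi> I"
  have QP: "?Q \<subseteq> P"
    using N(2) \<gamma>_order_ge_1_iff by (auto simp: \<gamma>_preimage_eq)
  have "P = {a \<in> R. \<exists>k. a ^ k \<in> ?Q}"
  proof (intro equalityI subsetI)
    fix p assume p: "p \<in> P"
    then have pR: "p \<in> R" by (rule P_R)
    have \<gamma>_power: "\<gamma> (p ^ k) = \<gamma> p ^ k" for k by (induction k) (simp_all add: \<gamma>_mult)
    have "\<gamma> p ^ N \<in> order_ge c N" using p \<gamma>_order_ge_1_iff[OF pR] by (intro order_ge_power) simp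
    then have "p ^ N \<in> ?Q" using N(3) polys_in_power[OF pR] by (auto simp: \<gamma>_preimage_eq \<gamma>_power)
    then show "p \<in> {a \<in> R. \<exists>k. a ^ k \<in> ?Q}" using pR by blast
  next
    fix a assume "a \<in> {a \<in> R. \<exists>k. a ^ k \<in> ?Q}"
    then obtain k where a: "a \<in> R" "a ^ k \<in> P" using QP by blast
    have "\<Phi> (a ^ j) = \<Phi> a ^ j" for j by (induction j) (simp_all add: \<Phi>_mult)
    then show "a \<in> P" using a by (simp add: P_def)
  qed
  moreover have "?Q \<noteq> R"
  proof
    assume "?Q = R"
    then have "1 \<in> P" using QP polys_in_1 by blast
    then show False by (simp add: P_def)
  qed
  moreover have "?Q \<in> saturated_above R P ?Q" by (rule \<gamma>_preimage_saturated[OF N(1,3) subset_refl])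
  ultimately have "primary_to (poly_ring n) P ?Q" using primary_to_P_iff by blast
  then show "?Q \<in> primary_ideals n P m"
    using multiplicity_preimage[OF N(1,3) prime] N(4) by (simp add: primary_ideals_def)
  have QR: "?Q \<subseteq> R" by (auto simp: \<gamma>_preimage_eq)
  have ordm: "order_ge c m \<subseteq> I" using chain_of_colength[OF char_0 N(1,3,4)] by blast
  note I' = ideal_in_primary_to_hilb[OF QR, of m]
  show "primary_to_hilb c m \<Phi> ?Q = I"
  proof (intro equalityI subsetI)
    fix z assume "z \<in> primary_to_hilb c m \<Phi> ?Q"
    then obtain x y where z: "z = x + y" "x \<in> order_ge c m" "y \<in> ideal_span S (\<gamma> ` ?Q)"
      unfolding primary_to_hilb_eq[OF QR] by blast
    have "ideal_span S (\<gamma> ` ?Q) \<subseteq> I"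
      by (rule ideal_span_minimal[OF N(1)]) (auto simp: \<gamma>_preimage_eq)
    then show "z \<in> I" unfolding z(1) using z(2,3) ordm by (intro ideal_inD(3)[OF N(1)]) auto
  next
    fix s assume s: "s \<in> I"
    then have sS: "s \<in> S" using ideal_inD(1)[OF N(1)] by blast
    obtain f h where fh: "f \<in> R" "h \<in> R" "\<Phi> h \<noteq> 0" "\<gamma> f - \<gamma> h * s \<in> order_ge c m"
      using jet_lift[OF sS] .
    have "(\<gamma> f - \<gamma> h * s) + \<gamma> h * s \<in> I"
      using fh ordm s by (intro ideal_inD(3)[OF N(1)] ideal_inD(4)[OF N(1)] \<gamma>_S) auto
    then have "f \<in> ?Q" using fh(1) by (simp add: \<gamma>_preimage_eq)
    then have \<gamma>f: "\<gamma> f \<in> primary_to_hilb c m \<Phi> ?Q" using I'(3) by blast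
    have "\<gamma> f - (\<gamma> f - \<gamma> h * s) \<in> primary_to_hilb c m \<Phi> ?Q"
      by (rule ideal_in_diff[OF is_subring_polys_in I'(1) \<gamma>f]) (use I'(2) fh(4) in blast)
    then have "\<gamma> h * s \<in> primary_to_hilb c m \<Phi> ?Q" by simp
    then show "s \<in> primary_to_hilb c m \<Phi> ?Q" by (rule \<gamma>_unit[OF I'(1,2) fh(2,3) sS])
  qed
qed

lemma primary_to_hilb_hilb:
  assumes m: "m \<ge> 1" and Q: "Q \<in> primary_ideals n P m" and prime: "primeideal P (poly_ring n)"
  shows "primary_to_hilb c m \<Phi> Q \<in> hilb_poly c m" "hilb_to_primary n c \<Phi> (primary_to_hilb c m \<Phi> Q) = Q"
proof -
  have prim: "primary_to (poly_ring n) P Q" and mult: "multiplicity_over (poly_ring n) P Q = enat m"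
    using Q by (auto simp: primary_ideals_def)
  have sat: "Q \<in> saturated_above R P Q" and rad: "P = {a \<in> R. \<exists>k. a ^ k \<in> Q}"
    using prim primary_to_P_iff by auto
  have QR: "Q \<subseteq> R" by (rule ideal_inD(1)[OF saturated_aboveD(1)[OF sat]])
  let ?I = "primary_to_hilb c m \<Phi> Q"
  note I = ideal_in_primary_to_hilb[OF QR, of m]
  show eq: "hilb_to_primary n c \<Phi> ?I = Q"
    by (rule preimage_primary_to_hilb[OF sat spow_le_primary[OF prim mult prime]])
  have QP: "Q \<subseteq> P"
  proof
    fix q assume "q \<in> Q"
    then have "q \<in> R" "q ^ 1 \<in> Q" using QR by auto
    then show "q \<in> P" using rad by blast
  qed
  have "ideal_span S (\<gamma> ` Q) \<subseteq> order_ge c 1"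
    using QP QR \<gamma>_order_ge_1_iff by (intro ideal_span_minimal[OF ideal_in_order_ge]) auto
  then have "?I \<subseteq> order_ge c 1"
    unfolding primary_to_hilb_eq[OF QR] using order_ge_antimono[OF m, of c] by (auto intro: order_ge_add)
  moreover have "mspace.dim (orth_ideal c ?I) = m"
    using multiplicity_preimage[OF I(1,2) prime] unfolding eq mult by simp
  ultimately show "?I \<in> hilb_poly c m"
    unfolding hilb_poly_iff[OF char_0] using I(1,2) by blast
qed

theorem primary_hilb_mutually_inverse:
  assumes "m \<ge> 1" "primeideal P (poly_ring n)"
  shows "mutually_inverse (primary_to_hilb c m \<Phi>) (hilb_to_primary n c \<Phi>) (primary_ideals n P m) (hilb_poly c m)"
  unfolding mutually_inverse_def image_subset_iff
  by (simp add: hilb_to_primary_primary[OF _ assms(2)] primary_to_hilb_hilb[OF assms(1) _ assms(2)])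

end

section \<open>The right action of the Weyl algebra\<close>

definition coeff_deriv :: "nat \<Rightarrow> 'k::comm_ring_1 weyl \<Rightarrow> 'k weyl" where
  "coeff_deriv i A = Poly_Mapping.map (mderiv i) A"

lemma lookup_coeff_deriv: "Poly_Mapping.lookup (coeff_deriv i A) \<alpha> = mderiv i (Poly_Mapping.lookup A \<alpha>)"
  by (simp add: coeff_deriv_def Poly_Mapping.map.rep_eq when_def)

lemma coeff_deriv_add: "coeff_deriv i (A + B) = coeff_deriv i A + coeff_deriv i B"
  by (rule poly_mapping_eqI) (simp add: lookup_coeff_deriv lookup_add mderiv_add)

lemma coeff_deriv_commute: "coeff_deriv i (coeff_deriv j A) = coeff_deriv j (coeff_deriv i A)"
  by (rule poly_mapping_eqI) (simp add: lookup_coeff_deriv mderiv_commute)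

lemma coeff_deriv_single: "coeff_deriv i (Poly_Mapping.single \<alpha> a) = Poly_Mapping.single \<alpha> (mderiv i a)"
  by (rule poly_mapping_eqI) (simp add: lookup_coeff_deriv lookup_single when_def)

lemma coeff_deriv_mvar: "coeff_deriv i (mvar j * A) = mvar j * coeff_deriv i A"
  by (induction A rule: poly_mapping_single_induct)
    (simp_all add: distrib_left coeff_deriv_add coeff_deriv_single mvar_times_single)

lemma coeff_deriv_const:
  "coeff_deriv i (mconst r * A) = mconst (mderiv i r) * A + mconst r * coeff_deriv i A"
  by (rule poly_mapping_eqI) (simp add: lookup_coeff_deriv lookup_mconst_mult lookup_add mderiv_mult)

lemma coeff_deriv_mderiv: "coeff_deriv i (mderiv j A) = mderiv j (coeff_deriv i A)"
proof (rule poly_mapping_eqI)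
  fix \<alpha>
  have "mderiv i (of_nat k * p) = of_nat k * mderiv i p" for k and p :: "'a mpoly"
    using mderiv_const_mult[of i "of_nat k" p] by (simp add: mconst_of_nat)
  then show "Poly_Mapping.lookup (coeff_deriv i (mderiv j A)) \<alpha> = Poly_Mapping.lookup (mderiv j (coeff_deriv i A)) \<alpha>"
    unfolding lookup_coeff_deriv lookup_mderiv by blast
qed

lemma weyl_lpartial_eq: "weyl_lpartial i A = mvar i * A + coeff_deriv i A"
proof -
  have "weyl_lpartial i A = (\<Sum>\<alpha>\<in>Poly_Mapping.keys A. mvar i * Poly_Mapping.single \<alpha> (Poly_Mapping.lookup A \<alpha>))
    + (\<Sum>\<alpha>\<in>Poly_Mapping.keys A. Poly_Mapping.single \<alpha> (mderiv i (Poly_Mapping.lookup A \<alpha>)))"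
    by (simp add: weyl_lpartial_def sum.distrib mvar_times_single evar_def)
  also have "(\<Sum>\<alpha>\<in>Poly_Mapping.keys A. mvar i * Poly_Mapping.single \<alpha> (Poly_Mapping.lookup A \<alpha>)) = mvar i * A"
    by (simp flip: sum_distrib_left poly_mapping_sum_singles)
  also have "(\<Sum>\<alpha>\<in>Poly_Mapping.keys A. Poly_Mapping.single \<alpha> (mderiv i (Poly_Mapping.lookup A \<alpha>))) = coeff_deriv i A"
    by (rule poly_mapping_eqI)
      (auto simp: lookup_sum lookup_single when_def lookup_coeff_deriv in_keys_iff)
  finally show ?thesis .
qed

lemma weyl_lpartial_add: "weyl_lpartial i (A + B) = weyl_lpartial i A + weyl_lpartial i B"
  by (simp add: weyl_lpartial_eq distrib_left coeff_deriv_add)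

lemma weyl_lpartial_commute: "weyl_lpartial i (weyl_lpartial j A) = weyl_lpartial j (weyl_lpartial i A)"
  by (simp add: weyl_lpartial_eq distrib_left coeff_deriv_add coeff_deriv_mvar coeff_deriv_commute[of i j] mult.left_commute[of "mvar i"])

text \<open>Right multiplication of an operator in normal form by the variable \<open>x\<^sub>i\<close>.\<close>

definition weyl_rvar :: "nat \<Rightarrow> 'k::comm_ring_1 weyl \<Rightarrow> 'k weyl" where
  "weyl_rvar i A = mconst (mvar i) * A + mderiv i A"

text \<open>
  Left and right multiplications commute.  Hence \<open>\<partial>\<^sup>\<beta> (x\<^sub>i r)\<close> is obtained from \<open>\<partial>\<^sup>\<beta> r\<close> by
  \<^const>\<open>weyl_rvar\<close>, which replaces the binomial formula for the normal form.
\<close>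

lemma weyl_lpartial_rvar: "weyl_lpartial j (weyl_rvar i A) = weyl_rvar i (weyl_lpartial j A)"
  by (simp add: weyl_lpartial_eq weyl_rvar_def distrib_left mderiv_add mderiv_mult mderiv_var
      coeff_deriv_add coeff_deriv_const coeff_deriv_mderiv mult.left_commute[of "mvar j"])

lemma foldr_ops_commute:
  assumes "\<And>j x. D j (f x) = f (D j x)"
  shows "foldr (\<lambda>j. D j ^^ k j) js (f x) = f (foldr (\<lambda>j. D j ^^ k j) js x)"
proof -
  have "(D j ^^ l) (f x) = f ((D j ^^ l) x)" for j l x
    by (induction l) (simp_all add: assms)
  then show ?thesis by (induction js) simp_all
qed

abbreviation weyl_partials :: "monom \<Rightarrow> 'k::comm_ring_1 weyl \<Rightarrow> 'k weyl" where
  "weyl_partials \<equiv> iterate_ops weyl_lpartial"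

lemma weyl_partials_rvar: "weyl_partials \<beta> (weyl_rvar i A) = weyl_rvar i (weyl_partials \<beta> A)"
  unfolding iterate_ops_def by (rule foldr_ops_commute) (rule weyl_lpartial_rvar)

lemma weyl_partials_add_evar: "weyl_partials (\<beta> + evar i) A = weyl_lpartial i (weyl_partials \<beta> A)"
  by (rule iterate_ops_add_evar) (rule weyl_lpartial_commute)

lemma weyl_partials_add: "weyl_partials \<beta> (A + B) = weyl_partials \<beta> A + weyl_partials \<beta> B"
  by (induction \<beta> rule: monom_induct) (simp_all add: weyl_partials_add_evar weyl_lpartial_add)

lemma weyl_partials_const: "weyl_partials \<beta> (weyl_of_poly (mconst a)) = Poly_Mapping.single \<beta> (mconst a)"
proof (induction \<beta> rule: monom_induct)
  case zero
  show ?case by (simp add: weyl_of_poly_def)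
next
  case (add \<beta> i)
  show ?case
    unfolding weyl_partials_add_evar add
    by (simp add: weyl_lpartial_eq mvar_times_single coeff_deriv_single)
qed

lemma weyl_of_poly_add: "weyl_of_poly (r + s) = weyl_of_poly r + weyl_of_poly s"
  by (simp add: weyl_of_poly_def single_add)

lemma weyl_of_poly_var: "weyl_of_poly (mvar i * r) = weyl_rvar i (weyl_of_poly r)"
  unfolding weyl_of_poly_def weyl_rvar_def mconst_def[symmetric] by (simp add: mconst_mult)

lemma weyl_lscale_1: "weyl_lscale 1 A = A"
  unfolding weyl_lscale_def by (simp flip: poly_mapping_sum_singles)

lemma weyl_mult_partial: "weyl_mult (weyl_partial \<beta>) A = weyl_partials \<beta> A"
  by (simp add: weyl_mult_def weyl_partial_def weyl_lscale_1)

lemma weyl_partials_coeffs: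
  assumes "\<And>\<alpha>. Poly_Mapping.lookup A \<alpha> \<in> polys_in V"
  shows "Poly_Mapping.lookup (weyl_partials \<beta> A) \<alpha> \<in> polys_in V"
proof (induction \<beta> arbitrary: \<alpha> rule: monom_induct)
  case (add \<beta> i)
  have "Poly_Mapping.lookup (weyl_lpartial i B) \<alpha> \<in> polys_in V"
    if "\<And>\<alpha>. Poly_Mapping.lookup B \<alpha> \<in> polys_in V" for B
    unfolding weyl_lpartial_eq lookup_add lookup_mvar_mult lookup_coeff_deriv
    using that by (auto simp: shift_def intro: polys_in_add polys_in_mderiv)
  then show ?case unfolding weyl_partials_add_evar using add.IH by blast
qed (use assms in simp)

lemma lookup_wn_tensor: "\<phi> 0 = 0 \<Longrightarrow> Poly_Mapping.lookup (wn_tensor \<phi> a A) \<beta> = a * \<phi> (Poly_Mapping.lookup A \<beta>)"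
  by (auto simp: wn_tensor_def lookup_sum lookup_single when_def in_keys_iff)

context generic_point
begin

lemma lookup_wn_right:
  "Poly_Mapping.lookup (wn_right \<Phi> w r) \<delta> =
    (\<Sum>\<beta>\<in>Poly_Mapping.keys w. Poly_Mapping.lookup w \<beta> * \<Phi> (Poly_Mapping.lookup (weyl_partials \<beta> (weyl_of_poly r)) \<delta>))"
  by (simp add: wn_right_def lookup_sum lookup_wn_tensor weyl_mult_partial)

lemma wn_right_add: "wn_right \<Phi> w (r + s) = wn_right \<Phi> w r + wn_right \<Phi> w s"
  by (rule poly_mapping_eqI)
    (simp add: lookup_wn_right lookup_add weyl_of_poly_add weyl_partials_add \<Phi>_add distrib_left sum.distrib)

lemma wn_right_const: "wn_right \<Phi> w (mconst a) = mscale (\<Phi> (mconst a)) w"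
  by (rule poly_mapping_eqI)
    (auto simp: lookup_wn_right weyl_partials_const lookup_single when_def in_keys_iff if_distrib mult.commute cong: if_cong)

text \<open>
  The right action of \<open>x\<^sub>i\<close> is \<open>u\<^sub>i + \<partial>\<^sub>i\<close>: closure under it is closure under \<open>\<partial>\<^sub>i\<close>, as \<open>u\<^sub>i\<close> is a scalar.
\<close>

lemma wn_right_var:
  "wn_right \<Phi> w (mvar i * r) = mscale (\<Phi> (mvar i)) (wn_right \<Phi> w r) + mderiv i (wn_right \<Phi> w r)"
proof (rule poly_mapping_eqI)
  fix \<delta>
  let ?T = "\<lambda>\<beta> \<delta>. Poly_Mapping.lookup (weyl_partials \<beta> (weyl_of_poly r)) \<delta>"
  have "Poly_Mapping.lookup (wn_right \<Phi> w (mvar i * r)) \<delta> =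
    (\<Sum>\<beta>\<in>Poly_Mapping.keys w. Poly_Mapping.lookup w \<beta> *
      (\<Phi> (mvar i) * \<Phi> (?T \<beta> \<delta>) + of_nat (Poly_Mapping.lookup \<delta> i + 1) * \<Phi> (?T \<beta> (\<delta> + evar i))))"
    unfolding lookup_wn_right weyl_of_poly_var weyl_partials_rvar
    unfolding weyl_rvar_def lookup_add lookup_mconst_mult lookup_mderiv \<Phi>_add \<Phi>_mult \<Phi>_of_nat ..
  also have "\<dots> = \<Phi> (mvar i) * Poly_Mapping.lookup (wn_right \<Phi> w r) \<delta> +
      of_nat (Poly_Mapping.lookup \<delta> i + 1) * Poly_Mapping.lookup (wn_right \<Phi> w r) (\<delta> + evar i)"
    unfolding lookup_wn_right sum_distrib_left distrib_left sum.distrib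
    by (intro arg_cong2[where f = "(+)"] sum.cong refl mult.left_commute)
  finally show "Poly_Mapping.lookup (wn_right \<Phi> w (mvar i * r)) \<delta> =
    Poly_Mapping.lookup (mscale (\<Phi> (mvar i)) (wn_right \<Phi> w r) + mderiv i (wn_right \<Phi> w r)) \<delta>"
    by (simp add: lookup_add lookup_mderiv)
qed

lemma weyl_noether_eq: "weyl_noether c = polys_in {1..c}"
  by (simp add: weyl_noether_def polys_in_def)

theorem sub_bimodules_eq: "sub_bimodules n c \<Phi> m = inverse_systems c m"
proof (intro equalityI subsetI)
  fix E assume "E \<in> sub_bimodules n c \<Phi> m"
  then have E: "E \<subseteq> S" "mspace.subspace E" "mspace.dim E = m"
    "\<And>w r. w \<in> E \<Longrightarrow> r \<in> R \<Longrightarrow> wn_right \<Phi> w r \<in> E"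
    by (auto simp: sub_bimodules_def weyl_noether_eq)
  have "mderiv i w \<in> E" if w: "w \<in> E" and i: "i \<in> {1..c}" for w i
  proof -
    have "mvar i \<in> R" using i c_le_n by (intro polys_in_var) auto
    then have "wn_right \<Phi> w (mvar i * 1) \<in> E" using E(4)[OF w] by simp
    moreover have "wn_right \<Phi> w 1 = w" using wn_right_const[of w 1] by simp
    ultimately have "mscale (\<Phi> (mvar i)) w + mderiv i w \<in> E" unfolding wn_right_var by simp
    moreover have "mscale (\<Phi> (mvar i)) w \<in> E" using E(2) w by (simp add: mspace.subspace_def)
    ultimately show ?thesis using mspace.subspace_diff[OF E(2)] by fastforce
  qed
  then show "E \<in> inverse_systems c m"
    using E by (simp add: inverse_systems_iff deriv_closed_def)
next
  fix V :: "'f mpoly set" assume "V \<in> inverse_systems c m"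
  then have V: "V \<subseteq> S" "mspace.subspace V" "mspace.dim V = m" "deriv_closed c V"
    by (simp_all add: inverse_systems_iff)
  have "wn_right \<Phi> w r \<in> V" if w: "w \<in> V" and r: "r \<in> R" for w r
    using r
  proof (induction r rule: polys_in_induct)
    case (const a)
    show ?case using V(2) w by (simp add: wn_right_const mspace.subspace_def)
  next
    case (add p q)
    then show ?case using V(2) by (simp add: wn_right_add mspace.subspace_def)
  next
    case (var i p)
    have "mderiv i (wn_right \<Phi> w p) \<in> V"
    proof (cases "i \<in> {1..c}")
      case True
      then show ?thesis using V(4) var(3) by (simp add: deriv_closed_def)
    next
      case False
      then have "mderiv i (wn_right \<Phi> w p) = 0" using mderiv_notin[of _ "{1..c}" i] V(1) var(3) by blast
      then show ?thesis using V(2) by (simp add: mspace.subspace_def)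
    qed
    then show ?case using V(2) var(3) by (simp add: wn_right_var mspace.subspace_def)
  qed
  moreover have "wn_left \<Phi> r w \<in> V" if "w \<in> V" for r w
    using V(2) that by (simp add: wn_left_def mspace.subspace_def)
  ultimately show "V \<in> sub_bimodules n c \<Phi> m"
    using V by (simp add: sub_bimodules_def weyl_noether_eq)
qed

section \<open>Noetherian operators\<close>

lemma common_denominator:
  assumes "finite A"
  shows "\<exists>q\<in>R. \<Phi> q \<noteq> 0 \<and> (\<forall>\<beta>\<in>A. \<exists>p\<in>R. \<Phi> q * a \<beta> = \<Phi> p)"
  using assms
proof (induction A rule: finite_induct)
  case empty
  show ?case by (intro bexI[of _ 1]) simp_all
next
  case (insert \<beta> A)
  then obtain q where q: "q \<in> R" "\<Phi> q \<noteq> 0" "\<And>\<beta>. \<beta> \<in> A \<Longrightarrow> \<exists>p\<in>R. \<Phi> q * a \<beta> = \<Phi> p" by blast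
  obtain p0 q0 where p0: "p0 \<in> R" "q0 \<in> R" "\<Phi> q0 \<noteq> 0" "a \<beta> * \<Phi> q0 = \<Phi> p0" using fractions by blast
  have "\<exists>p\<in>R. \<Phi> (q * q0) * a \<delta> = \<Phi> p" if "\<delta> \<in> insert \<beta> A" for \<delta>
  proof (cases "\<delta> = \<beta>")
    case True
    have "\<Phi> (q * q0) * a \<beta> = \<Phi> q * (a \<beta> * \<Phi> q0)" unfolding \<Phi>_mult by (simp only: mult_ac)
    also have "\<dots> = \<Phi> (q * p0)" unfolding p0(4) \<Phi>_mult ..
    finally have "\<Phi> (q * q0) * a \<beta> = \<Phi> (q * p0)" .
    then show ?thesis using True polys_in_mult[OF q(1) p0(1)] by blast
  next
    case False
    then obtain p where p: "p \<in> R" "\<Phi> q * a \<delta> = \<Phi> p"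
      using q(3)[of \<delta>] \<open>\<delta> \<in> insert \<beta> A\<close> by blast
    have "\<Phi> (q * q0) * a \<delta> = \<Phi> q0 * (\<Phi> q * a \<delta>)" unfolding \<Phi>_mult by (simp only: mult_ac)
    also have "\<dots> = \<Phi> (q0 * p)" unfolding p(2) \<Phi>_mult ..
    finally have "\<Phi> (q * q0) * a \<delta> = \<Phi> (q0 * p)" .
    then show ?thesis using polys_in_mult[OF p0(2) p(1)] by blast
  qed
  moreover have "q * q0 \<in> R" "\<Phi> (q * q0) \<noteq> 0" using q p0 by (auto simp: \<Phi>_mult intro: polys_in_mult)
  ultimately show ?case by blast
qed

lemma lift_exists:
  assumes w: "w \<in> S"
  shows "\<exists>A. is_lift n c \<Phi> w A"
proof -
  obtain q where q: "\<Phi> q \<noteq> 0" "\<forall>\<beta>\<in>Poly_Mapping.keys w. \<exists>p\<in>R. \<Phi> q * Poly_Mapping.lookup w \<beta> = \<Phi> p"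
    using common_denominator[where A = "Poly_Mapping.keys w" and a = "Poly_Mapping.lookup w", OF finite_keys] by blast
  have "\<exists>p. \<forall>\<beta>\<in>Poly_Mapping.keys w. p \<beta> \<in> R \<and> \<Phi> q * Poly_Mapping.lookup w \<beta> = \<Phi> (p \<beta>)"
    by (rule bchoice) (use q(2) in blast)
  then obtain p where p: "\<And>\<beta>. \<beta> \<in> Poly_Mapping.keys w \<Longrightarrow> p \<beta> \<in> R"
    "\<And>\<beta>. \<beta> \<in> Poly_Mapping.keys w \<Longrightarrow> \<Phi> q * Poly_Mapping.lookup w \<beta> = \<Phi> (p \<beta>)" by blast
  define A where "A = (\<Sum>\<beta>\<in>Poly_Mapping.keys w. Poly_Mapping.single \<beta> (p \<beta>))"
  have lookup_A: "Poly_Mapping.lookup A \<beta> = (if \<beta> \<in> Poly_Mapping.keys w then p \<beta> else 0)" for \<beta>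
    by (auto simp: A_def lookup_sum lookup_single when_def)
  have "A \<in> weyl_algebra n c"
    unfolding weyl_algebra_def
  proof (intro CollectI ballI conjI)
    fix \<alpha> assume "\<alpha> \<in> Poly_Mapping.keys A"
    then have \<alpha>: "\<alpha> \<in> Poly_Mapping.keys w" by (auto simp: in_keys_iff[of _ A] lookup_A split: if_splits)
    then show "Poly_Mapping.keys \<alpha> \<subseteq> {1..c}" using w by (auto simp: polys_in_def)
    show "Poly_Mapping.lookup A \<alpha> \<in> carrier (poly_ring n)" using \<alpha> p(1) by (simp add: lookup_A)
  qed
  moreover have "mscale (\<Phi> q) w = wn_tensor \<Phi> 1 A"
    by (rule poly_mapping_eqI) (auto simp: lookup_wn_tensor lookup_A p(2) in_keys_iff)
  ultimately show ?thesis using q(1) unfolding is_lift_def by blast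
qed

lemma mderivs_\<gamma>: "Poly_Mapping.keys \<beta> \<subseteq> {1..c} \<Longrightarrow> mderivs \<beta> (\<gamma> f) = \<gamma> (mderivs \<beta> f)"
  by (induction \<beta> rule: monom_induct) (simp_all add: mderivs_add_evar keys_plus_monom mderiv_\<gamma>)

lemma Taylor_coefficient:
  assumes "Poly_Mapping.keys \<beta> \<subseteq> {1..c}"
  shows "of_nat (mfact \<beta>) * Poly_Mapping.lookup (\<gamma> f) \<beta> = \<Phi> (mderivs \<beta> f)"
  using lookup_mderivs[of 0 \<beta> "\<gamma> f"] by (simp add: mderivs_\<gamma>[OF assms] lookup_\<gamma>_0)

text \<open>
  The factors \<open>\<alpha>!\<close> of the pairing cancel the denominators of the Taylor coefficients, so the pairing
  of \<open>\<gamma> f\<close> with \<open>\<Sum>\<alpha>. \<lambda>\<^sub>\<alpha> z\<^sup>\<alpha>\<close> is the class of \<open>\<Sum>\<alpha>. \<lambda>\<^sub>\<alpha> \<partial>\<^sup>\<alpha> f\<close>.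
\<close>

lemma weyl_act_in_P_iff:
  assumes A: "is_lift n c \<Phi> w A" and f: "f \<in> R"
  shows "weyl_act A f \<in> P \<longleftrightarrow> pair (Poly_Mapping.lookup (\<gamma> f)) w = 0"
proof -
  obtain a where a: "A \<in> weyl_algebra n c" "a \<noteq> 0" "mscale a w = wn_tensor \<Phi> 1 A"
    using A unfolding is_lift_def by blast
  have A': "\<And>\<alpha>. \<alpha> \<in> Poly_Mapping.keys A \<Longrightarrow> Poly_Mapping.keys \<alpha> \<subseteq> {1..c}"
    "\<And>\<alpha>. \<alpha> \<in> Poly_Mapping.keys A \<Longrightarrow> Poly_Mapping.lookup A \<alpha> \<in> R"
    using a(1) by (auto simp: weyl_algebra_def)
  have "a * pair (Poly_Mapping.lookup (\<gamma> f)) w = pair (Poly_Mapping.lookup (\<gamma> f)) (wn_tensor \<Phi> 1 A)"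
    by (simp add: pair_scale_right flip: a(3))
  also have "\<dots> = (\<Sum>\<alpha>\<in>Poly_Mapping.keys A. Poly_Mapping.lookup (\<gamma> f) \<alpha> * of_nat (mfact \<alpha>) *
      Poly_Mapping.lookup (wn_tensor \<Phi> 1 A) \<alpha>)"
  proof (rule pair_superset)
    show "Poly_Mapping.keys (wn_tensor \<Phi> 1 A) \<subseteq> Poly_Mapping.keys A"
      by (auto simp: in_keys_iff[of _ "wn_tensor \<Phi> 1 A"] lookup_wn_tensor in_keys_iff[of _ A])
  qed simp
  also have "\<dots> = (\<Sum>\<alpha>\<in>Poly_Mapping.keys A. \<Phi> (Poly_Mapping.lookup A \<alpha>) * \<Phi> (mderivs \<alpha> f))"
  proof (rule sum.cong[OF refl])
    fix \<alpha> assume \<alpha>: "\<alpha> \<in> Poly_Mapping.keys A"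
    show "Poly_Mapping.lookup (\<gamma> f) \<alpha> * of_nat (mfact \<alpha>) * Poly_Mapping.lookup (wn_tensor \<Phi> 1 A) \<alpha>
      = \<Phi> (Poly_Mapping.lookup A \<alpha>) * \<Phi> (mderivs \<alpha> f)"
      unfolding Taylor_coefficient[OF A'(1)[OF \<alpha>], symmetric] lookup_wn_tensor[where \<phi> = \<Phi>, OF \<Phi>_0]
      by (simp only: mult_1 mult_ac)
  qed
  also have "\<dots> = \<Phi> (weyl_act A f)"
    by (simp add: weyl_act_def \<Phi>_sum \<Phi>_mult)
  finally have "a * pair (Poly_Mapping.lookup (\<gamma> f)) w = \<Phi> (weyl_act A f)" .
  moreover have "weyl_act A f \<in> R"
    unfolding weyl_act_def using A'(2) f by (intro polys_in_sum polys_in_mult polys_in_mderivs)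
  ultimately show ?thesis using a(2) by (auto simp: P_def)
qed

theorem Noetherian_operators:
  assumes E: "E \<in> inverse_systems c m" and b: "mspace.span (b ` {1..m}) = E"
    and A: "\<And>l. l \<in> {1..m} \<Longrightarrow> is_lift n c \<Phi> (b l) (A l)"
  shows "hilb_to_primary n c \<Phi> (contraction c (ann c E)) = {f \<in> R. \<forall>l\<in>{1..m}. weyl_act (A l) f \<in> P}"
proof -
  have E': "E \<subseteq> S" "0 \<in> E" "deriv_closed c E"
    using E by (auto simp: inverse_systems_iff mspace.subspace_def)
  have "(\<forall>F\<in>E. pair f F = 0) \<longleftrightarrow> (\<forall>l\<in>{1..m}. pair f (b l) = 0)" for f
  proof
    assume "\<forall>F\<in>E. pair f F = 0"
    then show "\<forall>l\<in>{1..m}. pair f (b l) = 0" using b mspace.span_base by blast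
  next
    assume *: "\<forall>l\<in>{1..m}. pair f (b l) = 0"
    have "mspace.subspace {F. pair f F = 0}"
      using linear_functional_zero[OF linear_functional_pair]
      by (simp add: mspace.subspace_def pair_add_right pair_scale_right)
    then have "mspace.span (b ` {1..m}) \<subseteq> {F. pair f F = 0}"
      using * by (intro mspace.span_minimal) auto
    then show "\<forall>F\<in>E. pair f F = 0" using b by blast
  qed
  moreover have "f \<in> hilb_to_primary n c \<Phi> (contraction c (ann c E)) \<longleftrightarrow>
      f \<in> R \<and> (\<forall>F\<in>E. pair (Poly_Mapping.lookup (\<gamma> f)) F = 0)" for f
  proof -
    interpret ser: coefficient_space c "series c :: 'f mseries set"
      by (rule coefficient_space_series[OF char_0])
    show ?thesis
      unfolding ann_eq_annihilator[OF char_0 E'] \<gamma>_preimage_eq contraction_def ser.annihilator_def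
      using \<gamma>_S lookup_in_series by auto
  qed
  ultimately show ?thesis using weyl_act_in_P_iff[OF A] by blast
qed

end

section \<open>The residue field of a prime ideal\<close>

lemma poly_ring_eq: "poly_ring n = ring_on (polys_in {1..n})"
  by (simp add: poly_ring_def)

context
  fixes n c :: nat and P :: "'k::field_char_0 mpoly set"
    and \<psi> :: "'k mpoly set \<Rightarrow> 'a::idom" and \<phi> :: "'k mpoly \<Rightarrow> 'a fract"
  assumes prime: "primeideal P (poly_ring n)"
    and c_le_n: "c \<le> n"
    and indep: "max_independent_vars n {c+1..n} P"
    and residue_ring: "\<psi> \<in> ring_iso (poly_ring n Quot P) (ring_on UNIV)"
    and class_map: "\<phi> = (\<lambda>f. Fract (\<psi> (P +>\<^bsub>poly_ring n\<^esub> f)) 1)"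
begin

lemma residue_class_map:
  "f \<in> polys_in {1..n} \<Longrightarrow> g \<in> polys_in {1..n} \<Longrightarrow> \<phi> (f + g) = \<phi> f + \<phi> g"
  "f \<in> polys_in {1..n} \<Longrightarrow> g \<in> polys_in {1..n} \<Longrightarrow> \<phi> (f * g) = \<phi> f * \<phi> g"
  "\<phi> 1 = 1"
  "f \<in> polys_in {1..n} \<Longrightarrow> \<phi> f = 0 \<longleftrightarrow> f \<in> P"
  "\<exists>p\<in>polys_in {1..n}. \<exists>q\<in>polys_in {1..n}. \<phi> q \<noteq> 0 \<and> a * \<phi> q = \<phi> p"
proof -
  let ?R = "polys_in {1..n} :: 'k mpoly set"
  interpret P: primeideal P "poly_ring n" by (rule prime)
  interpret Q: ring "poly_ring n Quot P" by (rule P.quotient_is_ring)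
  let ?c = "(+>\<^bsub>poly_ring n\<^esub>) P"
  have c: "?c f \<in> carrier (poly_ring n Quot P)" if "f \<in> ?R" for f
    using ring_hom_closed[OF P.rcos_ring_hom, of f] that by simp
  have \<psi>_hom: "\<psi> \<in> ring_hom (poly_ring n Quot P) (ring_on UNIV)" and
    \<psi>_bij: "bij_betw \<psi> (carrier (poly_ring n Quot P)) UNIV"
    using residue_ring by (auto simp: ring_iso_def)
  define \<chi> where "\<chi> f = \<psi> (?c f)" for f
  have \<chi>: "\<chi> (f + g) = \<chi> f + \<chi> g" "\<chi> (f * g) = \<chi> f * \<chi> g" if "f \<in> ?R" "g \<in> ?R" for f g
    using ring_hom_add[OF P.rcos_ring_hom, of f g] ring_hom_mult[OF P.rcos_ring_hom, of f g]
      ring_hom_add[OF \<psi>_hom c[OF that(1)] c[OF that(2)]] ring_hom_mult[OF \<psi>_hom c[OF that(1)] c[OF that(2)]] that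
    by (simp_all add: \<chi>_def poly_ring_eq)
  have \<chi>1: "\<chi> 1 = 1"
    using ring_hom_one[OF P.rcos_ring_hom] ring_hom_one[OF \<psi>_hom] by (simp add: \<chi>_def poly_ring_eq)
  have \<phi>: "\<phi> f = Fract (\<chi> f) 1" for f by (simp add: class_map \<chi>_def)
  show "\<phi> (f + g) = \<phi> f + \<phi> g" "\<phi> (f * g) = \<phi> f * \<phi> g" if "f \<in> ?R" "g \<in> ?R"
    using \<chi>[OF that] by (simp_all add: \<phi>)
  show "\<phi> 1 = 1" by (simp add: \<phi> \<chi>1 fract_collapse)
  have \<chi>0: "\<chi> 0 = 0" using \<chi>(1)[of 0 0] by (metis add.right_neutral add_left_cancel polys_in_0)
  have \<chi>0_iff: "\<chi> f = 0 \<longleftrightarrow> f \<in> P" if f: "f \<in> ?R" for f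
  proof -
    have "\<chi> f = 0 \<longleftrightarrow> \<psi> (?c f) = \<psi> (?c 0)" using \<chi>0 by (simp add: \<chi>_def)
    also have "\<dots> \<longleftrightarrow> ?c f = ?c 0"
      using \<psi>_bij c[OF f] c[OF polys_in_0] by (auto simp: bij_betw_def inj_on_eq_iff)
    also have "\<dots> \<longleftrightarrow> f \<ominus>\<^bsub>poly_ring n\<^esub> \<zero>\<^bsub>poly_ring n\<^esub> \<in> P"
      using P.quotient_eq_iff_same_a_r_cos[OF P.is_ideal, of f "\<zero>\<^bsub>poly_ring n\<^esub>"] f by (simp add: poly_ring_eq)
    also have "f \<ominus>\<^bsub>poly_ring n\<^esub> \<zero>\<^bsub>poly_ring n\<^esub> = f"
      using f P.minus_zero P.r_zero[of f] by (simp add: P.minus_eq)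
    finally show ?thesis .
  qed
  show "\<phi> f = 0 \<longleftrightarrow> f \<in> P" if f: "f \<in> ?R"
    using \<chi>0_iff[OF f] by (simp add: \<phi> Zero_fract_def eq_fract)
  have surj: "\<exists>f\<in>?R. \<chi> f = x" for x
  proof -
    obtain y where y: "y \<in> carrier (poly_ring n Quot P)" "\<psi> y = x"
    proof -
      have "x \<in> \<psi> ` carrier (poly_ring n Quot P)" using \<psi>_bij by (simp add: bij_betw_def)
      then show thesis using that by blast
    qed
    then obtain f where "f \<in> ?R" "y = ?c f" by (auto simp: FactRing_def A_RCOSETS_def')
    then show ?thesis using y(2) by (auto simp: \<chi>_def)
  qed
  obtain x y where xy: "a = Fract x y" "y \<noteq> 0" by (cases a) auto
  obtain p q where pq: "p \<in> ?R" "\<chi> p = x" "q \<in> ?R" "\<chi> q = y" using surj by blast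
  have "\<phi> q \<noteq> 0" using pq(4) xy(2) by (simp add: \<phi> Zero_fract_def eq_fract)
  moreover have "a * \<phi> q = \<phi> p" using xy by (simp add: \<phi> pq eq_fract)
  ultimately show "\<exists>p\<in>?R. \<exists>q\<in>?R. \<phi> q \<noteq> 0 \<and> a * \<phi> q = \<phi> p" using pq(1,3) by blast
qed

text \<open>
  The residue class map is meaningful only on the polynomials in the variables \<open>1, \<dots>, n\<close>.
  Evaluation at the classes of the variables extends it to a homomorphism on the whole type.
\<close>

definition total_map :: "'k mpoly \<Rightarrow> 'a fract" where
  "total_map = meval (\<lambda>a. \<phi> (mconst a)) (\<lambda>i. \<phi> (mvar i))"

lemma total_map_hom:
  "total_map (f + g) = total_map f + total_map g" "total_map (f * g) = total_map f * total_map g"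
  "total_map (mconst a) = \<phi> (mconst a)" "total_map (mvar i) = \<phi> (mvar i)"
proof -
  have "\<phi> (mconst (a + b)) = \<phi> (mconst a) + \<phi> (mconst b)"
    "\<phi> (mconst (a * b)) = \<phi> (mconst a) * \<phi> (mconst b)" "\<phi> (mconst 1) = 1" for a b
    using residue_class_map(1-3) by (simp_all add: mconst_add mconst_mult)
  note * = this
  show "total_map (f + g) = total_map f + total_map g"
    unfolding total_map_def by (rule meval_add) (rule *)+
  show "total_map (f * g) = total_map f * total_map g"
    unfolding total_map_def by (rule meval_mult) (rule *)+
  show "total_map (mconst a) = \<phi> (mconst a)"
    unfolding total_map_def by (rule meval_const) (rule *)+
  show "total_map (mvar i) = \<phi> (mvar i)"
    unfolding total_map_def by (rule meval_var) (rule *)+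
qed

lemma total_map_eq: "f \<in> polys_in {1..n} \<Longrightarrow> total_map f = \<phi> f"
proof (induction f rule: polys_in_induct)
  case (var i p)
  then show ?case using residue_class_map(2)[of "mvar i" p] by (simp add: total_map_hom polys_in_var)
qed (simp_all add: total_map_hom residue_class_map(1))

lemma generic_point_total_map: "generic_point n c total_map"
proof
  show "c \<le> n" by (rule c_le_n)
  show "total_map 1 = 1" using total_map_eq[of 1] residue_class_map(3) by simp
  show "\<exists>p\<in>polys_in {1..n}. \<exists>q\<in>polys_in {1..n}. total_map q \<noteq> 0 \<and> a * total_map q = total_map p" for a
  proof -
    obtain p q where "p \<in> polys_in {1..n}" "q \<in> polys_in {1..n}" "\<phi> q \<noteq> 0" "a * \<phi> q = \<phi> p"
      using residue_class_map(5)[of a] by blast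
    then have "total_map q \<noteq> 0 \<and> a * total_map q = total_map p" "p \<in> polys_in {1..n}" "q \<in> polys_in {1..n}"
      by (simp_all add: total_map_eq)
    then show ?thesis by blast
  qed
  have max: "polys_in {c+1..n} \<inter> P = {0}"
    "\<And>W. {c+1..n} \<subset> W \<Longrightarrow> W \<subseteq> {1..n} \<Longrightarrow> polys_in W \<inter> P \<noteq> {0}"
    using indep by (auto simp: max_independent_vars_def)
  show "p = 0" if p: "p \<in> polys_in {c+1..n}" "total_map p = 0" for p
  proof -
    have "polys_in {c+1..n} \<subseteq> (polys_in {1..n} :: 'k mpoly set)" by (rule polys_in_mono) auto
    then have "p \<in> polys_in {1..n}" using p(1) by blast
    then have "p \<in> P" using p(2) total_map_eq residue_class_map(4) by auto
    then show ?thesis using max(1) p(1) by blast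
  qed
  show "\<exists>p\<in>polys_in (insert i {c+1..n}). p \<noteq> 0 \<and> total_map p = 0" if i: "i \<in> {1..c}" for i
  proof -
    let ?W = "insert i {c+1..n}"
    interpret primeideal P "poly_ring n" by (rule prime)
    have "i \<notin> {c+1..n}" using i by simp
    then have W: "{c+1..n} \<subset> ?W" by blast
    have W2: "?W \<subseteq> {1..n}" using i c_le_n by auto
    have "0 \<in> P" using max(1) by auto
    then have "0 \<in> polys_in ?W \<inter> P" by simp
    then obtain p where p: "p \<in> polys_in ?W" "p \<in> P" "p \<noteq> 0" using max(2)[OF W W2] by blast
    have "p \<in> polys_in {1..n}" using p(1) polys_in_mono[OF W2] by blast
    then have "total_map p = 0" using p(2) total_map_eq residue_class_map(4) by auto
    then show ?thesis using p by blast
  qed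
qed (rule total_map_hom)+

lemma kernel_total_map: "generic_point.P n total_map = P"
proof -
  interpret generic_point n c total_map by (rule generic_point_total_map)
  interpret primeideal P "poly_ring n" by (rule prime)
  have "P \<subseteq> polys_in {1..n}" using a_subset by simp
  then show ?thesis unfolding P_def using total_map_eq residue_class_map(4) by auto
qed

lemma gamma_total_map: "gamma c total_map = gamma c \<phi>"
  unfolding gamma_def total_map_hom ..

lemma omega_eq: "omega \<phi> F = F"
proof -
  have "omega \<phi> F = (\<Sum>\<alpha>\<in>Poly_Mapping.keys F. Poly_Mapping.single \<alpha> (Poly_Mapping.lookup F \<alpha>))"
    by (simp add: omega_def wn_tensor_def weyl_partial_def residue_class_map(3) mscale_single)
  then show ?thesis by (simp flip: poly_mapping_sum_singles)
qed

lemma wn_tensor_total_map: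
  assumes "\<And>\<alpha>. \<alpha> \<in> Poly_Mapping.keys A \<Longrightarrow> Poly_Mapping.lookup A \<alpha> \<in> polys_in {1..n}"
  shows "wn_tensor total_map a A = wn_tensor \<phi> a A"
  unfolding wn_tensor_def by (rule sum.cong) (simp_all add: total_map_eq assms)

lemma sub_bimodules_total_map: "sub_bimodules n c total_map m = sub_bimodules n c \<phi> m"
proof -
  have "wn_right total_map w r = wn_right \<phi> w r" if r: "r \<in> polys_in {1..n}" for w r
  proof -
    have "Poly_Mapping.lookup (weyl_of_poly r) \<alpha> \<in> polys_in {1..n}" for \<alpha>
      using r by (simp add: weyl_of_poly_def lookup_single when_def)
    then show ?thesis
      unfolding wn_right_def weyl_mult_partial
      by (intro sum.cong refl wn_tensor_total_map weyl_partials_coeffs)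
  qed
  then show ?thesis
    unfolding sub_bimodules_def by (auto simp: wn_left_def total_map_eq)
qed

lemma is_lift_total_map: "is_lift n c total_map w A \<longleftrightarrow> is_lift n c \<phi> w A"
proof -
  have "wn_tensor total_map 1 A = wn_tensor \<phi> 1 A" if "A \<in> weyl_algebra n c"
    using that by (intro wn_tensor_total_map) (auto simp: weyl_algebra_def)
  then show ?thesis unfolding is_lift_def by auto
qed

end

theorem theorem2p1:
  fixes n c m :: nat
    and P :: "'k::field_char_0 mpoly set"
    and \<psi> :: "'k mpoly set \<Rightarrow> 'a::idom"
    and \<phi> :: "'k mpoly \<Rightarrow> 'a fract"
  assumes prime: "primeideal P (poly_ring n)"
    and c_le_n: "c \<le> n"
    and codim: "codimension (poly_ring n) P = enat c"
    and indep: "max_independent_vars n {c+1..n} P"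
    and residue_ring: "\<psi> \<in> ring_iso (poly_ring n Quot P) (ring_on UNIV)"
    and class_map: "\<phi> = (\<lambda>f. Fract (\<psi> (P +>\<^bsub>poly_ring n\<^esub> f)) 1)"
    and m: "m \<ge> 1"
  shows
    "mutually_inverse (contraction c) (extension c)
       (hilb_series c m :: 'a fract mseries set set) (hilb_poly c m) \<and>
     mutually_inverse (primary_to_hilb c m \<phi>) (hilb_to_primary n c \<phi>)
       (primary_ideals n P m) (hilb_poly c m) \<and>
     mutually_inverse (perp c) (ann c)
       (hilb_series c m :: 'a fract mseries set set) (inverse_systems c m) \<and>
     mutually_inverse ((`) (omega \<phi>)) (omega_preimage c \<phi>)
       (inverse_systems c m) (sub_bimodules n c \<phi> m) \<and>
     (\<forall>E\<in>sub_bimodules n c \<phi> m. \<forall>b :: nat \<Rightarrow> 'a fract weyl_noether.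
        inj_on b {1..m} \<and> mspace.independent (b ` {1..m}) \<and> mspace.span (b ` {1..m}) = E \<longrightarrow>
        (\<exists>A. \<forall>l\<in>{1..m}. is_lift n c \<phi> (b l) (A l)) \<and>
        (\<forall>A. (\<forall>l\<in>{1..m}. is_lift n c \<phi> (b l) (A l)) \<longrightarrow>
           hilb_to_primary n c \<phi> (contraction c (ann c (omega_preimage c \<phi> E))) =
             {f \<in> carrier (poly_ring n). \<forall>l\<in>{1..m}. weyl_act (A l) f \<in> P}))"
proof -
  note setting = prime c_le_n indep residue_ring class_map
  define \<Phi> where "\<Phi> = total_map \<phi>"
  interpret gp: generic_point n c \<Phi>
    unfolding \<Phi>_def by (rule generic_point_total_map[OF setting])
  have P: "gp.P = P"
    unfolding \<Phi>_def by (rule kernel_total_map[OF setting])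
  have gamma: "gamma c \<phi> = gamma c \<Phi>"
    unfolding \<Phi>_def by (rule gamma_total_map[OF setting, symmetric])
  have hilb: "primary_to_hilb c m \<phi> = primary_to_hilb c m \<Phi>" "hilb_to_primary n c \<phi> = hilb_to_primary n c \<Phi>"
    by (simp_all add: fun_eq_iff primary_to_hilb_def hilb_to_primary_def gamma)
  have omega: "omega \<phi> = (\<lambda>F. F)"
    by (rule ext) (rule omega_eq[OF setting])
  have bimodules: "sub_bimodules n c \<phi> m = inverse_systems c m"
    using sub_bimodules_total_map[OF setting, of m] gp.sub_bimodules_eq unfolding \<Phi>_def by simp
  have lift: "is_lift n c \<phi> w A \<longleftrightarrow> is_lift n c \<Phi> w A" for w A
    unfolding \<Phi>_def by (rule is_lift_total_map[OF setting, symmetric])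
  have preimage: "omega_preimage c \<phi> E = E" if "E \<in> inverse_systems c m" for E
    using that unfolding omega_preimage_def omega inverse_systems_iff by auto
  have operators: "(\<exists>A. \<forall>l\<in>{1..m}. is_lift n c \<phi> (b l) (A l)) \<and>
        (\<forall>A. (\<forall>l\<in>{1..m}. is_lift n c \<phi> (b l) (A l)) \<longrightarrow>
           hilb_to_primary n c \<phi> (contraction c (ann c (omega_preimage c \<phi> E))) =
             {f \<in> carrier (poly_ring n). \<forall>l\<in>{1..m}. weyl_act (A l) f \<in> P})"
    if E: "E \<in> inverse_systems c m" and b: "mspace.span (b ` {1..m}) = E" for E and b :: "nat \<Rightarrow> 'a fract weyl_noether"
  proof (intro conjI allI impI)
    have "b l \<in> polys_in {1..c}" if "l \<in> {1..m}" for l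
      using that b mspace.span_base[of "b l" "b ` {1..m}"] E unfolding inverse_systems_iff by blast
    then have "\<forall>l\<in>{1..m}. \<exists>A. is_lift n c \<phi> (b l) A"
      unfolding lift using gp.lift_exists by blast
    then show "\<exists>A. \<forall>l\<in>{1..m}. is_lift n c \<phi> (b l) (A l)" by (rule bchoice)
    fix A assume "\<forall>l\<in>{1..m}. is_lift n c \<phi> (b l) (A l)"
    then show "hilb_to_primary n c \<phi> (contraction c (ann c (omega_preimage c \<phi> E))) =
             {f \<in> carrier (poly_ring n). \<forall>l\<in>{1..m}. weyl_act (A l) f \<in> P}"
      using gp.Noetherian_operators[OF E b, of A] unfolding lift preimage[OF E] hilb P by simp
  qed
  show ?thesis
  proof (intro conjI ballI allI impI)
    show "mutually_inverse (contraction c) (extension c)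
       (hilb_series c m :: 'a fract mseries set set) (hilb_poly c m)"
      by (rule contraction_extension_mutually_inverse[OF gp.char_0 m])
    show "mutually_inverse (primary_to_hilb c m \<phi>) (hilb_to_primary n c \<phi>) (primary_ideals n P m) (hilb_poly c m)"
      unfolding hilb using gp.primary_hilb_mutually_inverse[OF m] prime unfolding P .
    show "mutually_inverse (perp c) (ann c)
       (hilb_series c m :: 'a fract mseries set set) (inverse_systems c m)"
      by (rule perp_ann_mutually_inverse[OF gp.char_0 m])
    show "mutually_inverse ((`) (omega \<phi>)) (omega_preimage c \<phi>) (inverse_systems c m) (sub_bimodules n c \<phi> m)"
      unfolding mutually_inverse_def bimodules omega using preimage by (auto simp: image_subset_iff)
  qed (use operators bimodules in blast)+
qed

end
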